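(* Let $G$ be a finite planar graph with at least $7$ vertices. Then there is a vertex $v$ of $G$ such that, after deleting $v$ from $G$, one can collect at least $6$ vertices, i.e. there exist distinct vertices $u_1,\dots,u_6$ of $G-v$ such that for each $i\in\{1,\dots,6\}$ the vertex $u_i$ has degree at most $4$ in the graph $G-\{v,u_1,\dots,u_{i-1}\}$.
   Context: To delete a vertex means to remove it together with its incident edges. To collect a vertex means to delete it when its degree in the current graph is at most $4$; collecting a set of vertices means collecting them one after another in some order, each having degree at most $4$ in the current graph at the moment it is collected. *)

theory Defs
  imports "HOL-Analysis.Analysis" "Graph_Theory.Digraph_Component"
begin

text \<open>
  A finite simple graph is a \<^locale>\<open>graph\<close> of the Graph_Theory library: every edge
  \<open>uv\<close> is represented by its two orientations \<open>(u, v)\<close> and \<open>(v, u)\<close>. Hence the degree of a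
  vertex is its \<^const>\<open>out_degree\<close> (which equals its \<^const>\<open>in_degree\<close>), and a drawing
  assigns a curve to the unordered pair \<open>{u, v}\<close>, so that both orientations share one curve.
\<close>

text \<open>
  A drawing in the plane without crossings: the vertices are distinct points, each edge is a
  simple arc joining its two ends and avoiding all other vertices, and two different edges meet
  at most in common ends.
\<close>

definition plane_drawing ::
  "('a, 'b) pre_digraph \<Rightarrow> ('a \<Rightarrow> complex) \<Rightarrow> ('a set \<Rightarrow> real \<Rightarrow> complex) \<Rightarrow> bool" where
  "plane_drawing G p \<gamma> \<longleftrightarrow>
     inj_on p (verts G) \<and>
     (\<forall>(u, v) \<in> arcs_ends G.
        arc (\<gamma> {u, v}) \<and>
        {pathstart (\<gamma> {u, v}), pathfinish (\<gamma> {u, v})} = {p u, p v} \<and>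
        path_image (\<gamma> {u, v}) \<inter> p ` verts G = {p u, p v}) \<and>
     (\<forall>(u, v) \<in> arcs_ends G. \<forall>(x, y) \<in> arcs_ends G. {u, v} \<noteq> {x, y} \<longrightarrow>
        path_image (\<gamma> {u, v}) \<inter> path_image (\<gamma> {x, y}) \<subseteq> p ` ({u, v} \<inter> {x, y}))"

definition planar :: "('a, 'b) pre_digraph \<Rightarrow> bool" where
  "planar G \<longleftrightarrow> (\<exists>p \<gamma>. plane_drawing G p \<gamma>)"

definition del_verts :: "('a, 'b) pre_digraph \<Rightarrow> 'a set \<Rightarrow> ('a, 'b) pre_digraph" where
  "del_verts G S = G \<restriction> (verts G - S)"

lemma (in graph) out_degree_del_verts:
  assumes "u \<notin> S"
  shows "out_degree (del_verts G S) u = card {w \<in> verts G - S. (u, w) \<in> arcs_ends G}"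
proof -
  have "inj_on (head G) (out_arcs (del_verts G S) u)"
    by (auto simp: inj_on_def out_arcs_def del_verts_def arc_to_ends_def intro!: no_multi_arcs)
  moreover have "head G ` out_arcs (del_verts G S) u = {w \<in> verts G - S. (u, w) \<in> arcs_ends G}"
    using assms by (auto simp: out_arcs_def del_verts_def arcs_ends_conv)
  ultimately show ?thesis
    unfolding out_degree_def by (metis card_image)
qed

end

theory Submission
  imports Defs "HOL-Combinatorics.Orbits"
begin

text \<open>
  A drawing is pixelated on a fine square grid; this exhibits the graph as a subgraph of a minor of the grid. Grids are
  combinatorial maps of the sphere, and these are closed under contraction, so the graph lies in a connected planar map,
  where Euler's formula and the absence of \<open>K\<^sub>5\<close> are available.

  In a counterexample with fewest vertices all degrees are at least 5 (a vertex of degree at most 4 could be contracted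
  into a neighbour and collected first), and an edge-maximal planar graph containing it is a triangulation. Call \<open>S\<close>
  closed if every vertex outside \<open>S\<close> has at least 5 neighbours outside \<open>S\<close>; the closure of each single vertex then has
  at most 6 elements. Charge a vertex of degree \<open>d\<close> with \<open>d - 6\<close>. Vertices of degree at least 7 send their charge to the
  vertices of degree 5 and 6 in their closure, and those of degree 6 pass it on to their neighbours of degree 5. The
  bound on closures leaves so few local configurations that every vertex of degree 5 receives one unit. The exceptions
  are the 5-vertices that have at least four neighbours of degree 6 and no neighbour of degree 5 (hubs): together with
  their neighbours they form a closed set, and they are paid by the vertices opposite to the edges of their link. So
  the total charge is nonnegative, whereas Euler's formula makes it at most \<open>-12\<close>.
\<close>

section \<open>Cycles of permutations\<close>

text \<open>The topology of the plane enters only through compactness and connectedness. No Jordan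
  curve theorem is needed, since faces are never regions but cycles of a permutation, and Euler's
  formula is kept only as an inequality, which a contraction preserves with the face permutation
  literally unchanged. Graphs are kept connected so that any unwanted vertex can be contracted into
  another one. Closures have at most six elements because a closure consists of the deleted vertex
  and all that is collected after it; a seventh element would be the sixth collected vertex. The
  charge of 1 that a 5-vertex lacks is counted as ten half units, two for each neighbour. A
  neighbour of degree at least 7 gives its two directly, one of degree 6 hands on what it receives,
  and the share of a 5-neighbour has to come from vertices of large degree further away. The
  casework concerns this last share and the possibility that vertices named separately in a local
  picture coincide: a coincidence produces a vertex of degree 3 or a \<open>K5\<close>, or it raises
  the degree and with it the payment.\<close>

definition ncyc :: "'d set \<Rightarrow> ('d \<Rightarrow> 'd) \<Rightarrow> nat" where
  "ncyc D f = card (orbit f ` D)"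

lemma self_in_orbit:
  assumes "f permutes D" "finite D"
  shows "x \<in> orbit f x"
  using assms permutation_self_in_orbit permutation_permutes by metis

lemma orbit_eq_if_mem:
  assumes "f permutes D" "finite D" "y \<in> orbit f x"
  shows "orbit f y = orbit f x"
  by (metis assms cyclic_on_orbit orbit_cyclic_eq3 permutation_permutes)

lemma orbit_subset_carrier:
  assumes "f permutes D" "x \<in> D"
  shows "orbit f x \<subseteq> D"
  using assms by (rule permutes_orbit_subset)

lemma orbit_least:
  assumes "x \<in> X" "\<And>y. y \<in> X \<Longrightarrow> f y \<in> X"
  shows "orbit f x \<subseteq> X"
proof
  fix y assume "y \<in> orbit f x"
  then show "y \<in> X"
    by (induction rule: orbit.induct) (use assms in auto)
qed

text \<open>Swapping the successors of \<open>a\<close> and \<open>b\<close> splices their cycles: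
  after \<open>a\<close> the new map continues behind \<open>b\<close>, and conversely. All surgery
  on maps, at vertices and at faces, consists of this step and its inverse.\<close>

lemma orbit_comp_transpose_merge:
  assumes f: "f permutes D" "finite D" and ab: "a \<in> D" "b \<in> D" "b \<notin> orbit f a"
  shows "orbit (f \<circ> Transposition.transpose a b) x =
    (if x \<in> orbit f a \<union> orbit f b then orbit f a \<union> orbit f b else orbit f x)"
proof -
  define g where "g = f \<circ> Transposition.transpose a b"
  have g: "g permutes D"
    unfolding g_def using f ab permutes_compose permutes_swap_id by metis
  have ne: "a \<noteq> b" using ab self_in_orbit[OF f] by blast
  have a_notin: "a \<notin> orbit f b"
    using ab orbit_eq_if_mem[OF f] self_in_orbit[OF f] by blast
  have gs: "g a = f b" "g b = f a" "\<And>y. y \<noteq> a \<Longrightarrow> y \<noteq> b \<Longrightarrow> g y = f y"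
    by (auto simp: g_def)
  have B: "y \<in> orbit g a" if "y \<in> orbit f b" for y
    using that
  proof (induction rule: orbit.induct)
    case base then show ?case using gs orbit.base by metis
  next
    case (step y)
    then show ?case using gs a_notin orbit.base orbit.step by metis
  qed
  have A: "y \<in> orbit g b" if "y \<in> orbit f a" for y
    using that
  proof (induction rule: orbit.induct)
    case base then show ?case using gs orbit.base by metis
  next
    case (step y)
    then show ?case using gs ab(3) orbit.base orbit.step by metis
  qed
  have eq: "orbit g b = orbit g a"
    using B self_in_orbit[OF f] orbit_eq_if_mem[OF g f(2)] by blast
  have sub: "orbit f a \<union> orbit f b \<subseteq> orbit g a" using A B eq by blast
  show ?thesis
  proof (cases "x \<in> orbit f a \<union> orbit f b")
    case True
    then have "orbit g x = orbit g a"
      using sub orbit_eq_if_mem[OF g f(2)] by blast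
    moreover have "orbit g a \<subseteq> orbit f a \<union> orbit f b"
    proof (rule orbit_least)
      show "a \<in> orbit f a \<union> orbit f b" using self_in_orbit[OF f] by blast
      fix y assume "y \<in> orbit f a \<union> orbit f b"
      then show "g y \<in> orbit f a \<union> orbit f b"
        using gs by (metis UnE UnI1 UnI2 orbit.base orbit.step)
    qed
    ultimately show ?thesis using True sub by (auto simp: g_def)
  next
    case False
    have inX: "y \<in> orbit f x \<Longrightarrow> y \<noteq> a \<and> y \<noteq> b" for y
      using False orbit_eq_if_mem[OF f, of y x] self_in_orbit[OF f] by blast
    have "orbit g x = orbit f x"
    proof (rule orbit_cong0[symmetric, of x "orbit f x"])
      show "x \<in> orbit f x" using self_in_orbit[OF f] .
      show "f \<in> orbit f x \<rightarrow> orbit f x" by (auto intro: orbit.step)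
      show "\<And>y. y \<in> orbit f x \<Longrightarrow> f y = g y" using inX gs(3) by metis
    qed
    then show ?thesis using False by (simp add: g_def)
  qed
qed

lemma ncyc_merge:
  assumes f: "f permutes D" "finite D" and ab: "a \<in> D" "b \<in> D" "b \<notin> orbit f a"
  shows "ncyc D f = Suc (ncyc D (f \<circ> Transposition.transpose a b))"
proof -
  let ?A = "orbit f a" and ?B = "orbit f b"
  let ?R = "orbit f ` (D - (?A \<union> ?B))"
  have AD: "?A \<subseteq> D" "?B \<subseteq> D" using orbit_subset_carrier[OF f(1)] ab by blast+
  have self: "x \<in> orbit f x" for x using self_in_orbit[OF f] .
  have AB: "?A \<noteq> ?B" using ab self by blast
  have "orbit f ` D = insert ?A (insert ?B ?R)"
    using AD ab orbit_eq_if_mem[OF f] by (auto simp: image_iff)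
  moreover have "?A \<notin> ?R" "?B \<notin> ?R" using self by blast+
  ultimately have 1: "ncyc D f = Suc (Suc (card ?R))"
    using AB f(2) by (simp add: ncyc_def)
  have "orbit (f \<circ> Transposition.transpose a b) ` D = insert (?A \<union> ?B) ?R"
    using ab self by (auto simp: orbit_comp_transpose_merge[OF f ab] image_iff)
  moreover have "?A \<union> ?B \<notin> ?R"
  proof
    assume "?A \<union> ?B \<in> ?R"
    then obtain x where "x \<notin> ?A \<union> ?B" "?A \<union> ?B = orbit f x" by blast
    then show False using self by blast
  qed
  ultimately show ?thesis using 1 f(2) by (simp add: ncyc_def)
qed

text \<open>Take the least positive \<open>k\<close> with \<open>(f ^^ k) a = b\<close>. The new map
  sends \<open>b\<close> to \<open>f a\<close> and otherwise follows \<open>f\<close> along the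
  segment from \<open>f a\<close> to \<open>b\<close>; this segment is therefore closed under it and
  misses \<open>a\<close>.\<close>

lemma split_not_mem:
  assumes f: "f permutes D" "finite D" and ab: "a \<noteq> b" "b \<in> orbit f a"
  shows "b \<notin> orbit (f \<circ> Transposition.transpose a b) a"
proof
  define g where "g = f \<circ> Transposition.transpose a b"
  assume "b \<in> orbit (f \<circ> Transposition.transpose a b) a"
  then have bg: "b \<in> orbit g a" by (simp add: g_def)
  have D: "a \<in> D" "b \<in> D"
  proof -
    show "a \<in> D"
    proof (rule ccontr)
      assume "a \<notin> D"
      then have "orbit f a = {a}" using f(1) by (simp add: orbit_eq_singleton_iff permutes_def)
      then show False using ab by simp
    qed
    then show "b \<in> D" using ab(2) orbit_subset_carrier[OF f(1)] by blast
  qed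
  have g: "g permutes D"
    unfolding g_def using f D permutes_compose permutes_swap_id by metis
  obtain m where m: "0 < m" "(f ^^ m) a = b" using ab(2) by (auto simp: orbit_altdef)
  define k where "k = (LEAST k. 0 < k \<and> (f ^^ k) a = b)"
  have k: "0 < k" "(f ^^ k) a = b"
    using LeastI[of "\<lambda>k. 0 < k \<and> (f ^^ k) a = b" m] m unfolding k_def by auto
  have kl: "(f ^^ i) a \<noteq> b" if "0 < i" "i < k" for i
    using that not_less_Least[of i "\<lambda>k. 0 < k \<and> (f ^^ k) a = b"] unfolding k_def by auto
  have ka: "(f ^^ i) a \<noteq> a" if "0 < i" "i \<le> k" for i
  proof
    assume *: "(f ^^ i) a = a"
    show False
    proof (cases "i = k")
      case True then show ?thesis using * k ab by simp
    next
      case False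
      have "(f ^^ (k - i)) a = (f ^^ (k - i)) ((f ^^ i) a)" using * by simp
      also have "\<dots> = (f ^^ k) a" using that by (simp flip: funpow_add comp_apply[of "f ^^ _"])
      finally show False using k kl[of "k - i"] False that by auto
    qed
  qed
  define X where "X = (\<lambda>i. (f ^^ i) a) ` {1..k}"
  have "orbit g b \<subseteq> X"
  proof (rule orbit_least)
    show "b \<in> X" using k unfolding X_def by force
    fix y assume "y \<in> X"
    then obtain i where i: "1 \<le> i" "i \<le> k" "y = (f ^^ i) a" unfolding X_def by auto
    show "g y \<in> X"
    proof (cases "i = k")
      case True
      then have "g y = (f ^^ 1) a" using i k by (simp add: g_def)
      then show ?thesis using k(1) unfolding X_def by force
    next
      case False
      then have "y \<noteq> a" "y \<noteq> b" using i ka[of i] kl[of i] by auto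
      then have "g y = (f ^^ Suc i) a" using i by (simp add: g_def)
      then show ?thesis using i False unfolding X_def by (metis Suc_leI atLeastAtMost_iff imageI le_Suc_eq le_antisym nat_less_le not_less_eq_eq)
    qed
  qed
  moreover have "a \<notin> X" using ka by (auto simp: X_def dest: sym)
  moreover have "a \<in> orbit g b"
    using orbit_eq_if_mem[OF g f(2) bg] self_in_orbit[OF g f(2)] by simp
  ultimately show False by blast
qed

text \<open>A transposition is its own inverse, so this is merging read backwards.\<close>

lemma ncyc_split:
  assumes f: "f permutes D" "finite D" and ab: "a \<in> D" "b \<in> D" "a \<noteq> b" "b \<in> orbit f a"
  shows "ncyc D (f \<circ> Transposition.transpose a b) = Suc (ncyc D f)"
proof -
  let ?g = "f \<circ> Transposition.transpose a b"
  have g: "?g permutes D"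
    using f ab permutes_compose permutes_swap_id by metis
  have "ncyc D ?g = Suc (ncyc D (?g \<circ> Transposition.transpose a b))"
    using ncyc_merge[OF g f(2) ab(1,2)] split_not_mem[OF f ab(3,4)] by blast
  moreover have "?g \<circ> Transposition.transpose a b = f" by (simp add: comp_assoc)
  ultimately show ?thesis by simp
qed

lemma ncyc_insert_fixed:
  assumes "f permutes D" "finite D" "x \<notin> D"
  shows "ncyc (insert x D) f = Suc (ncyc D f)"
proof -
  have "orbit f x = {x}" using assms by (simp add: orbit_eq_singleton_iff permutes_def)
  moreover have "{x} \<notin> orbit f ` D"
    using assms orbit_subset_carrier[OF assms(1)] by blast
  ultimately show ?thesis using assms by (simp add: ncyc_def)
qed

text \<open>A quantity that is constant along cycles takes one value per cycle. This bounds the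
  faces of a grid from below without computing an orbit, and a lower bound is all that the Euler
  inequality asks for.\<close>

lemma ncyc_ge_invariant:
  assumes "finite D" "\<And>d. d \<in> D \<Longrightarrow> h (f d) = h d" "f permutes D"
  shows "card (h ` D) \<le> ncyc D f"
proof -
  have inv: "h y = h x" if "y \<in> orbit f x" "x \<in> D" for x y
    using that
  proof (induction rule: orbit.induct)
    case base then show ?case using assms(2) by simp
  next
    case (step y)
    then have "y \<in> D" using orbit_subset_carrier[OF assms(3)] by blast
    then show ?case using assms(2) step by simp
  qed
  have "h ` D \<subseteq> (\<lambda>C. h (SOME x. x \<in> C)) ` (orbit f ` D)"
  proof
    fix v assume "v \<in> h ` D"
    then obtain x where x: "x \<in> D" "v = h x" by blast
    have "(SOME y. y \<in> orbit f x) \<in> orbit f x"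
      using self_in_orbit[OF assms(3,1)] by (rule someI)
    then have "h (SOME y. y \<in> orbit f x) = h x" using inv x by blast
    then show "v \<in> (\<lambda>C. h (SOME x. x \<in> C)) ` (orbit f ` D)" using x by force
  qed
  then show ?thesis unfolding ncyc_def
    by (meson assms(1) card_image_le card_mono finite_imageI le_trans)
qed

section \<open>Combinatorial maps\<close>

text \<open>A map on the set \<open>D\<close> of darts: the cycles of \<open>s\<close> are the vertices (named by \<open>lab\<close>), \<open>a\<close> reverses
  darts, and the cycles of \<open>s \<circ> a\<close> are the faces. Fixed points of \<open>a\<close> are dangling half-edges, which do not
  count as edges. The last clause bounds the Euler characteristic from below, \<open>k = 4\<close> being the sphere
  (all quantities are doubled).\<close>

definition pmap ::
  "nat \<Rightarrow> 'd set \<Rightarrow> ('d \<Rightarrow> 'd) \<Rightarrow> ('d \<Rightarrow> 'd) \<Rightarrow> ('d \<Rightarrow> 'v) \<Rightarrow> 'v set \<Rightarrow> ('v \<times> 'v) set \<Rightarrow> bool" where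
  "pmap k D s a lab V E \<longleftrightarrow>
     finite D \<and> s permutes D \<and> a permutes D \<and> (\<forall>x. a (a x) = x) \<and> V = lab ` D \<and>
     (\<forall>x\<in>D. \<forall>y\<in>D. lab x = lab y \<longleftrightarrow> y \<in> orbit s x) \<and>
     E = (\<lambda>x. (lab x, lab (a x))) ` D - Id \<and>
     card {x\<in>D. a x \<noteq> x} + k \<le> 2 * card V + 2 * ncyc D (s \<circ> a)"

lemma pmapD:
  assumes "pmap k D s a lab V E"
  shows "finite D" "s permutes D" "a permutes D" "\<And>x. a (a x) = x" "V = lab ` D"
    "\<And>x y. x \<in> D \<Longrightarrow> y \<in> D \<Longrightarrow> lab x = lab y \<longleftrightarrow> y \<in> orbit s x"
    "E = (\<lambda>x. (lab x, lab (a x))) ` D - Id"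
    "card {x\<in>D. a x \<noteq> x} + k \<le> 2 * card V + 2 * ncyc D (s \<circ> a)"
    "s \<circ> a permutes D"
  using assms permutes_compose unfolding pmap_def by blast+

lemma pmap_weaken: "pmap k D s a lab V E \<Longrightarrow> j \<le> k \<Longrightarrow> pmap j D s a lab V E"
  unfolding pmap_def by auto

text \<open>A change of \<open>s\<close> at two darts is thereby visible as a change of the face
  permutation \<open>s \<circ> a\<close> at their reversals.\<close>

lemma comp_transpose_involution:
  assumes "\<And>x. a (a x) = x"
  shows "a \<circ> Transposition.transpose y z = Transposition.transpose (a y) (a z) \<circ> a"
proof
  fix x
  have "a x = a u \<longleftrightarrow> x = u" for u using assms by metis
  then show "(a \<circ> Transposition.transpose y z) x = (Transposition.transpose (a y) (a z) \<circ> a) x"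
    by (auto simp: Transposition.transpose_def)
qed

text \<open>Both \<open>s\<close> and \<open>a\<close> are composed with the transposition
  \<open>t\<close> of the two darts of the edge. As \<open>t\<close> commutes with \<open>a\<close>,
  the face permutation does not change at all; one vertex and one edge are lost, so the Euler bound
  survives exactly. The two darts stay behind as dangling half-edges, which keeps \<open>D\<close>
  fixed.\<close>

lemma pmap_contract:
  assumes P: "pmap k D s a lab V E" and e: "(u, v) \<in> E"
  defines "f \<equiv> (\<lambda>w. if w = u then v else w)"
  shows "\<exists>s' a'. pmap k D s' a' (f \<circ> lab) (V - {u}) (map_prod f f ` E - Id) \<and> s' \<circ> a' = s \<circ> a"
proof -
  note M = pmapD[OF P]
  obtain d where d: "d \<in> D" "lab d = u" "lab (a d) = v" "u \<noteq> v"
    using e M(7) by auto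
  define e' where "e' = a d"
  have ad: "e' \<in> D" "a e' = d" "a d = e'" "d \<noteq> e'" "lab e' = v"
    using d M(3,4) permutes_in_image unfolding e'_def by fastforce+
  define t where "t = Transposition.transpose d e'"
  define s' where "s' = s \<circ> t"
  define a' where "a' = a \<circ> t"
  have tp: "t permutes D" unfolding t_def using d ad permutes_swap_id by metis
  have s'p: "s' permutes D" and a'p: "a' permutes D"
    unfolding s'_def a'_def using M(2,3) tp permutes_compose by blast+
  have a'eq: "a' x = (if x = d \<or> x = e' then x else a x)" for x
    using ad by (auto simp: a'_def t_def Transposition.transpose_def)
  have a'inv: "a' (a' x) = x" for x
    using a'eq M(4) ad by metis
  have ta: "t \<circ> a = a \<circ> t"
    unfolding t_def using comp_transpose_involution[of a d e', OF M(4)] ad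
    by (simp add: transpose_commute)
  have phi: "s' \<circ> a' = s \<circ> a"
  proof -
    have "s' \<circ> a' = s \<circ> (t \<circ> a) \<circ> t" by (simp add: s'_def a'_def comp_assoc)
    also have "\<dots> = s \<circ> a \<circ> (t \<circ> t)" by (simp only: ta comp_assoc)
    finally show ?thesis by (simp add: t_def)
  qed
  have nm: "e' \<notin> orbit s d" using M(6)[of d e'] d ad by auto
  have orb: "orbit s' x = (if x \<in> orbit s d \<union> orbit s e' then orbit s d \<union> orbit s e' else orbit s x)" for x
    unfolding s'_def t_def by (rule orbit_comp_transpose_merge[OF M(2,1) d(1) ad(1) nm])
  have lab': "(f \<circ> lab) x = (f \<circ> lab) y \<longleftrightarrow> y \<in> orbit s' x" if xy: "x \<in> D" "y \<in> D" for x y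
  proof -
    have 1: "z \<in> orbit s d \<longleftrightarrow> lab z = u" if "z \<in> D" for z using M(6)[of d z] d that by auto
    have 2: "z \<in> orbit s e' \<longleftrightarrow> lab z = v" if "z \<in> D" for z using M(6)[of e' z] ad that by auto
    show ?thesis using orb[of x] 1[OF xy(1)] 1[OF xy(2)] 2[OF xy(1)] 2[OF xy(2)] M(6)[OF xy] d(4)
      by (auto simp: f_def)
  qed
  have V': "V - {u} = (f \<circ> lab) ` D"
    using M(5) d ad by (auto simp: f_def image_iff)
  have E': "map_prod f f ` E - Id = (\<lambda>x. ((f \<circ> lab) x, (f \<circ> lab) (a' x))) ` D - Id"
  proof -
    have *: "(f (lab x), f (lab (a' x))) \<in> Id \<longleftrightarrow> (f (lab x), f (lab (a x))) \<in> Id"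
      "(f (lab x), f (lab (a' x))) \<notin> Id \<Longrightarrow> a' x = a x" for x
      using a'eq[of x] d ad by (auto simp: f_def)
    have "map_prod f f ` E - Id = (\<lambda>x. (f (lab x), f (lab (a x)))) ` D - Id"
    proof -
      have "map_prod f f ` (A - Id) - Id = map_prod f f ` A - Id" for A by auto
      then show ?thesis unfolding M(7) by (simp add: image_image)
    qed
    also have "\<dots> = (\<lambda>x. (f (lab x), f (lab (a' x)))) ` D - Id"
      using * by (auto simp: image_iff)
    finally show ?thesis by simp
  qed
  have "{x\<in>D. a x \<noteq> x} = insert d (insert e' {x\<in>D. a' x \<noteq> x})"
    using a'eq d ad by auto
  moreover have "d \<notin> insert e' {x\<in>D. a' x \<noteq> x}" "e' \<notin> {x\<in>D. a' x \<noteq> x}"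
    using a'eq ad by auto
  ultimately have c1: "card {x\<in>D. a x \<noteq> x} = card {x\<in>D. a' x \<noteq> x} + 2"
    using M(1) by simp
  have "u \<in> V" "finite V" using M(1,5) d by auto
  then have c2: "card V = card (V - {u}) + 1"
    by (metis Suc_eq_plus1 card_Suc_Diff1)
  have "pmap k D s' a' (f \<circ> lab) (V - {u}) (map_prod f f ` E - Id)"
    unfolding pmap_def using M(1) s'p a'p a'inv V' lab' E' c1 c2 M(8) phi by auto
  then show ?thesis using phi by blast
qed

text \<open>The edge disappears by turning its darts into dangling ones. If both lie on one face,
  this face splits, and one edge less with one face more raises the doubled characteristic by 4.
  Otherwise two faces merge and the losses balance.\<close>

lemma pmap_delete:
  assumes P: "pmap k D s a lab V E" and x: "x \<in> D" "a x \<noteq> x"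
  defines "a' \<equiv> a \<circ> Transposition.transpose x (a x)"
  assumes E': "E' = (\<lambda>y. (lab y, lab (a y))) ` (D - {x, a x}) - Id"
  shows "a x \<in> orbit (s \<circ> a) x \<Longrightarrow> pmap (k + 4) D s a' lab V E'"
    and "a x \<notin> orbit (s \<circ> a) x \<Longrightarrow> pmap k D s a' lab V E'"
    and "a x \<notin> orbit (s \<circ> a) x \<Longrightarrow> orbit (s \<circ> a) y \<subseteq> orbit (s \<circ> a') y"
    and "card {y\<in>D. a' y \<noteq> y} < card {y\<in>D. a y \<noteq> y}"
proof -
  note M = pmapD[OF P]
  have ax: "a x \<in> D" using x M(3) by (simp add: permutes_in_image)
  have a'eq: "a' y = (if y = x \<or> y = a x then y else a y)" for y
    using M(4) by (auto simp: a'_def Transposition.transpose_def)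
  have a'p: "a' permutes D"
    unfolding a'_def using M(3) x ax permutes_compose permutes_swap_id by metis
  have a'inv: "a' (a' y) = y" for y using a'eq M(4) by metis
  have E'': "E' = (\<lambda>y. (lab y, lab (a' y))) ` D - Id"
    unfolding E' using a'eq by (auto simp: image_iff)
  have "{y\<in>D. a y \<noteq> y} = insert x (insert (a x) {y\<in>D. a' y \<noteq> y})"
    using a'eq x ax M(4) by auto
  moreover have "x \<notin> insert (a x) {y\<in>D. a' y \<noteq> y}" "a x \<notin> {y\<in>D. a' y \<noteq> y}"
    using a'eq x by auto
  ultimately have c1: "card {y\<in>D. a y \<noteq> y} = card {y\<in>D. a' y \<noteq> y} + 2"
    using M(1) by simp
  then show "card {y\<in>D. a' y \<noteq> y} < card {y\<in>D. a y \<noteq> y}" by simp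
  have phi: "s \<circ> a' = s \<circ> a \<circ> Transposition.transpose x (a x)" by (simp add: a'_def comp_assoc)
  note base = M(1,2,5,6) a'p a'inv E''
  show "pmap (k + 4) D s a' lab V E'" if "a x \<in> orbit (s \<circ> a) x"
  proof -
    have "ncyc D (s \<circ> a') = Suc (ncyc D (s \<circ> a))"
      unfolding phi using ncyc_split[OF M(9,1) x(1) ax] x(2) that by auto
    then show ?thesis unfolding pmap_def using base c1 M(8) by auto
  qed
  show "pmap k D s a' lab V E'" if "a x \<notin> orbit (s \<circ> a) x"
  proof -
    have "ncyc D (s \<circ> a) = Suc (ncyc D (s \<circ> a'))"
      unfolding phi using ncyc_merge[OF M(9,1) x(1) ax] that by auto
    then show ?thesis unfolding pmap_def using base c1 M(8) by auto
  qed
  show "orbit (s \<circ> a) y \<subseteq> orbit (s \<circ> a') y" if "a x \<notin> orbit (s \<circ> a) x"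
  proof -
    have self: "z \<in> orbit (s \<circ> a) z" for z using self_in_orbit[OF M(9,1)] .
    have "y \<in> orbit (s \<circ> a) z \<Longrightarrow> orbit (s \<circ> a) y = orbit (s \<circ> a) z" for z
      using orbit_eq_if_mem[OF M(9,1)] by blast
    then show ?thesis
      unfolding phi orbit_comp_transpose_merge[OF M(9,1) x(1) ax that] by auto
  qed
qed

definition simple_map :: "'d set \<Rightarrow> ('d \<Rightarrow> 'd) \<Rightarrow> ('d \<Rightarrow> 'v) \<Rightarrow> bool" where
  "simple_map D a lab \<longleftrightarrow> (\<forall>x\<in>D. a x \<noteq> x \<longrightarrow> lab x \<noteq> lab (a x) \<and>
     (\<forall>y\<in>D. a y \<noteq> y \<longrightarrow> lab y = lab x \<longrightarrow> lab (a y) = lab (a x) \<longrightarrow> y = x))"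

text \<open>Loops and parallel edges are deleted, which does not affect \<open>E\<close>. Labels
  \<open>L\<close> on a common face stay together as long as faces merge. A deletion that splits a
  face may separate them, but then the bound jumps to \<open>8\<close>. Either alternative is strong
  enough for \<open>no_K4_in_face\<close>.\<close>

lemma pmap_simplify:
  assumes "pmap 4 D s a lab V E" "(\<exists>d\<in>D. L \<subseteq> lab ` orbit (s \<circ> a) d) \<or> pmap 8 D s a lab V E"
  shows "\<exists>a'. simple_map D a' lab \<and> pmap 4 D s a' lab V E \<and>
    ((\<exists>d\<in>D. L \<subseteq> lab ` orbit (s \<circ> a') d) \<or> pmap 8 D s a' lab V E)"
  using assms
proof (induction "card {y\<in>D. a y \<noteq> y}" arbitrary: a rule: less_induct)
  case less
  note P = less.prems(1)
  note M = pmapD[OF P]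
  show ?case
  proof (cases "simple_map D a lab")
    case True then show ?thesis using less.prems by blast
  next
    case False
    then obtain x where x: "x \<in> D" "a x \<noteq> x" and
      cs: "lab x = lab (a x) \<or> (\<exists>y\<in>D. a y \<noteq> y \<and> lab y = lab x \<and> lab (a y) = lab (a x) \<and> y \<noteq> x)"
      unfolding simple_map_def by blast
    have EE: "E = (\<lambda>y. (lab y, lab (a y))) ` (D - {x, a x}) - Id"
      using cs
    proof
      assume "lab x = lab (a x)"
      then show ?thesis unfolding M(7) using M(4) by (auto simp: image_iff)
    next
      assume "\<exists>y\<in>D. a y \<noteq> y \<and> lab y = lab x \<and> lab (a y) = lab (a x) \<and> y \<noteq> x"
      then obtain y where y: "y \<in> D" "a y \<noteq> y" "lab y = lab x" "lab (a y) = lab (a x)" "y \<noteq> x" by blast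
      show ?thesis
      proof (cases "lab x = lab (a x)")
        case True then show ?thesis unfolding M(7) using M(4) by (auto simp: image_iff)
      next
        case False
        moreover have "a y \<noteq> a x" using y M(4) by metis
        ultimately have "y \<in> D - {x, a x}" "a y \<in> D - {x, a x}"
          using y M(4) permutes_in_image[OF M(3)] by auto
        moreover have "(lab x, lab (a x)) = (lab y, lab (a y))"
          "(lab (a x), lab (a (a x))) = (lab (a y), lab (a (a y)))" using y M(4) by auto
        ultimately have "(\<lambda>y. (lab y, lab (a y))) ` D = (\<lambda>y. (lab y, lab (a y))) ` (D - {x, a x})"
          by (auto simp: image_iff)
        then show ?thesis unfolding M(7) by simp
      qed
    qed
    define a' where "a' = a \<circ> Transposition.transpose x (a x)"
    note del = pmap_delete[OF _ x EE, folded a'_def]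
    have lt: "card {y\<in>D. a' y \<noteq> y} < card {y\<in>D. a y \<noteq> y}" using del(4)[OF P] .
    show ?thesis
    proof (rule less.hyps[OF lt])
      show "pmap 4 D s a' lab V E"
        using del(1,2)[OF P] pmap_weaken by (meson le_add1)
      show "(\<exists>d\<in>D. L \<subseteq> lab ` orbit (s \<circ> a') d) \<or> pmap 8 D s a' lab V E"
      proof (cases "a x \<in> orbit (s \<circ> a) x")
        case True then show ?thesis using del(1)[OF P] by simp
      next
        case False
        show ?thesis using less.prems(2)
        proof
          assume "\<exists>d\<in>D. L \<subseteq> lab ` orbit (s \<circ> a) d"
          then show ?thesis using del(3)[OF P False] by blast
        next
          assume "pmap 8 D s a lab V E"
          then show ?thesis using del(2) False by blast
        qed
      qed
    qed
  qed
qed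

text \<open>Dropping \<open>x\<close> from its vertex cycle drops it from its face as well. No label
  is lost on that face, because the next dart there is \<open>s x\<close>, which belongs to the same
  vertex.\<close>

lemma pmap_remove_dangling:
  assumes P: "pmap k D s a lab V E" and x: "x \<in> D" "a x = x" "s x \<noteq> x"
  shows "\<exists>s'. pmap k (D - {x}) s' a lab V E \<and>
    (\<forall>d\<in>D. \<exists>d'\<in>D - {x}. lab ` orbit (s \<circ> a) d \<subseteq> lab ` orbit (s' \<circ> a) d')"
proof -
  note M = pmapD[OF P]
  obtain y where y: "s y = x" "y \<in> D" "y \<noteq> x"
    using x M(2) by (metis permutes_def)
  define s' where "s' = s \<circ> Transposition.transpose x y"
  have s'D: "s' permutes D" unfolding s'_def using M(2) x y permutes_compose permutes_swap_id by metis
  have s'x: "s' x = x" using y by (simp add: s'_def)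
  have s'p: "s' permutes (D - {x})"
    by (rule permutes_superset[OF s'D]) (use s'x in auto)
  have ap: "a permutes (D - {x})"
    by (rule permutes_superset[OF M(3)]) (use x in auto)
  have s_eq: "s = s' \<circ> Transposition.transpose x y" by (simp add: s'_def comp_assoc)
  have ox: "orbit s' x = {x}" using s'x orbit_eq_singleton_iff[of s' x] by simp
  have ynm: "y \<notin> orbit s' x" using ox y by simp
  have orbs: "orbit s z = (if z \<in> orbit s' x \<union> orbit s' y then orbit s' x \<union> orbit s' y else orbit s' z)" for z
    unfolding s_eq by (rule orbit_comp_transpose_merge[OF s'D M(1) x(1) y(2) ynm])
  define p where "p = a y"
  have p: "p \<in> D" "p \<noteq> x"
    using y x M(4) permutes_in_image[OF M(3)] unfolding p_def by metis+
  define g where "g = s' \<circ> a"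
  have gD: "g permutes D" unfolding g_def using M(3) s'D permutes_compose by blast
  have gp: "g permutes (D - {x})" unfolding g_def using ap s'p permutes_compose by blast
  have gx: "orbit g x = {x}" using s'x x orbit_eq_singleton_iff[of g x] unfolding g_def by simp
  have phi: "s \<circ> a = g \<circ> Transposition.transpose x p"
  proof -
    have "s \<circ> a = (s' \<circ> Transposition.transpose x y) \<circ> a" by (simp flip: s_eq)
    also have "\<dots> = s' \<circ> (Transposition.transpose x y \<circ> a)" by (simp add: comp_assoc)
    also have "Transposition.transpose x y \<circ> a = a \<circ> Transposition.transpose x p"
      using comp_transpose_involution[of a x p, OF M(4)] x M(4) by (simp add: p_def)
    finally show ?thesis by (simp only: g_def comp_assoc)
  qed
  have pnm: "p \<notin> orbit g x" using gx p by auto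
  have orbg: "orbit (s \<circ> a) z = (if z \<in> orbit g x \<union> orbit g p then orbit g x \<union> orbit g p else orbit g z)" for z
    unfolding phi by (rule orbit_comp_transpose_merge[OF gD M(1) x(1) p(1) pnm])
  have "ncyc D g = Suc (ncyc D (s \<circ> a))"
    unfolding phi by (rule ncyc_merge[OF gD M(1) x(1) p(1) pnm])
  moreover have "ncyc D g = Suc (ncyc (D - {x}) g)"
    using ncyc_insert_fixed[OF gp, of x] M(1) x(1) by (simp add: insert_absorb)
  ultimately have nc: "ncyc (D - {x}) g = ncyc D (s \<circ> a)" by simp
  have ly: "lab x = lab y" using M(6)[OF y(2) x(1)] y orbit.base[of s y] by simp
  have lim: "lab ` (D - {x}) = lab ` D" using ly y x by (auto simp: image_iff)
  have l: "lab u = lab w \<longleftrightarrow> w \<in> orbit s' u" if uw: "u \<in> D - {x}" "w \<in> D - {x}" for u w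
  proof -
    have "u \<in> orbit s' y \<Longrightarrow> orbit s' u = orbit s' y" using orbit_eq_if_mem[OF s'D M(1)] by blast
    then show ?thesis using M(6)[of u w] uw orbs[of u] ox by auto
  qed
  have E: "E = (\<lambda>z. (lab z, lab (a z))) ` (D - {x}) - Id"
    unfolding M(7) using x by (auto simp: image_iff)
  have c: "{z\<in>D - {x}. a z \<noteq> z} = {z\<in>D. a z \<noteq> z}" using x by auto
  have "pmap k (D - {x}) s' a lab V E"
    unfolding pmap_def using M(1,4,5,8) s'p ap lim l E nc c unfolding g_def by auto
  moreover have "\<exists>d'\<in>D - {x}. lab ` orbit (s \<circ> a) d \<subseteq> lab ` orbit (s' \<circ> a) d'" if "d \<in> D" for d
  proof (cases "d \<in> orbit g x \<union> orbit g p")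
    case True
    have "s x \<in> orbit g p"
    proof -
      have "g p = s' y" using M(4) by (simp add: g_def p_def)
      also have "\<dots> = s x" using y by (simp add: s'_def)
      finally show ?thesis using orbit.base[of g p] by simp
    qed
    moreover have "lab x = lab (s x)"
      using M(6)[of x "s x"] x(1) orbit.base[of s x] permutes_in_image[OF M(2)] by simp
    ultimately have "lab ` orbit (s \<circ> a) d \<subseteq> lab ` orbit g p"
      using orbg[of d] True gx by auto
    then show ?thesis using p g_def by blast
  next
    case False
    then have "orbit (s \<circ> a) d = orbit g d" "d \<noteq> x" using orbg[of d] gx by auto
    then show ?thesis using that g_def by (metis DiffI empty_iff insert_iff order_refl)
  qed
  ultimately show ?thesis by blast
qed

text \<open>As every vertex has an edge, a dangling dart is never alone in its vertex cycle, so no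
  vertex vanishes with it.\<close>

lemma pmap_clean:
  assumes "pmap 4 D s a lab V E" "\<And>v. v \<in> V \<Longrightarrow> \<exists>w. (v, w) \<in> E" "simple_map D a lab"
    "(\<exists>d\<in>D. L \<subseteq> lab ` orbit (s \<circ> a) d) \<or> pmap 8 D s a lab V E"
  shows "\<exists>D' s'. simple_map D' a lab \<and> pmap 4 D' s' a lab V E \<and> (\<forall>x\<in>D'. a x \<noteq> x) \<and>
    ((\<exists>d\<in>D'. L \<subseteq> lab ` orbit (s' \<circ> a) d) \<or> pmap 8 D' s' a lab V E)"
  using assms
proof (induction "card D" arbitrary: D s rule: less_induct)
  case less
  note P = less.prems(1)
  note M = pmapD[OF P]
  show ?case
  proof (cases "\<forall>x\<in>D. a x \<noteq> x")
    case True then show ?thesis using less.prems by blast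
  next
    case False
    then obtain x where x: "x \<in> D" "a x = x" by blast
    have sx: "s x \<noteq> x"
    proof
      assume "s x = x"
      then have o: "orbit s x = {x}" using orbit_eq_singleton_iff[of s x] by simp
      obtain w where "(lab x, w) \<in> E" using less.prems(2) x M(5) by blast
      then obtain y where y: "y \<in> D" "lab y = lab x" "(lab y, lab (a y)) \<notin> Id" using M(7) by auto
      then have "y \<in> orbit s x" using M(6)[of x y] x by metis
      then show False using o y x by simp
    qed
    have lt: "card (D - {x}) < card D" using card_Diff1_less[OF M(1) x(1)] .
    have simp': "simple_map (D - {x}) a lab" using less.prems(3) unfolding simple_map_def by blast
    show ?thesis
      using less.prems(4)
    proof
      assume "\<exists>d\<in>D. L \<subseteq> lab ` orbit (s \<circ> a) d"
      then obtain d where d: "d \<in> D" "L \<subseteq> lab ` orbit (s \<circ> a) d" by blast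
      obtain s' where s': "pmap 4 (D - {x}) s' a lab V E"
        "\<forall>d\<in>D. \<exists>d'\<in>D - {x}. lab ` orbit (s \<circ> a) d \<subseteq> lab ` orbit (s' \<circ> a) d'"
        using pmap_remove_dangling[OF P x sx] by blast
      have "\<exists>d\<in>D - {x}. L \<subseteq> lab ` orbit (s' \<circ> a) d" using d s'(2) by (meson order_trans)
      then show ?thesis using less.hyps[OF lt s'(1) less.prems(2) simp'] by blast
    next
      assume P8: "pmap 8 D s a lab V E"
      obtain s' where s': "pmap 8 (D - {x}) s' a lab V E"
        using pmap_remove_dangling[OF P8 x sx] by blast
      have s4: "pmap 4 (D - {x}) s' a lab V E" using s' pmap_weaken by fastforce
      show ?thesis using less.hyps[OF lt s4 less.prems(2) simp'] s' by blast
    qed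
  qed
qed

text \<open>The fresh dangling dart goes between \<open>c\<close> and \<open>s c\<close>. This
  corner belongs to the face through \<open>a c\<close>, since
  \<open>s (a (a c)) = s c\<close>.\<close>

lemma pmap_insert:
  assumes P: "pmap k D s a lab V E" and x: "x \<notin> D" "c \<in> D"
  shows "pmap k (insert x D) (s \<circ> Transposition.transpose c x) a (lab(x := lab c)) V E"
    and "orbit (s \<circ> Transposition.transpose c x \<circ> a) y =
      (if y \<in> insert x (orbit (s \<circ> a) (a c)) then insert x (orbit (s \<circ> a) (a c)) else orbit (s \<circ> a) y)"
proof -
  note M = pmapD[OF P]
  let ?D = "insert x D" and ?s = "s \<circ> Transposition.transpose c x"
  have fin: "finite ?D" using M(1) by simp
  have sp: "s permutes ?D" "a permutes ?D" "s \<circ> a permutes ?D"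
    using M(2,3,9) permutes_subset by blast+
  have fx: "s x = x" "a x = x" using M(2,3) x by (auto simp: permutes_def)
  have s'p: "?s permutes ?D" using sp(1) x permutes_compose permutes_swap_id by (metis insertCI)
  have ac: "a c \<in> D" using x M(3) by (simp add: permutes_in_image)
  have cn: "c \<noteq> x" using x by blast
  have ox: "orbit s x = {x}" "orbit (s \<circ> a) x = {x}" using fx orbit_eq_singleton_iff[of _ x] by auto
  have oc: "orbit s c \<subseteq> D" "orbit (s \<circ> a) (a c) \<subseteq> D"
    using orbit_subset_carrier M(2,9) x ac by metis+
  have nm: "x \<notin> orbit s c" "x \<notin> orbit (s \<circ> a) (a c)" using oc x by auto
  have orbs: "orbit ?s z = (if z \<in> orbit s c \<union> orbit s x then orbit s c \<union> orbit s x else orbit s z)" for z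
    by (rule orbit_comp_transpose_merge[OF sp(1) fin _ _ nm(1)]) (use x in auto)
  have phi: "?s \<circ> a = s \<circ> a \<circ> Transposition.transpose (a c) x"
    using comp_transpose_involution[of a "a c" x, OF M(4)] M(4) fx by (simp add: comp_assoc)
  have orbp: "orbit (s \<circ> a \<circ> Transposition.transpose (a c) x) z =
     (if z \<in> orbit (s \<circ> a) (a c) \<union> orbit (s \<circ> a) x then orbit (s \<circ> a) (a c) \<union> orbit (s \<circ> a) x
      else orbit (s \<circ> a) z)" for z
    by (rule orbit_comp_transpose_merge[OF sp(3) fin _ _ nm(2)]) (use ac in auto)
  show "orbit (?s \<circ> a) y =
      (if y \<in> insert x (orbit (s \<circ> a) (a c)) then insert x (orbit (s \<circ> a) (a c)) else orbit (s \<circ> a) y)"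
    unfolding phi orbp ox by auto
  have "ncyc ?D (s \<circ> a) = Suc (ncyc ?D (?s \<circ> a))"
    unfolding phi by (rule ncyc_merge[OF sp(3) fin _ _ nm(2)]) (use ac in auto)
  then have nc: "ncyc ?D (?s \<circ> a) = ncyc D (s \<circ> a)"
    using ncyc_insert_fixed[OF M(9,1) x(1)] by simp
  let ?l = "lab(x := lab c)"
  have inD: "z \<in> D \<Longrightarrow> z \<noteq> x" for z using x by blast
  have oeq: "orbit s z = orbit s c" if "z \<in> orbit s c" for z
    using orbit_eq_if_mem[OF M(2,1)] that .
  have osub: "orbit s z \<subseteq> D" if "z \<in> D" for z using orbit_subset_carrier[OF M(2)] that .
  have l: "?l u = ?l w \<longleftrightarrow> w \<in> orbit ?s u" if uw: "u \<in> ?D" "w \<in> ?D" for u w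
  proof (cases "u = x")
    case True
    have o: "orbit ?s x = insert x (orbit s c)" using orbs[of x] ox by simp
    show ?thesis
    proof (cases "w = x")
      case False
      then have "w \<in> D" using uw by simp
      then show ?thesis using True False o M(6)[OF x(2)] by simp
    qed (use True o in simp)
  next
    case False
    then have u: "u \<in> D" using uw by simp
    show ?thesis
    proof (cases "w = x")
      case True
      have "x \<notin> orbit s u" using osub[OF u] x by blast
      then have "x \<in> orbit ?s u \<longleftrightarrow> u \<in> orbit s c" using orbs[of u] ox False by simp
      then show ?thesis using True False M(6)[OF x(2) u] by auto
    next
      case wx: False
      then have w: "w \<in> D" using uw by simp
      have "w \<in> orbit ?s u \<longleftrightarrow> w \<in> orbit s u"
        using orbs[of u] ox False wx oeq[of u] by simp
      then show ?thesis using False wx M(6)[OF u w] by simp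
    qed
  qed
  have aD: "a z \<in> D" if "z \<in> D" for z using that M(3) by (simp add: permutes_in_image)
  have "(\<lambda>z. (?l z, ?l (a z))) ` D = (\<lambda>z. (lab z, lab (a z))) ` D"
    by (rule image_cong) (use aD inD in auto)
  then have E: "E = (\<lambda>z. (?l z, ?l (a z))) ` ?D - Id"
    unfolding M(7) using fx by auto
  have V: "V = ?l ` ?D" unfolding M(5) using x by (auto simp: image_iff)
  have c: "{z\<in>?D. a z \<noteq> z} = {z\<in>D. a z \<noteq> z}" using fx by auto
  show "pmap k ?D ?s a ?l V E"
    unfolding pmap_def using fin s'p sp(2) M(4) V l E c nc M(8) by auto
qed

text \<open>Joining two dangling darts of one face splits the face; the new edge is balanced by the
  new face.\<close>

lemma pmap_join:
  assumes P: "pmap k D s a lab V E" and x: "x \<in> D" "y \<in> D" "a x = x" "a y = y" "x \<noteq> y"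
    "y \<in> orbit (s \<circ> a) x"
  shows "pmap k D s (a \<circ> Transposition.transpose x y) lab V (E \<union> {(lab x, lab y), (lab y, lab x)} - Id)"
proof -
  note M = pmapD[OF P]
  let ?a = "a \<circ> Transposition.transpose x y"
  have ap: "?a permutes D" using M(3) x permutes_compose permutes_swap_id by metis
  have aeq: "?a z = (if z = x then y else if z = y then x else a z)" for z
    using x by (auto simp: Transposition.transpose_def)
  have ainv: "?a (?a z) = z" for z using aeq M(4) x by metis
  have "ncyc D (s \<circ> a \<circ> Transposition.transpose x y) = Suc (ncyc D (s \<circ> a))"
    using ncyc_split[OF M(9,1)] x by auto
  then have nc: "ncyc D (s \<circ> ?a) = Suc (ncyc D (s \<circ> a))" by (simp add: comp_assoc)
  have "{z\<in>D. ?a z \<noteq> z} = insert x (insert y {z\<in>D. a z \<noteq> z})"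
    using aeq x by auto
  moreover have "x \<notin> insert y {z\<in>D. a z \<noteq> z}" "y \<notin> {z\<in>D. a z \<noteq> z}" using x by auto
  ultimately have c: "card {z\<in>D. ?a z \<noteq> z} = card {z\<in>D. a z \<noteq> z} + 2" using M(1) by simp
  have E: "E \<union> {(lab x, lab y), (lab y, lab x)} - Id = (\<lambda>z. (lab z, lab (?a z))) ` D - Id"
  proof -
    have "(\<lambda>z. (lab z, lab (?a z))) ` D =
       (\<lambda>z. (lab z, lab (?a z))) ` (D - {x, y}) \<union> {(lab x, lab y), (lab y, lab x)}"
    proof -
      have "D = (D - {x, y}) \<union> {x, y}" using x by blast
      then have "(\<lambda>z. (lab z, lab (?a z))) ` D =
        (\<lambda>z. (lab z, lab (?a z))) ` (D - {x, y}) \<union> (\<lambda>z. (lab z, lab (?a z))) ` {x, y}"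
        by (metis image_Un)
      then show ?thesis using aeq x(3,4) by simp
    qed
    also have "(\<lambda>z. (lab z, lab (?a z))) ` (D - {x, y}) = (\<lambda>z. (lab z, lab (a z))) ` (D - {x, y})"
      using aeq by (intro image_cong) auto
    finally have "(\<lambda>z. (lab z, lab (?a z))) ` D =
      (\<lambda>z. (lab z, lab (a z))) ` (D - {x, y}) \<union> {(lab x, lab y), (lab y, lab x)}" .
    moreover have "(\<lambda>z. (lab z, lab (a z))) ` D - Id = (\<lambda>z. (lab z, lab (a z))) ` (D - {x, y}) - Id"
      using x by auto
    ultimately show ?thesis unfolding M(7) by (simp only: Un_Diff Diff_idemp)
  qed
  show ?thesis unfolding pmap_def using M(1,2,5,6,8) ap ainv E c nc by auto
qed

text \<open>A half-edge is inserted at each end, in a corner of the common face, and the two are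
  joined. The type of darts has to be infinite to supply fresh ones.\<close>

lemma pmap_add_chord:
  fixes D :: "'d set"
  assumes P: "pmap k D s a lab V E" and inf: "infinite (UNIV :: 'd set)"
    and d: "d \<in> D" "e \<in> D" "e \<in> orbit (s \<circ> a) d" "lab d \<noteq> lab e"
  shows "\<exists>D' s' a' lab'. pmap k (D' :: 'd set) s' a' lab' V (E \<union> {(lab d, lab e), (lab e, lab d)})"
proof -
  note M = pmapD[OF P]
  obtain x where x: "x \<notin> D" using inf M(1) ex_new_if_finite by blast
  obtain y where y: "y \<notin> insert x D" using inf M(1) ex_new_if_finite[of "insert x D"] by blast
  \<comment> \<open>With \<open>c\<close> the predecessor of \<open>z\<close> at its vertex, the
    corner between them lies on the face of \<open>z\<close>.\<close>
  have pred: "\<exists>c\<in>D. s c = z \<and> z \<in> orbit (s \<circ> a) (a c)" if z: "z \<in> D" for z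
  proof -
    obtain c where "s c = z" "c \<in> D" using M(2) z by (metis permutes_def)
    moreover have "(s \<circ> a) (a c) = s c" using M(4) by simp
    ultimately show ?thesis using orbit.base by metis
  qed
  obtain c where c: "c \<in> D" "s c = d" "d \<in> orbit (s \<circ> a) (a c)" using pred d by blast
  obtain f where f: "f \<in> D" "s f = e" "e \<in> orbit (s \<circ> a) (a f)" using pred d by blast
  note eqo = orbit_eq_if_mem[OF M(9,1)]
  note self = self_in_orbit[OF M(9,1)]
  have o1: "orbit (s \<circ> a) (a c) = orbit (s \<circ> a) d" "orbit (s \<circ> a) (a f) = orbit (s \<circ> a) d"
    using c f d eqo by metis+
  define s1 where "s1 = s \<circ> Transposition.transpose c x"
  define l1 where "l1 = lab(x := lab c)"
  note I1 = pmap_insert[OF P x c(1), folded s1_def l1_def]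
  have fD: "f \<in> insert x D" using f by blast
  define s2 where "s2 = s1 \<circ> Transposition.transpose f y"
  define l2 where "l2 = l1(y := l1 f)"
  note I2 = pmap_insert[OF I1(1) y fD, folded s2_def l2_def]
  have fx: "a x = x" "a y = y" using M(3) x y by (auto simp: permutes_def)
  have af: "a f \<in> orbit (s \<circ> a) (a c)" using o1 self by metis
  have x1: "orbit (s1 \<circ> a) (a f) = insert x (orbit (s \<circ> a) (a c))" using I1(2)[of "a f"] af by simp
  have "orbit (s2 \<circ> a) x = insert y (orbit (s1 \<circ> a) (a f))" using I2(2)[of x] x1 by simp
  then have "y \<in> orbit (s2 \<circ> a) x" by simp
  then have "pmap k (insert y (insert x D)) s2 (a \<circ> Transposition.transpose x y) l2 V (E \<union> {(l2 x, l2 y), (l2 y, l2 x)} - Id)"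
    using pmap_join[OF I2(1), of x y] fx y by auto
  moreover have "l2 x = lab d" "l2 y = lab e"
  proof -
    have "lab c = lab d" using M(6)[of c d] c d orbit.base by metis
    moreover have "x \<noteq> y" using y by blast
    ultimately show "l2 x = lab d" by (simp add: l2_def l1_def)
    have "lab f = lab e" using M(6)[of f e] f d orbit.base by metis
    then show "l2 y = lab e" using x f by (auto simp: l2_def l1_def)
  qed
  moreover have "E \<union> {(lab d, lab e), (lab e, lab d)} - Id = E \<union> {(lab d, lab e), (lab e, lab d)}"
    using d(4) unfolding M(7) by auto
  ultimately show ?thesis by metis
qed

section \<open>Connected planar graphs\<close>

lemma pmap_graph:
  assumes "pmap k D s a lab V E"
  shows "finite V" "E \<subseteq> V \<times> V" "\<And>u v. (u, v) \<in> E \<Longrightarrow> (v, u) \<in> E" "\<And>v. (v, v) \<notin> E"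
proof -
  note M = pmapD[OF assms]
  have aD: "a x \<in> D" if "x \<in> D" for x using that M(3) by (simp add: permutes_in_image)
  show "finite V" using M(1,5) by simp
  show "E \<subseteq> V \<times> V" unfolding M(5,7) using aD by auto
  show "(v, u) \<in> E" if uv: "(u, v) \<in> E" for u v
  proof -
    obtain x where x: "x \<in> D" "lab x = u" "lab (a x) = v" "u \<noteq> v" using uv unfolding M(7) by auto
    then have "(v, u) = (lab (a x), lab (a (a x)))" using M(4) by simp
    then show ?thesis unfolding M(7) using x aD by blast
  qed
  show "(v, v) \<notin> E" for v unfolding M(7) by blast
qed

definition conn :: "'v set \<Rightarrow> ('v \<times> 'v) set \<Rightarrow> bool" where
  "conn V E \<longleftrightarrow> (\<forall>u\<in>V. \<forall>v\<in>V. (u, v) \<in> E\<^sup>*)"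

lemma conn_mono: "conn V E \<Longrightarrow> E \<subseteq> E' \<Longrightarrow> conn V E'"
  unfolding conn_def by (meson rtrancl_mono subsetD)

lemma rtrancl_map_quotient:
  assumes "(u, v) \<in> E\<^sup>*"
  shows "(f u, f v) \<in> (map_prod f f ` E - Id)\<^sup>*"
  using assms
proof (induction rule: rtrancl_induct)
  case (step y z)
  then show ?case
  proof (cases "f y = f z")
    case False
    have "map_prod f f (y, z) \<in> map_prod f f ` E" using step(2) by (rule imageI)
    then have "(f y, f z) \<in> map_prod f f ` E - Id" using False by simp
    then show ?thesis using step(3) by (rule rtrancl.rtrancl_into_rtrancl[rotated])
  qed auto
qed auto

text \<open>Connectedness provides an edge along which a vertex outside \<open>W\<close> can be
  contracted. Contraction leaves the face permutation and the labels in \<open>W\<close> alone, so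
  labels of \<open>W\<close> on a common face remain on one.\<close>

lemma pmap_contract_to:
  assumes "pmap k D s a lab V E" "conn V E" "W \<subseteq> V" "W \<noteq> {}"
  shows "\<exists>s' a' lab' E'. pmap k D s' a' lab' W E' \<and> conn W E' \<and> s' \<circ> a' = s \<circ> a \<and>
    (\<forall>d\<in>D. lab d \<in> W \<longrightarrow> lab' d = lab d) \<and> E \<inter> W \<times> W \<subseteq> E'"
  using assms
proof (induction "card (V - W)" arbitrary: V E s a lab rule: less_induct)
  case less
  note P = less.prems(1) and G = pmap_graph[OF less.prems(1)]
  show ?case
  proof (cases "V = W")
    case True then show ?thesis using less.prems by blast
  next
    case False
    then obtain u w where u: "u \<in> V" "u \<notin> W" "w \<in> W" using less.prems(3,4) by blast
    then have "(u, w) \<in> E\<^sup>*" "u \<noteq> w" using less.prems(2,3) by (auto simp: conn_def)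
    then obtain v where v: "(u, v) \<in> E" by (meson converse_rtranclE)
    define f where "f = (\<lambda>w. if w = u then v else w)"
    obtain s' a' where P': "pmap k D s' a' (f \<circ> lab) (V - {u}) (map_prod f f ` E - Id)"
      and phi: "s' \<circ> a' = s \<circ> a"
      using pmap_contract[OF P v] unfolding f_def by blast
    have lt: "card (V - {u} - W) < card (V - W)"
      using u G(1) by (metis Diff_iff Diff_insert2 card_Diff1_less finite_Diff insert_Diff_single Diff_insert)
    have c: "conn (V - {u}) (map_prod f f ` E - Id)"
      unfolding conn_def
    proof (intro ballI)
      fix p q assume pq: "p \<in> V - {u}" "q \<in> V - {u}"
      then have "(p, q) \<in> E\<^sup>*" using less.prems(2) by (auto simp: conn_def)
      then have "(f p, f q) \<in> (map_prod f f ` E - Id)\<^sup>*" by (rule rtrancl_map_quotient)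
      moreover have "f p = p" "f q = q" using pq by (auto simp: f_def)
      ultimately show "(p, q) \<in> (map_prod f f ` E - Id)\<^sup>*" by simp
    qed
    obtain s2 a2 l2 E2 where I: "pmap k D s2 a2 l2 W E2" "conn W E2" "s2 \<circ> a2 = s' \<circ> a'"
      "\<forall>d\<in>D. (f \<circ> lab) d \<in> W \<longrightarrow> l2 d = (f \<circ> lab) d"
      "(map_prod f f ` E - Id) \<inter> W \<times> W \<subseteq> E2"
    proof -
      have "W \<subseteq> V - {u}" using less.prems(3) u by blast
      from less.hyps[OF lt P' c this less.prems(4)] show ?thesis using that by blast
    qed
    have "l2 d = lab d" if "d \<in> D" "lab d \<in> W" for d
    proof -
      have "f (lab d) = lab d" using that u by (auto simp: f_def)
      then show ?thesis using I(4) that by simp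
    qed
    moreover have "E \<inter> W \<times> W \<subseteq> E2"
    proof
      fix e assume e: "e \<in> E \<inter> W \<times> W"
      then obtain p q where pq: "e = (p, q)" "p \<in> W" "q \<in> W" "(p, q) \<in> E" by auto
      then have "p \<noteq> q" "f p = p" "f q = q" using G(4) u by (auto simp: f_def)
      then have "e \<in> (map_prod f f ` E - Id) \<inter> W \<times> W" using pq by (metis DiffI IntI SigmaI image_eqI map_prod_simp pair_in_Id_conv)
      then show "e \<in> E2" using I(5) by blast
    qed
    ultimately show ?thesis using I phi by metis
  qed
qed

lemma lab_face_step:
  assumes P: "pmap k D s a lab V E" and d: "d \<in> D"
  shows "(s \<circ> a) d \<in> D" "lab ((s \<circ> a) d) = lab (a d)"
proof -
  note M = pmapD[OF P]
  have ad: "a d \<in> D" using d M(3) by (simp add: permutes_in_image)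
  then show "(s \<circ> a) d \<in> D" using M(2) by (simp add: permutes_in_image)
  then show "lab ((s \<circ> a) d) = lab (a d)"
    using M(6)[OF ad, of "s (a d)"] orbit.base[of s "a d"] by simp
qed

lemma card_clean_simple:
  assumes P: "pmap k D s a lab V E" and S: "simple_map D a lab" and C: "\<forall>x\<in>D. a x \<noteq> x"
  shows "card D = card E" "{x\<in>D. a x \<noteq> x} = D"
proof -
  note M = pmapD[OF P]
  show "{x\<in>D. a x \<noteq> x} = D" using C by blast
  have "inj_on (\<lambda>x. (lab x, lab (a x))) D"
    using S C unfolding simple_map_def inj_on_def by (metis prod.inject)
  moreover have "E = (\<lambda>x. (lab x, lab (a x))) ` D"
    unfolding M(7) using S C unfolding simple_map_def by auto
  ultimately show "card D = card E" by (simp add: card_image)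
qed

text \<open>If the third label repeated the first, simplicity would make \<open>f d\<close> the
  reverse of \<open>d\<close>; then \<open>s\<close> would fix \<open>a d\<close>, whose vertex
  would have degree 1.\<close>

lemma face_three_distinct:
  assumes P: "pmap k D s a lab V E" and S: "simple_map D a lab" and C: "\<forall>x\<in>D. a x \<noteq> x"
    and deg: "\<And>v. v \<in> V \<Longrightarrow> \<exists>u w. (v, u) \<in> E \<and> (v, w) \<in> E \<and> u \<noteq> w"
    and d: "d \<in> D"
  defines "f \<equiv> s \<circ> a"
  shows "lab d \<noteq> lab (f d)" "lab d \<noteq> lab (f (f d))" "f d \<in> D" "lab (f d) = lab (a d)"
proof -
  note M = pmapD[OF P]
  note st = lab_face_step[OF P, folded f_def]
  show fd: "f d \<in> D" "lab (f d) = lab (a d)" using st[OF d] .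
  have ne: "lab x \<noteq> lab (a x)" if "x \<in> D" for x using S C that unfolding simple_map_def by blast
  show "lab d \<noteq> lab (f d)" using ne[OF d] fd by simp
  show "lab d \<noteq> lab (f (f d))"
  proof
    assume "lab d = lab (f (f d))"
    then have e: "lab (a (f d)) = lab (a (a d))" using st[OF fd(1)] M(4) by simp
    have ad: "a d \<in> D" using d M(3) by (simp add: permutes_in_image)
    then have "f d = a d" using S C fd e unfolding simple_map_def by metis
    then have "s (a d) = a d" by (simp add: f_def)
    then have o: "orbit s (a d) = {a d}" using orbit_eq_singleton_iff[of s "a d"] by simp
    have "lab (a d) \<in> V" using ad M(5) by blast
    then obtain u w where uw: "(lab (a d), u) \<in> E" "(lab (a d), w) \<in> E" "u \<noteq> w" using deg by blast
    then obtain x y where xy: "x \<in> D" "lab x = lab (a d)" "lab (a x) = u" "y \<in> D" "lab y = lab (a d)" "lab (a y) = w"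
      unfolding M(7) by auto
    then have "x = a d" "y = a d" using M(6)[OF ad, of x] M(6)[OF ad, of y] o by auto
    then show False using xy uw by simp
  qed
qed

lemma card_eq_sum_orbits:
  assumes f: "f permutes D" "finite D"
  shows "card D = (\<Sum>C\<in>orbit f ` D. card C)"
proof -
  have U: "\<Union> (orbit f ` D) = D"
    using self_in_orbit[OF f] orbit_subset_carrier[OF f(1)] by blast
  have "card (\<Union> (orbit f ` D)) = (\<Sum>C\<in>orbit f ` D. card C)"
  proof (rule card_Union_disjoint)
    show "pairwise disjnt (orbit f ` D)"
      unfolding pairwise_def disjnt_def using orbit_eq_if_mem[OF f] by blast
    show "\<And>A. A \<in> orbit f ` D \<Longrightarrow> finite A"
      using f(2) orbit_subset_carrier[OF f(1)] finite_subset by blast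
  qed
  then show ?thesis using U by simp
qed

lemma sum_strict_mono2_aux:
  fixes f g :: "'b \<Rightarrow> nat"
  assumes "finite A" "x \<in> A" "\<And>i. i \<in> A \<Longrightarrow> f i \<le> g i" "f x < g x"
  shows "sum f A < sum g A"
  using assms by (meson sum_strict_mono_ex1)

lemma face_count:
  assumes P: "pmap k D s a lab V E" and S: "simple_map D a lab" and C: "\<forall>x\<in>D. a x \<noteq> x"
    and deg: "\<And>v. v \<in> V \<Longrightarrow> \<exists>u w. (v, u) \<in> E \<and> (v, w) \<in> E \<and> u \<noteq> w"
  shows "3 * ncyc D (s \<circ> a) \<le> card D"
    and "d \<in> D \<Longrightarrow> 4 \<le> card (orbit (s \<circ> a) d) \<Longrightarrow> 3 * ncyc D (s \<circ> a) + 1 \<le> card D"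
proof -
  note M = pmapD[OF P]
  let ?f = "s \<circ> a"
  have fin: "finite (orbit ?f x)" if "x \<in> D" for x
    using M(1) orbit_subset_carrier[OF M(9) that] finite_subset by blast
  have three: "3 \<le> card (orbit ?f x)" if x: "x \<in> D" for x
  proof -
    note t = face_three_distinct[OF P S C deg x]
    note t2 = face_three_distinct[OF P S C deg t(3)]
    have "x \<noteq> ?f x" "x \<noteq> ?f (?f x)" "?f x \<noteq> ?f (?f x)" using t(1,2) t2(1) by metis+
    then have "card {x, ?f x, ?f (?f x)} = 3" by simp
    moreover have "{x, ?f x, ?f (?f x)} \<subseteq> orbit ?f x"
      using self_in_orbit[OF M(9,1), of x] orbit.base[of ?f x] orbit.step[OF orbit.base[of ?f x]] by blast
    ultimately show ?thesis using fin[OF x] by (metis card_mono)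
  qed
  have sum: "card D = (\<Sum>C\<in>orbit ?f ` D. card C)" using card_eq_sum_orbits[OF M(9,1)] .
  have "(\<Sum>C\<in>orbit ?f ` D. 3) \<le> (\<Sum>C\<in>orbit ?f ` D. card C)"
    by (rule sum_mono) (use three in auto)
  then show "3 * ncyc D ?f \<le> card D" unfolding sum by (simp add: ncyc_def)
  assume d: "d \<in> D" "4 \<le> card (orbit ?f d)"
  have "(\<Sum>C\<in>orbit ?f ` D. 3) < (\<Sum>C\<in>orbit ?f ` D. card C)"
  proof (rule sum_strict_mono2_aux)
    show "finite (orbit ?f ` D)" using M(1) by simp
    show "orbit ?f d \<in> orbit ?f ` D" using d by blast
    show "\<And>C. C \<in> orbit ?f ` D \<Longrightarrow> 3 \<le> card C" using three by auto
    show "3 < card (orbit ?f d)" using d by simp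
  qed
  then show "3 * ncyc D ?f + 1 \<le> card D" unfolding sum by (simp add: ncyc_def)
qed

lemma pmap_normal_form:
  assumes P: "pmap 4 D s a lab V E" and Q: "d \<in> D" "L \<subseteq> lab ` orbit (s \<circ> a) d"
    and deg: "\<And>v. v \<in> V \<Longrightarrow> \<exists>u w. (v, u) \<in> E \<and> (v, w) \<in> E \<and> u \<noteq> w"
  shows "\<exists>D' s' a'. pmap 4 D' s' a' lab V E \<and> simple_map D' a' lab \<and> (\<forall>x\<in>D'. a' x \<noteq> x) \<and>
    ((\<exists>d\<in>D'. L \<subseteq> lab ` orbit (s' \<circ> a') d) \<or> pmap 8 D' s' a' lab V E)"
proof -
  obtain a' where a': "simple_map D a' lab" "pmap 4 D s a' lab V E"
    "(\<exists>d\<in>D. L \<subseteq> lab ` orbit (s \<circ> a') d) \<or> pmap 8 D s a' lab V E"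
    using pmap_simplify[OF P, of L] Q by blast
  have "\<exists>w. (v, w) \<in> E" if "v \<in> V" for v using deg[OF that] by blast
  then show ?thesis using pmap_clean[OF a'(2) _ a'(1,3)] by blast
qed

text \<open>With everything else contracted, \<open>K\<close> carries 20 darts. The Euler bound
  demands at least 7 faces, while faces of length at least 3 leave room for only 6.\<close>

lemma no_K5:
  assumes P: "pmap 4 D s a lab V E" and c: "conn V E"
    and K: "K \<subseteq> V" "card K = 5" "K \<times> K - Id \<subseteq> E"
  shows False
proof -
  have Kne: "K \<noteq> {}" using K(2) by auto
  obtain s1 a1 l1 E1 where I: "pmap 4 D s1 a1 l1 K E1" "E \<inter> K \<times> K \<subseteq> E1"
    using pmap_contract_to[OF P c K(1) Kne] by blast
  have E1: "E1 = K \<times> K - Id" using I(2) K(3) pmap_graph[OF I(1)] by auto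
  have finK: "finite K" using K(2) card.infinite by fastforce
  have deg: "\<exists>u w. (v, u) \<in> E1 \<and> (v, w) \<in> E1 \<and> u \<noteq> w" if v: "v \<in> K" for v
  proof -
    have "card (K - {v}) = 4" using v K(2) finK by simp
    then obtain u w where "u \<in> K - {v}" "w \<in> K - {v}" "u \<noteq> w"
      by (metis card_le_Suc0_iff_eq finK finite_Diff numeral_eq_Suc One_nat_def Suc_le_mono le_0_eq nat.simps(3) pred_numeral_simps(2) not_less_eq_eq)
    then show ?thesis using v E1 by blast
  qed
  obtain d where d: "d \<in> D" using Kne pmapD(5)[OF I(1)] by blast
  obtain D' s' a' where N: "pmap 4 D' s' a' l1 K E1" "simple_map D' a' l1" "\<forall>x\<in>D'. a' x \<noteq> x"
    using pmap_normal_form[OF I(1) d _ deg, of "{}"] by blast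
  have "card E1 = 20"
  proof -
    have "K \<times> K = E1 \<union> Id_on K" "E1 \<inter> Id_on K = {}" unfolding E1 by auto
    then have "card (K \<times> K) = card E1 + card (Id_on K)"
      using finK by (metis card_Un_disjoint finite_SigmaI finite_Un)
    moreover have "Id_on K = (\<lambda>x. (x, x)) ` K" by auto
    then have "card (Id_on K) = card K" by (simp add: card_image inj_on_def)
    ultimately show ?thesis using K(2) by (simp add: card_cartesian_product)
  qed
  then have "card D' = 20" using card_clean_simple[OF N] by simp
  moreover have "card D' + 4 \<le> 10 + 2 * ncyc D' (s' \<circ> a')"
    using pmapD(8)[OF N(1)] card_clean_simple(2)[OF N] K(2) by simp
  moreover have "3 * ncyc D' (s' \<circ> a') \<le> card D'" using face_count(1)[OF N deg] .
  ultimately show False by linarith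
qed

text \<open>Contraction to \<open>K\<close> leaves 12 darts. If \<open>K\<close> still lies on one
  face, the Euler bound asks for 4 faces, but a face of length at least 4 leaves room for only 3. If
  simplification destroyed that face, the bound \<open>8\<close> asks for 6 faces where at most 4
  fit.\<close>

lemma no_K4_in_face:
  assumes P: "pmap 4 D s a lab V E" and c: "conn V E"
    and K: "K \<subseteq> V" "card K = 4" "K \<times> K - Id \<subseteq> E"
    and d: "d \<in> D" "K \<subseteq> lab ` orbit (s \<circ> a) d"
  shows False
proof -
  note M = pmapD[OF P]
  have Kne: "K \<noteq> {}" using K(2) by auto
  obtain s1 a1 l1 E1 where I: "pmap 4 D s1 a1 l1 K E1" "s1 \<circ> a1 = s \<circ> a"
     "\<forall>d\<in>D. lab d \<in> K \<longrightarrow> l1 d = lab d" "E \<inter> K \<times> K \<subseteq> E1"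
    using pmap_contract_to[OF P c K(1) Kne] by blast
  have E1: "E1 = K \<times> K - Id" using I(4) K(3) pmap_graph[OF I(1)] by auto
  have finK: "finite K" using K(2) card.infinite by fastforce
  have deg: "\<exists>u w. (v, u) \<in> E1 \<and> (v, w) \<in> E1 \<and> u \<noteq> w" if v: "v \<in> K" for v
  proof -
    have "card (K - {v}) = 3" using v K(2) finK by simp
    then obtain u w where "u \<in> K - {v}" "w \<in> K - {v}" "u \<noteq> w"
      by (metis card_le_Suc0_iff_eq finK finite_Diff numeral_eq_Suc One_nat_def Suc_le_mono le_0_eq nat.simps(3) pred_numeral_simps(3) not_less_eq_eq)
    then show ?thesis using v E1 by blast
  qed
  have "K \<subseteq> l1 ` orbit (s1 \<circ> a1) d"
  proof
    fix v assume v: "v \<in> K"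
    then obtain x where x: "x \<in> orbit (s \<circ> a) d" "lab x = v" using d(2) by auto
    then have "x \<in> D" using orbit_subset_carrier[OF M(9) d(1)] by blast
    then have "l1 x = v" using I(3) x v by auto
    then show "v \<in> l1 ` orbit (s1 \<circ> a1) d" using x I(2) by auto
  qed
  then obtain D' s' a' where N: "pmap 4 D' s' a' l1 K E1" "simple_map D' a' l1" "\<forall>x\<in>D'. a' x \<noteq> x"
    and Q: "(\<exists>d\<in>D'. K \<subseteq> l1 ` orbit (s' \<circ> a') d) \<or> pmap 8 D' s' a' l1 K E1"
    using pmap_normal_form[OF I(1) d(1) _ deg, of K] by blast
  have "card E1 = 12"
  proof -
    have "K \<times> K = E1 \<union> Id_on K" "E1 \<inter> Id_on K = {}" unfolding E1 by auto
    then have "card (K \<times> K) = card E1 + card (Id_on K)"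
      using finK by (metis card_Un_disjoint finite_SigmaI finite_Un)
    moreover have "Id_on K = (\<lambda>x. (x, x)) ` K" by auto
    then have "card (Id_on K) = card K" by (simp add: card_image inj_on_def)
    ultimately show ?thesis using K(2) by (simp add: card_cartesian_product)
  qed
  then have D12: "card D' = 12" using card_clean_simple[OF N] by simp
  show False using Q
  proof
    assume "\<exists>d\<in>D'. K \<subseteq> l1 ` orbit (s' \<circ> a') d"
    then obtain e where e: "e \<in> D'" "K \<subseteq> l1 ` orbit (s' \<circ> a') e" by blast
    have "finite (orbit (s' \<circ> a') e)"
      using orbit_subset_carrier[OF pmapD(9)[OF N(1)] e(1)] pmapD(1)[OF N(1)] finite_subset by blast
    then have "card K \<le> card (orbit (s' \<circ> a') e)"
      using e(2) by (meson card_image_le card_mono finite_imageI le_trans)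
    then have "3 * ncyc D' (s' \<circ> a') + 1 \<le> card D'" using face_count(2)[OF N deg e(1)] K(2) by simp
    moreover have "card D' + 4 \<le> 8 + 2 * ncyc D' (s' \<circ> a')"
      using pmapD(8)[OF N(1)] card_clean_simple(2)[OF N] K(2) by simp
    ultimately show False using D12 by linarith
  next
    assume "pmap 8 D' s' a' l1 K E1"
    then have "card D' + 8 \<le> 8 + 2 * ncyc D' (s' \<circ> a')"
      using pmapD(8) card_clean_simple(2)[OF N] K(2) by fastforce
    moreover have "3 * ncyc D' (s' \<circ> a') \<le> card D'" using face_count(1)[OF N deg] .
    ultimately show False using D12 by linarith
  qed
qed

text \<open>One fixed infinite type serves all maps, since \<open>planar_conn\<close> cannot
  quantify over types. Its elements are grid points with a direction.\<close>

type_synonym dart = "(int \<times> int) \<times> nat"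

definition planar_conn :: "'v set \<Rightarrow> ('v \<times> 'v) set \<Rightarrow> bool" where
  "planar_conn V E \<longleftrightarrow> conn V E \<and> (\<exists>(D :: dart set) s a lab. pmap 4 D s a lab V E)"

text \<open>Two vertices on a common face can be joined by a chord, hence are adjacent by
  maximality. Four different labels in succession on a face would thus be a \<open>K4\<close> on
  that face.\<close>

lemma triangulated_if_maximal:
  assumes T: "planar_conn V E" and max: "\<And>E'. planar_conn V E' \<Longrightarrow> E \<subseteq> E' \<Longrightarrow> E' = E"
    and deg: "\<And>v. v \<in> V \<Longrightarrow> \<exists>u w. (v, u) \<in> E \<and> (v, w) \<in> E \<and> u \<noteq> w" and ne: "V \<noteq> {}"
  shows "\<exists>(D :: dart set) s a lab. pmap 4 D s a lab V E \<and> simple_map D a lab \<and> (\<forall>x\<in>D. a x \<noteq> x) \<and>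
    (\<forall>d\<in>D. s (a (s (a (s (a d))))) = d)"
proof -
  have c: "conn V E" using T by (simp add: planar_conn_def)
  obtain D0 :: "dart set" and s0 a0 lab where P0: "pmap 4 D0 s0 a0 lab V E"
    using T unfolding planar_conn_def by blast
  obtain d0 where d0: "d0 \<in> D0" using ne pmapD(5)[OF P0] by blast
  obtain D :: "dart set" and s a where P: "pmap 4 D s a lab V E" and S: "simple_map D a lab" and C: "\<forall>x\<in>D. a x \<noteq> x"
    using pmap_normal_form[OF P0 d0 _ deg, of "{}"] by blast
  note M = pmapD[OF P]
  define f where "f = s \<circ> a"
  have st: "lab d \<noteq> lab (f d)" "lab d \<noteq> lab (f (f d))" "f d \<in> D" "lab (f d) = lab (a d)"
    if "d \<in> D" for d
    using face_three_distinct[OF P S C deg that] unfolding f_def by simp_all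
  have inf: "infinite (UNIV :: dart set)" by (simp add: finite_prod)
  have chord: "(lab x, lab y) \<in> E" if xy: "x \<in> D" "y \<in> D" "y \<in> orbit f x" "lab x \<noteq> lab y" for x y
  proof -
    let ?E = "E \<union> {(lab x, lab y), (lab y, lab x)}"
    obtain D' :: "dart set" and s' a' l' where "pmap 4 D' s' a' l' V ?E"
      using pmap_add_chord[OF P inf xy[unfolded f_def]] by blast
    then have "planar_conn V ?E" using conn_mono[OF c, of ?E] unfolding planar_conn_def by blast
    then have "?E = E" using max by blast
    then show ?thesis by blast
  qed
  have "f (f (f d)) = d" if d: "d \<in> D" for d
  proof (rule ccontr)
    assume ne3: "f (f (f d)) \<noteq> d"
    have key: False if x: "x \<in> D" and n: "lab (f (f (f x))) \<noteq> lab x" for x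
    proof -
      define x1 x2 x3 where "x1 = f x" and "x2 = f x1" and "x3 = f x2"
      have D: "x1 \<in> D" "x2 \<in> D" "x3 \<in> D" using st(3) x unfolding x1_def x2_def x3_def by blast+
      have o0: "x \<in> orbit f x" using self_in_orbit[OF M(9,1), of x] by (simp only: f_def)
      have o1: "x1 \<in> orbit f x" using orbit.base[of f x] by (simp only: x1_def)
      have o2: "x2 \<in> orbit f x" using orbit.step[OF o1] by (simp only: x2_def)
      have o3: "x3 \<in> orbit f x" using orbit.step[OF o2] by (simp only: x3_def)
      note o = o0 o1 o2 o3
      let ?K = "{lab x, lab x1, lab x2, lab x3}"
      have ds: "lab x \<noteq> lab x1" "lab x1 \<noteq> lab x2" "lab x2 \<noteq> lab x3" "lab x \<noteq> lab x2" "lab x1 \<noteq> lab x3" "lab x3 \<noteq> lab x"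
        using st(1,2) x D n unfolding x1_def x2_def x3_def by metis+
      have op: "z \<in> orbit f y" if "y \<in> orbit f x" "z \<in> orbit f x" for y z
        using that orbit_eq_if_mem[OF M(9,1), folded f_def] by blast
      have E: "(lab y, lab z) \<in> E" if "y \<in> {x, x1, x2, x3}" "z \<in> {x, x1, x2, x3}" "lab y \<noteq> lab z" for y z
        using that chord[of y z] op[of y z] o D x by blast
      have "?K \<times> ?K - Id \<subseteq> E" using E by blast
      moreover have "card ?K = 4" using ds by simp
      moreover have "?K \<subseteq> lab ` orbit f x" using o by blast
      moreover have "?K \<subseteq> V" using M(5) D x by blast
      ultimately show False using no_K4_in_face[OF P c, of ?K x] x unfolding f_def by blast
    qed
    have D: "f d \<in> D" "f (f d) \<in> D" "f (f (f d)) \<in> D" using st(3) d by blast+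
    \<comment> \<open>Three steps lead back to the label of \<open>d\<close>, and likewise from
      \<open>f d\<close>. Since a dart of a simple map is determined by its two labels, they lead
      back to \<open>d\<close> itself.\<close>
    have l3: "lab (f (f (f d))) = lab d" using key[OF d] by blast
    have l4: "lab (f (f (f (f d)))) = lab (f d)" using key[OF D(1)] by blast
    have "lab (a (f (f (f d)))) = lab (a d)" using l4 st(4)[OF D(3)] st(4)[OF d] by simp
    then have "f (f (f d)) = d" using l3 S C D d unfolding simple_map_def by metis
    then show False using ne3 by simp
  qed
  then have "\<forall>d\<in>D. s (a (s (a (s (a d))))) = d" by (simp add: f_def)
  then show ?thesis using P S C
    by (intro exI[of _ D] exI[of _ s] exI[of _ a] exI[of _ lab] conjI)
qed

text \<open>A dart of a simple map is determined by the labels of its ends, so the rotation of darts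
  descends to neighbours: \<open>nx v u\<close> is the third corner of one of the two faces at the
  edge. The bound on \<open>card E\<close>, which counts every edge twice, combines the Euler
  inequality with at least three darts per face.\<close>

lemma rotation_exists:
  assumes T: "planar_conn V E" and max: "\<And>E'. planar_conn V E' \<Longrightarrow> E \<subseteq> E' \<Longrightarrow> E' = E"
    and deg: "\<And>v. v \<in> V \<Longrightarrow> \<exists>u w. (v, u) \<in> E \<and> (v, w) \<in> E \<and> u \<noteq> w" and ne: "V \<noteq> {}"
  shows "\<exists>nx :: 'v \<Rightarrow> 'v \<Rightarrow> 'v.
    (\<forall>u v w. (v, u) \<in> E \<longrightarrow> w = nx v u \<longrightarrow>
       (v, w) \<in> E \<and> (u, w) \<in> E \<and> nx w v = u \<and> nx u w = v) \<and>
    (\<forall>v p q. (v, p) \<in> E \<longrightarrow> (v, q) \<in> E \<longrightarrow> (\<exists>k. (nx v ^^ k) p = q)) \<and>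
    card E + 12 \<le> 6 * card V"
proof -
  obtain D :: "dart set" and s a lab where P: "pmap 4 D s a lab V E" and S: "simple_map D a lab"
    and C: "\<forall>x\<in>D. a x \<noteq> x" and tri: "\<forall>d\<in>D. s (a (s (a (s (a d))))) = d"
    using triangulated_if_maximal[OF assms] by blast
  note M = pmapD[OF P]
  have aD: "a x \<in> D" if "x \<in> D" for x using that M(3) by (simp add: permutes_in_image)
  have sD: "s x \<in> D" "lab (s x) = lab x" if "x \<in> D" for x
  proof -
    show "s x \<in> D" using that M(2) by (simp add: permutes_in_image)
    then show "lab (s x) = lab x" using M(6)[OF that, of "s x"] orbit.base[of s x] by simp
  qed
  define dt where "dt = (\<lambda>v u. THE d. d \<in> D \<and> lab d = v \<and> lab (a d) = u)"
  have dt_eq: "dt (lab d) (lab (a d)) = d" if "d \<in> D" for d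
    unfolding dt_def
  proof (rule the_equality)
    show "d \<in> D \<and> lab d = lab d \<and> lab (a d) = lab (a d)" using that by simp
    show "e = d" if "e \<in> D \<and> lab e = lab d \<and> lab (a e) = lab (a d)" for e
      using S C that \<open>d \<in> D\<close> unfolding simple_map_def by blast
  qed
  have dt: "dt v u \<in> D \<and> lab (dt v u) = v \<and> lab (a (dt v u)) = u" if vu: "(v, u) \<in> E" for v u
  proof -
    obtain d where "d \<in> D" "lab d = v" "lab (a d) = u" using vu unfolding M(7) by auto
    then show ?thesis using dt_eq[of d] by simp
  qed
  define nx where "nx = (\<lambda>v u. lab (a (s (dt v u))))"
  have step: "s (dt v u) = dt v (nx v u)" if vu: "(v, u) \<in> E" for v u
    using dt_eq[of "s (dt v u)"] dt[OF vu] sD unfolding nx_def by simp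
  have inE: "(lab d, lab (a d)) \<in> E" if "d \<in> D" for d
    unfolding M(7) using that S C unfolding simple_map_def by auto
  have adt: "a (dt v u) = dt u v" if vu: "(v, u) \<in> E" for v u
    using dt_eq[of "a (dt v u)"] dt[OF vu] aD M(4) by simp
  have nxE: "(v, nx v u) \<in> E" if vu: "(v, u) \<in> E" for v u
    using inE[of "s (dt v u)"] dt[OF vu] sD unfolding nx_def by simp
  have sym: "(v, u) \<in> E" if "(u, v) \<in> E" for u v using pmap_graph(3)[OF P that] .
  have face: "(v, w) \<in> E \<and> (u, w) \<in> E \<and> nx w v = u \<and> nx u w = v"
    if vu: "(v, u) \<in> E" and w: "w = nx v u" for u v w
  proof -
    have phi: "s (a (dt u' v')) = dt v' (nx v' u')" if "(u', v') \<in> E" for u' v'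
      using adt[OF that] step[OF sym[OF that]] by simp
    have vw: "(v, w) \<in> E" using nxE[OF vu] w by simp
    have 1: "s (a (dt u v)) = dt v w" using phi[OF sym[OF vu]] w by simp
    define y where "y = nx w v"
    have 2: "s (a (dt v w)) = dt w y" using phi[OF vw] y_def by simp
    have wy: "(w, y) \<in> E" using nxE[OF sym[OF vw]] y_def by simp
    have 3: "s (a (dt w y)) = dt y (nx y w)" using phi[OF wy] .
    have yy: "(y, nx y w) \<in> E" using nxE[OF sym[OF wy]] .
    have "dt y (nx y w) = dt u v" using tri dt[OF sym[OF vu]] 1 2 3 by metis
    then have "y = u" "nx y w = v" using dt[OF yy] dt[OF sym[OF vu]] by metis+
    then show ?thesis using vw wy sym y_def by metis
  qed
  have ring: "\<exists>k. (nx v ^^ k) p = q" if vp: "(v, p) \<in> E" and vq: "(v, q) \<in> E" for v p q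
  proof -
    have "dt v q \<in> orbit s (dt v p)" using M(6)[of "dt v p" "dt v q"] dt[OF vp] dt[OF vq] by simp
    then obtain k where k: "dt v q = (s ^^ k) (dt v p)" by (auto simp: orbit_altdef)
    have "(s ^^ k) (dt v p) = dt v ((nx v ^^ k) p) \<and> (v, (nx v ^^ k) p) \<in> E" for k
      by (induction k) (use vp step nxE in auto)
    then have "dt v q = dt v ((nx v ^^ k) p)" "(v, (nx v ^^ k) p) \<in> E" using k by auto
    then show ?thesis using dt[OF vq] dt by metis
  qed
  have "card D = card E" "{x\<in>D. a x \<noteq> x} = D" using card_clean_simple[OF P S C] by auto
  moreover have "3 * ncyc D (s \<circ> a) \<le> card D" using face_count(1)[OF P S C deg] .
  ultimately have "card E + 12 \<le> 6 * card V" using M(8) by simp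
  then show ?thesis using face ring by (intro exI[of _ nx]) blast
qed

lemma pmap_relabel:
  assumes P: "pmap k D s a lab V E" and inj: "inj_on f V"
  shows "pmap k D s a (f \<circ> lab) (f ` V) (map_prod f f ` E)"
proof -
  note M = pmapD[OF P]
  have aD: "a x \<in> D" if "x \<in> D" for x using that M(3) by (simp add: permutes_in_image)
  have l: "f (lab x) = f (lab y) \<longleftrightarrow> y \<in> orbit s x" if "x \<in> D" "y \<in> D" for x y
    using M(6)[OF that] inj that M(5) by (auto simp: inj_on_eq_iff)
  have "(lab x, lab (a x)) \<in> Id \<longleftrightarrow> (f (lab x), f (lab (a x))) \<in> Id" if "x \<in> D" for x
    using inj aD[OF that] that M(5) by (auto simp: inj_on_eq_iff)
  then have "map_prod f f ` E = (\<lambda>x. (f (lab x), f (lab (a x)))) ` D - Id"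
    unfolding M(7) by (auto simp: image_iff)
  moreover have "card (f ` V) = card V" using inj by (rule card_image)
  ultimately show ?thesis using M l unfolding pmap_def by (auto simp: image_image)
qed

lemma rtrancl_map_fibre:
  assumes "(u, v) \<in> (E \<inter> {(p, q). h p = h q})\<^sup>*" "\<And>p. h (f p) = h p"
  shows "(f u, f v) \<in> ((map_prod f f ` E - Id) \<inter> {(p, q). h p = h q})\<^sup>*"
  using assms(1)
proof (induction rule: rtrancl_induct)
  case (step y z)
  show ?case
  proof (cases "f y = f z")
    case False
    have "map_prod f f (y, z) \<in> map_prod f f ` E" using step(2) by blast
    then have "(f y, f z) \<in> (map_prod f f ` E - Id) \<inter> {(p, q). h p = h q}"
      using False step(2) assms(2) by simp
    then show ?thesis using step(3) by (rule rtrancl.rtrancl_into_rtrancl[rotated])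
  qed (use step in simp)
qed auto

text \<open>Each fibre of \<open>h\<close> is connected by its own edges, so edges inside fibres can
  be contracted one at a time until \<open>h\<close> is injective.\<close>

lemma pmap_quotient:
  assumes "pmap k D s a lab V E"
    and "\<And>u v. u \<in> V \<Longrightarrow> v \<in> V \<Longrightarrow> h u = h v \<Longrightarrow> (u, v) \<in> (E \<inter> {(p, q). h p = h q})\<^sup>*"
  shows "\<exists>s' a' lab'. pmap k D s' a' lab' (h ` V) (map_prod h h ` E - Id)"
  using assms
proof (induction "card V" arbitrary: V E s a lab rule: less_induct)
  case less
  note P = less.prems(1) and G = pmap_graph[OF less.prems(1)]
  show ?case
  proof (cases "inj_on h V")
    case True
    have "map_prod h h ` E - Id = map_prod h h ` E"
      using True G(2,4) by (auto simp: inj_on_eq_iff)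
    then show ?thesis using pmap_relabel[OF P True] by metis
  next
    case False
    then obtain u v where uv: "u \<in> V" "v \<in> V" "u \<noteq> v" "h u = h v" by (auto simp: inj_on_def)
    then have "(u, v) \<in> (E \<inter> {(p, q). h p = h q})\<^sup>*" using less.prems(2) by blast
    then obtain w where w: "(u, w) \<in> E" "h u = h w" using uv(3)
      by (metis (mono_tags, lifting) IntE case_prodD converse_rtranclE mem_Collect_eq)
    define f where "f = (\<lambda>p. if p = u then w else p)"
    have hf: "h (f p) = h p" for p using w by (simp add: f_def)
    obtain s' a' where P': "pmap k D s' a' (f \<circ> lab) (V - {u}) (map_prod f f ` E - Id)"
      using pmap_contract[OF P w(1)] unfolding f_def by blast
    have lt: "card (V - {u}) < card V" using card_Diff1_less[OF G(1) uv(1)] .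
    have fib: "(p, q) \<in> ((map_prod f f ` E - Id) \<inter> {(p, q). h p = h q})\<^sup>*"
      if "p \<in> V - {u}" "q \<in> V - {u}" "h p = h q" for p q
    proof -
      have "(p, q) \<in> (E \<inter> {(p, q). h p = h q})\<^sup>*" using less.prems(2) that by blast
      from rtrancl_map_fibre[OF this, of f, OF hf] show ?thesis using that by (simp add: f_def)
    qed
    have "w \<in> V - {u}" using w G(2,4) by blast
    then have "h ` (V - {u}) = h ` V" using w uv by (auto simp: image_iff)
    moreover have "map_prod h h ` (map_prod f f ` E - Id) - Id = map_prod h h ` E - Id"
    proof -
      have "map_prod h h ` (X - Id) - Id = map_prod h h ` X - Id" for X by auto
      moreover have "map_prod h h ` map_prod f f ` E = map_prod h h ` E"
        by (simp add: image_image hf map_prod_def split_beta)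
      ultimately show ?thesis by metis
    qed
    ultimately show ?thesis using less.hyps[OF lt P' fib] by metis
  qed
qed

section \<open>Square grids\<close>

definition grid_sq :: "nat \<Rightarrow> (int \<times> int) set" where
  "grid_sq N = {-int N..int N} \<times> {-int N..int N}"

text \<open>The directions run counterclockwise: adding 1 modulo 4 turns left, adding 2
  reverses.\<close>

definition grid_step :: "(int \<times> int) \<Rightarrow> nat \<Rightarrow> int \<times> int" where
  "grid_step p k = (if k = 0 then (fst p + 1, snd p) else if k = 1 then (fst p, snd p + 1)
     else if k = 2 then (fst p - 1, snd p) else (fst p, snd p - 1))"

definition grid_edges :: "nat \<Rightarrow> ((int \<times> int) \<times> (int \<times> int)) set" where
  "grid_edges N = {(p, q). p \<in> grid_sq N \<and> q \<in> grid_sq N \<and> (\<exists>k<4. q = grid_step p k)}"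

lemma nat_less_4: "(k::nat) < 4 \<longleftrightarrow> k = 0 \<or> k = 1 \<or> k = 2 \<or> k = 3" by auto

text \<open>With \<open>n = 2 * N\<close> there are at most \<open>4 * n * (n + 1)\<close> darts on
  edges, \<open>(n + 1) * (n + 1)\<close> vertices and at least \<open>n * n + 1\<close> faces,
  which is exactly what the sphere requires. Darts pointing out of the square are left
  dangling.\<close>

lemma grid_pmap:
  "\<exists>(D :: dart set) s a lab. pmap 4 D s a lab (grid_sq N) (grid_edges N)"
proof -
  define D :: "dart set" where "D = grid_sq N \<times> {..<4}"
  define s :: "dart \<Rightarrow> dart" where
    "s = (\<lambda>(p, k). if (p, k) \<in> D then (p, (k + 1) mod 4) else (p, k))"
  define a :: "dart \<Rightarrow> dart" where
    "a = (\<lambda>(p, k). if (p, k) \<in> D \<and> grid_step p k \<in> grid_sq N then (grid_step p k, (k + 2) mod 4) else (p, k))"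
  have fin: "finite D" by (simp add: D_def grid_sq_def)
  have bk: "grid_step (grid_step p k) ((k + 2) mod 4) = p" if "k < 4" for p k
    using that by (auto simp: nat_less_4 grid_step_def)
  have aa: "a (a x) = x" for x
  proof -
    obtain p k where x: "x = (p, k)" by fastforce
    have a1: "a (q, j) = (grid_step q j, (j + 2) mod 4)" if "q \<in> grid_sq N" "j < 4" "grid_step q j \<in> grid_sq N" for q j
      using that by (simp add: a_def D_def)
    show ?thesis
    proof (cases "p \<in> grid_sq N \<and> k < 4 \<and> grid_step p k \<in> grid_sq N")
      case True
      have "((k + 2) mod 4 + 2) mod 4 = k" using True by (auto simp: nat_less_4)
      then show ?thesis
        using True a1[of p k] a1[of "grid_step p k" "(k + 2) mod 4"] bk[of k p] by (simp add: x)
    next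
      case False
      then have "a x = x" by (auto simp: x a_def D_def)
      then show ?thesis by simp
    qed
  qed
  have aD: "a x \<in> D \<longleftrightarrow> x \<in> D" for x unfolding a_def D_def by (auto split: prod.splits)
  have ap: "a permutes D"
  proof (rule bij_imp_permutes)
    show "bij_betw a D D" by (rule bij_betw_byWitness[of D a a D]) (use aa aD in auto)
    show "\<And>x. x \<notin> D \<Longrightarrow> a x = x" by (auto simp: a_def)
  qed
  have s4: "s (s (s (s x))) = x" for x
  proof -
    obtain p k where x: "x = (p, k)" by fastforce
    have s1: "s (p, j) = (p, (j + 1) mod 4)" if "p \<in> grid_sq N" "j < 4" for j
      using that by (simp add: s_def D_def)
    show ?thesis
    proof (cases "p \<in> grid_sq N \<and> k < 4")
      case True
      then have "k < 4" by simp
      then have "((((k + 1) mod 4 + 1) mod 4 + 1) mod 4 + 1) mod 4 = k" by presburger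
      then show ?thesis using True s1 unfolding x by (metis mod_less_divisor zero_less_numeral)
    next
      case False
      then have "s x = x" by (auto simp: x s_def D_def)
      then show ?thesis by simp
    qed
  qed
  have sD: "s x \<in> D \<longleftrightarrow> x \<in> D" for x unfolding s_def D_def by (auto split: prod.splits)
  have sp: "s permutes D"
  proof (rule bij_imp_permutes)
    show "bij_betw s D D" by (rule bij_betw_byWitness[of D "s \<circ> s \<circ> s" s D]) (simp_all add: s4 sD image_subset_iff)
    show "\<And>x. x \<notin> D \<Longrightarrow> s x = x" by (auto simp: s_def)
  qed
  have lab: "fst x = fst y \<longleftrightarrow> y \<in> orbit s x" if xy: "x \<in> D" "y \<in> D" for x y
  proof
    assume "fst x = fst y"
    then obtain p k j where e: "x = (p, k)" "y = (p, j)" "k < 4" "j < 4" "p \<in> grid_sq N"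
      using xy by (cases x; cases y) (auto simp: D_def)
    have "y \<in> {s x, s (s x), s (s (s x)), s (s (s (s x)))}"
      using e by (auto simp: s_def D_def nat_less_4)
    moreover have "s x \<in> orbit s x" "s (s x) \<in> orbit s x" "s (s (s x)) \<in> orbit s x" "s (s (s (s x))) \<in> orbit s x"
      by (simp_all add: orbit.base orbit.step)
    ultimately show "y \<in> orbit s x" by blast
  next
    assume "y \<in> orbit s x"
    moreover have "orbit s x \<subseteq> {z. fst z = fst x}"
      by (rule orbit_least) (auto simp: s_def)
    ultimately show "fst x = fst y" by auto
  qed
  have V: "grid_sq N = fst ` D" by (simp add: D_def lessThan_empty_iff)
  have E: "grid_edges N = (\<lambda>x. (fst x, fst (a x))) ` D - Id"
  proof
    show "grid_edges N \<subseteq> (\<lambda>x. (fst x, fst (a x))) ` D - Id"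
    proof
      fix e assume "e \<in> grid_edges N"
      then obtain p k where e: "e = (p, grid_step p k)" "p \<in> grid_sq N" "grid_step p k \<in> grid_sq N" "k < 4"
        by (auto simp: grid_edges_def)
      then have pk: "e = (\<lambda>x. (fst x, fst (a x))) (p, k)" "(p, k) \<in> D" by (auto simp: a_def D_def)
      have "p \<noteq> grid_step p k" by (cases p) (auto simp: grid_step_def)
      then have "e \<notin> Id" using e(1) by simp
      moreover have "e \<in> (\<lambda>x. (fst x, fst (a x))) ` D" using pk by (rule image_eqI)
      ultimately show "e \<in> (\<lambda>x. (fst x, fst (a x))) ` D - Id" by simp
    qed
    show "(\<lambda>x. (fst x, fst (a x))) ` D - Id \<subseteq> grid_edges N"
    proof
      fix e assume "e \<in> (\<lambda>x. (fst x, fst (a x))) ` D - Id"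
      then obtain x where x: "x \<in> D" "e = (fst x, fst (a x))" "e \<notin> Id" by blast
      obtain p k where "x = (p, k)" by (cases x)
      then have pk: "e = (p, fst (a (p, k)))" "(p, k) \<in> D" "p \<noteq> fst (a (p, k))" using x by simp_all
      then have "grid_step p k \<in> grid_sq N" "a (p, k) = (grid_step p k, (k + 2) mod 4)"
        by (auto simp: a_def split: if_splits)
      then show "e \<in> grid_edges N" using pk unfolding grid_edges_def D_def by auto
    qed
  qed
  have cI: "card {-int N..int N} = 2 * N + 1" "card {-int N..int N - 1} = 2 * N" "card {-int N + 1..int N} = 2 * N"
    unfolding card_atLeastAtMost_int by linarith+
  have card_sq: "card (grid_sq N) = (2 * N + 1) * (2 * N + 1)"
    unfolding grid_sq_def card_cartesian_product cI ..
  have nd: "card {x \<in> D. a x \<noteq> x} \<le> 4 * ((2 * N) * (2 * N + 1))"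
  proof -
    let ?I = "{-int N..int N}"
    let ?S = "({-int N..int N - 1} \<times> ?I) \<times> {0::nat} \<union> (?I \<times> {-int N..int N - 1}) \<times> {1}
      \<union> ({-int N + 1..int N} \<times> ?I) \<times> {2} \<union> (?I \<times> {-int N + 1..int N}) \<times> {3}"
    have "{x \<in> D. a x \<noteq> x} \<subseteq> ?S"
      by (auto simp: a_def D_def grid_sq_def grid_step_def nat_less_4 split: if_splits)
    then have "card {x \<in> D. a x \<noteq> x} \<le> card ?S" by (rule card_mono[rotated]) simp
    also have "\<dots> \<le> card (({-int N..int N - 1} \<times> ?I) \<times> {0::nat}) + card ((?I \<times> {-int N..int N - 1}) \<times> {1::nat})
      + card (({-int N + 1..int N} \<times> ?I) \<times> {2::nat}) + card ((?I \<times> {-int N + 1..int N}) \<times> {3::nat})"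
      by (meson add_le_mono card_Un_le le_trans order_refl)
    also have "\<dots> = 4 * ((2 * N) * (2 * N + 1))"
      unfolding card_cartesian_product cI by simp
    finally show ?thesis .
  qed
  define C where "C = {-int N..int N - 1} \<times> {-int N..int N - 1}"
  \<comment> \<open>The unit cell to the right of the dart, named by its lower left corner.
    Following a face keeps it; cells beyond the square all count as the outer face
    \<open>None\<close>.\<close>
  define cell :: "dart \<Rightarrow> int \<times> int" where
    "cell = (\<lambda>(p, k). if k = 0 then (fst p, snd p - 1) else if k = 1 then p
       else if k = 2 then (fst p - 1, snd p) else (fst p - 1, snd p - 1))"
  define h where "h = (\<lambda>x. if cell x \<in> C then Some (cell x) else None)"
  have inv: "h ((s \<circ> a) x) = h x" if "x \<in> D" for x
  proof -
    obtain p q k where x: "x = ((p, q), k)" by (metis prod.exhaust)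
    have k: "k = 0 \<or> k = 1 \<or> k = 2 \<or> k = 3" and pq: "(p, q) \<in> grid_sq N"
      using that by (auto simp: x D_def nat_less_4)
    have s1: "s (r, j) = (r, (j + 1) mod 4)" if "r \<in> grid_sq N" "j < 4" for r j
      using that by (simp add: s_def D_def)
    show ?thesis
    proof (cases "grid_step (p, q) k \<in> grid_sq N")
      case True
      then have "(s \<circ> a) x = (grid_step (p, q) k, ((k + 2) mod 4 + 1) mod 4)"
        using that s1 by (simp add: x a_def)
      then show ?thesis using k
        by (elim disjE) (simp_all add: x h_def cell_def grid_step_def)
    next
      case False
      then have e: "(s \<circ> a) x = ((p, q), (k + 1) mod 4)"
        using that k pq s1[of "(p, q)" k] by (auto simp: x a_def)
      have "h ((p, q), (k + 1) mod 4) = h ((p, q), k)" using k False pq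
        by (elim disjE) (auto simp: h_def cell_def C_def grid_sq_def grid_step_def)
      then show ?thesis using e x by simp
    qed
  qed
  have "insert None (Some ` C) \<subseteq> h ` D"
  proof -
    have "h ((int N, int N), 1) = None" "((int N, int N), 1) \<in> D"
      by (auto simp: h_def cell_def C_def D_def grid_sq_def)
    moreover have "h (c, 1) = Some c" "(c, 1) \<in> D" if "c \<in> C" for c
      using that by (auto simp: h_def cell_def C_def D_def grid_sq_def)
    ultimately show ?thesis by (metis imageI image_subsetI insert_subset)
  qed
  then have "card (insert None (Some ` C)) \<le> card (h ` D)" using fin by (meson card_mono finite_imageI)
  moreover have "card (insert None (Some ` C)) = (2 * N) * (2 * N) + 1"
  proof -
    have "card C = (2 * N) * (2 * N)" unfolding C_def card_cartesian_product cI ..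
    moreover have "finite C" by (simp add: C_def)
    ultimately show ?thesis by (simp add: card_image)
  qed
  ultimately have "(2 * N) * (2 * N) + 1 \<le> ncyc D (s \<circ> a)"
    using ncyc_ge_invariant[OF fin, of h "s \<circ> a", OF inv permutes_compose[OF ap sp]] by linarith
  then have chi: "card {x \<in> D. a x \<noteq> x} + 4 \<le> 2 * card (grid_sq N) + 2 * ncyc D (s \<circ> a)"
    using nd unfolding card_sq by (simp add: algebra_simps)
  have "pmap 4 D s a fst (grid_sq N) (grid_edges N)"
    unfolding pmap_def using fin sp ap aa V lab E chi by blast
  then show ?thesis by blast
qed

lemma grid_edges_sym: "(p, q) \<in> grid_edges N \<Longrightarrow> (q, p) \<in> grid_edges N"
proof -
  assume "(p, q) \<in> grid_edges N"
  then obtain k where k: "p \<in> grid_sq N" "q \<in> grid_sq N" "k < 4" "q = grid_step p k"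
    by (auto simp: grid_edges_def)
  have "p = grid_step q ((k + 2) mod 4)" using k by (auto simp: nat_less_4 grid_step_def)
  moreover have "(k + 2) mod 4 < 4" by simp
  ultimately show ?thesis using k(1,2) unfolding grid_edges_def by blast
qed

lemma grid_conn: "conn (grid_sq N) (grid_edges N)"
proof -
  let ?R = "(grid_edges N)\<^sup>*"
  have sym: "(q, p) \<in> ?R" if "(p, q) \<in> ?R" for p q
    using that by (meson grid_edges_sym symD symI sym_rtrancl)
  have x: "((-int N, y), (-int N + int j, y)) \<in> ?R" if "j \<le> 2 * N" "y \<in> {-int N..int N}" for j y
    using that
  proof (induction j)
    case (Suc j)
    have "((-int N + int j, y), (-int N + int (Suc j), y)) \<in> grid_edges N"
      using Suc by (auto simp: grid_edges_def grid_sq_def grid_step_def intro!: exI[of _ 0])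
    then show ?case using Suc by (meson Suc_leD rtrancl.rtrancl_into_rtrancl)
  qed auto
  have y: "((-int N, -int N), (-int N, -int N + int j)) \<in> ?R" if "j \<le> 2 * N" for j
    using that
  proof (induction j)
    case (Suc j)
    have "((-int N, -int N + int j), (-int N, -int N + int (Suc j))) \<in> grid_edges N"
      using Suc by (auto simp: grid_edges_def grid_sq_def grid_step_def intro!: exI[of _ 1])
    then show ?case using Suc by (meson Suc_leD rtrancl.rtrancl_into_rtrancl)
  qed auto
  have base: "((-int N, -int N), p) \<in> ?R" if p: "p \<in> grid_sq N" for p
  proof -
    obtain u v where uv: "p = (u, v)" "u \<in> {-int N..int N}" "v \<in> {-int N..int N}"
      using p by (auto simp: grid_sq_def)
    have "((-int N, v), p) \<in> ?R" using x[of "nat (u + int N)" v] uv by auto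
    moreover have "((-int N, -int N), (-int N, v)) \<in> ?R" using y[of "nat (v + int N)"] uv by auto
    ultimately show ?thesis by (meson rtrancl_trans)
  qed
  show ?thesis unfolding conn_def using base sym by (meson rtrancl_trans)
qed

section \<open>From drawings to grid minors\<close>

text \<open>Closed squares, so that finitely many have a closed union; a point on a common side or
  corner belongs to several of them.\<close>

definition pixel :: "real \<Rightarrow> int \<times> int \<Rightarrow> complex set" where
  "pixel \<delta> p = {z. \<delta> * of_int (fst p) \<le> Re z \<and> Re z \<le> \<delta> * (of_int (fst p) + 1) \<and>
                    \<delta> * of_int (snd p) \<le> Im z \<and> Im z \<le> \<delta> * (of_int (snd p) + 1)}"

definition pixels :: "real \<Rightarrow> complex set \<Rightarrow> (int \<times> int) set" where
  "pixels \<delta> A = {p. pixel \<delta> p \<inter> A \<noteq> {}}"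

definition grid_adj :: "((int \<times> int) \<times> (int \<times> int)) set" where
  "grid_adj = {(p, q). \<exists>k<4. q = grid_step p k}"

lemma grid_adj_iff:
  "((i, j), (i', j')) \<in> grid_adj \<longleftrightarrow> \<bar>i - i'\<bar> + \<bar>j - j'\<bar> = 1"
proof -
  have "((i, j), (i', j')) \<in> grid_adj \<longleftrightarrow>
    (i', j') = (i + 1, j) \<or> (i', j') = (i, j + 1) \<or> (i', j') = (i - 1, j) \<or> (i', j') = (i, j - 1)"
  proof -
    have "(\<exists>k<4. P k) \<longleftrightarrow> P 0 \<or> P 1 \<or> P 2 \<or> P 3" for P :: "nat \<Rightarrow> bool"
      by (auto simp: nat_less_4)
    then show ?thesis by (simp add: grid_adj_def grid_step_def)
  qed
  then show ?thesis unfolding prod.inject by presburger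
qed

lemma grid_adj_sym: "(p, q) \<in> grid_adj \<Longrightarrow> (q, p) \<in> grid_adj"
  by (cases p; cases q) (simp add: grid_adj_iff abs_minus_commute)

lemma closed_pixel: "closed (pixel \<delta> p)"
proof -
  have "pixel \<delta> p = {z. \<delta> * of_int (fst p) \<le> Re z} \<inter> {z. Re z \<le> \<delta> * (of_int (fst p) + 1)} \<inter>
    {z. \<delta> * of_int (snd p) \<le> Im z} \<inter> {z. Im z \<le> \<delta> * (of_int (snd p) + 1)}"
    by (auto simp: pixel_def)
  then show ?thesis
    by (simp add: closed_Int closed_halfspace_Re_ge closed_halfspace_Re_le closed_halfspace_Im_ge closed_halfspace_Im_le)
qed

lemma pixel_dist:
  assumes "z \<in> pixel \<delta> p" "w \<in> pixel \<delta> p"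
  shows "dist z w \<le> 2 * \<delta>"
proof -
  have "\<bar>Re (z - w)\<bar> \<le> \<delta>" "\<bar>Im (z - w)\<bar> \<le> \<delta>"
    using assms by (auto simp: pixel_def algebra_simps)
  then show ?thesis unfolding dist_norm using cmod_le[of "z - w"] by linarith
qed

lemma pixel_cover:
  assumes "\<delta> > 0"
  shows "z \<in> pixel \<delta> (\<lfloor>Re z / \<delta>\<rfloor>, \<lfloor>Im z / \<delta>\<rfloor>)"
proof -
  have "\<delta> * of_int \<lfloor>t / \<delta>\<rfloor> \<le> t \<and> t \<le> \<delta> * (of_int \<lfloor>t / \<delta>\<rfloor> + 1)" for t
    using floor_divide_lower[OF assms, of t] floor_divide_upper[OF assms, of t]
    by (simp add: mult.commute)
  then show ?thesis by (simp add: pixel_def)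
qed

lemma pixel_index_bound:
  fixes t \<delta> :: real
  assumes "\<delta> > 0" "\<delta> * of_int i \<le> t" "t \<le> \<delta> * (of_int i + 1)"
    "\<delta> * of_int i' \<le> t" "t \<le> \<delta> * (of_int i' + 1)"
  shows "\<bar>i - i'\<bar> \<le> (1::int)"
proof -
  have "\<delta> * of_int i \<le> \<delta> * (of_int i' + 1)" "\<delta> * of_int i' \<le> \<delta> * (of_int i + 1)" using assms by linarith+
  then have "(of_int i :: real) \<le> of_int i' + 1" "(of_int i' :: real) \<le> of_int i + 1" using assms(1) by simp_all
  then show ?thesis by linarith
qed

lemma finite_pixels:
  assumes "\<delta> > 0" "bounded A"
  shows "finite (pixels \<delta> A)"
proof -
  obtain B where B: "\<And>z. z \<in> A \<Longrightarrow> cmod z \<le> B" using assms(2) bounded_iff by blast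
  define M where "M = \<lceil>B / \<delta>\<rceil> + 1"
  have "pixels \<delta> A \<subseteq> {-M..M} \<times> {-M..M}"
  proof
    fix p assume "p \<in> pixels \<delta> A"
    then obtain z where z: "z \<in> A" "z \<in> pixel \<delta> p" by (auto simp: pixels_def)
    have b: "\<bar>Re z\<bar> \<le> B" "\<bar>Im z\<bar> \<le> B"
      using B[OF z(1)] abs_Re_le_cmod[of z] abs_Im_le_cmod[of z] by linarith+
    have "i \<in> {-M..M}" if "\<bar>t\<bar> \<le> B" "\<delta> * of_int i \<le> t" "t \<le> \<delta> * (of_int i + 1)" for t and i :: int
    proof -
      have "\<delta> * of_int i \<le> B" "- B \<le> \<delta> * (of_int i + 1)" using that by linarith+
      then have "of_int i \<le> B / \<delta>" "- (B / \<delta>) \<le> of_int i + 1" using assms(1) by (simp_all add: field_simps)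
      then show ?thesis unfolding M_def by (simp; linarith)
    qed
    then show "p \<in> {-M..M} \<times> {-M..M}" using b z(2) by (cases p) (auto simp: pixel_def)
  qed
  then show ?thesis by (rule finite_subset) simp
qed

text \<open>Otherwise the pixels reachable from \<open>p\<close> and the remaining ones form two
  closed sets that cover \<open>A\<close> and both meet it. By connectedness they share a point of
  \<open>A\<close>, but two pixels of \<open>A\<close> through one point are linked by grid
  steps.\<close>

lemma pixels_connected:
  assumes \<delta>: "\<delta> > 0" and A: "topological_space_class.connected A" "bounded A" and pq: "p \<in> pixels \<delta> A" "q \<in> pixels \<delta> A"
  shows "(p, q) \<in> (grid_adj \<inter> pixels \<delta> A \<times> pixels \<delta> A)\<^sup>*"
proof (rule ccontr)
  let ?P = "pixels \<delta> A"
  let ?R = "grid_adj \<inter> ?P \<times> ?P"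
  assume neg: "(p, q) \<notin> ?R\<^sup>*"
  define X where "X = {x \<in> ?P. (p, x) \<in> ?R\<^sup>*}"
  define U1 where "U1 = \<Union> (pixel \<delta> ` X)"
  define U2 where "U2 = \<Union> (pixel \<delta> ` (?P - X))"
  have fin: "finite ?P" using finite_pixels[OF \<delta> A(2)] .
  then have "finite X" "finite (?P - X)" by (simp_all add: X_def)
  then have cl: "closed U1" "closed U2" unfolding U1_def U2_def by (auto intro!: closed_UN closed_pixel)
  have cov: "A \<subseteq> U1 \<union> U2"
  proof
    fix z assume z: "z \<in> A"
    let ?p = "(\<lfloor>Re z / \<delta>\<rfloor>, \<lfloor>Im z / \<delta>\<rfloor>)"
    have "z \<in> pixel \<delta> ?p" using pixel_cover[OF \<delta>] .
    moreover from this have "?p \<in> ?P" using z unfolding pixels_def by blast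
    ultimately show "z \<in> U1 \<union> U2" unfolding U1_def U2_def by blast
  qed
  have "p \<in> X" "q \<in> ?P - X" using pq neg unfolding X_def by auto
  then have "U1 \<inter> A \<noteq> {}" "U2 \<inter> A \<noteq> {}" using pq unfolding U1_def U2_def pixels_def by blast+
  then have "A \<inter> U1 \<inter> U2 \<noteq> {}"
    using A(1) cl cov unfolding connected_closed by (metis inf_commute inf_assoc)
  then obtain z x y where z: "z \<in> A" "x \<in> X" "z \<in> pixel \<delta> x" "y \<in> ?P" "y \<notin> X" "z \<in> pixel \<delta> y"
    unfolding U1_def U2_def by blast
  obtain i j i' j' where ij: "x = (i, j)" "y = (i', j')" by (cases x; cases y)
  have b: "\<bar>i - i'\<bar> \<le> 1" "\<bar>j - j'\<bar> \<le> 1"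
    using pixel_index_bound[OF \<delta>, of i "Re z" i'] pixel_index_bound[OF \<delta>, of j "Im z" j'] z ij
    by (auto simp: pixel_def)
  \<comment> \<open>Pixels that meet only in a corner are not adjacent; this third pixel contains
    the same point and bridges them.\<close>
  have mid: "z \<in> pixel \<delta> (i', j)" using z ij by (auto simp: pixel_def)
  then have midP: "(i', j) \<in> ?P" using z(1) unfolding pixels_def by blast
  have xP: "(p, x) \<in> ?R\<^sup>*" "x \<in> ?P" using z(2) X_def by auto
  have 1: "(x, (i', j)) \<in> ?R\<^sup>*"
  proof (cases "i = i'")
    case False
    then have "(x, (i', j)) \<in> ?R" using b xP midP ij by (auto simp: grid_adj_iff)
    then show ?thesis by (rule r_into_rtrancl)
  qed (use ij in simp)
  have 2: "((i', j), y) \<in> ?R\<^sup>*"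
  proof (cases "j = j'")
    case False
    then have "((i', j), y) \<in> ?R" using b z(4) midP ij by (auto simp: grid_adj_iff)
    then show ?thesis by (rule r_into_rtrancl)
  qed (use ij in simp)
  have "(p, y) \<in> ?R\<^sup>*" using xP(1) 1 2 by (meson rtrancl_trans)
  then show False using z(4,5) unfolding X_def by blast
qed

lemma finite_uniform_pos:
  assumes "finite S" "\<And>s. s \<in> S \<Longrightarrow> \<exists>d>0::real. P s d" "\<And>s d d'. P s d \<Longrightarrow> 0 < d' \<Longrightarrow> d' \<le> d \<Longrightarrow> P s d'"
  shows "\<exists>d>0. \<forall>s\<in>S. P s d"
  using assms(1,2)
proof (induction rule: finite_induct)
  case empty then show ?case by (intro exI[of _ 1]) auto
next
  case (insert s S)
  obtain d where d: "d > 0" "\<forall>s\<in>S. P s d" using insert by blast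
  obtain e where e: "e > 0" "P s e" using insert.prems by blast
  have "min d e > 0" "\<forall>t\<in>insert s S. P t (min d e)"
    using d e assms(3)[of _ d "min d e"] assms(3)[of s e "min d e"] by auto
  then show ?case by blast
qed

text \<open>Continuity at 0 and 1 yields parameters \<open>a\<close> and \<open>b\<close> close
  enough to the ends; the part of the arc between them omits both end points and still comes within
  \<open>r\<close> of each.\<close>

lemma arc_middle:
  fixes g :: "real \<Rightarrow> complex"
  assumes g: "arc g" and r: "r > 0"
  shows "\<exists>M. compact M \<and> topological_space_class.connected M \<and> M \<subseteq> path_image g - {pathstart g, pathfinish g} \<and>
    M \<inter> cball (pathstart g) r \<noteq> {} \<and> M \<inter> cball (pathfinish g) r \<noteq> {}"
proof -
  have cont: "continuous_on {0..1} g" and inj: "inj_on g {0..1}"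
    using g by (auto simp: arc_def path_def)
  obtain d where d: "d > 0" "\<And>t. t \<in> {0..1} \<Longrightarrow> dist t 0 < d \<Longrightarrow> dist (g t) (g 0) < r"
    using cont r unfolding continuous_on_iff by (metis atLeastAtMost_iff order_refl zero_le_one)
  obtain e where e: "e > 0" "\<And>t. t \<in> {0..1} \<Longrightarrow> dist t 1 < e \<Longrightarrow> dist (g t) (g 1) < r"
    using cont r unfolding continuous_on_iff by (metis atLeastAtMost_iff order_refl zero_le_one)
  define a where "a = min (1/3) (d/2)"
  define b where "b = max (2/3) (1 - e/2)"
  have ab: "0 < a" "a < b" "b < 1" "dist a 0 < d" "dist b 1 < e"
    using d(1) e(1) by (auto simp: a_def b_def dist_real_def)
  let ?M = "g ` {a..b}"
  have sub: "{a..b} \<subseteq> {0..1}" using ab by auto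
  have "compact ?M" "topological_space_class.connected ?M"
    using continuous_on_subset[OF cont sub] by (auto intro: compact_continuous_image connected_continuous_image)
  moreover have "?M \<subseteq> path_image g - {pathstart g, pathfinish g}"
  proof -
    have "g t \<noteq> g 0" "g t \<noteq> g 1" if t: "t \<in> {a..b}" for t
    proof -
      have "t \<in> {0..1}" "t \<noteq> 0" "t \<noteq> 1" using t ab by auto
      then show "g t \<noteq> g 0" "g t \<noteq> g 1" using inj_onD[OF inj, of t 0] inj_onD[OF inj, of t 1] by auto
    qed
    then show ?thesis using sub by (auto simp: path_image_def pathstart_def pathfinish_def)
  qed
  moreover have "g a \<in> ?M \<inter> cball (pathstart g) r"
    using d(2)[of a] ab by (auto simp: pathstart_def dist_commute less_imp_le)
  moreover have "g b \<in> ?M \<inter> cball (pathfinish g) r"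
    using e(2)[of b] ab by (auto simp: pathfinish_def dist_commute less_imp_le)
  ultimately show ?thesis by blast
qed

lemma rtrancl_crossing:
  assumes "(x, y) \<in> R\<^sup>*" "x \<in> X" "y \<notin> X"
  shows "\<exists>u v. (u, v) \<in> R \<and> u \<in> X \<and> v \<notin> X"
  using assms by (induction rule: rtrancl_induct) auto

text \<open>Vertices become discs and edges become middle parts of their arcs. These compact sets
  are disjoint except that an edge meets the discs of its own ends, so on a fine grid disjoint sets
  have disjoint pixels. The pixels of an edge outside the discs that can be reached from one chosen
  end join the branch set of this end; from there a single grid step leads into the disc of the
  other end.\<close>

lemma drawing_grid_minor:
  assumes G: "graph G" and dr: "plane_drawing G p \<gamma>"
  shows "\<exists>N W. (\<forall>v\<in>verts G. W v \<noteq> {} \<and> W v \<subseteq> grid_sq N \<and>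
        (\<forall>x\<in>W v. \<forall>y\<in>W v. (x, y) \<in> (grid_edges N \<inter> W v \<times> W v)\<^sup>*)) \<and>
      (\<forall>u\<in>verts G. \<forall>v\<in>verts G. u \<noteq> v \<longrightarrow> W u \<inter> W v = {}) \<and>
      (\<forall>(u, v)\<in>arcs_ends G. \<exists>x\<in>W u. \<exists>y\<in>W v. (x, y) \<in> grid_edges N)"
proof -
  define Ed where "Ed = (\<lambda>(u, v). {u, v}) ` arcs_ends G"
  have finV: "finite (verts G)" and finE: "finite Ed"
    and endsV: "\<And>u v. (u, v) \<in> arcs_ends G \<Longrightarrow> u \<in> verts G"
      "\<And>u v. (u, v) \<in> arcs_ends G \<Longrightarrow> v \<in> verts G"
      "\<And>u v. (u, v) \<in> arcs_ends G \<Longrightarrow> u \<noteq> v"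
  proof -
    interpret graph G by fact
    show "finite (verts G)" "finite Ed" unfolding Ed_def arcs_ends_def by simp_all
    show "u \<in> verts G" "v \<in> verts G" "u \<noteq> v" if "(u, v) \<in> arcs_ends G" for u v
      using that adj_in_verts adj_not_same by auto
  qed
  have inj: "inj_on p (verts G)" using dr unfolding plane_drawing_def by (elim conjE)
  have dr2: "\<forall>(u, v) \<in> arcs_ends G. arc (\<gamma> {u, v}) \<and>
      {pathstart (\<gamma> {u, v}), pathfinish (\<gamma> {u, v})} = {p u, p v} \<and>
      path_image (\<gamma> {u, v}) \<inter> p ` verts G = {p u, p v}"
    using dr unfolding plane_drawing_def by (elim conjE)
  have dr3: "\<forall>(u, v) \<in> arcs_ends G. \<forall>(x, y) \<in> arcs_ends G. {u, v} \<noteq> {x, y} \<longrightarrow>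
      path_image (\<gamma> {u, v}) \<inter> path_image (\<gamma> {x, y}) \<subseteq> p ` ({u, v} \<inter> {x, y})"
    using dr unfolding plane_drawing_def by (elim conjE)
  have arcE: "arc (\<gamma> e)" and finE_ends: "{pathstart (\<gamma> e), pathfinish (\<gamma> e)} = p ` e"
    and imgE: "path_image (\<gamma> e) \<inter> p ` verts G = p ` e" and subE: "e \<subseteq> verts G"
    if e: "e \<in> Ed" for e
  proof -
    obtain u v where uv: "e = {u, v}" "(u, v) \<in> arcs_ends G" using e by (auto simp: Ed_def)
    have *: "arc (\<gamma> {u, v}) \<and> {pathstart (\<gamma> {u, v}), pathfinish (\<gamma> {u, v})} = {p u, p v} \<and>
        path_image (\<gamma> {u, v}) \<inter> p ` verts G = {p u, p v}"
      using bspec[OF dr2 uv(2)] unfolding prod.case .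
    show "arc (\<gamma> e)" "{pathstart (\<gamma> e), pathfinish (\<gamma> e)} = p ` e"
      "path_image (\<gamma> e) \<inter> p ` verts G = p ` e" using * uv(1) by simp_all
    show "e \<subseteq> verts G" using endsV[OF uv(2)] uv(1) by simp
  qed
  have crossE: "path_image (\<gamma> e) \<inter> path_image (\<gamma> f) \<subseteq> p ` (e \<inter> f)"
    if "e \<in> Ed" "f \<in> Ed" "e \<noteq> f" for e f
  proof -
    obtain u v where uv: "e = {u, v}" "(u, v) \<in> arcs_ends G" using \<open>e \<in> Ed\<close> by (auto simp: Ed_def)
    obtain x y where xy: "f = {x, y}" "(x, y) \<in> arcs_ends G" using \<open>f \<in> Ed\<close> by (auto simp: Ed_def)
    show ?thesis
      using bspec[OF bspec[OF dr3 uv(2), unfolded prod.case] xy(2), unfolded prod.case]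
        that(3) unfolding uv(1) xy(1) by (rule mp)
  qed
  \<comment> \<open>Everything the disc around \<open>w\<close> has to avoid: the other vertices and
    the arcs not incident with \<open>w\<close>.\<close>
  define F where "F = (\<lambda>w. p ` (verts G - {w}) \<union> \<Union> ((\<lambda>e. path_image (\<gamma> e)) ` {e \<in> Ed. w \<notin> e}))"
  have sep: "\<exists>d>0. \<forall>x\<in>F w. d \<le> dist (p w) x" if w: "w \<in> verts G" for w
  proof (rule separate_point_closed)
    have "closed (path_image (\<gamma> e))" if "e \<in> Ed" for e
      using arcE[OF that] by (simp add: closed_path_image arc_imp_path)
    then show "closed (F w)" unfolding F_def using finV finE
      by (intro closed_Un closed_UN finite_imp_closed) auto
    have "p w \<notin> path_image (\<gamma> e)" if e: "e \<in> Ed" "w \<notin> e" for e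
    proof
      assume "p w \<in> path_image (\<gamma> e)"
      then have "p w \<in> p ` e" using imgE[OF e(1)] w by blast
      then show False using inj w e subE[OF e(1)] by (metis inj_on_image_mem_iff)
    qed
    then show "p w \<notin> F w" unfolding F_def using inj w by (auto simp: inj_on_def)
  qed
  have "\<exists>d>0. \<forall>w\<in>verts G. \<forall>x\<in>F w. d \<le> dist (p w) x"
  proof (rule finite_uniform_pos[OF finV sep])
    fix w and d d' :: real
    assume "\<forall>x\<in>F w. d \<le> dist (p w) x" "d' \<le> d"
    then show "\<forall>x\<in>F w. d' \<le> dist (p w) x" by (meson order_trans)
  qed
  then obtain d where d: "d > 0" "\<forall>w\<in>verts G. \<forall>x\<in>F w. d \<le> dist (p w) x" by blast
  \<comment> \<open>Discs of a third of the distance \<open>d\<close> are disjoint, as their centres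
    are at least \<open>d\<close> apart.\<close>
  define r where "r = d / 3"
  have r: "r > 0" using d by (simp add: r_def)
  define B where "B = (\<lambda>w. cball (p w) r)"
  have "\<exists>M. compact M \<and> topological_space_class.connected M \<and> M \<subseteq> path_image (\<gamma> e) - p ` e \<and> (\<forall>w\<in>e. M \<inter> B w \<noteq> {})"
    if e: "e \<in> Ed" for e
  proof -
    obtain M where M: "compact M" "topological_space_class.connected M" "M \<subseteq> path_image (\<gamma> e) - {pathstart (\<gamma> e), pathfinish (\<gamma> e)}"
      "M \<inter> cball (pathstart (\<gamma> e)) r \<noteq> {}" "M \<inter> cball (pathfinish (\<gamma> e)) r \<noteq> {}"
      using arc_middle[OF arcE[OF e] r] by blast
    have "M \<inter> B w \<noteq> {}" if "w \<in> e" for w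
    proof -
      have "p w \<in> {pathstart (\<gamma> e), pathfinish (\<gamma> e)}" using finE_ends[OF e] that by blast
      then show ?thesis using M(4,5) unfolding B_def by auto
    qed
    then show ?thesis using M finE_ends[OF e] by auto
  qed
  then obtain M where M: "\<And>e. e \<in> Ed \<Longrightarrow> compact (M e)" "\<And>e. e \<in> Ed \<Longrightarrow> topological_space_class.connected (M e)"
    "\<And>e. e \<in> Ed \<Longrightarrow> M e \<subseteq> path_image (\<gamma> e) - p ` e" "\<And>e w. e \<in> Ed \<Longrightarrow> w \<in> e \<Longrightarrow> M e \<inter> B w \<noteq> {}"
    by metis
  have MM: "M e \<inter> M f = {}" if "e \<in> Ed" "f \<in> Ed" "e \<noteq> f" for e f
    using crossE[OF that] M(3)[OF that(1)] M(3)[OF that(2)] by blast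
  have MB: "M e \<inter> B w = {}" if "e \<in> Ed" "w \<in> verts G" "w \<notin> e" for e w
  proof -
    have "path_image (\<gamma> e) \<subseteq> F w" unfolding F_def using that by blast
    then have "d \<le> dist (p w) x" if "x \<in> M e" for x
      using that M(3)[OF \<open>e \<in> Ed\<close>] d(2) \<open>w \<in> verts G\<close> by blast
    then show ?thesis unfolding B_def using d(1) by (force simp: r_def)
  qed
  have BB: "B u \<inter> B w = {}" if "u \<in> verts G" "w \<in> verts G" "u \<noteq> w" for u w
  proof (rule ccontr)
    assume "B u \<inter> B w \<noteq> {}"
    then obtain x where "dist (p u) x \<le> r" "dist (p w) x \<le> r" unfolding B_def by auto
    then have "dist (p u) (p w) \<le> 2 * r" using dist_triangle2[of "p u" "p w" x] by simp
    moreover have "p w \<in> F u" unfolding F_def using that by blast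
    then have "d \<le> dist (p u) (p w)" using d(2) that by blast
    ultimately show False using d(1) by (simp add: r_def)
  qed
  define fam where "fam = B ` verts G \<union> M ` Ed"
  have fam: "finite fam" "\<And>A. A \<in> fam \<Longrightarrow> compact A"
    unfolding fam_def using finV finE M(1) by (auto simp: B_def)
  have "\<exists>d>0. \<forall>AC\<in>fam \<times> fam. fst AC \<inter> snd AC = {} \<longrightarrow> (\<forall>x\<in>fst AC. \<forall>y\<in>snd AC. d \<le> dist x y)"
  proof (rule finite_uniform_pos)
    show "finite (fam \<times> fam)" using fam by simp
    fix AC assume "AC \<in> fam \<times> fam"
    then have "compact (fst AC)" "compact (snd AC)" using fam(2) by (auto simp: mem_Times_iff)
    then show "\<exists>d>0. fst AC \<inter> snd AC = {} \<longrightarrow> (\<forall>x\<in>fst AC. \<forall>y\<in>snd AC. d \<le> dist x y)"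
      using separate_compact_closed[of "fst AC" "snd AC"] compact_imp_closed zero_less_one by blast
  next
    fix AC and d d' :: real
    assume "fst AC \<inter> snd AC = {} \<longrightarrow> (\<forall>x\<in>fst AC. \<forall>y\<in>snd AC. d \<le> dist x y)" "d' \<le> d"
    then show "fst AC \<inter> snd AC = {} \<longrightarrow> (\<forall>x\<in>fst AC. \<forall>y\<in>snd AC. d' \<le> dist x y)"
      by (meson order_trans)
  qed
  then obtain s where s: "s > 0" "\<And>A C x y. A \<in> fam \<Longrightarrow> C \<in> fam \<Longrightarrow> A \<inter> C = {} \<Longrightarrow> x \<in> A \<Longrightarrow> y \<in> C \<Longrightarrow> s \<le> dist x y"
    by fastforce
  \<comment> \<open>Two points of one pixel are at most \<open>2 * \<delta>\<close> apart, which is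
    less than the distance \<open>s\<close> between disjoint members of \<open>fam\<close>.\<close>
  define \<delta> where "\<delta> = s / 3"
  have \<delta>: "\<delta> > 0" using s by (simp add: \<delta>_def)
  have pdisj: "pixels \<delta> A \<inter> pixels \<delta> C = {}" if AC: "A \<in> fam" "C \<in> fam" "A \<inter> C = {}" for A C
  proof (rule ccontr)
    assume "pixels \<delta> A \<inter> pixels \<delta> C \<noteq> {}"
    then obtain q x y where "x \<in> pixel \<delta> q" "x \<in> A" "y \<in> pixel \<delta> q" "y \<in> C" by (auto simp: pixels_def)
    then have "s \<le> dist x y" "dist x y \<le> 2 * \<delta>" using s(2)[OF AC] pixel_dist by blast+
    then show False using s(1) by (simp add: \<delta>_def)
  qed
  have pconn: "(x, y) \<in> (grid_adj \<inter> pixels \<delta> A \<times> pixels \<delta> A)\<^sup>*"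
    if "A \<in> fam" "x \<in> pixels \<delta> A" "y \<in> pixels \<delta> A" for A x y
  proof (rule pixels_connected[OF \<delta> _ _ that(2,3)])
    show "topological_space_class.connected A" using that(1) M(2) by (auto simp: fam_def B_def)
    show "bounded A" using fam(2)[OF that(1)] by (rule compact_imp_bounded)
  qed
  have pmem: "\<exists>q. q \<in> pixels \<delta> A \<inter> pixels \<delta> C" if AC: "A \<inter> C \<noteq> {}" for A C
  proof -
    obtain z where "z \<in> A" "z \<in> C" using AC by blast
    then have "(\<lfloor>Re z / \<delta>\<rfloor>, \<lfloor>Im z / \<delta>\<rfloor>) \<in> pixels \<delta> A \<inter> pixels \<delta> C"
      using pixel_cover[OF \<delta>, of z] unfolding pixels_def by blast
    then show ?thesis by blast
  qed
  define PB where "PB = (\<lambda>w. pixels \<delta> (B w))"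
  define PM where "PM = (\<lambda>e. pixels \<delta> (M e))"
  define Pe where "Pe = (\<lambda>e. PM e - \<Union> (PB ` verts G))"
  define ch where "ch = (\<lambda>e. SOME u. u \<in> (e :: 'a set))"
  \<comment> \<open>Only the target of a step has to avoid the discs, so that paths may start in the
    disc of \<open>ch e\<close>.\<close>
  define rel where "rel = (\<lambda>e. grid_adj \<inter> UNIV \<times> Pe e)"
  define Ac where "Ac = (\<lambda>e. {q \<in> Pe e. \<exists>b\<in>PB (ch e). (b, q) \<in> (rel e)\<^sup>*})"
  define W where "W = (\<lambda>u. PB u \<union> \<Union> (Ac ` {e \<in> Ed. ch e = u}))"
  have chE: "ch e \<in> e" "ch e \<in> verts G" if e: "e \<in> Ed" for e
  proof -
    have "e \<noteq> {}" using e by (auto simp: Ed_def)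
    then show "ch e \<in> e" unfolding ch_def by (simp add: some_in_eq)
    then show "ch e \<in> verts G" using subE[OF e] by blast
  qed
  have Bfam: "B w \<in> fam" if "w \<in> verts G" for w using that by (simp add: fam_def)
  have Mfam: "M e \<in> fam" if "e \<in> Ed" for e using that by (simp add: fam_def)
  have Wdisj: "W u \<inter> W v = {}" if uv: "u \<in> verts G" "v \<in> verts G" "u \<noteq> v" for u v
  proof -
    have 1: "PB u \<inter> PB v = {}" unfolding PB_def using pdisj[OF Bfam[OF uv(1)] Bfam[OF uv(2)] BB[OF uv]] .
    have 2: "PB w \<inter> Ac e = {}" if "w \<in> verts G" for w e using that unfolding Ac_def Pe_def by blast
    have 3: "Ac e \<inter> Ac f = {}" if "e \<in> Ed" "f \<in> Ed" "e \<noteq> f" for e f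
      using pdisj[OF Mfam[OF that(1)] Mfam[OF that(2)] MM[OF that]] unfolding Ac_def Pe_def PM_def by blast
    show ?thesis
    proof (rule ccontr)
      assume "W u \<inter> W v \<noteq> {}"
      then obtain q where q: "q \<in> W u" "q \<in> W v" by blast
      have "q \<notin> PB u" "q \<notin> PB v" using q 1 2[OF uv(1)] 2[OF uv(2)] unfolding W_def by blast+
      then obtain e f where "e \<in> Ed" "ch e = u" "q \<in> Ac e" "f \<in> Ed" "ch f = v" "q \<in> Ac f"
        using q unfolding W_def by blast
      then show False using 3[of e f] uv(3) by blast
    qed
  qed
  have Wconn: "(x, y) \<in> (grid_adj \<inter> W u \<times> W u)\<^sup>*" if u: "u \<in> verts G" and xy: "x \<in> W u" "y \<in> W u" for u x y
  proof -
    let ?R = "grid_adj \<inter> W u \<times> W u"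
    have sym: "(b, a) \<in> ?R\<^sup>*" if "(a, b) \<in> ?R\<^sup>*" for a b
    proof -
      have "sym ?R" using grid_adj_sym by (auto simp: sym_def)
      then show ?thesis using that by (meson symD sym_rtrancl)
    qed
    have PBR: "(a, b) \<in> ?R\<^sup>*" if "a \<in> PB u" "b \<in> PB u" for a b
    proof -
      have "(a, b) \<in> (grid_adj \<inter> PB u \<times> PB u)\<^sup>*" unfolding PB_def
        using pconn[OF Bfam[OF u]] that unfolding PB_def .
      moreover have "grid_adj \<inter> PB u \<times> PB u \<subseteq> ?R" unfolding W_def by blast
      ultimately show ?thesis by (meson rtrancl_mono subsetD)
    qed
    have "\<exists>b\<in>PB u. (b, z) \<in> ?R\<^sup>*" if z: "z \<in> W u" for z
    proof (cases "z \<in> PB u")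
      case False
      then obtain e where e: "e \<in> Ed" "ch e = u" "z \<in> Ac e" using z unfolding W_def by blast
      then obtain b where b: "b \<in> PB u" "(b, z) \<in> (rel e)\<^sup>*" unfolding Ac_def by blast
      have sub: "Ac e \<subseteq> W u" using e unfolding W_def by blast
      have "(b, z) \<in> ?R\<^sup>* \<and> z \<in> W u" using b(2)
      proof (induction rule: rtrancl_induct)
        case base then show ?case using b(1) by (simp add: W_def)
      next
        case (step y z)
        have "(b, z) \<in> (rel e)\<^sup>*" using step(1,2) by (rule rtrancl.rtrancl_into_rtrancl)
        then have "z \<in> Ac e" using step(2) b(1) e(2) unfolding Ac_def rel_def by blast
        then have zW: "z \<in> W u" using sub by blast
        then have "(y, z) \<in> ?R" using step(2,3) unfolding rel_def by blast
        then show ?case using step(3) zW by (meson rtrancl.rtrancl_into_rtrancl)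
      qed
      then show ?thesis using b(1) by blast
    qed blast
    then obtain b c where "b \<in> PB u" "(b, x) \<in> ?R\<^sup>*" "c \<in> PB u" "(c, y) \<in> ?R\<^sup>*" using xy by metis
    then show ?thesis using PBR sym by (meson rtrancl_trans)
  qed
  have Wne: "W u \<noteq> {}" if "u \<in> verts G" for u
  proof -
    have "B u \<noteq> {}" using r by (simp add: B_def)
    then have "PB u \<noteq> {}" using pmem[of "B u" "B u"] unfolding PB_def by auto
    then show ?thesis by (simp add: W_def)
  qed
  have Wadj: "\<exists>x\<in>W u. \<exists>y\<in>W v. (x, y) \<in> grid_adj" if e: "{u, v} \<in> Ed" "ch {u, v} = u" for u v
  proof -
    let ?e = "{u, v}"
    have V: "u \<in> verts G" "v \<in> verts G" using subE[OF e(1)] by auto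
    obtain x where x: "x \<in> PM ?e \<inter> PB u" using pmem[OF M(4)[OF e(1), of u]] unfolding PM_def PB_def by auto
    obtain y where y: "y \<in> PM ?e \<inter> PB v" using pmem[OF M(4)[OF e(1), of v]] unfolding PM_def PB_def by auto
    show ?thesis
    proof (cases "u = v")
      case True
      obtain a b where ab: "(a, b) \<in> arcs_ends G" "{a, b} = ?e" using e(1) unfolding Ed_def by auto
      then show ?thesis using True endsV(3)[OF ab(1)] by auto
    next
      case False
      have uv: "PB u \<inter> PB v = {}" unfolding PB_def using pdisj[OF Bfam[OF V(1)] Bfam[OF V(2)] BB[OF V False]] .
      have cov: "PM ?e \<subseteq> PB u \<union> PB v \<union> Pe ?e"
      proof -
        have "PM ?e \<inter> PB w = {}" if "w \<in> verts G" "w \<noteq> u" "w \<noteq> v" for w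
          unfolding PM_def PB_def
          using pdisj[OF Mfam[OF e(1)] Bfam[OF that(1)]] MB[OF e(1) that(1)] that(2,3) by simp
        then show ?thesis unfolding Pe_def by blast
      qed
      \<comment> \<open>A walk through the pixels of the edge towards the disc of \<open>v\<close>
        leaves \<open>?X\<close> somewhere. The pixel entered cannot avoid all discs, since it would
        then be accessible, so it lies in the disc of \<open>v\<close>.\<close>
      let ?X = "PB u \<union> Ac ?e"
      have "y \<notin> ?X" using y uv V unfolding Ac_def Pe_def by blast
      moreover have "(x, y) \<in> (grid_adj \<inter> PM ?e \<times> PM ?e)\<^sup>*"
        using pconn[OF Mfam[OF e(1)], of x y] x y unfolding PM_def by simp
      ultimately obtain a b where ab: "(a, b) \<in> grid_adj \<inter> PM ?e \<times> PM ?e" "a \<in> ?X" "b \<notin> ?X"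
        using rtrancl_crossing[of x y _ ?X] x by blast
      have "b \<notin> Pe ?e"
      proof
        assume b: "b \<in> Pe ?e"
        then have st: "(a, b) \<in> rel ?e" using ab(1) unfolding rel_def by blast
        have "\<exists>c\<in>PB u. (c, a) \<in> (rel ?e)\<^sup>*" using ab(2) e(2) unfolding Ac_def by auto
        then have "\<exists>c\<in>PB u. (c, b) \<in> (rel ?e)\<^sup>*" using st by (meson rtrancl.rtrancl_into_rtrancl)
        then have "b \<in> Ac ?e" using b e(2) unfolding Ac_def by auto
        then show False using ab(3) by blast
      qed
      then have "b \<in> PB v" using ab cov by blast
      moreover have "a \<in> W u" using ab(2) e unfolding W_def by blast
      ultimately show ?thesis using ab(1) unfolding W_def by blast
    qed
  qed
  have "finite (\<Union> (W ` verts G))"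
  proof -
    have 1: "finite (PB w)" if "w \<in> verts G" for w
      unfolding PB_def B_def by (rule finite_pixels[OF \<delta>]) simp
    have "finite (PM e)" if "e \<in> Ed" for e
      unfolding PM_def by (rule finite_pixels[OF \<delta> compact_imp_bounded[OF M(1)[OF that]]])
    then have "finite (Ac e)" if "e \<in> Ed" for e
      using that by (rule_tac finite_subset[of _ "PM e"]) (auto simp: Ac_def Pe_def)
    then show ?thesis unfolding W_def using 1 finV finE by auto
  qed
  then have "\<exists>N. \<Union> (W ` verts G) \<subseteq> grid_sq N"
  proof -
    assume fin: "finite (\<Union> (W ` verts G))"
    define N where "N = nat (Max (insert 0 ((\<lambda>q. max \<bar>fst q\<bar> \<bar>snd q\<bar>) ` \<Union> (W ` verts G))))"
    have "q \<in> grid_sq N" if "q \<in> \<Union> (W ` verts G)" for q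
    proof -
      have "max \<bar>fst q\<bar> \<bar>snd q\<bar> \<le> Max (insert 0 ((\<lambda>q. max \<bar>fst q\<bar> \<bar>snd q\<bar>) ` \<Union> (W ` verts G)))"
        using fin that by (intro Max_ge) auto
      then have "max \<bar>fst q\<bar> \<bar>snd q\<bar> \<le> int N" unfolding N_def by linarith
      then show ?thesis by (cases q) (auto simp: grid_sq_def)
    qed
    then show ?thesis by blast
  qed
  then obtain N where N: "\<And>v. v \<in> verts G \<Longrightarrow> W v \<subseteq> grid_sq N" by blast
  have ge: "(x, y) \<in> grid_edges N" if "(x, y) \<in> grid_adj" "x \<in> grid_sq N" "y \<in> grid_sq N" for x y
    using that by (auto simp: grid_edges_def grid_adj_def)
  have c: "(x, y) \<in> (grid_edges N \<inter> W v \<times> W v)\<^sup>*" if v: "v \<in> verts G" and xy: "x \<in> W v" "y \<in> W v" for v x y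
  proof -
    have "grid_adj \<inter> W v \<times> W v \<subseteq> grid_edges N \<inter> W v \<times> W v" using ge N[OF v] by blast
    then show ?thesis using Wconn[OF v xy] by (meson rtrancl_mono subsetD)
  qed
  have ad: "\<exists>x\<in>W u. \<exists>y\<in>W v. (x, y) \<in> grid_edges N" if uv: "(u, v) \<in> arcs_ends G" for u v
  proof -
    have e: "{u, v} \<in> Ed" using uv unfolding Ed_def by auto
    note V = endsV[OF uv]
    have "ch {u, v} \<in> {u, v}" using chE(1)[OF e] .
    then consider "ch {u, v} = u" | "ch {v, u} = v" by (auto simp: insert_commute)
    then show ?thesis
    proof cases
      case 1
      then show ?thesis using Wadj[OF e] ge N V by (meson subsetD)
    next
      case 2
      then obtain x y where "x \<in> W v" "y \<in> W u" "(x, y) \<in> grid_adj"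
        using Wadj[of v u] e by (auto simp: insert_commute)
      then show ?thesis using ge grid_adj_sym N V by (meson subsetD)
    qed
  qed
  show ?thesis using Wne N c Wdisj ad by (intro exI[of _ N] exI[of _ W]) auto
qed

section \<open>Discharging in a triangulation\<close>

text \<open>The last assumption says that the greedy process started by deleting \<open>v\<close> stops before collecting six vertices: its
  result \<open>S\<close> is closed, no vertex outside having degree at most 4 in the remaining graph.\<close>

locale triangulation =
  fixes V :: "'a set" and N :: "'a \<Rightarrow> 'a set" and nx :: "'a \<Rightarrow> 'a \<Rightarrow> 'a"
  assumes finV: "finite V"
    and adjV: "u \<in> N v \<Longrightarrow> u \<in> V"
    and sym: "u \<in> N v \<Longrightarrow> v \<in> N u"
    and irr: "v \<notin> N v"
    and face: "u \<in> N v \<Longrightarrow> nx v u \<in> N v \<and> nx v u \<in> N u \<and> nx (nx v u) v = u \<and> nx u (nx v u) = v"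
    and ring: "p \<in> N v \<Longrightarrow> q \<in> N v \<Longrightarrow> \<exists>k. (nx v ^^ k) p = q"
    and euler: "(\<Sum>v\<in>V. card (N v)) + 12 \<le> 6 * card V"
    and noK5: "K \<subseteq> V \<Longrightarrow> card K = 5 \<Longrightarrow> (\<And>x y. x \<in> K \<Longrightarrow> y \<in> K \<Longrightarrow> x \<noteq> y \<Longrightarrow> y \<in> N x) \<Longrightarrow> False"
    and deg5: "v \<in> V \<Longrightarrow> 5 \<le> card (N v)"
    and closed6: "v \<in> V \<Longrightarrow> \<exists>S. v \<in> S \<and> S \<subseteq> V \<and> (\<forall>u\<in>V - S. 5 \<le> card (N u - S)) \<and> card S \<le> 6"
begin

section \<open>Degrees, closed sets and closures\<close>

definition d :: "'a \<Rightarrow> nat" where "d v = card (N v)"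

definition clsd :: "'a set \<Rightarrow> bool" where
  "clsd S \<longleftrightarrow> S \<subseteq> V \<and> (\<forall>u\<in>V - S. 5 \<le> card (N u - S))"

definition cl :: "'a \<Rightarrow> 'a set" where "cl v = \<Inter> {S. clsd S \<and> v \<in> S}"

lemma NV: "u \<in> N v \<Longrightarrow> u \<in> V" "u \<in> N v \<Longrightarrow> v \<in> V"
  using adjV sym by blast+

lemma finN: "finite (N v)"
  using finV NV by (meson finite_subset subsetI)

lemma symN: "u \<in> N v \<longleftrightarrow> v \<in> N u" using sym by blast

lemma d5: "v \<in> V \<Longrightarrow> 5 \<le> d v" using deg5 d_def by simp

text \<open>Intersections of closed sets are closed, because shrinking \<open>S\<close> only
  enlarges \<open>N u - S\<close>. So \<open>cl v\<close> is the least closed set containing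
  \<open>v\<close>, independent of any order of collecting.\<close>

lemma clsd_cl: assumes "v \<in> V" shows "clsd (cl v)"
proof -
  have "clsd V" by (simp add: clsd_def)
  then have sub: "cl v \<subseteq> V" using assms unfolding cl_def by blast
  have "5 \<le> card (N u - cl v)" if u: "u \<in> V - cl v" for u
  proof -
    obtain S where S: "clsd S" "v \<in> S" "u \<notin> S" using u unfolding cl_def by blast
    then have "5 \<le> card (N u - S)" using u by (simp add: clsd_def)
    moreover have "cl v \<subseteq> S" using S unfolding cl_def by blast
    then have "card (N u - S) \<le> card (N u - cl v)" using finN by (intro card_mono) auto
    ultimately show ?thesis by simp
  qed
  then show ?thesis using sub by (simp add: clsd_def)
qed

lemma cl_self: "v \<in> cl v" unfolding cl_def by blast

lemma cl_sub: "v \<in> V \<Longrightarrow> cl v \<subseteq> V" using clsd_cl clsd_def by blast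

lemma cl_least: "clsd S \<Longrightarrow> v \<in> S \<Longrightarrow> cl v \<subseteq> S" unfolding cl_def by blast

lemma cl_mono: "w \<in> cl v \<Longrightarrow> v \<in> V \<Longrightarrow> cl w \<subseteq> cl v"
  using cl_least clsd_cl by blast

lemma fin_cl: "v \<in> V \<Longrightarrow> finite (cl v)" using cl_sub finV finite_subset by blast

lemma cl_card: assumes "v \<in> V" shows "card (cl v) \<le> 6"
proof -
  obtain S where S: "v \<in> S" "clsd S" "card S \<le> 6" using closed6[OF assms] unfolding clsd_def by blast
  then have "cl v \<subseteq> S" "finite S" using cl_least finV finite_subset unfolding clsd_def by blast+
  then show ?thesis using S(3) card_mono[of S "cl v"] by simp
qed

text \<open>Used mostly in reverse: a vertex whose degree is less than 5 plus the number of its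
  known neighbours in a closed set must belong to that set.\<close>

lemma contacts:
  assumes "clsd S" "u \<in> V" "u \<notin> S" "X \<subseteq> N u \<inter> S"
  shows "5 + card X \<le> d u"
proof -
  have fX: "finite X" using assms(4) finN finite_subset by blast
  have "5 \<le> card (N u - S)" using assms by (simp add: clsd_def)
  also have "\<dots> \<le> card (N u - X)" using assms(4) finN by (intro card_mono) auto
  also have "\<dots> = d u - card X" using assms(4) fX unfolding d_def by (intro card_Diff_subset) auto
  finally show ?thesis by simp
qed

lemma contacts_cl:
  assumes "v \<in> V" "u \<in> V" "u \<notin> cl v" "X \<subseteq> N u \<inter> cl v"
  shows "5 + card X \<le> d u"
  using contacts[OF clsd_cl[OF assms(1)] assms(2-4)] .

lemma absorb1: "v \<in> V \<Longrightarrow> a \<in> N u \<Longrightarrow> a \<in> cl v \<Longrightarrow> d u \<le> 5 \<Longrightarrow> u \<in> cl v"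
  using contacts_cl[of v u "{a}"] NV by fastforce

lemma absorb2: "v \<in> V \<Longrightarrow> a \<in> N u \<Longrightarrow> b \<in> N u \<Longrightarrow> a \<noteq> b \<Longrightarrow> a \<in> cl v \<Longrightarrow> b \<in> cl v \<Longrightarrow> d u \<le> 6 \<Longrightarrow> u \<in> cl v"
  using contacts_cl[of v u "{a, b}"] NV by fastforce

lemma absorb3: "v \<in> V \<Longrightarrow> a \<in> N u \<Longrightarrow> b \<in> N u \<Longrightarrow> c \<in> N u \<Longrightarrow> distinct [a, b, c] \<Longrightarrow> a \<in> cl v \<Longrightarrow> b \<in> cl v \<Longrightarrow> c \<in> cl v
  \<Longrightarrow> d u \<le> 7 \<Longrightarrow> u \<in> cl v"
  using contacts_cl[of v u "{a, b, c}"] NV by fastforce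

lemma closure_not_seven: "v \<in> V \<Longrightarrow> set xs \<subseteq> cl v \<Longrightarrow> distinct xs \<Longrightarrow> length xs = 7 \<Longrightarrow> False"
  using cl_card[of v] card_mono[OF fin_cl, of v "set xs"] distinct_card[of xs] by simp

lemma closure_six_eq: "v \<in> V \<Longrightarrow> set xs \<subseteq> cl v \<Longrightarrow> distinct xs \<Longrightarrow> length xs = 6 \<Longrightarrow> cl v = set xs"
  using cl_card[of v] card_subset_eq[OF fin_cl, of v "set xs"] distinct_card[of xs]
    card_mono[OF fin_cl, of v "set xs"] by simp

text \<open>\<open>F x y z\<close>: the triangle \<open>xyz\<close> is a face.\<close>

definition F :: "'a \<Rightarrow> 'a \<Rightarrow> 'a \<Rightarrow> bool" where
  "F x y z \<longleftrightarrow> y \<in> N x \<and> z \<in> N x \<and> (nx x y = z \<or> nx x z = y)"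

lemma F_swap: "F x y z \<Longrightarrow> F x z y" unfolding F_def by blast

lemma F_rot: "F x y z \<Longrightarrow> F y z x"
  unfolding F_def using face symN by metis

lemma F_perm: "F x y z \<Longrightarrow> F x z y \<and> F y x z \<and> F y z x \<and> F z x y \<and> F z y x"
  using F_swap F_rot by blast

lemma F_adj: "F x y z \<Longrightarrow> y \<in> N x \<and> x \<in> N y \<and> z \<in> N x \<and> x \<in> N z \<and> z \<in> N y \<and> y \<in> N z"
  using F_rot[of x y z] F_rot[of y z x] unfolding F_def by blast

lemma F_dist: "F x y z \<Longrightarrow> x \<noteq> y \<and> y \<noteq> z \<and> x \<noteq> z \<and> y \<noteq> x \<and> z \<noteq> y \<and> z \<noteq> x"
  using F_adj irr by metis

lemma F_V: "F x y z \<Longrightarrow> x \<in> V \<and> y \<in> V \<and> z \<in> V" using F_adj NV by blast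

section \<open>Links as cycles of neighbours, and excluded coincidences\<close>

lemma nx_inj: "a \<in> N v \<Longrightarrow> b \<in> N v \<Longrightarrow> nx v a = nx v b \<Longrightarrow> a = b" using face by metis

lemma link_closed:
  assumes "X \<subseteq> N v" "a \<in> X" "\<And>x. x \<in> X \<Longrightarrow> nx v x \<in> X"
  shows "X = N v"
proof
  show "N v \<subseteq> X"
  proof
    fix q assume "q \<in> N v"
    then obtain k where k: "(nx v ^^ k) a = q" using ring assms by blast
    have "(nx v ^^ k) a \<in> X" by (induction k) (use assms in auto)
    then show "q \<in> X" using k by simp
  qed
qed (use assms in blast)

text \<open>If both faces at an edge had the same apex, this apex and \<open>y\<close> alone would
  be closed under \<open>nx x\<close>, giving \<open>x\<close> degree at most 2.\<close>

lemma apex_two: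
  assumes "y \<in> N x"
  shows "F x y z \<longleftrightarrow> z = nx x y \<or> z = nx y x" "nx x y \<noteq> nx y x"
proof -
  have f: "nx x y \<in> N x" "nx y x \<in> N x" "nx x (nx y x) = y"
    using face[OF assms] face[OF sym[OF assms]] by auto
  show "F x y z \<longleftrightarrow> z = nx x y \<or> z = nx y x"
    unfolding F_def using assms f nx_inj by metis
  show "nx x y \<noteq> nx y x"
  proof
    assume e: "nx x y = nx y x"
    then have "nx x (nx x y) = y" using f by simp
    then have "{y, nx x y} = N x" by (intro link_closed[of _ x y]) (use assms f in auto)
    moreover have "card {y, nx x y} \<le> 2" by (simp add: card_insert_if)
    ultimately have "card (N x) \<le> 2" by simp
    then show False using deg5[of x] NV assms by fastforce
  qed
qed

lemma F_third: "F x y a \<Longrightarrow> F x y b \<Longrightarrow> F x y c \<Longrightarrow> a \<noteq> b \<Longrightarrow> c = a \<or> c = b"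
  using apex_two(1) F_adj by metis

lemma link_closed_F:
  assumes "X \<subseteq> N v" "a \<in> X" "\<And>x z. x \<in> X \<Longrightarrow> F v x z \<Longrightarrow> z \<in> X"
  shows "X = N v"
  using link_closed[OF assms(1,2)] assms(3) unfolding F_def by (metis assms(1) face subsetD)

text \<open>Three faces that close up around \<open>v\<close> exhaust its link. Together with the
  absence of \<open>K5\<close> this excludes most coincidences of vertices that carry different
  names in a local picture.\<close>

lemma not_degree_3:
  assumes "F v a b" "F v b c" "F v c a" "a \<noteq> b" "b \<noteq> c" "a \<noteq> c"
  shows False
proof -
  have "{a, b, c} = N v"
  proof (rule link_closed_F)
    show "{a, b, c} \<subseteq> N v" using assms F_adj by blast
    show "a \<in> {a, b, c}" by simp
    show "z \<in> {a, b, c}" if "x \<in> {a, b, c}" "F v x z" for x z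
      using that F_third F_swap assms by (metis insertCI insertE singletonD)
  qed
  moreover have "card {a, b, c} = 3" using assms by simp
  ultimately have "card (N v) \<le> 3" by simp
  then show False using deg5[of v] F_V assms by fastforce
qed

lemma K5:
  assumes "distinct [a, b, c, e, f]"
    "b \<in> N a" "c \<in> N a" "e \<in> N a" "f \<in> N a" "c \<in> N b" "e \<in> N b" "f \<in> N b" "e \<in> N c" "f \<in> N c" "f \<in> N e"
  shows False
proof (rule noK5[of "{a, b, c, e, f}"])
  show "{a, b, c, e, f} \<subseteq> V" using assms NV by blast
  show "card {a, b, c, e, f} = 5" using assms(1) by simp
  fix x y assume "x \<in> {a, b, c, e, f}" "y \<in> {a, b, c, e, f}" "x \<noteq> y"
  then show "y \<in> N x" using assms(2-) symN by auto
qed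

definition rg :: "'a \<Rightarrow> 'a list \<Rightarrow> bool" where
  "rg x xs \<longleftrightarrow> distinct xs \<and> set xs = N x \<and> xs \<noteq> [] \<and>
     (\<forall>i<length xs. F x (xs ! i) (xs ! ((i + 1) mod length xs)))"

lemma rg_length: "rg x xs \<Longrightarrow> length xs = d x"
  unfolding rg_def d_def by (metis distinct_card)

text \<open>Iterating \<open>nx x\<close> up to the first return to \<open>y\<close> lists distinct
  neighbours, and the list is closed under \<open>nx x\<close>, hence complete.\<close>

lemma rg_exists:
  assumes y: "y \<in> N x"
  shows "\<exists>xs. rg x xs \<and> xs ! 0 = y \<and> xs ! 1 = nx x y"
proof -
  define a where "a = (\<lambda>k. (nx x ^^ k) y)"
  have aN: "a k \<in> N x" for k unfolding a_def by (induction k) (use y face in auto)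
  have a0: "a 0 = y" by (simp add: a_def)
  have aS: "a (Suc k) = nx x (a k)" for k by (simp add: a_def)
  obtain j where "(nx x ^^ j) (nx x y) = y" using ring face y by blast
  then have "a (Suc j) = y" by (simp add: a_def funpow_swap1)
  then have ex: "0 < Suc j \<and> a (Suc j) = y" by simp
  define k where "k = (LEAST k. 0 < k \<and> a k = y)"
  have k: "0 < k" "a k = y" using LeastI[of "\<lambda>k. 0 < k \<and> a k = y", OF ex] unfolding k_def by auto
  have kl: "a i \<noteq> y" if "0 < i" "i < k" for i
    using not_less_Least[of i "\<lambda>k. 0 < k \<and> a k = y"] that unfolding k_def by auto
  have inj: "a i \<noteq> a j" if "i < j" "j < k" for i j
  proof
    assume "a i = a j"
    then have "a 0 = a (j - i)" using that(1)
    proof (induction i arbitrary: j)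
      case (Suc i)
      obtain j' where j': "j = Suc j'" using Suc.prems(2) by (cases j) auto
      then have "a i = a j'" using Suc.prems(1) aS aN nx_inj by metis
      then show ?case using Suc.IH[of j'] Suc.prems(2) j' by simp
    qed simp
    moreover have "0 < j - i" "j - i < k" using that by auto
    ultimately show False using kl[of "j - i"] by (simp add: a_def)
  qed
  define xs where "xs = map a [0..<k]"
  have len: "length xs = k" by (simp add: xs_def)
  have dist: "distinct xs" unfolding xs_def distinct_map inj_on_def
    using inj by (metis atLeastLessThan_iff distinct_upt nat_neq_iff set_upt)
  have "set xs = N x"
  proof (rule link_closed)
    show "set xs \<subseteq> N x" using aN by (auto simp: xs_def)
    show "y \<in> set xs" using k(1) by (auto simp: xs_def a_def image_iff intro!: bexI[of _ 0])
    fix z assume "z \<in> set xs"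
    then obtain i where i: "i < k" "z = a i" by (auto simp: xs_def)
    show "nx x z \<in> set xs"
    proof (cases "Suc i = k")
      case True
      then have "nx x z = a 0" using i aS[of i] k(2) a0 by simp
      then show ?thesis using k(1) by (auto simp: xs_def)
    next
      case False
      then have "nx x z = a (Suc i)" "Suc i < k" using i aS by auto
      then show ?thesis by (auto simp: xs_def)
    qed
  qed
  moreover have "F x (xs ! i) (xs ! ((i + 1) mod length xs))" if i: "i < length xs" for i
  proof -
    have "xs ! ((i + 1) mod length xs) = nx x (a i)"
    proof (cases "Suc i = k")
      case True
      then have "xs ! ((i + 1) mod length xs) = a 0" using len k(1) by (simp add: xs_def)
      then show ?thesis using True k(2) aS[of i] a0 by simp
    next
      case False
      then show ?thesis using i len aS by (simp add: xs_def)
    qed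
    then show ?thesis using i len aN face unfolding F_def by (simp add: xs_def)
  qed
  moreover have "xs ! 0 = y" using k(1) by (simp add: xs_def a_def)
  moreover have "xs ! 1 = nx x y"
  proof -
    have "k \<noteq> 1"
    proof
      assume "k = 1"
      then have "nx x y = y" using k by (simp add: a_def)
      then show False using face[OF y] irr by metis
    qed
    then show ?thesis using k(1) by (simp add: xs_def a_def)
  qed
  ultimately have "rg x xs \<and> xs ! 0 = y \<and> xs ! 1 = nx x y"
    unfolding rg_def using dist len k(1) by auto
  then show ?thesis by blast
qed

lemma rg_rev: assumes "rg x xs" shows "rg x (rev xs)"
proof -
  have r: "distinct xs" "set xs = N x" "xs \<noteq> []" "\<And>i. i < length xs \<Longrightarrow> F x (xs ! i) (xs ! ((i + 1) mod length xs))"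
    using assms unfolding rg_def by blast+
  let ?n = "length xs"
  have "F x (rev xs ! i) (rev xs ! ((i + 1) mod ?n))" if i: "i < ?n" for i
  proof (cases "i + 1 = ?n")
    case True
    have "Suc (?n - 1) = ?n" using i by simp
    then have "F x (xs ! (?n - 1)) (xs ! 0)" using r(4)[of "?n - 1"] i by simp
    then show ?thesis using True i F_swap r(3) by (simp add: rev_nth)
  next
    case False
    have "F x (xs ! (?n - 2 - i)) (xs ! (?n - 1 - i))" using r(4)[of "?n - 2 - i"] i False by (simp add: Suc_diff_Suc)
    then show ?thesis using False i F_swap by (simp add: rev_nth)
  qed
  then show ?thesis using r unfolding rg_def by simp
qed

lemma rg_rotate: assumes "rg x xs" shows "rg x (rotate k xs)"
proof -
  have r: "distinct xs" "set xs = N x" "xs \<noteq> []" "\<And>i. i < length xs \<Longrightarrow> F x (xs ! i) (xs ! ((i + 1) mod length xs))"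
    using assms unfolding rg_def by blast+
  have "F x (rotate k xs ! i) (rotate k xs ! ((i + 1) mod length xs))" if "i < length xs" for i
    using r(4)[of "(k + i) mod length xs"] that r(3) by (simp add: nth_rotate mod_simps add.assoc)
  then show ?thesis using r unfolding rg_def by simp
qed

lemma rg_start: assumes "F x y z" shows "\<exists>xs. rg x xs \<and> xs ! 0 = y \<and> xs ! 1 = z"
proof -
  have yz: "y \<in> N x" "z \<in> N x" "nx x y = z \<or> nx x z = y" using assms F_def by auto
  from yz(3) show ?thesis
  proof
    assume "nx x y = z" then show ?thesis using rg_exists[OF yz(1)] by blast
  next
    assume e: "nx x z = y"
    obtain xs where xs: "rg x xs" "xs ! 0 = z" "xs ! 1 = y" using rg_exists[OF yz(2)] e by blast
    have len: "5 \<le> length xs" using rg_length[OF xs(1)] d5 NV yz by fastforce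
    let ?n = "length xs"
    \<comment> \<open>The reversed list ends with \<open>y\<close> and \<open>z\<close>; rotating by
      \<open>?n - 2\<close> brings these two to the front.\<close>
    have "rg x (rotate (?n - 2) (rev xs))" using rg_rotate[OF rg_rev[OF xs(1)]] .
    moreover have "rotate (?n - 2) (rev xs) ! 0 = y" "rotate (?n - 2) (rev xs) ! 1 = z"
    proof -
      have xs0: "xs \<noteq> []" using len by auto
      have "?n - 2 < ?n" "?n - 1 < ?n" "?n - Suc (?n - 2) = 1" "?n - Suc (?n - 1) = 0" "?n - 2 + 1 = ?n - 1"
        using len by auto
      then show "rotate (?n - 2) (rev xs) ! 0 = y" "rotate (?n - 2) (rev xs) ! 1 = z"
        using nth_rotate[of 0 "rev xs" "?n - 2"] nth_rotate[of 1 "rev xs" "?n - 2"] len xs xs0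
        by (simp_all add: rev_nth)
    qed
    ultimately show ?thesis by blast
  qed
qed

text \<open>The link is recorded without an orientation, so that local pictures may be rotated and
  reflected freely.\<close>

definition r5 :: "'a \<Rightarrow> 'a \<Rightarrow> 'a \<Rightarrow> 'a \<Rightarrow> 'a \<Rightarrow> 'a \<Rightarrow> bool" where
  "r5 x a b c p q \<longleftrightarrow> d x = 5 \<and> N x = {a, b, c, p, q} \<and> distinct [a, b, c, p, q] \<and>
     F x a b \<and> F x b c \<and> F x c p \<and> F x p q \<and> F x q a"

definition r6 :: "'a \<Rightarrow> 'a \<Rightarrow> 'a \<Rightarrow> 'a \<Rightarrow> 'a \<Rightarrow> 'a \<Rightarrow> 'a \<Rightarrow> bool" where
  "r6 x a b c p q r \<longleftrightarrow> d x = 6 \<and> N x = {a, b, c, p, q, r} \<and> distinct [a, b, c, p, q, r] \<and>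
     F x a b \<and> F x b c \<and> F x c p \<and> F x p q \<and> F x q r \<and> F x r a"

lemma r5_ex: assumes "F x a b" "d x = 5" shows "\<exists>c p q. r5 x a b c p q"
proof -
  obtain xs where xs: "rg x xs" "xs ! 0 = a" "xs ! 1 = b" using rg_start[OF assms(1)] by blast
  have "length xs = 5" using rg_length[OF xs(1)] assms(2) by simp
  then obtain c p q where e: "xs = [a, b, c, p, q]" using xs(2,3)
    by (auto simp: length_Suc_conv numeral_eq_Suc)
  have Fi: "F x (xs ! i) (xs ! ((i + 1) mod 5))" if "i < 5" for i
    using xs(1) that e unfolding rg_def by auto
  have "F x a b" using Fi[of 0] unfolding e by simp
  moreover have "F x b c" using Fi[of 1] unfolding e by simp
  moreover have "F x c p" using Fi[of 2] unfolding e by simp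
  moreover have "F x p q" using Fi[of 3] unfolding e by simp
  moreover have "F x q a" using Fi[of 4] unfolding e by simp
  moreover have "N x = {a, b, c, p, q}" "distinct [a, b, c, p, q]"
    using xs(1) e unfolding rg_def by auto
  ultimately show ?thesis using assms(2) unfolding r5_def by blast
qed

lemma r6_ex: assumes "F x a b" "d x = 6" shows "\<exists>c p q r. r6 x a b c p q r"
proof -
  obtain xs where xs: "rg x xs" "xs ! 0 = a" "xs ! 1 = b" using rg_start[OF assms(1)] by blast
  have "length xs = 6" using rg_length[OF xs(1)] assms(2) by simp
  then obtain c p q r where e: "xs = [a, b, c, p, q, r]" using xs(2,3)
    by (auto simp: length_Suc_conv numeral_eq_Suc)
  have Fi: "F x (xs ! i) (xs ! ((i + 1) mod 6))" if "i < 6" for i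
    using xs(1) that e unfolding rg_def by auto
  have "F x a b" using Fi[of 0] unfolding e by simp
  moreover have "F x b c" using Fi[of 1] unfolding e by simp
  moreover have "F x c p" using Fi[of 2] unfolding e by simp
  moreover have "F x p q" using Fi[of 3] unfolding e by simp
  moreover have "F x q r" using Fi[of 4] unfolding e by simp
  moreover have "F x r a" using Fi[of 5] unfolding e by simp
  moreover have "N x = {a, b, c, p, q, r}" "distinct [a, b, c, p, q, r]"
    using xs(1) e unfolding rg_def by auto
  ultimately show ?thesis using assms(2) unfolding r6_def by blast
qed

lemma r5D: assumes "r5 x a b c p q"
  shows "d x = 5" "N x = {a, b, c, p, q}" "distinct [a, b, c, p, q]"
    "F x a b" "F x b c" "F x c p" "F x p q" "F x q a" "x \<in> V" "x \<notin> {a, b, c, p, q}"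
proof -
  show *: "d x = 5" "N x = {a, b, c, p, q}" "distinct [a, b, c, p, q]"
    "F x a b" "F x b c" "F x c p" "F x p q" "F x q a" using assms unfolding r5_def by blast+
  show "x \<in> V" using F_V[OF *(4)] by blast
  show "x \<notin> {a, b, c, p, q}" using irr[of x] *(2) by simp
qed

lemma r6D: assumes "r6 x a b c p q r"
  shows "d x = 6" "N x = {a, b, c, p, q, r}" "distinct [a, b, c, p, q, r]"
    "F x a b" "F x b c" "F x c p" "F x p q" "F x q r" "F x r a" "x \<in> V" "x \<notin> {a, b, c, p, q, r}"
proof -
  show *: "d x = 6" "N x = {a, b, c, p, q, r}" "distinct [a, b, c, p, q, r]"
    "F x a b" "F x b c" "F x c p" "F x p q" "F x q r" "F x r a" using assms unfolding r6_def by blast+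
  show "x \<in> V" using F_V[OF *(4)] by blast
  show "x \<notin> {a, b, c, p, q, r}" using irr[of x] *(2) by simp
qed

lemma r5_mid: assumes "F y a x" "F y x b" "a \<noteq> b" "d y = 5" shows "\<exists>p q. r5 y a x b p q"
proof -
  obtain c p q where r: "r5 y a x c p q" using r5_ex[OF assms(1,4)] by blast
  then have "F y x c" "c \<noteq> a" unfolding r5_def by auto
  then have "c = b" using F_third[of y x a b c] assms F_swap by blast
  then show ?thesis using r by blast
qed

lemma r6_mid: assumes "F y a x" "F y x b" "a \<noteq> b" "d y = 6" shows "\<exists>p q r. r6 y a x b p q r"
proof -
  obtain c p q r where r: "r6 y a x c p q r" using r6_ex[OF assms(1,4)] by blast
  then have "F y x c" "c \<noteq> a" unfolding r6_def by auto
  then have "c = b" using F_third[of y x a b c] assms F_swap by blast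
  then show ?thesis using r by blast
qed

lemma r5_rot: "r5 x a b c p q \<Longrightarrow> r5 x b c p q a" unfolding r5_def by auto
lemma r5_rev: "r5 x a b c p q \<Longrightarrow> r5 x q p c b a" unfolding r5_def using F_swap by auto
lemma r6_rot: "r6 x a b c p q r \<Longrightarrow> r6 x b c p q r a" unfolding r6_def by auto
lemma r6_rev: "r6 x a b c p q r \<Longrightarrow> r6 x r q p c b a" unfolding r6_def using F_swap by auto

definition big :: "'a \<Rightarrow> bool" where "big v \<longleftrightarrow> v \<in> V \<and> 7 \<le> d v"
definition P5 :: "'a \<Rightarrow> 'a set" where "P5 x = {y \<in> N x. d y = 5}"
definition T6 :: "'a \<Rightarrow> 'a set" where "T6 x = {y \<in> N x. d y = 6}"
definition Bg :: "'a \<Rightarrow> 'a set" where "Bg x = {y \<in> N x. 7 \<le> d y}"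

lemma P5_T6_Bg: "N x = P5 x \<union> T6 x \<union> Bg x" "card (N x) = card (P5 x) + card (T6 x) + card (Bg x)"
proof -
  have "d y = 5 \<or> d y = 6 \<or> 7 \<le> d y" if "y \<in> N x" for y
    using d5[OF NV(1)[OF that]] by linarith
  then show 1: "N x = P5 x \<union> T6 x \<union> Bg x"
    unfolding P5_def T6_def Bg_def by blast
  have "finite (P5 x)" "finite (T6 x)" "finite (Bg x)" unfolding P5_def T6_def Bg_def using finN by auto
  moreover have "P5 x \<inter> T6 x = {}" "(P5 x \<union> T6 x) \<inter> Bg x = {}" unfolding P5_def T6_def Bg_def by auto
  ultimately show "card (N x) = card (P5 x) + card (T6 x) + card (Bg x)"
    by (subst 1) (simp add: card_Un_disjoint)
qed

text \<open>A member without neighbours in the closure could be removed from it without spoiling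
  closedness.\<close>

lemma cl_nbr: assumes "y \<in> cl u" "y \<noteq> u" "u \<in> V" shows "N y \<inter> cl u \<noteq> {}"
proof
  assume e: "N y \<inter> cl u = {}"
  have yV: "y \<in> V" using assms cl_sub by blast
  have "clsd (cl u - {y})"
    unfolding clsd_def
  proof (intro conjI ballI)
    show "cl u - {y} \<subseteq> V" using cl_sub assms by blast
    fix w assume w: "w \<in> V - (cl u - {y})"
    show "5 \<le> card (N w - (cl u - {y}))"
    proof (cases "w = y")
      case True
      then have "N w - (cl u - {y}) = N w" using e by blast
      then show ?thesis using deg5 w by simp
    next
      case False
      then have "5 \<le> card (N w - cl u)" using w clsd_cl[OF assms(3)] unfolding clsd_def by blast
      also have "\<dots> \<le> card (N w - (cl u - {y}))" using finN by (intro card_mono) auto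
      finally show ?thesis .
    qed
  qed
  moreover have "u \<in> cl u - {y}" using assms cl_self by blast
  ultimately have "cl u \<subseteq> cl u - {y}" by (rule cl_least)
  then show False using assms(1) by blast
qed

text \<open>Neighbours that are not absorbed have degree at least 6, so deleting \<open>u\<close>
  alone leaves them enough neighbours.\<close>

lemma cl_trivial: assumes "u \<in> V" "N u \<inter> cl u = {}" shows "cl u = {u}"
proof -
  have "clsd {u}" unfolding clsd_def
  proof (intro conjI ballI)
    fix w assume w: "w \<in> V - {u}"
    show "5 \<le> card (N w - {u})"
    proof (cases "u \<in> N w")
      case True
      then have "w \<notin> cl u" using assms(2) symN by blast
      then have "6 \<le> d w" using contacts_cl[of u w "{u}"] True w assms(1) cl_self by fastforce
      then show ?thesis using True finN by (simp add: d_def)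
    next
      case False then show ?thesis using deg5 w by simp
    qed
  qed (use assms in simp)
  then show ?thesis using cl_least[of "{u}" u] cl_self by blast
qed

section \<open>Hubs and their stars\<close>

definition hub0 :: "'a \<Rightarrow> bool" where "hub0 x \<longleftrightarrow> d x = 5 \<and> P5 x = {} \<and> Bg x = {}"
definition hub1 :: "'a \<Rightarrow> bool" where "hub1 x \<longleftrightarrow> d x = 5 \<and> P5 x = {} \<and> card (Bg x) = 1"
definition hub :: "'a \<Rightarrow> bool" where "hub x \<longleftrightarrow> hub0 x \<or> hub1 x"

lemma d5V: "d x = 5 \<Longrightarrow> x \<in> V"
proof (rule ccontr)
  assume "d x = 5" "x \<notin> V"
  then have "N x = {}" using NV by blast
  then show False using \<open>d x = 5\<close> by (simp add: d_def)
qed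

text \<open>Along the link each new vertex has two contacts, \<open>x\<close> and its predecessor,
  which suffices for degree at most 6.\<close>

lemma ring_prop:
  assumes "r5 x a b c p q" "w \<in> V" "x \<in> cl w" "a \<in> cl w"
  shows "d b \<le> 6 \<Longrightarrow> b \<in> cl w"
    "d b \<le> 6 \<Longrightarrow> d c \<le> 6 \<Longrightarrow> c \<in> cl w"
    "d b \<le> 6 \<Longrightarrow> d c \<le> 6 \<Longrightarrow> d p \<le> 6 \<Longrightarrow> p \<in> cl w"
    "d b \<le> 6 \<Longrightarrow> d c \<le> 6 \<Longrightarrow> d p \<le> 6 \<Longrightarrow> d q \<le> 6 \<Longrightarrow> q \<in> cl w"
proof -
  have Fs: "F x a b" "F x b c" "F x c p" "F x p q" using assms(1) unfolding r5_def by auto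
  have st: "z \<in> cl w" if "F x y z" "y \<in> cl w" "d z \<le> 6" for y z
    using absorb2[of w x z y] F_adj[OF that(1)] F_dist[OF that(1)] that assms(2,3) by blast
  show b: "d b \<le> 6 \<Longrightarrow> b \<in> cl w" using st Fs assms(4) by blast
  show c: "d b \<le> 6 \<Longrightarrow> d c \<le> 6 \<Longrightarrow> c \<in> cl w" using st Fs b by blast
  show p: "d b \<le> 6 \<Longrightarrow> d c \<le> 6 \<Longrightarrow> d p \<le> 6 \<Longrightarrow> p \<in> cl w" using st Fs c by blast
  show "d b \<le> 6 \<Longrightarrow> d c \<le> 6 \<Longrightarrow> d p \<le> 6 \<Longrightarrow> d q \<le> 6 \<Longrightarrow> q \<in> cl w" using st Fs p by blast
qed

lemma hub_ring:
  assumes "hub x"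
  shows "\<exists>a b c p q. r5 x a b c p q \<and> d b = 6 \<and> d c = 6 \<and> d p = 6 \<and> d q = 6 \<and> (hub1 x \<longrightarrow> Bg x = {a} \<and> 7 \<le> d a) \<and> (hub0 x \<longrightarrow> d a = 6)"
proof -
  have dx: "d x = 5" and P: "P5 x = {}" using assms unfolding hub_def hub0_def hub1_def by auto
  have ne: "N x \<noteq> {}" using dx by (auto simp: d_def)
  obtain a where a: "a \<in> N x" "hub1 x \<longrightarrow> Bg x = {a}"
  proof (cases "hub1 x")
    case True
    then obtain a where "Bg x = {a}" unfolding hub1_def by (metis card_1_singletonE)
    then show ?thesis using that[of a] unfolding Bg_def by blast
  next
    case False then show ?thesis using that ne by blast
  qed
  obtain b c p q where r: "r5 x a b c p q" using r5_ex[of x a "nx x a"] dx face[OF a(1)] a(1) unfolding F_def by blast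
  have N: "N x = {a, b, c, p, q}" "distinct [a, b, c, p, q]" using r unfolding r5_def by auto
  have six: "d y = 6" if "y \<in> N x" "y \<notin> Bg x" for y
    using that P P5_T6_Bg(1)[of x] unfolding T6_def by blast
  have "hub0 x \<longrightarrow> Bg x = {}" by (simp add: hub0_def)
  then have "y \<notin> Bg x" if "y \<in> {b, c, p, q}" for y
    using that a(2) N assms unfolding hub_def by auto
  then have "d b = 6" "d c = 6" "d p = 6" "d q = 6" using six N(1) by auto
  moreover have "hub1 x \<longrightarrow> 7 \<le> d a" using a(2) unfolding Bg_def by blast
  moreover have "hub0 x \<longrightarrow> d a = 6" using six[OF a(1)] by (simp add: hub0_def)
  ultimately show ?thesis using r a(2) by blast
qed

text \<open>Start from the rim vertex \<open>a\<close> that may have large degree: its closure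
  absorbs \<open>x\<close> and then the rest of the rim. These six vertices fill the bound, so they
  are the closure of \<open>a\<close>.\<close>

lemma hub_closed:
  assumes "hub x"
  shows "clsd (insert x (N x))" "card (insert x (N x)) = 6"
proof -
  obtain a b c p q where r: "r5 x a b c p q" "d b = 6" "d c = 6" "d p = 6" "d q = 6" using hub_ring[OF assms] by blast
  have N: "N x = {a, b, c, p, q}" "distinct [a, b, c, p, q]" "d x = 5" using r unfolding r5_def by auto
  have aV: "a \<in> V" "x \<in> V" "a \<in> N x" using N NV by blast+
  have xa: "x \<in> cl a" using absorb1[OF aV(1), of a x] N(3) aV cl_self by simp
  note rp = ring_prop[OF r(1) aV(1) xa cl_self]
  have sub: "insert x (N x) \<subseteq> cl a" using rp r(2-5) xa N(1) cl_self by auto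
  show c: "card (insert x (N x)) = 6" using N(3) irr[of x] finN[of x] by (simp add: d_def)
  have "insert x (N x) = cl a"
    using card_subset_eq[OF fin_cl[OF aV(1)] sub] c cl_card[OF aV(1)] card_mono[OF fin_cl[OF aV(1)] sub] by simp
  then show "clsd (insert x (N x))" using clsd_cl[OF aV(1)] by simp
qed

text \<open>A closure that meets the star swallows the hub and its rim vertices of degree 6. If the
  whole rim has degree 6, this makes seven vertices with \<open>u\<close>. Otherwise the closure is
  known exactly, and it then turns out that \<open>u\<close> is already closed by itself.\<close>

lemma hub_disjoint:
  assumes h: "hub x" and u: "u \<in> V" "u \<notin> insert x (N x)"
  shows "cl u \<inter> insert x (N x) = {}"
proof (rule ccontr)
  assume ne: "cl u \<inter> insert x (N x) \<noteq> {}"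
  obtain a b c p q where r: "r5 x a b c p q" "d b = 6" "d c = 6" "d p = 6" "d q = 6"
    and a: "hub1 x \<longrightarrow> Bg x = {a}" "hub0 x \<longrightarrow> d a = 6" using hub_ring[OF h] by blast
  have N: "N x = {a, b, c, p, q}" "distinct [a, b, c, p, q]" "d x = 5" using r unfolding r5_def by auto
  have xV: "x \<in> V" using d5V N(3) by blast
  have aV: "a \<in> N x" "a \<in> V" using N NV by blast+
  have xn: "x \<notin> {a, b, c, p, q}" using irr[of x] N(1) by simp
  note r2 = r5_rot[OF r(1)] note r3 = r5_rot[OF r2] note r4 = r5_rot[OF r3] note r5' = r5_rot[OF r4]
  have seven: False if "insert x (N x) \<subseteq> cl u"
  proof -
    have "insert u (insert x (N x)) \<subseteq> cl u" using that cl_self by blast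
    then have "card (insert u (insert x (N x))) \<le> card (cl u)" using fin_cl[OF u(1)] by (rule card_mono[rotated])
    then show False using hub_closed(2)[OF h] cl_card[OF u(1)] u(2) finN by simp
  qed
  have na: "a \<notin> cl u"
  proof
    assume au: "a \<in> cl u"
    have xu: "x \<in> cl u" using absorb1[OF u(1), of a x] au aV N(3) by simp
    show False using seven ring_prop[OF r(1) u(1) xu au] r(2-5) xu au N(1) by auto
  qed
  obtain n where n: "n \<in> N x" "n \<in> cl u"
  proof (cases "x \<in> cl u")
    case True
    then have "N x \<inter> cl u \<noteq> {}" using cl_nbr u by blast
    then show ?thesis using that by blast
  next
    case False then show ?thesis using that ne by blast
  qed
  have xu: "x \<in> cl u" using absorb1[OF u(1), of n x] n N(3) by simp
  have lights: "{b, c, p, q} \<subseteq> cl u"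
  proof -
    have "n \<noteq> a" using n na by blast
    then have "n \<in> {b, c, p, q}" using n N(1) by simp
    then consider "n = b" | "n = c" | "n = p" | "n = q" by blast
    then show ?thesis
    proof cases
      case 1
      show ?thesis using ring_prop[OF r2 u(1) xu] n 1 r(2-5) by auto
    next
      case 2
      show ?thesis using ring_prop[OF r3 u(1) xu] ring_prop[OF r5_rev[OF r4] u(1) xu] n 2 r(2-5) by auto
    next
      case 3
      show ?thesis using ring_prop[OF r4 u(1) xu] ring_prop[OF r5_rev[OF r5'] u(1) xu] n 3 r(2-5) by auto
    next
      case 4
      show ?thesis using ring_prop[OF r5_rev[OF r(1)] u(1) xu] n 4 r(2-5) by auto
    qed
  qed
  show False
  proof (cases "hub0 x")
    case True
    then have "d a = 6" using a by blast
    then have "a \<in> cl u" using ring_prop(1)[OF r5' u(1) xu] lights by auto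
    then show False using na by blast
  next
    case False
    have un: "u \<notin> {x, b, c, p, q}" using u(2) N(1) by auto
    have cu: "cl u = set [u, x, b, c, p, q]"
      by (rule closure_six_eq[OF u(1)]) (use lights xu cl_self un xn N(2) in auto)
    \<comment> \<open>A 5-vertex adjacent to \<open>u\<close> would lie in \<open>cl u\<close>,
      where only \<open>x\<close> qualifies, and \<open>x\<close> is not adjacent to
      \<open>u\<close>.\<close>
    have "clsd {u}" unfolding clsd_def
    proof (intro conjI ballI)
      fix w assume w: "w \<in> V - {u}"
      show "5 \<le> card (N w - {u})"
      proof (cases "d w = 5 \<and> u \<in> N w")
        case True
        then have "w \<in> cl u" using absorb1[OF u(1), of u w] cl_self by simp
        then have "w = x" using cu True r(2-5) w by auto
        then show ?thesis using True u(2) by blast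
      next
        case False
        then have "u \<notin> N w \<or> 6 \<le> d w" using d5[of w] w by auto
        then show ?thesis using finN[of w] deg5[of w] w by (auto simp: d_def card_Diff_singleton_if)
      qed
    qed (use u in simp)
    then have "cl u \<subseteq> {u}" by (rule cl_least) simp
    moreover have "x \<noteq> u" using u(2) by auto
    ultimately show False using xu by auto
  qed
qed

text \<open>Another 5-vertex next to \<open>n\<close> would lie outside the closed star and have a
  contact with it, which needs degree at least 6.\<close>

lemma hub_five:
  assumes "hub x" "n \<in> N x" "d n = 6" "y \<in> N n" "d y = 5"
  shows "y = x"
proof (rule ccontr)
  assume ne: "y \<noteq> x"
  have "y \<notin> N x" using assms(1,5) unfolding hub_def hub0_def hub1_def P5_def by blast
  then have "y \<notin> insert x (N x)" using ne by blast
  moreover have "y \<in> V" using assms(5) d5V by blast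
  moreover have "{n} \<subseteq> N y \<inter> insert x (N x)" using assms(2,4) symN by blast
  ultimately have "5 + card {n} \<le> d y" using contacts[OF hub_closed(1)[OF assms(1)]] by blast
  then show False using assms(5) by simp
qed

text \<open>A vertex across a rim edge that were itself on the rim would produce a vertex of degree
  3 if it is next to that edge; if it is the opposite vertex \<open>b\<close>, the link of
  \<open>b\<close>, which has degree 6, leads to degree 3 or to a \<open>K5\<close>.\<close>

lemma corner_outside:
  assumes r: "r5 x n m a b c" and dd: "d b = 6" and u: "F u n m" "u \<noteq> x"
  shows "u \<notin> insert x (N x)"
proof
  assume "u \<in> insert x (N x)"
  have N: "N x = {n, m, a, b, c}" "distinct [n, m, a, b, c]"
    and Fx: "F x n m" "F x m a" "F x a b" "F x b c" "F x c n" using r5D[OF r] by blast+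
  note P = F_perm[OF Fx(1)] F_perm[OF Fx(2)] F_perm[OF Fx(3)] F_perm[OF Fx(4)] F_perm[OF Fx(5)] F_perm[OF u(1)]
  have xn: "x \<notin> {n, m, a, b, c}" using irr[of x] N(1) by simp
  have un: "u \<noteq> n" "u \<noteq> m" using F_dist[OF u(1)] by auto
  then consider "u = a" | "u = b" | "u = c" using \<open>u \<in> insert x (N x)\<close> N(1) u(2) by blast
  then show False
  proof cases
    case 1
    show False using not_degree_3[of m x n a] P 1 N(2) xn by auto
  next
    case 3
    show False using not_degree_3[of n x m c] P 3 N(2) xn by auto
  next
    case 2
    have "F b a x" "F b x c" "a \<noteq> c" using P N(2) by auto
    then obtain s t w where rb: "r6 b a x c s t w" using r6_mid dd by blast
    have Nb: "N b = {a, x, c, s, t, w}" "distinct [a, x, c, s, t, w]"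
      and Fb: "F b c s" "F b s t" "F b t w" "F b w a" using r6D[OF rb] by blast+
    note Pb = F_perm[OF Fb(1)] F_perm[OF Fb(2)] F_perm[OF Fb(3)] F_perm[OF Fb(4)]
    have bnm: "F b n m" using u 2 by simp
    have nm: "n \<in> {s, t, w}" "m \<in> {s, t, w}" using F_adj[OF bnm] Nb N(2) xn by auto
    have th: "y = s \<or> y = w" if "F b t y" for y
      using F_third[of b t s w y] that Pb Nb(2) F_swap by auto
    have sc: "y = c \<or> y = t" if "F b s y" for y
      using F_third[of b s c t y] that Pb Nb(2) F_swap by auto
    have wc: "y = t \<or> y = a" if "F b w y" for y
      using F_third[of b w t a y] that Pb Nb(2) F_swap by auto
    have cases: "n = s \<and> m = t \<or> n = t \<and> m = s \<or> n = t \<and> m = w \<or> n = w \<and> m = t"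
      using nm th[of m] th[of n] sc[of m] wc[of m] bnm F_swap[OF bnm] Nb(2) N(2) by auto
    note adj = F_adj[OF Fx(1)] F_adj[OF Fx(2)] F_adj[OF Fx(3)] F_adj[OF Fx(4)] F_adj[OF Fx(5)] F_adj[OF bnm]
      F_adj[OF Fb(1)] F_adj[OF Fb(4)]
    from cases consider "n = s" "m = t" | "n = t" "m = s" | "n = t" "m = w" | "n = w" "m = t" by blast
    then show False
    proof cases
      case 1
      then show False using not_degree_3[of c x n b] P Pb N(2) xn by auto
    next
      case 2
      then show False using K5[of x n m c b] adj N(2) xn by auto
    next
      case 3
      then show False using not_degree_3[of a x m b] P Pb N(2) xn by auto
    next
      case 4
      then show False using K5[of x n m a b] adj N(2) xn by auto
    qed
  qed
qed

text \<open>\<open>CP x n\<close>: the rim pair \<open>n\<close>, \<open>nx x n\<close> of the hub \<open>x\<close> claims one unit from the vertex on the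
  other side of the edge between them; \<open>cor u\<close> lists the pairs for which \<open>u\<close> is that vertex.\<close>

definition CP :: "'a \<Rightarrow> 'a \<Rightarrow> bool" where
  "CP x n \<longleftrightarrow> n \<in> N x \<and> (hub0 x \<or> hub1 x \<and> (\<exists>v. Bg x = {v} \<and> n \<noteq> v \<and> nx x n \<noteq> v \<and>
     (nx x v = n \<or> nx x (nx x n) = v)))"

definition cor :: "'a \<Rightarrow> 'a set" where
  "cor u = {m \<in> N u. CP (nx (nx u m) m) (nx u m)}"

definition z :: "'a \<Rightarrow> nat" where "z u = card (cor u)"

definition C56 :: "'a \<Rightarrow> 'a set" where "C56 v = {c \<in> cl v - {v}. d c \<le> 6}"

text \<open>Each \<open>v\<close> of degree at least 7 has \<open>10 * (d v - 6)\<close> half units of charge, and gives \<open>pay v c\<close> half units to every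
  \<open>c\<close> of degree 5 or 6 in its closure, besides one unit per corner. The reduced payments of overflowing vertices keep
  a vertex of degree 7 within its budget.\<close>

definition ovf :: "'a \<Rightarrow> bool" where
  "ovf v \<longleftrightarrow> d v = 7 \<and> 1 \<le> z v \<and> 6 \<le> card (C56 v) + z v"

definition pay :: "'a \<Rightarrow> 'a \<Rightarrow> nat" where
  "pay v c = (if d v = 7 then (if c \<in> N v \<or> \<not> ovf v then 2 else 1)
              else if d v = 8 then (if c \<in> N v then 4 else 2) else 4)"

section \<open>Corners and the budget of the vertices of degree at least 7\<close>

lemma corE:
  assumes "m \<in> cor u"
  shows "\<exists>x a b c. hub x \<and> r5 x (nx u m) m a b c \<and> nx x (nx u m) = m \<and> d (nx u m) = 6 \<and> d m = 6 \<and> d b = 6 \<and>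
    F u m (nx u m) \<and> u \<noteq> x \<and> u \<notin> insert x (N x) \<and> 5 + card (N u \<inter> N x) \<le> d u"
proof -
  define n where "n = nx u m"
  define x where "x = nx n m"
  have m: "m \<in> N u" "CP x n" using assms unfolding cor_def n_def x_def by auto
  have f1: "n \<in> N u" "n \<in> N m" "nx n u = m" "nx m n = u" using face[OF m(1)] unfolding n_def by auto
  have mn: "m \<in> N n" using f1(2) symN by blast
  have f2: "x \<in> N n" "x \<in> N m" "nx x n = m" "nx m x = n" using face[OF mn] unfolding x_def by auto
  have Fxnm: "F x n m" unfolding F_def using f2 symN by blast
  have Fumn: "F u m n" unfolding F_def using f1 m(1) n_def by simp
  have h: "hub x" using m(2) unfolding CP_def hub_def by blast
  have dx: "d x = 5" using h unfolding hub_def hub0_def hub1_def by auto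
  obtain a b c where r: "r5 x n m a b c" using r5_ex[OF Fxnm dx] by blast
  note R = r5D[OF r]
  \<comment> \<open>\<open>u\<close> and \<open>x\<close> are the apexes of the two faces at one
    edge.\<close>
  have ux: "u \<noteq> x"
  proof
    assume "u = x"
    then have "nx m n = nx n m" using f1(4) x_def by simp
    then show False using apex_two(2)[OF mn] by simp
  qed
  have six: "y \<in> N x \<Longrightarrow> y \<notin> Bg x \<Longrightarrow> d y = 6" for y
    using h P5_T6_Bg(1)[of x] unfolding hub_def hub0_def hub1_def T6_def by blast
  have all6: "d n = 6 \<and> d m = 6 \<and> d b = 6"
  proof (cases "hub0 x")
    case True
    then show ?thesis using six R(2) unfolding hub0_def by auto
  next
    case False
    \<comment> \<open>The pair claimed by such a hub lies next to its large neighbour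
      \<open>v\<close>, so \<open>v\<close> is not the vertex \<open>b\<close> opposite to the pair;
      \<open>corner_outside\<close> requires degree 6 for \<open>b\<close>.\<close>
    then obtain v where v: "Bg x = {v}" "n \<noteq> v" "m \<noteq> v" "nx x v = n \<or> nx x m = v"
      using m(2) f2(3) unfolding CP_def by auto
    have vN: "v \<in> N x" using v(1) unfolding Bg_def by blast
    have "F x v n \<or> F x m v" using v(4) vN R(2) f2 unfolding F_def by (metis insertCI)
    then have "v = c \<or> v = a"
    proof
      assume "F x v n"
      then have "v = m \<or> v = c" using F_third[of x n m c v] R(3,4,8) F_swap by auto
      then show ?thesis using v by blast
    next
      assume "F x m v"
      then have "v = n \<or> v = a" using F_third[of x m n a v] R(3,4,5) F_swap by auto
      then show ?thesis using v by blast
    qed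
    then have "b \<noteq> v" using R(3) by auto
    then show ?thesis using six v R(2) by auto
  qed
  have out: "u \<notin> insert x (N x)" using corner_outside[OF r _ F_swap[OF Fumn] ux] all6 by simp
  have uV: "u \<in> V" using NV m(1) by blast
  have "5 + card (N u \<inter> N x) \<le> d u" by (rule contacts[OF hub_closed(1)[OF h] uV out]) blast
  then show ?thesis using h r f2(3) all6 Fumn ux out unfolding n_def[symmetric] by blast
qed

text \<open>The corner vertices have degree 6, so \<open>u\<close> together with such a
  \<open>y\<close> would absorb one of them; but the closure of a vertex outside the star of a hub
  does not meet the star.\<close>

lemma cor_not_cl:
  assumes "m \<in> cor u" "y \<in> N m \<or> y \<in> N (nx u m)" "y \<noteq> u" "u \<in> V"
  shows "y \<notin> cl u"
proof
  assume y: "y \<in> cl u"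
  obtain x where x: "hub x" "m \<in> N x" "nx u m \<in> N x" "d m = 6" "d (nx u m) = 6" "F u m (nx u m)" "u \<notin> insert x (N x)"
    using corE[OF assms(1)] r5D(2) by (metis insertCI)
  have "m \<in> cl u \<or> nx u m \<in> cl u"
    using assms(2)
  proof
    assume "y \<in> N m"
    then show ?thesis using absorb2[OF assms(4), of u m y] F_adj[OF x(6)] y x(4) assms(3) cl_self by auto
  next
    assume "y \<in> N (nx u m)"
    then show ?thesis using absorb2[OF assms(4), of u "nx u m" y] F_adj[OF x(6)] y x(5) assms(3) cl_self by auto
  qed
  then show False using hub_disjoint[OF x(1) assms(4) x(7)] x(2,3) by blast
qed

text \<open>A proper part of a cycle is not closed under the successor.\<close>

lemma nx_image_grow:
  assumes A: "A \<subseteq> N u" "A \<noteq> {}" "A \<union> nx u ` A \<noteq> N u"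
  shows "card A + 1 \<le> card (A \<union> nx u ` A)"
proof -
  have fin: "finite A" using A(1) finN finite_subset by blast
  have "\<not> nx u ` A \<subseteq> A"
  proof
    assume s: "nx u ` A \<subseteq> A"
    then have "A = N u" using link_closed[of A u] A by blast
    then show False using A(3) s by blast
  qed
  then have "A \<subset> A \<union> nx u ` A" by blast
  then show ?thesis using psubset_card_mono[of "A \<union> nx u ` A" A] fin by simp
qed

lemma nx_bij: "bij_betw (nx u) (N u) (N u)"
proof -
  have "inj_on (nx u) (N u)" using nx_inj by (auto simp: inj_on_def)
  moreover have "nx u ` N u \<subseteq> N u" using face by blast
  ultimately show ?thesis using finN by (simp add: bij_betw_def endo_inj_surj)
qed

definition Rd :: "'a \<Rightarrow> 'a set" where "Rd u = N u \<inter> cl u"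

text \<open>Consecutive corners at \<open>v\<close> share a rim vertex of degree 6, whose only
  5-neighbour is the hub, so both belong to one hub. Then \<open>v\<close> has three contacts with
  the closed star and hence degree at least 8.\<close>

lemma cor_disj: assumes "d v = 7" shows "cor v \<inter> nx v ` cor v = {}"
proof (rule ccontr)
  assume "cor v \<inter> nx v ` cor v \<noteq> {}"
  then obtain m where m: "m \<in> cor v" "nx v m \<in> cor v" by blast
  have mN: "m \<in> N v" using m unfolding cor_def by blast
  obtain x a b c where x: "hub x" "r5 x (nx v m) m a b c" "d (nx v m) = 6" "5 + card (N v \<inter> N x) \<le> d v"
    using corE[OF m(1)] by blast
  obtain x' a' b' c' where x': "hub x'" "r5 x' (nx v (nx v m)) (nx v m) a' b' c'"
    using corE[OF m(2)] by blast
  have "x' \<in> N (nx v m)" "d x' = 5" using F_adj[OF r5D(4)[OF x'(2)]] r5D(1)[OF x'(2)] by auto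
  then have "x' = x" using hub_five[OF x(1) _ x(3)] r5D(2)[OF x(2)] by auto
  then have "{m, nx v m, nx v (nx v m)} \<subseteq> N v \<inter> N x"
    using r5D(2)[OF x(2)] r5D(2)[OF x'(2)] mN face by auto
  moreover have "card {m, nx v m, nx v (nx v m)} = 3"
  proof -
    have "m \<noteq> nx v m" "nx v m \<noteq> nx v (nx v m)" using r5D(3)[OF x(2)] r5D(3)[OF x'(2)] by auto
    moreover have "m \<noteq> nx v (nx v m)"
    proof
      assume e: "m = nx v (nx v m)"
      have "nx (nx v m) v = m" using face[OF mN] by blast
      then have "nx v (nx v m) = nx (nx v m) v" using e by simp
      then show False using apex_two(2)[of "nx v m" v] face[OF mN] by blast
    qed
    ultimately show ?thesis by simp
  qed
  ultimately have "3 \<le> card (N v \<inter> N x)" using finN by (metis card_mono finite_Int)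
  then show False using x(4) assms by simp
qed

text \<open>\<open>Rd u\<close> keeps away from corner edges: its successors miss
  \<open>cor u\<close> and the first three images of \<open>cor u\<close> under \<open>nx u\<close>.
  Each image adds at least one vertex, which explains the 3; for degree 7 the first image is even
  disjoint from \<open>cor u\<close>.\<close>

lemma load_R:
  assumes u: "u \<in> V" and z1: "1 \<le> z u" and R: "Rd u \<noteq> {}"
  shows "card (Rd u) + z u + 3 \<le> d u"
    and "d u = 7 \<Longrightarrow> card (Rd u) + 2 * z u \<le> 5"
proof -
  let ?f = "nx u"
  let ?Z = "cor u"
  have ZN: "?Z \<subseteq> N u" unfolding cor_def by blast
  have Zne: "?Z \<noteq> {}" using z1 unfolding z_def by auto
  have fN: "?f ` A \<subseteq> N u" if "A \<subseteq> N u" for A using face that by blast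
  define A1 where "A1 = ?Z \<union> ?f ` ?Z"
  define A2 where "A2 = A1 \<union> ?f ` A1"
  define A3 where "A3 = A2 \<union> ?f ` A2"
  have sub: "A1 \<subseteq> N u" "A2 \<subseteq> N u" "A3 \<subseteq> N u" unfolding A1_def A2_def A3_def using ZN fN by (meson Un_least)+
  have fR: "?f ` Rd u \<inter> A3 = {}"
  proof (rule ccontr)
    assume "?f ` Rd u \<inter> A3 \<noteq> {}"
    then obtain r where r: "r \<in> Rd u" "?f r \<in> A3" by blast
    have rN: "r \<in> N u" "r \<in> cl u" "r \<noteq> u" using r(1) irr unfolding Rd_def by auto
    have "?f r \<in> ?Z \<or> r \<in> ?Z \<or> (\<exists>m\<in>?Z. r = ?f m) \<or> (\<exists>m\<in>?Z. r = ?f (?f m))"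
    proof -
      have "A3 = ?Z \<union> ?f ` ?Z \<union> ?f ` ?f ` ?Z \<union> ?f ` ?f ` ?f ` ?Z"
        unfolding A3_def A2_def A1_def by blast
      then consider "?f r \<in> ?Z" | m where "m \<in> ?Z" "?f r = ?f m" | m where "m \<in> ?Z" "?f r = ?f (?f m)"
        | m where "m \<in> ?Z" "?f r = ?f (?f (?f m))" using r(2) by blast
      then show ?thesis
      proof cases
        case 2
        then show ?thesis using nx_inj[OF rN(1), of m] ZN by blast
      next
        case 3
        then have "r = ?f m" using nx_inj[OF rN(1), of "?f m"] face ZN by blast
        then show ?thesis using 3 by blast
      next
        case 4
        then have "r = ?f (?f m)" using nx_inj[OF rN(1), of "?f (?f m)"] face ZN by blast
        then show ?thesis using 4 by blast
      qed blast
    qed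
    then consider "?f r \<in> ?Z" | "r \<in> ?Z" | m where "m \<in> ?Z" "r = ?f m" | m where "m \<in> ?Z" "r = ?f (?f m)" by blast
    then show False
    proof cases
      case 1
      have "r \<in> N (?f r)" using face[OF rN(1)] symN by blast
      then show False using cor_not_cl[OF 1 _ rN(3) u] rN(2) by blast
    next
      case 2
      have "r \<in> N (?f r)" using face[OF rN(1)] symN by blast
      then show False using cor_not_cl[OF 2 _ rN(3) u] rN(2) by blast
    next
      case 3
      then have "m \<in> N u" using ZN by blast
      then have "r \<in> N m" using face 3 by blast
      then show False using cor_not_cl[OF 3(1) _ rN(3) u] rN(2) by blast
    next
      case 4
      then have "?f m \<in> N u" using ZN face by blast
      then have "r \<in> N (?f m)" using face 4 by blast
      then show False using cor_not_cl[OF 4(1) _ rN(3) u] rN(2) by blast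
    qed
  qed
  have RN: "Rd u \<subseteq> N u" unfolding Rd_def by blast
  have cR: "card (?f ` Rd u) = card (Rd u)"
    using nx_inj RN by (intro card_image) (auto simp: inj_on_def)
  have tot: "card (Rd u) + card A3 \<le> d u"
  proof -
    have "card (?f ` Rd u \<union> A3) = card (?f ` Rd u) + card A3"
      using fR finite_subset[OF fN[OF RN] finN] finite_subset[OF sub(3) finN] by (intro card_Un_disjoint)
    moreover have "card (?f ` Rd u \<union> A3) \<le> card (N u)"
      using finN fN[OF RN] sub(3) by (intro card_mono) auto
    ultimately show ?thesis using cR by (simp add: d_def)
  qed
  have ne3: "A3 \<noteq> N u" using fR R fN[OF RN] by blast
  have ne2: "A2 \<noteq> N u" using ne3 sub(3) unfolding A3_def by blast
  have ne1: "A1 \<noteq> N u" using ne2 sub(2) unfolding A2_def by blast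
  have nem: "A1 \<noteq> {}" "A2 \<noteq> {}" using Zne unfolding A1_def A2_def by auto
  have g3: "card A2 + 1 \<le> card A3" unfolding A3_def by (rule nx_image_grow) (use sub nem ne3 A3_def in auto)
  have g2: "card A1 + 1 \<le> card A2" unfolding A2_def by (rule nx_image_grow) (use sub nem ne2 A2_def in auto)
  have g1: "card ?Z + 1 \<le> card A1" unfolding A1_def by (rule nx_image_grow) (use ZN Zne ne1 A1_def in auto)
  show "card (Rd u) + z u + 3 \<le> d u" using tot g1 g2 g3 unfolding z_def by linarith
  assume d7: "d u = 7"
  note dis = cor_disj[OF d7]
  have "card A1 = card ?Z + card (?f ` ?Z)" unfolding A1_def
    using dis finite_subset[OF ZN finN] by (intro card_Un_disjoint) auto
  moreover have "card (?f ` ?Z) = card ?Z" using nx_inj ZN by (intro card_image) (auto simp: inj_on_def)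
  ultimately have "card A1 = 2 * z u" by (simp add: z_def)
  then show "card (Rd u) + 2 * z u \<le> 5" using tot g2 g3 d7 by linarith
qed

lemma z_le_d: "z u \<le> d u"
  unfolding z_def d_def cor_def using finN by (intro card_mono) auto

lemma C56_fin: "v \<in> V \<Longrightarrow> finite (C56 v)" unfolding C56_def using fin_cl by simp

lemma C56_card: assumes "v \<in> V" shows "card (C56 v) \<le> 5"
proof -
  have "card (C56 v) \<le> card (cl v - {v})" unfolding C56_def using fin_cl[OF assms] by (intro card_mono) auto
  also have "\<dots> \<le> 5" using cl_card[OF assms] cl_self[of v] fin_cl[OF assms] by simp
  finally show ?thesis .
qed

text \<open>Degree 7 has a budget of 10 and at most five recipients. Without overflow, two half
  units for every recipient and corner fit. With overflow, the payments amount to the number of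
  recipients plus the number of adjacent ones, and \<open>load_R\<close> bounds the latter plus
  twice the corners by 5. Degree 8 balances similarly against 20, and from degree 9 on the budget
  outgrows the corners.\<close>

lemma load:
  assumes v: "big v"
  shows "(\<Sum>c\<in>C56 v. pay v c) + 2 * z v \<le> 10 * (d v - 6)"
proof -
  have vV: "v \<in> V" and d7: "7 \<le> d v" using v unfolding big_def by auto
  define R where "R = C56 v \<inter> N v"
  have fin: "finite (C56 v)" using C56_fin[OF vV] .
  have c5: "card (C56 v) \<le> 5" using C56_card[OF vV] .
  have RRd: "R \<subseteq> Rd v" unfolding R_def Rd_def C56_def by blast
  have finRd: "finite (Rd v)" unfolding Rd_def using finN by simp
  have cR: "card R \<le> card (Rd v)" using RRd finRd by (rule card_mono[rotated])
  have cRC: "card R \<le> card (C56 v)" unfolding R_def using fin by (intro card_mono) auto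
  have sum: "(\<Sum>c\<in>C56 v. pay v c) = p * card R + q * (card (C56 v) - card R)"
    if "\<And>c. c \<in> N v \<Longrightarrow> pay v c = p" "\<And>c. c \<notin> N v \<Longrightarrow> pay v c = q" for p q
  proof -
    have "(\<Sum>c\<in>C56 v. pay v c) = (\<Sum>c\<in>R. pay v c) + (\<Sum>c\<in>C56 v - R. pay v c)"
      using fin by (simp add: R_def sum.subset_diff[of "C56 v \<inter> N v" "C56 v"])
    also have "(\<Sum>c\<in>R. pay v c) = (\<Sum>c\<in>R. p)" using that(1) by (intro sum.cong) (auto simp: R_def)
    also have "(\<Sum>c\<in>C56 v - R. pay v c) = (\<Sum>c\<in>C56 v - R. q)" using that(2) by (intro sum.cong) (auto simp: R_def)
    finally have "(\<Sum>c\<in>C56 v. pay v c) = p * card R + q * card (C56 v - R)" by (simp add: mult.commute)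
    moreover have "card (C56 v - R) = card (C56 v) - card R" unfolding R_def using fin by (intro card_Diff_subset) auto
    ultimately show ?thesis by simp
  qed
  \<comment> \<open>Without a neighbour in its closure \<open>v\<close> pays for corners
    only.\<close>
  have Cempty: "card (C56 v) = 0" if "Rd v = {}"
  proof -
    have "cl v = {v}" using cl_trivial[OF vV] that unfolding Rd_def by blast
    then show ?thesis unfolding C56_def by simp
  qed
  consider "d v = 7" | "d v = 8" | "9 \<le> d v" using d7 by linarith
  then show ?thesis
  proof cases
    case 1
    show ?thesis
    proof (cases "ovf v")
      case False
      have "(\<Sum>c\<in>C56 v. pay v c) = 2 * card R + 2 * (card (C56 v) - card R)"
        by (rule sum) (use 1 False in \<open>auto simp: pay_def\<close>)
      then have "(\<Sum>c\<in>C56 v. pay v c) = 2 * card (C56 v)" using cRC by linarith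
      moreover have "card (C56 v) + z v \<le> 5" using False 1 c5 unfolding ovf_def by linarith
      ultimately show ?thesis using 1 by linarith
    next
      case True
      then have z1: "1 \<le> z v" unfolding ovf_def by blast
      have s: "(\<Sum>c\<in>C56 v. pay v c) = 2 * card R + 1 * (card (C56 v) - card R)"
        by (rule sum) (use 1 True in \<open>auto simp: pay_def\<close>)
      show ?thesis
      proof (cases "Rd v = {}")
        case T: True
        have "z v \<le> 3"
        proof (rule ccontr)
          assume "\<not> z v \<le> 3"
          note dis = cor_disj[OF 1]
          have ZN: "cor v \<subseteq> N v" unfolding cor_def by blast
          have "card (cor v \<union> nx v ` cor v) = card (cor v) + card (nx v ` cor v)"
            using dis finite_subset[OF ZN finN] by (intro card_Un_disjoint) auto
          moreover have "card (nx v ` cor v) = card (cor v)" using nx_inj ZN by (intro card_image) (auto simp: inj_on_def)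
          moreover have "card (cor v \<union> nx v ` cor v) \<le> card (N v)"
            using finN ZN face by (intro card_mono) auto
          ultimately show False using 1 \<open>\<not> z v \<le> 3\<close> unfolding z_def d_def by linarith
        qed
        then show ?thesis using Cempty[OF T] s 1 cRC by simp
      next
        case F: False
        then show ?thesis using load_R(2)[OF vV z1 F 1] s c5 cR cRC 1 by linarith
      qed
    qed
  next
    case 2
    have s: "(\<Sum>c\<in>C56 v. pay v c) = 4 * card R + 2 * (card (C56 v) - card R)"
      by (rule sum) (use 2 in \<open>auto simp: pay_def\<close>)
    show ?thesis
    proof (cases "Rd v = {} \<or> z v = 0")
      case True
      then show ?thesis
      proof
        assume "Rd v = {}"
        then show ?thesis using Cempty s 2 cRC z_le_d[of v] by simp
      qed (use s 2 c5 cRC in linarith)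
    next
      case False
      then show ?thesis using load_R(1)[OF vV] s c5 cR cRC 2 by force
    qed
  next
    case 3
    have s: "(\<Sum>c\<in>C56 v. pay v c) = 4 * card R + 4 * (card (C56 v) - card R)"
      by (rule sum) (use 3 in \<open>auto simp: pay_def\<close>)
    show ?thesis
    proof (cases "Rd v = {} \<or> z v = 0")
      case True
      then show ?thesis
      proof
        assume "Rd v = {}"
        then show ?thesis using Cempty s 3 cRC z_le_d[of v] by simp
      qed (use s 3 c5 cRC in linarith)
    next
      case False
      then have "1 \<le> card (Rd v)" using finRd by (simp add: Suc_leI card_gt_0_iff)
      moreover have "card (Rd v) + z v + 3 \<le> d v" using load_R(1)[OF vV] False by auto
      ultimately show ?thesis using s c5 cRC 3 by linarith
    qed
  qed
qed

section \<open>Growing closures step by step\<close>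

lemma r5_adj: assumes "r5 x a b c p q"
  shows "d x = 5 \<and> x \<in> V \<and> a \<in> V \<and> b \<in> V \<and> c \<in> V \<and> p \<in> V \<and> q \<in> V"
    "a \<in> N x \<and> b \<in> N x \<and> c \<in> N x \<and> p \<in> N x \<and> q \<in> N x \<and> x \<in> N a \<and> x \<in> N b \<and> x \<in> N c \<and> x \<in> N p \<and> x \<in> N q"
    "b \<in> N a \<and> a \<in> N b \<and> c \<in> N b \<and> b \<in> N c \<and> p \<in> N c \<and> c \<in> N p \<and> q \<in> N p \<and> p \<in> N q \<and> a \<in> N q \<and> q \<in> N a"
    "distinct [x, a, b, c, p, q]"
proof -
  note R = r5D[OF assms]
  note A = F_adj[OF R(4)] F_adj[OF R(5)] F_adj[OF R(6)] F_adj[OF R(7)] F_adj[OF R(8)]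
  show "d x = 5 \<and> x \<in> V \<and> a \<in> V \<and> b \<in> V \<and> c \<in> V \<and> p \<in> V \<and> q \<in> V"
    using R(1) F_V[OF R(4)] F_V[OF R(5)] F_V[OF R(6)] F_V[OF R(7)] by simp
  show "a \<in> N x \<and> b \<in> N x \<and> c \<in> N x \<and> p \<in> N x \<and> q \<in> N x \<and> x \<in> N a \<and> x \<in> N b \<and> x \<in> N c \<and> x \<in> N p \<and> x \<in> N q"
    using A by simp
  show "b \<in> N a \<and> a \<in> N b \<and> c \<in> N b \<and> b \<in> N c \<and> p \<in> N c \<and> c \<in> N p \<and> q \<in> N p \<and> p \<in> N q \<and> a \<in> N q \<and> q \<in> N a"
    using A by simp
  show "distinct [x, a, b, c, p, q]" using R(3,10) by simp
qed

lemma r6_adj: assumes "r6 x a b c p q r"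
  shows "d x = 6 \<and> x \<in> V \<and> a \<in> V \<and> b \<in> V \<and> c \<in> V \<and> p \<in> V \<and> q \<in> V \<and> r \<in> V"
    "a \<in> N x \<and> b \<in> N x \<and> c \<in> N x \<and> p \<in> N x \<and> q \<in> N x \<and> r \<in> N x \<and>
     x \<in> N a \<and> x \<in> N b \<and> x \<in> N c \<and> x \<in> N p \<and> x \<in> N q \<and> x \<in> N r"
    "b \<in> N a \<and> a \<in> N b \<and> c \<in> N b \<and> b \<in> N c \<and> p \<in> N c \<and> c \<in> N p \<and> q \<in> N p \<and> p \<in> N q \<and> r \<in> N q \<and> q \<in> N r
     \<and> a \<in> N r \<and> r \<in> N a"
    "distinct [x, a, b, c, p, q, r]"
proof -
  note R = r6D[OF assms]
  note A = F_adj[OF R(4)] F_adj[OF R(5)] F_adj[OF R(6)] F_adj[OF R(7)] F_adj[OF R(8)] F_adj[OF R(9)]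
  show "d x = 6 \<and> x \<in> V \<and> a \<in> V \<and> b \<in> V \<and> c \<in> V \<and> p \<in> V \<and> q \<in> V \<and> r \<in> V"
    using R(1) F_V[OF R(4)] F_V[OF R(5)] F_V[OF R(6)] F_V[OF R(7)] F_V[OF R(8)] by simp
  show "a \<in> N x \<and> b \<in> N x \<and> c \<in> N x \<and> p \<in> N x \<and> q \<in> N x \<and> r \<in> N x \<and>
     x \<in> N a \<and> x \<in> N b \<and> x \<in> N c \<and> x \<in> N p \<and> x \<in> N q \<and> x \<in> N r"
    using A by simp
  show "b \<in> N a \<and> a \<in> N b \<and> c \<in> N b \<and> b \<in> N c \<and> p \<in> N c \<and> c \<in> N p \<and> q \<in> N p \<and> p \<in> N q \<and> r \<in> N q \<and> q \<in> N r
     \<and> a \<in> N r \<and> r \<in> N a"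
    using A by simp
  show "distinct [x, a, b, c, p, q, r]" using R(3,11) by simp
qed

text \<open>All orders of the corners of a face at once, ready for rewriting.\<close>

definition F6 :: "'a \<Rightarrow> 'a \<Rightarrow> 'a \<Rightarrow> bool" where
  "F6 x y t \<longleftrightarrow> F x y t \<and> F x t y \<and> F y x t \<and> F y t x \<and> F t x y \<and> F t y x"

lemma F6: "F x y t \<Longrightarrow> F6 x y t" unfolding F6_def using F_perm by blast

lemma r5_faces: assumes "r5 x a b c p q"
  shows "F6 x a b \<and> F6 x b c \<and> F6 x c p \<and> F6 x p q \<and> F6 x q a"
  using r5D[OF assms] F6 by blast

lemma r6_faces: assumes "r6 x a b c p q r"
  shows "F6 x a b \<and> F6 x b c \<and> F6 x c p \<and> F6 x p q \<and> F6 x q r \<and> F6 x r a"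
  using r6D[OF assms] F6 by blast

text \<open>\<open>chain S steps\<close>: the vertices listed in \<open>steps\<close> can be added to a closed set containing \<open>S\<close> one
  after another, each because of the listed neighbours.\<close>

fun chain :: "'a list \<Rightarrow> ('a \<times> 'a list) list \<Rightarrow> bool" where
  "chain S [] \<longleftrightarrow> True"
| "chain S ((u, cs) # r) \<longleftrightarrow> set cs \<subseteq> set S \<and> set cs \<subseteq> N u \<and> cs \<noteq> [] \<and> distinct cs \<and> d u \<le> 4 + length cs \<and> chain (u # S) r"

lemma chain_cl: assumes "v \<in> V" "chain S steps" "set S \<subseteq> cl v" shows "set (map fst steps) \<subseteq> cl v"
  using assms(2,3)
proof (induction S steps rule: chain.induct)
  case (2 S u cs r)
  have "u \<in> cl v"
  proof (rule ccontr)
    assume n: "u \<notin> cl v"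
    have "hd cs \<in> N u" using 2(2) by auto
    then have "u \<in> V" using NV by blast
    then have "5 + card (set cs) \<le> d u" using contacts_cl[OF assms(1) _ n, of "set cs"] 2(2,3) by auto
    then show False using 2(2) distinct_card[of cs] by auto
  qed
  then show ?case using 2 by auto
qed simp

lemma cl_chain: assumes "v \<in> V" "chain [v] steps" shows "set (v # map fst steps) \<subseteq> cl v"
  using chain_cl[OF assms] cl_self by auto

text \<open>The standard contradiction of the case analysis: six absorptions after \<open>v\<close>
  make seven vertices in a closure.\<close>

lemma explode:
  assumes "v \<in> V" "chain [v] steps" "distinct (v # map fst steps)" "length steps = 6"
  shows False
  using closure_not_seven[OF assms(1) cl_chain[OF assms(1,2)] assms(3)] assms(4) by simp

lemma saturate:
  assumes "v \<in> V" "chain [v] steps" "distinct (v # map fst steps)" "length steps = 5"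
  shows "cl v = set (v # map fst steps)"
  using closure_six_eq[OF assms(1) cl_chain[OF assms(1,2)] assms(3)] assms(4) by simp

text \<open>Five absorptions fill the closure of \<open>v\<close>, so it is known exactly and a
  vertex not listed is outside. This is the source of large degrees, and so of payments, in the case
  analysis.\<close>

lemma outside:
  assumes "v \<in> V" "chain [v] steps" "distinct (v # map fst steps)" "length steps = 5"
    "w \<notin> set (v # map fst steps)" "set cs \<subseteq> N w" "set cs \<subseteq> set (v # map fst steps)" "distinct cs" "cs \<noteq> []"
  shows "5 + length cs \<le> d w"
proof -
  have "hd cs \<in> N w" using assms by auto
  then have "w \<in> V" using NV by blast
  moreover note saturate[OF assms(1-4)]
  ultimately show ?thesis using contacts_cl[of v w "set cs"] assms distinct_card[of cs] by auto
qed

text \<open>5-neighbours of \<open>u\<close> lie in \<open>cl u\<close>, hence are not adjacent to a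
  corner edge and sit on the three middle positions of the link. One of the two is extreme there.
  The link vertex between it and the corner edge absorbs both 5-vertices, then \<open>u\<close> by
  three contacts, then a corner vertex. But this vertex lies in the star of a hub that a closure
  started outside cannot meet.\<close>

lemma overflow_lonely:
  assumes d7: "d u = 7" and z1: "1 \<le> z u" and y: "y1 \<in> N u" "y2 \<in> N u" "y1 \<noteq> y2" "d y1 = 5" "d y2 = 5"
    and m: "y2 \<in> cl y1" "y1 \<in> cl y2"
  shows False
proof -
  obtain m0 where m0: "m0 \<in> cor u" using z1 unfolding z_def by (metis card.empty ex_in_conv not_one_le_zero)
  have mN: "m0 \<in> N u" using m0 unfolding cor_def by blast
  have uV: "u \<in> V" using NV y by blast
  obtain x where x: "hub x" "m0 \<in> N x" "nx u m0 \<in> N x" "d m0 = 6" "d (nx u m0) = 6" "u \<notin> insert x (N x)"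
    and cnt: "5 + card (N u \<inter> N x) \<le> d u"
    using corE[OF m0] r5D(2) by (metis insertCI)
  obtain xs where xs: "rg u xs" "xs ! 0 = m0" "xs ! 1 = nx u m0" using rg_exists[OF mN] by blast
  have "length xs = 7" using rg_length[OF xs(1)] d7 by simp
  then obtain a2 a3 a4 a5 a6 where e: "xs = [m0, nx u m0, a2, a3, a4, a5, a6]" using xs(2,3)
    by (auto simp: length_Suc_conv numeral_eq_Suc)
  have Nu: "N u = {m0, nx u m0, a2, a3, a4, a5, a6}" "distinct [m0, nx u m0, a2, a3, a4, a5, a6]"
    using xs(1) e unfolding rg_def by auto
  have Fi: "F u (xs ! i) (xs ! ((i + 1) mod 7))" if "i < 7" for i
    using xs(1) that e unfolding rg_def by auto
  have Fs: "F u m0 (nx u m0)" "F u (nx u m0) a2" "F u a2 a3" "F u a5 a6" "F u a6 m0"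
    using Fi[of 0] Fi[of 1] Fi[of 2] Fi[of 5] Fi[of 6] unfolding e by simp_all
  note A = F_adj[OF Fs(1)] F_adj[OF Fs(2)] F_adj[OF Fs(3)] F_adj[OF Fs(4)] F_adj[OF Fs(5)]
  have bad: False if w: "w \<in> N u" "w \<in> N y" "w \<in> N r" "r \<in> {m0, nx u m0}" "w \<notin> {m0, nx u m0}"
    and yy: "y \<in> N u" "y' \<in> N u" "y \<noteq> y'" "d y = 5" "y' \<in> cl y" "w \<noteq> y'" for w y y' r
  proof -
    have wV: "w \<in> V" using NV w(1) by blast
    have "y \<in> cl w" using absorb1[OF wV, of w y] w(2) yy(4) cl_self by simp
    moreover have "y' \<in> cl w" using cl_mono[OF \<open>y \<in> cl w\<close> wV] yy(5) by blast
    moreover have "w \<noteq> y" using w(2) irr by blast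
    ultimately have "u \<in> cl w" using absorb3[OF wV w(1) yy(1,2)] yy(3,6) d7 cl_self by auto
    moreover have "r \<in> N u" "d r = 6" "r \<in> N x" using w(4) Nu(1) x by auto
    moreover have "w \<noteq> u" using w(1) irr by blast
    ultimately have "r \<in> cl w" using absorb2[OF wV w(3), of u] cl_self symN by auto
    have "w \<notin> insert x (N x)"
    proof
      assume "w \<in> insert x (N x)"
      moreover have "w \<noteq> x" using w(1) x(6) symN by blast
      ultimately have "{w, m0, nx u m0} \<subseteq> N u \<inter> N x" using w(1) x Nu by auto
      moreover have "card {w, m0, nx u m0} = 3" using w(5) Nu(2) by simp
      ultimately have "3 \<le> card (N u \<inter> N x)" using finN by (metis card_mono finite_Int)
      then show False using cnt d7 by simp
    qed
    then show False using hub_disjoint[OF x(1) wV] \<open>r \<in> cl w\<close> \<open>r \<in> N x\<close> by blast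
  qed
  have pos: "y \<in> {a3, a4, a5}" if yy: "y \<in> N u" "d y = 5" for y
  proof -
    have ycl: "y \<in> cl u" using absorb1[OF uV, of u y] yy cl_self symN by simp
    have "y \<noteq> u" using yy irr by blast
    then have "y \<notin> N m0" "y \<notin> N (nx u m0)" using cor_not_cl[OF m0 _ _ uV] ycl by blast+
    then show ?thesis using yy(1) Nu(1) A by auto
  qed
  have "y1 \<in> {a3, a4, a5}" "y2 \<in> {a3, a4, a5}" using pos y by auto
  then consider "y1 = a3" | "y1 = a5" | "y2 = a3" | "y2 = a5" using y(3) by auto
  then show False
  proof cases
    case 1
    show False using bad[of a2 y1 "nx u m0" y2] 1 A Nu y m \<open>y2 \<in> {a3, a4, a5}\<close> by auto
  next
    case 2
    show False using bad[of a6 y1 m0 y2] 2 A Nu y m \<open>y2 \<in> {a3, a4, a5}\<close> by auto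
  next
    case 3
    show False using bad[of a2 y2 "nx u m0" y1] 3 A Nu y m \<open>y1 \<in> {a3, a4, a5}\<close> by auto
  next
    case 4
    show False using bad[of a6 y2 m0 y1] 4 A Nu y m \<open>y1 \<in> {a3, a4, a5}\<close> by auto
  qed
qed

section \<open>Income of the vertices of degree 5\<close>

definition gv :: "'a \<Rightarrow> 'a \<Rightarrow> bool" where "gv c v \<longleftrightarrow> big v \<and> c \<in> cl v"

definition ghat :: "'a \<Rightarrow> nat" where "ghat c = (\<Sum>v\<in>{v. gv c v}. pay v c)"

lemma fin_gv: "finite {v. gv c v}"
  by (rule finite_subset[OF _ finV]) (auto simp: gv_def big_def)

lemma ghat_list:
  assumes "distinct vs" "\<And>v. v \<in> set vs \<Longrightarrow> gv c v"
  shows "sum_list (map (\<lambda>v. pay v c) vs) \<le> ghat c"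
proof -
  have "sum_list (map (\<lambda>v. pay v c) vs) = (\<Sum>v\<in>set vs. pay v c)"
    using assms(1) by (simp add: sum_list_distinct_conv_sum_set)
  also have "\<dots> \<le> ghat c" unfolding ghat_def using assms(2) fin_gv by (intro sum_mono2) auto
  finally show ?thesis .
qed

lemma gv_adj5: "d x = 5 \<Longrightarrow> v \<in> N x \<Longrightarrow> 7 \<le> d v \<Longrightarrow> gv x v"
  unfolding gv_def big_def using absorb1[of v v x] cl_self NV by auto

lemma gv_adj55: "d x = 5 \<Longrightarrow> d p = 5 \<Longrightarrow> p \<in> N x \<Longrightarrow> v \<in> N p \<Longrightarrow> 7 \<le> d v \<Longrightarrow> gv x v"
  using absorb1[of v v p] absorb1[of v p x] cl_self[of v] NV[of v p] unfolding gv_def big_def by auto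

text \<open>The excess of a payment to the 5-vertex \<open>x\<close> over one unit per neighbour of degree at least 7.\<close>

definition extra :: "'a \<Rightarrow> 'a \<Rightarrow> nat" where
  "extra x v = (if v \<in> N x then (if 8 \<le> d v then 2 else 0) else pay v x)"

text \<open>The failure of \<open>x\<close> to be paid in full, in a form that a few named payers
  can contradict. It is applied with \<open>k = 2 * card (P5 x) - 1\<close>, one half unit short of
  the share that the 5-neighbours cannot provide themselves.\<close>

definition slack :: "'a \<Rightarrow> nat \<Rightarrow> bool" where
  "slack x k \<longleftrightarrow> (\<forall>vs. distinct vs \<longrightarrow> (\<forall>v\<in>set vs. gv x v) \<longrightarrow> sum_list (map (extra x) vs) \<le> k)"

lemma ghat_Bg:
  assumes "d x = 5"
  shows "2 * card (Bg x) \<le> ghat x" "ghat x \<le> 2 * card (Bg x) + k \<Longrightarrow> slack x k"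
proof -
  have sub: "Bg x \<subseteq> {v. gv x v}" unfolding Bg_def using gv_adj5[OF assms] by blast
  have le: "(if v \<in> Bg x then 2 else 0) + extra x v \<le> pay v x" if "gv x v" for v
    using that sym[of v x] unfolding extra_def Bg_def pay_def gv_def big_def by auto
  have s: "(\<Sum>v\<in>{v. gv x v}. (if v \<in> Bg x then 2 else 0) + extra x v) \<le> ghat x"
    unfolding ghat_def by (rule sum_mono) (use le in auto)
  have "{v. gv x v \<and> v \<in> Bg x} = Bg x" using sub by blast
  then have "(\<Sum>v\<in>{v. gv x v}. if v \<in> Bg x then (2::nat) else 0) = 2 * card (Bg x)"
    using fin_gv[of x] by (subst sum.If_cases) (auto simp: Int_def)
  then have s2: "2 * card (Bg x) + (\<Sum>v\<in>{v. gv x v}. extra x v) \<le> ghat x" using s by (simp add: sum.distrib)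
  then show "2 * card (Bg x) \<le> ghat x" by simp
  assume g: "ghat x \<le> 2 * card (Bg x) + k"
  show "slack x k" unfolding slack_def
  proof (intro allI impI)
    fix vs assume vs: "distinct vs" "\<forall>v\<in>set vs. gv x v"
    have "sum_list (map (extra x) vs) = (\<Sum>v\<in>set vs. extra x v)" using vs by (simp add: sum_list_distinct_conv_sum_set)
    also have "\<dots> \<le> (\<Sum>v\<in>{v. gv x v}. extra x v)" using vs fin_gv by (intro sum_mono2) auto
    finally show "sum_list (map (extra x) vs) \<le> k" using s2 g by linarith
  qed
qed

lemma slackD: "slack x k \<Longrightarrow> distinct vs \<Longrightarrow> (\<And>v. v \<in> set vs \<Longrightarrow> gv x v) \<Longrightarrow> sum_list (map (extra x) vs) \<le> k"
  unfolding slack_def by blast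

lemma extra_in: "v \<in> N x \<Longrightarrow> 8 \<le> d v \<Longrightarrow> extra x v = 2" unfolding extra_def by simp

lemma extra_out: "v \<notin> N x \<Longrightarrow> 1 \<le> extra x v" "v \<notin> N x \<Longrightarrow> \<not> ovf v \<Longrightarrow> 2 \<le> extra x v"
  "v \<notin> N x \<Longrightarrow> 8 \<le> d v \<Longrightarrow> 2 \<le> extra x v" "v \<notin> N x \<Longrightarrow> 9 \<le> d v \<Longrightarrow> 4 \<le> extra x v"
  unfolding extra_def pay_def by auto

lemma pay_lower: "1 \<le> pay v x" "v \<in> N x \<Longrightarrow> 2 \<le> pay v x" "\<not> ovf v \<Longrightarrow> 2 \<le> pay v x" "8 \<le> d v \<Longrightarrow> 2 \<le> pay v x"
  "v \<in> N x \<Longrightarrow> 8 \<le> d v \<Longrightarrow> 4 \<le> pay v x"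
  unfolding pay_def ovf_def using symN by auto

lemma mutual_cl:
  assumes "d x = 5" "d p = 5" "p \<in> N x" shows "p \<in> cl x" "x \<in> cl p"
  using absorb1[of x x p] absorb1[of p p x] cl_self assms symN d5V by auto

lemma not_ovf_two:
  assumes "v \<in> N p" "v \<in> N q" "p \<noteq> q" "d p = 5" "d q = 5" "p \<in> cl q" "q \<in> cl p"
  shows "\<not> ovf v"
  using overflow_lonely[of v p q] assms symN unfolding ovf_def by auto

text \<open>The common 5-neighbour \<open>x\<close> puts \<open>p\<close> and \<open>q\<close> into
  each other's closure, so \<open>overflow_lonely\<close> applies.\<close>

lemma not_ovf_two':
  assumes "v \<in> N p" "v \<in> N q" "p \<noteq> q" "d p = 5" "d q = 5" "d x = 5" "p \<in> N x" "q \<in> N x"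
  shows "\<not> ovf v"
proof -
  have V: "p \<in> V" "q \<in> V" using assms d5V by auto
  have "p \<in> cl q" "q \<in> cl p"
    using mutual_cl[of x p] mutual_cl[of x q] cl_mono[OF _ V(1)] cl_mono[OF _ V(2)] assms by auto
  then show ?thesis using not_ovf_two assms by blast
qed

lemma not_ovf_adj:
  assumes "v \<in> N p" "v \<in> N q" "p \<in> N q" "d p = 5" "d q = 5"
  shows "\<not> ovf v"
proof -
  have "p \<noteq> q" using assms irr by blast
  then show ?thesis using not_ovf_two[of v p q] mutual_cl[of q p] assms by auto
qed

text \<open>Otherwise the two neighbours of \<open>p\<close> off the link edge pair at
  \<open>x\<close> would be the two far rim vertices of \<open>x\<close>; one order of them gives
  degree 3, the other a \<open>K5\<close>.\<close>

lemma nbr_outside: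
  assumes "d x = 5" "p \<in> N x" "d p = 5"
  shows "\<exists>w\<in>N p. w \<notin> insert x (N x)"
proof (rule ccontr)
  assume c: "\<not> ?thesis"
  have xp: "x \<in> N p" using assms symN by blast
  obtain a b e f where r: "r5 x p a b e f" using r5_ex[of x p "nx x p"] assms face[OF assms(2)] unfolding F_def by blast
  note R = r5_adj[OF r] r5_faces[OF r, unfolded F6_def] r5D(2)[OF r]
  have Fp: "F p a x" "F p x f" "a \<noteq> f" using R by auto
  obtain s t where rp: "r5 p a x f s t" using r5_mid[OF Fp assms(3)] by blast
  note P = r5_adj[OF rp] r5_faces[OF rp, unfolded F6_def] r5D(2)[OF rp]
  have "s \<in> {b, e}" "t \<in> {b, e}" "s \<noteq> t" using c P R by auto
  then consider "s = e" | "s = b" "t = e" by auto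
  then show False
  proof cases
    case 1
    show False using not_degree_3[of f x p e] R P 1 by auto
  next
    case 2
    show False using K5[of x p a b e] R P 2 by auto
  qed
qed

text \<open>If the rim has degrees at most 6, an outer neighbour of a 5-vertex on the rim swallows
  the whole star, which makes seven vertices.\<close>

lemma Bg_nonempty:
  assumes "d x = 5" "P5 x \<noteq> {}" shows "Bg x \<noteq> {}"
proof
  assume e: "Bg x = {}"
  obtain p where p: "p \<in> N x" "d p = 5" using assms(2) unfolding P5_def by blast
  obtain w where w: "w \<in> N p" "w \<notin> insert x (N x)" using nbr_outside[OF assms(1) p] by blast
  obtain a b c f where r: "r5 x p a b c f" using r5_ex[of x p "nx x p"] assms face[OF p(1)] p(1) unfolding F_def by blast
  have le: "d y \<le> 6" if "y \<in> N x" for y using e that unfolding Bg_def by force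
  note R = r5_adj[OF r]
  have "w \<in> V" "w \<noteq> p" using w NV p by auto
  moreover have "p \<in> N w" using w symN by blast
  ultimately show False using explode[of w "[(p, [w]), (x, [p]), (a, [p, x]), (b, [a, x]), (c, [b, x]), (f, [c, x])]"]
    R le w r5D(2)[OF r] p(2) by auto
qed

lemma slack_sum1: "slack x k \<Longrightarrow> gv x a \<Longrightarrow> extra x a \<le> k"
  using slackD[of x k "[a]"] by simp

lemma slack_sum2: "slack x k \<Longrightarrow> gv x a \<Longrightarrow> gv x b \<Longrightarrow> a \<noteq> b \<Longrightarrow> extra x a + extra x b \<le> k"
  using slackD[of x k "[a, b]"] by auto

lemma slack_sum3: "slack x k \<Longrightarrow> gv x a \<Longrightarrow> gv x b \<Longrightarrow> gv x c \<Longrightarrow> distinct [a, b, c] \<Longrightarrow>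
    extra x a + extra x b + extra x c \<le> k"
  unfolding slack_def by (drule spec[of _ "[a, b, c]"]) auto

lemma slack_sum4: "slack x k \<Longrightarrow> gv x a \<Longrightarrow> gv x b \<Longrightarrow> gv x c \<Longrightarrow> gv x e \<Longrightarrow> distinct [a, b, c, e] \<Longrightarrow>
    extra x a + extra x b + extra x c + extra x e \<le> k"
  unfolding slack_def by (drule spec[of _ "[a, b, c, e]"]) auto

lemma slack_sum5: "slack x k \<Longrightarrow> gv x a \<Longrightarrow> gv x b \<Longrightarrow> gv x c \<Longrightarrow> gv x e \<Longrightarrow> gv x f \<Longrightarrow> distinct [a, b, c, e, f] \<Longrightarrow>
    extra x a + extra x b + extra x c + extra x e + extra x f \<le> k"
  unfolding slack_def by (drule spec[of _ "[a, b, c, e, f]"]) auto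

lemma ovf_7: "ovf v \<Longrightarrow> d v = 7" unfolding ovf_def by blast

text \<open>Nearly always the closure of \<open>m\<close> or \<open>n\<close> reaches seven
  vertices. What survives is an overflowing \<open>e1\<close> of degree 7 whose closure is known
  exactly, with at most three recipients. Overflow then demands three corners, too many beside the
  neighbour \<open>p\<close> in this closure.\<close>

lemma slack_single_core:
  assumes r: "r5 x p a m n b" and r': "r5 p x a e1 e2 b"
    and le: "d a \<le> 7" "d b \<le> 7" "d m \<le> 7" "d n \<le> 7"
    and e1: "e1 \<in> {m, n} \<or> d e1 \<le> 6 \<or> ovf e1" and e2: "e2 \<in> {m, n} \<or> d e2 \<le> 6"
  shows False
proof -
  note R = r5_adj[OF r] r5_adj[OF r']
  note FF = r5_faces[OF r, unfolded F6_def] r5_faces[OF r', unfolded F6_def]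
  have n1: "e1 \<noteq> m" using not_degree_3[of a x p m] FF R by auto
  have n2: "e2 \<noteq> n" using not_degree_3[of b x p n] FF R by auto
  show False
  proof (cases "e1 = n")
    case e1n: True
    show False
    proof (cases "e2 = m")
      case True
      then show False using K5[of x p a m n] R e1n by auto
    next
      case False
      then have "d e2 \<le> 6" using e2 n2 by blast
      then show False using explode[of n "[(x, [n]), (p, [x]), (e2, [p, n]), (b, [x, p, n]), (a, [x, p, n]), (m, [x, a, n])]"]
        R le e1n False by auto
    qed
  next
    case e1n: False
    show False
    proof (cases "d e1 \<le> 6")
      case e16: True
      show False
      proof (cases "e2 = m")
        case True
        then show False using explode[of m "[(x, [m]), (p, [x]), (e1, [p, m]), (a, [x, p, m]), (b, [x, p, m]), (n, [x, b, m])]"]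
          R le e1n e16 n1 by auto
      next
        case False
        then have "d e2 \<le> 6" using e2 n2 by blast
        then show False using explode[of m "[(x, [m]), (p, [x]), (a, [x, p, m]), (e1, [p, a]), (e2, [p, e1]), (b, [x, p, e2])]"]
          R le e16 n1 False by auto
      qed
    next
      case False
      then have o: "ovf e1" using e1 n1 e1n by blast
      have e17: "d e1 = 7" using ovf_7[OF o] .
      show False
      proof (cases "e2 = m")
        case True
        then show False using explode[of m "[(x, [m]), (p, [x]), (a, [x, p, m]), (b, [x, p, m]), (n, [x, b, m]), (e1, [p, a, m])]"]
          R le e1n e17 n1 by auto
      next
        case False
        then have e26: "d e2 \<le> 6" using e2 n2 by blast
        have c: "cl e1 = {e1, p, x, e2, a, b}"
          using saturate[of e1 "[(p, [e1]), (x, [p]), (e2, [p, e1]), (a, [e1, x, p]), (b, [e2, x, p])]"]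
            R le e26 by auto
        have b7: "d b = 7"
        proof (rule ccontr)
          assume "d b \<noteq> 7"
          then have "d b \<le> 6" using le by simp
          then show False using explode[of m "[(x, [m]), (p, [x]), (a, [m, x, p]), (b, [x, p]), (e2, [p, b]), (e1, [p, a, e2])]"]
            R le e26 e17 n1 e1n n2 False by auto
        qed
        have a7: "d a = 7"
        proof (rule ccontr)
          assume "d a \<noteq> 7"
          then have "d a \<le> 6" using le by simp
          then show False using explode[of n "[(x, [n]), (p, [x]), (b, [n, x, p]), (a, [x, p]), (e2, [p, b]), (e1, [p, a, e2])]"]
            R le e26 e17 n1 e1n n2 False by auto
        qed
        have "C56 e1 \<subseteq> {x, p, e2}" unfolding C56_def using c a7 b7 by auto
        then have "card (C56 e1) \<le> card {x, p, e2}" by (intro card_mono) auto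
        also have "\<dots> \<le> 3" by (simp add: card_insert_if)
        finally have "3 \<le> z e1" using o unfolding ovf_def by simp
        moreover have "p \<in> Rd e1" unfolding Rd_def using c R by auto
        ultimately show False using load_R(2)[of e1] e17 R by auto
      qed
    qed
  qed
qed

text \<open>Slack 1 excludes rim degrees of 8 or more and, among the two outer neighbours of
  \<open>p\<close>, allows at most one payer off the rim, which must overflow. The core case then
  applies to the picture or to its mirror image.\<close>

lemma slack_single:
  assumes r: "r5 x p a m n b" and p: "d p = 5" "d a \<noteq> 5" "d m \<noteq> 5" "d n \<noteq> 5" "d b \<noteq> 5" and s: "slack x 1"
  shows False
proof -
  note R = r5_adj[OF r] note FF = r5_faces[OF r, unfolded F6_def]
  have dx: "d x = 5" using R by simp
  have le: "d v \<le> 7" if v: "v \<in> N x" for v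
  proof (rule ccontr)
    assume "\<not> d v \<le> 7"
    then show False using slack_sum1[OF s gv_adj5[OF dx v]] extra_in[OF v] by simp
  qed
  obtain e1 e2 where r': "r5 p b x a e1 e2" using r5_mid[of p b x a] FF p(1) R by auto
  note r2 = r5_rot[OF r'] note R2 = r5_adj[OF r']
  have out: "v \<in> {m, n} \<or> d v \<le> 6 \<or> (ovf v \<and> gv x v \<and> v \<notin> N x)" if v: "v \<in> {e1, e2}" for v
  proof (cases "v \<in> N x \<or> d v \<le> 6")
    case True
    then show ?thesis using v R2 r5D(2)[OF r] by auto
  next
    case False
    then have "gv x v" using gv_adj55[of x p v] v R2 R p dx by auto
    then show ?thesis using slack_sum1[OF s, of v] extra_out(2)[of v x] False by auto
  qed
  have one: "\<not> (ovf e1 \<and> gv x e1 \<and> e1 \<notin> N x \<and> ovf e2 \<and> gv x e2 \<and> e2 \<notin> N x)"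
  proof
    assume h: "ovf e1 \<and> gv x e1 \<and> e1 \<notin> N x \<and> ovf e2 \<and> gv x e2 \<and> e2 \<notin> N x"
    then have "1 \<le> extra x e1" "1 \<le> extra x e2" using extra_out(1) by auto
    moreover have "extra x e1 + extra x e2 \<le> 1" using slack_sum2[OF s, of e1 e2] h R2 by auto
    ultimately show False by linarith
  qed
  have les: "d a \<le> 7" "d b \<le> 7" "d m \<le> 7" "d n \<le> 7" using le R by auto
  consider "e2 \<in> {m, n} \<or> d e2 \<le> 6" | "e1 \<in> {m, n} \<or> d e1 \<le> 6" using out[of e1] out[of e2] one by auto
  then show False
  proof cases
    case 1
    show False using slack_single_core[OF r r2] les out[of e1] 1 by auto
  next
    case 2
    have r3: "r5 x p b n m a" using r5_rot[OF r5_rot[OF r5_rot[OF r5_rot[OF r5_rev[OF r]]]]] .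
    have r4: "r5 p x b e2 e1 a" using r5_rot[OF r5_rot[OF r5_rot[OF r5_rev[OF r']]]] .
    show False using slack_single_core[OF r3 r4] les out[of e2] 2 by auto
  qed
qed

text \<open>\<open>e2 = b\<close> would give \<open>c\<close> degree 3; \<open>e2 = q\<close> makes
  the links of \<open>p\<close> and \<open>q\<close> interlock until a \<open>K5\<close>
  appears.\<close>

lemma slack_pair_apart_outside:
  assumes r: "r5 x p a q b c" and rp: "r5 p c x a e1 e2" and q: "d q = 5"
  shows "e2 \<notin> insert x (N x)"
proof
  assume e: "e2 \<in> insert x (N x)"
  note R = r5_adj[OF r] r5_adj[OF rp]
  note FF = r5_faces[OF r, unfolded F6_def] r5_faces[OF rp, unfolded F6_def]
  have "e2 \<noteq> b" using not_degree_3[of c x p b] FF R by auto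
  then have e2q: "e2 = q" using e r5D(2)[OF r] R by auto
  obtain f2 f1 where rq: "r5 q a x b f2 f1" using r5_mid[of q a x b] FF q R by auto
  note Q = r5_adj[OF rq] r5_faces[OF rq, unfolded F6_def]
  have "c \<in> N q" "p \<in> N q" using R e2q by auto
  then have cp: "c \<in> {f1, f2}" "p \<in> {f1, f2}" using r5D(2)[OF rq] R by auto
  have "f2 \<noteq> c" using not_degree_3[of b x q c] FF R Q by auto
  then have f: "f1 = c" "f2 = p" using cp R by auto
  then have "b \<in> N p" using Q by auto
  then have "e1 = b" using r5D(2)[OF rp] R e2q by auto
  then show False using K5[of x p q a b] R Q e2q by auto
qed

text \<open>Slack 3 leaves room for one rim vertex of degree at least 8, which accounts for 2, and
  one more half unit. If neither \<open>a\<close> nor \<open>b\<close> is that large, a closure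
  explodes; if one is, the outer vertices \<open>e2\<close> and \<open>f2\<close> overpay or are
  small enough to be absorbed.\<close>

lemma slack_pair_apart_main:
  assumes r: "r5 x p a q b c" and rp: "r5 p c x a e1 e2" and rq: "r5 q b x a f1 f2"
    and p: "d p = 5" and q: "d q = 5" and s: "slack x 3" and c7: "d c \<le> 7"
  shows False
proof -
  have rm: "r5 x q a p c b" using r5_rot[OF r5_rot[OF r5_rev[OF r]]] .
  have eo: "e2 \<notin> insert x (N x)" using slack_pair_apart_outside[OF r rp q] .
  have fo: "f2 \<notin> insert x (N x)" using slack_pair_apart_outside[OF rm rq p] .
  note R = r5_adj[OF r] r5_adj[OF rp] r5_adj[OF rq] r5D(2)[OF r]
  have dx: "d x = 5" using R by simp
  have ge: "7 \<le> d e2 \<Longrightarrow> gv x e2" using gv_adj55[of x p e2] R p dx by auto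
  have gf: "7 \<le> d f2 \<Longrightarrow> gv x f2" using gv_adj55[of x q f2] R q dx by auto
  have ga: "8 \<le> d a \<Longrightarrow> gv x a \<and> extra x a = 2" using gv_adj5[of x a] extra_in[of a x] R by auto
  have gb: "8 \<le> d b \<Longrightarrow> gv x b \<and> extra x b = 2" using gv_adj5[of x b] extra_in[of b x] R by auto
  have eq: "e2 = f2 \<Longrightarrow> \<not> ovf e2" using not_ovf_two'[of e2 p q x] R p q dx by auto
  have ex: "1 \<le> extra x e2" "1 \<le> extra x f2" "\<not> ovf e2 \<Longrightarrow> 2 \<le> extra x e2" using extra_out[of e2 x] extra_out(1)[of f2 x] eo fo by auto
  have ne: "e2 \<noteq> a" "e2 \<noteq> b" "e2 \<noteq> c" "f2 \<noteq> a" "f2 \<noteq> b" "e2 \<noteq> q" "e2 \<noteq> x" "f2 \<noteq> x" "f2 \<noteq> c" "f2 \<noteq> p" "e2 \<noteq> p" "f2 \<noteq> q" using eo fo R by auto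
  consider "d a \<le> 7" "d b \<le> 7" | "8 \<le> d a" "d b \<le> 7" | "8 \<le> d b" "d a \<le> 7" | "8 \<le> d a" "8 \<le> d b" by linarith
  then show False
  proof cases
    case 1
    show False using explode[of e2 "[(p, [e2]), (x, [p]), (q, [x]), (a, [x, p, q]), (c, [x, p, e2]), (b, [x, q, c])]"]
      R p q c7 1 ne by auto
  next
    case 2
    note g = ga[OF 2(1)]
    show False
    proof (cases "e2 = f2")
      case True
      show False
      proof (cases "7 \<le> d e2")
        case t: True
        then show False using slack_sum2[OF s _ ge[OF t], of a] g ex eq True ne by auto
      next
        case False
        then show False using explode[of a "[(x, [a]), (p, [x]), (q, [x]), (e2, [p, q]), (c, [x, p, e2]), (b, [x, q, c])]"]
          R p q c7 2 ne True by auto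
      qed
    next
      case False
      have "\<not> (7 \<le> d e2 \<and> 7 \<le> d f2)"
      proof
        assume "7 \<le> d e2 \<and> 7 \<le> d f2"
        then show False using slack_sum3[OF s _ ge gf, of a] g ex ne False by auto
      qed
      then have "d e2 \<le> 6 \<or> d f2 \<le> 6" by auto
      then show False
      proof
        assume "d f2 \<le> 6"
        then show False using explode[of e2 "[(p, [e2]), (x, [p]), (q, [x]), (c, [x, p, e2]), (b, [x, q, c]), (f2, [q, b])]"]
          R p q c7 2 ne False by auto
      next
        assume "d e2 \<le> 6"
        then show False using explode[of f2 "[(q, [f2]), (x, [q]), (p, [x]), (b, [x, q, f2]), (c, [x, p, b]), (e2, [p, c])]"]
          R p q c7 2 ne False by auto
      qed
    qed
  next
    case 3
    note g = gb[OF 3(1)]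
    have e7: "7 \<le> d e2"
    proof (rule ccontr)
      assume "\<not> 7 \<le> d e2"
      then show False using explode[of b "[(x, [b]), (p, [x]), (q, [x]), (a, [x, p, q]), (c, [x, p, b]), (e2, [p, c])]"]
        R p q c7 3 ne by auto
    qed
    have f7: "7 \<le> d f2"
    proof (rule ccontr)
      assume "\<not> 7 \<le> d f2"
      then show False using explode[of b "[(x, [b]), (p, [x]), (q, [x]), (a, [x, p, q]), (c, [x, p, b]), (f2, [q, b])]"]
        R p q c7 3 ne by auto
    qed
    show False
    proof (cases "e2 = f2")
      case True
      then show False using slack_sum2[OF s _ ge[OF e7], of b] g ex eq ne by auto
    next
      case False
      then show False using slack_sum3[OF s _ ge[OF e7] gf[OF f7], of b] g ex ne by auto
    qed
  next
    case 4
    show False using slack_sum2[OF s, of a b] ga[OF 4(1)] gb[OF 4(2)] R by auto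
  qed
qed

lemma slack_pair_apart:
  assumes r: "r5 x p a q b c" and p: "d p = 5" and q: "d q = 5" and s: "slack x 3"
  shows False
proof -
  note R = r5_adj[OF r] note FF = r5_faces[OF r, unfolded F6_def]
  have rm: "r5 x q a p c b" using r5_rot[OF r5_rot[OF r5_rev[OF r]]] .
  obtain e1 e2 where rp: "r5 p c x a e1 e2" using r5_mid[of p c x a] FF p R by auto
  obtain f1 f2 where rq: "r5 q b x a f1 f2" using r5_mid[of q b x a] FF q R by auto
  have "d c \<le> 7 \<or> d b \<le> 7"
  proof (rule ccontr)
    assume "\<not> ?thesis"
    then have "8 \<le> d c" "8 \<le> d b" by auto
    then show False using slack_sum2[OF s gv_adj5 gv_adj5, of b c] extra_in[of b x] extra_in[of c x] R by auto
  qed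
  then show False using slack_pair_apart_main[OF r rp rq p q s] slack_pair_apart_main[OF rm rq rp q p s] by blast
qed

text \<open>\<open>e\<close> is the second apex over the edge of the two 5-vertices and never
  overflows. The cases: it pays from outside the star, it is the opposite rim vertex
  \<open>g\<close>, or it is too small to pay and is absorbed.\<close>

lemma slack_pair_adjacent_main:
  assumes r: "r5 x p q b g c" and rp: "r5 p c x q e g1" and rq: "r5 q b x p e g2"
    and s: "slack x 3" and c7: "d c \<le> 7"
  shows False
proof -
  note R = r5_adj[OF r] r5_adj[OF rp] r5_adj[OF rq]
  note FF = r5_faces[OF r, unfolded F6_def] r5_faces[OF rp, unfolded F6_def] r5_faces[OF rq, unfolded F6_def]
  have dd: "d x = 5" "d p = 5" "d q = 5" using R by simp_all
  have gp: "gv x v" if "7 \<le> d v" "v \<in> N p \<or> v \<in> N q" for v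
    using gv_adj55[of x p v] gv_adj55[of x q v] R that by auto
  have gx: "gv x v \<and> extra x v = 2" if "8 \<le> d v" "v \<in> N x" for v
    using gv_adj5[of x v] extra_in[of v x] that dd by auto
  have no: "\<not> ovf v" if "v \<in> N p" "v \<in> N q" for v
    using not_ovf_adj[of v p q] that R by auto
  have nin: "v \<noteq> p \<and> v \<noteq> q \<and> v \<noteq> b \<and> v \<noteq> g \<and> v \<noteq> c" if "v \<notin> N x" for v using R that by auto
  have g1x: "g1 \<in> N x \<Longrightarrow> g1 = g \<or> g1 = b" using R r5D(2)[OF r] by auto
  have g2x: "g2 \<in> N x \<Longrightarrow> g2 = g \<or> g2 = c" using R r5D(2)[OF r] by auto
  have g1g: "g1 \<noteq> g \<or> e = g" using not_degree_3[of c x p g] FF R by auto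
  have g2g: "g2 \<noteq> g \<or> e = g" using not_degree_3[of b x q g] FF R by auto
  have ex: "e \<in> N x \<Longrightarrow> e = g" using R r5D(2)[OF r] by auto
  have kbc: "\<not> (g1 = b \<and> g2 = c)" using K5[of x p q b c] R by auto
  consider (a) "e \<notin> N x" "7 \<le> d e" | (b) "e = g" | (c) "e \<notin> N x" "d e \<le> 6" using ex by fastforce
  then show False
  proof cases
    case a
    have ge: "gv x e" "2 \<le> extra x e" using gp[of e] extra_out(2)[OF a(1)] no[of e] a R by auto
    have le: "d v \<le> 7" if "v \<in> N x" for v
    proof (rule ccontr)
      assume "\<not> d v \<le> 7"
      then show False using slack_sum2[OF s ge(1), of v] ge gx[of v] that a by auto
    qed
    have o: "ovf v" if "7 \<le> d v" "v \<in> N p \<or> v \<in> N q" "v \<notin> N x" "v \<noteq> e" for v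
      using slack_sum2[OF s ge(1) gp[OF that(1,2)]] ge extra_out(2)[OF that(3)] that(4) by fastforce
    have les: "d b \<le> 7" "d g \<le> 7" using le R by auto
    have eg: "e \<noteq> g" using a R by auto
    have g1: "g1 = b \<or> (7 \<le> d g1 \<and> g1 \<notin> N x)"
    proof (rule ccontr)
      assume h: "\<not> ?thesis"
      then have "g1 \<notin> N x" using g1x g1g eg by blast
      moreover from this have "d g1 \<le> 6" using h by auto
      ultimately show False using nin[of g1] explode[of g "[(x, [g]), (p, [x]), (q, [x]), (b, [x, q, g]), (c, [x, p, g]), (g1, [p, c])]"]
        R c7 les by auto
    qed
    have g2: "g2 = c \<or> (7 \<le> d g2 \<and> g2 \<notin> N x)"
    proof (rule ccontr)
      assume h: "\<not> ?thesis"
      then have "g2 \<notin> N x" using g2x g2g eg by blast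
      moreover from this have "d g2 \<le> 6" using h by auto
      ultimately show False using nin[of g2] explode[of g "[(x, [g]), (p, [x]), (q, [x]), (b, [x, q, g]), (c, [x, p, g]), (g2, [q, b])]"]
        R c7 les by auto
    qed
    consider "g1 = b" "7 \<le> d g2" "g2 \<notin> N x" | "g2 = c" "7 \<le> d g1" "g1 \<notin> N x"
      | "7 \<le> d g1" "g1 \<notin> N x" "7 \<le> d g2" "g2 \<notin> N x" using g1 g2 kbc by blast
    then show False
    proof cases
      case 1
      then have "d g2 = 7" using o[of g2] ovf_7[of g2] R by auto
      then show False using 1 nin[of g2] explode[of g2 "[(q, [g2]), (x, [q]), (p, [x]), (b, [x, q, g2]), (c, [x, p, b]), (g, [x, b, c])]"]
        R c7 les by auto
    next
      case 2
      then have "d g1 = 7" using o[of g1] ovf_7[of g1] R by auto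
      then show False using 2 nin[of g1] explode[of g1 "[(p, [g1]), (x, [p]), (q, [x]), (c, [x, p, g1]), (b, [x, q, c]), (g, [x, b, c])]"]
        R c7 les by auto
    next
      case 3
      have "ovf g1" using o[of g1] 3 R by auto
      then have "g1 \<noteq> g2" using no[of g1] R by auto
      moreover have "gv x g1" "gv x g2" using gp 3 R by auto
      ultimately show False using slack_sum3[OF s ge(1), of g1 g2] ge extra_out(1)[OF 3(2)] extra_out(1)[OF 3(4)] R by auto
    qed
  next
    case b
    have g1b: "g1 \<noteq> b" using K5[of x p q g b] R b by auto
    have g2c: "g2 \<noteq> c" using K5[of x p q g c] R b by auto
    have g1o: "g1 \<notin> N x" and g2o: "g2 \<notin> N x" using g1x g2x g1b g2c R b by auto
    show False
    proof (cases "d b \<le> 7")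
      case b7: True
      have g18: "8 \<le> d g1"
      proof (rule ccontr)
        assume "\<not> 8 \<le> d g1"
        then show False using explode[of g "[(x, [g]), (p, [x]), (q, [x]), (b, [x, q, g]), (c, [x, p, g]), (g1, [p, c, g])]"]
          R c7 b7 nin[OF g1o] b by auto
      qed
      have g28: "8 \<le> d g2"
      proof (rule ccontr)
        assume "\<not> 8 \<le> d g2"
        then show False using explode[of g "[(x, [g]), (p, [x]), (q, [x]), (b, [x, q, g]), (c, [x, p, g]), (g2, [q, b, g])]"]
          R c7 b7 nin[OF g2o] b by auto
      qed
      have gg: "gv x g1" "gv x g2" using gp g18 g28 R by auto
      have ee: "2 \<le> extra x g1" "2 \<le> extra x g2" using extra_out(3) g1o g2o g18 g28 by auto
      have eq: "g1 = g2" using slack_sum2[OF s gg] ee by fastforce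
      have "d g \<le> 7"
      proof (rule ccontr)
        assume "\<not> d g \<le> 7"
        then show False using slack_sum2[OF s gg(1), of g] ee gx[of g] R g1o by auto
      qed
      then show False using explode[of g1 "[(p, [g1]), (x, [p]), (q, [x]), (g, [x, p, q]), (c, [x, p, g1]), (b, [x, q, g1])]"]
        R c7 b7 nin[OF g1o] b eq by auto
    next
      case False
      then have bb: "gv x b" "extra x b = 2" using gx[of b] R by auto
      have g7: "d g \<le> 7"
      proof (rule ccontr)
        assume "\<not> d g \<le> 7"
        then show False using slack_sum2[OF s bb(1), of g] bb gx[of g] R by auto
      qed
      have "8 \<le> d g1"
      proof (rule ccontr)
        assume "\<not> 8 \<le> d g1"
        then show False using explode[of b "[(x, [b]), (p, [x]), (q, [x]), (g, [x, p, q]), (c, [x, p, g]), (g1, [p, c, g])]"]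
          R c7 g7 nin[OF g1o] b by auto
      qed
      then show False using slack_sum2[OF s bb(1), of g1] bb gp[of g1] extra_out(3)[OF g1o] g1b R by auto
    qed
  next
    case c
    have eg: "e \<noteq> g" using c R by auto
    show False
    proof (cases "d b \<le> 7")
      case True
      then show False using explode[of g "[(x, [g]), (p, [x]), (q, [x]), (b, [x, q, g]), (c, [x, p, g]), (e, [p, q])]"]
        R c7 c nin[OF c(1)] by auto
    next
      case False
      then have bb: "gv x b" "extra x b = 2" using gx[of b] R by auto
      have g1b: "g1 = b"
      proof (rule ccontr)
        assume h: "g1 \<noteq> b"
        then have g1o: "g1 \<notin> N x" using g1x g1g eg by blast
        have "8 \<le> d g1"
        proof (rule ccontr)
          assume "\<not> 8 \<le> d g1"
          then show False using explode[of g "[(x, [g]), (p, [x]), (q, [x]), (e, [p, q]), (c, [x, p, g]), (g1, [p, c, e])]"]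
            R c7 c nin[OF g1o] nin[OF c(1)] by auto
        qed
        then show False using slack_sum2[OF s bb(1), of g1] bb gp[of g1] extra_out(3)[OF g1o] h R by auto
      qed
      then have g2o: "g2 \<notin> N x" using g2x g2g eg kbc by blast
      have g27: "7 \<le> d g2"
      proof (rule ccontr)
        assume "\<not> 7 \<le> d g2"
        then show False using explode[of g "[(x, [g]), (p, [x]), (q, [x]), (e, [p, q]), (c, [x, p, g]), (g2, [q, e])]"]
          R c7 c nin[OF g2o] nin[OF c(1)] by auto
      qed
      have "ovf g2" using slack_sum2[OF s bb(1) gp[OF g27]] bb extra_out(2)[OF g2o] R by fastforce
      then have "d g2 = 7" by (rule ovf_7)
      then show False using explode[of b "[(x, [b]), (p, [x]), (q, [x]), (e, [p, q]), (g2, [q, b, e]), (c, [x, p, b])]"]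
        R c7 c nin[OF g2o] nin[OF c(1)] g1b by auto
    qed
  qed
qed

text \<open>An edge has only one apex besides \<open>x\<close>, so the links of consecutive
  5-vertices can be written with the same name \<open>e\<close>.\<close>

lemma r5_share:
  assumes "F q b x" "F q x p" "b \<noteq> p" "d q = 5" "F p q e" "e \<noteq> x"
  shows "\<exists>t. r5 q b x p e t"
proof -
  obtain e' t where r: "r5 q b x p e' t" using r5_mid[OF assms(1-4)] by blast
  have "F q p e'" "e' \<noteq> x" "F q p x" "F q p e" using r5D[OF r] F_perm[OF assms(5)] F_swap[OF assms(2)] by auto
  then have "e' = e" using F_third[of q p x e e'] assms(6) by auto
  then show ?thesis using r by blast
qed

lemma slack_pair_adjacent:
  assumes r: "r5 x p q b g c" and p: "d p = 5" and q: "d q = 5" and s: "slack x 3"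
  shows False
proof -
  note R = r5_adj[OF r] note FF = r5_faces[OF r, unfolded F6_def]
  have rm: "r5 x q p c g b" using r5_rot[OF r5_rot[OF r5_rot[OF r5_rev[OF r]]]] .
  obtain e g1 where rp: "r5 p c x q e g1" using r5_mid[of p c x q] FF p R by auto
  obtain g2 where rq: "r5 q b x p e g2"
    using r5_share[of q b x p e] FF q R r5_faces[OF rp, unfolded F6_def] r5_adj(4)[OF rp] by auto
  have "d c \<le> 7 \<or> d b \<le> 7"
  proof (rule ccontr)
    assume "\<not> ?thesis"
    then have "8 \<le> d c" "8 \<le> d b" by auto
    then show False using slack_sum2[OF s gv_adj5 gv_adj5, of b c] extra_in[of b x] extra_in[of c x] R by auto
  qed
  then show False using slack_pair_adjacent_main[OF r rp rq s] slack_pair_adjacent_main[OF rm rq rp s] by blast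
qed

lemma slack_triple_split_nonadjacent:
  assumes r: "r5 x p a q r b" and rp: "r5 p a x b e2 e1" and rq: "r5 q a x r h f"
  shows "q \<notin> N p"
proof
  assume qp: "q \<in> N p"
  note R = r5_adj[OF r] r5_adj[OF rp] r5_adj[OF rq]
  note FF = r5_faces[OF r, unfolded F6_def] r5_faces[OF rp, unfolded F6_def] r5_faces[OF rq, unfolded F6_def]
  have "p \<in> N q" using qp symN by blast
  then have "p = h \<or> p = f" using r5D(2)[OF rq] R by auto
  moreover have "p \<noteq> f" using not_degree_3[of a x p q] FF R by auto
  ultimately have ph: "p = h" by blast
  then have "r \<in> N p" using R by auto
  then have "r = e1 \<or> r = e2" "q = e1 \<or> q = e2" using qp r5D(2)[OF rp] R by auto
  moreover have "e1 \<noteq> q" using not_degree_3[of a x p q] FF R by auto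
  ultimately have "e1 = r" "e2 = q" using R by auto
  then show False using K5[of x p q r a] R ph by auto
qed

text \<open>If \<open>b\<close> were smaller, \<open>a\<close> would be large and its closure would
  be the star of \<open>x\<close>. The outer vertices \<open>e1\<close>, \<open>e2\<close>,
  \<open>h\<close> then have degree at least 7 and together with \<open>a\<close> exceed the slack.
  Where \<open>h\<close> coincides with another one, four contacts raise the degree to 9 and the
  payment to 4.\<close>

lemma slack_triple_split_main:
  assumes r: "r5 x p a q r b" and rp: "r5 p a x b e2 e1" and rq: "r5 q a x r h f" and rr: "r5 r b x q h k"
    and s: "slack x 5"
  shows "8 \<le> d b"
proof (rule ccontr)
  assume b7: "\<not> 8 \<le> d b"
  note R = r5_adj[OF r] r5_adj[OF rp] r5_adj[OF rq] r5_adj[OF rr]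
  have rm: "r5 x p b r q a" using r5_rot[OF r5_rot[OF r5_rot[OF r5_rot[OF r5_rev[OF r]]]]] .
  have rpm: "r5 p b x a e1 e2" using r5_rot[OF r5_rot[OF r5_rev[OF rp]]] .
  have nq: "q \<notin> N p" "r \<notin> N p" using slack_triple_split_nonadjacent[OF r rp rq] slack_triple_split_nonadjacent[OF rm rpm rr] .
  have out: "h \<notin> N x" "e1 \<notin> N x" "e2 \<notin> N x" using R nq r5D(2)[OF r] symN by auto
  have ne: "e1 \<noteq> q" "e1 \<noteq> r" "e2 \<noteq> q" "e2 \<noteq> r" "h \<noteq> p" using R nq symN by auto
  have gv: "gv x v" if "7 \<le> d v" "v \<in> N p \<or> v \<in> N q \<or> v \<in> N r" for v
    using gv_adj55[of x p v] gv_adj55[of x q v] gv_adj55[of x r v] R that by auto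
  show False
  proof (cases "d a \<le> 7")
    case True
    then show False using explode[of e1 "[(p, [e1]), (x, [p]), (q, [x]), (r, [x]), (a, [x, p, q]), (b, [x, p, r])]"]
      R b7 ne by auto
  next
    case False
    then have a: "gv x a" "extra x a = 2" using gv_adj5[of x a] extra_in[of a x] R by auto
    let ?S = "[(x, [a]), (p, [x]), (q, [x]), (r, [x]), (b, [x, p, r])]"
    have o: "5 + length cs \<le> d w" if "w \<notin> {a, x, p, q, r, b}" "set cs \<subseteq> N w" "set cs \<subseteq> {a, x, p, q, r, b}" "distinct cs" "cs \<noteq> []" for w cs
      using outside[of a ?S w cs] that R b7 by auto
    have e17: "7 \<le> d e1" using o[of e1 "[p, a]"] R ne by auto
    have e27: "7 \<le> d e2" using o[of e2 "[p, b]"] R ne by auto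
    have h7: "7 \<le> d h" using o[of h "[q, r]"] R ne by auto
    have g: "gv x e1" "gv x e2" "gv x h" using gv e17 e27 h7 R by auto
    have ex: "1 \<le> extra x e1" "1 \<le> extra x e2" using extra_out(1) out by auto
    have exh: "2 \<le> extra x h" using extra_out(2)[OF out(1)] not_ovf_adj[of h q r] R by auto
    consider "h = e1" | "h = e2" | "h \<noteq> e1" "h \<noteq> e2" by blast
    then show False
    proof cases
      case 1
      then have "9 \<le> d h" using o[of h "[p, q, r, a]"] R ne by auto
      then show False using slack_sum2[OF s a(1) g(3)] extra_out(4)[OF out(1)] a R by auto
    next
      case 2
      then have "9 \<le> d h" using o[of h "[p, q, r, b]"] R ne by auto
      then show False using slack_sum2[OF s a(1) g(3)] extra_out(4)[OF out(1)] a R by auto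
    next
      case 3
      then show False using slack_sum4[OF s a(1) g] a ex exh R by auto
    qed
  qed
qed

text \<open>The separators \<open>a\<close> and \<open>b\<close> both have degree at least 8 and use
  up 4 of the slack. Hence \<open>h\<close> is too small to pay, and \<open>e1\<close>,
  \<open>e2\<close> have degree at most 7; they are absorbed or pay one half unit each, one too
  many.\<close>

lemma slack_triple_split:
  assumes r: "r5 x p a q r b" and d5s: "d p = 5" "d q = 5" "d r = 5" and s: "slack x 5"
  shows False
proof -
  note R0 = r5_adj[OF r] note F0 = r5_faces[OF r, unfolded F6_def]
  obtain e2 e1 where rp: "r5 p a x b e2 e1" using r5_mid[of p a x b] F0 d5s R0 by auto
  obtain h f where rq: "r5 q a x r h f" using r5_mid[of q a x r] F0 d5s R0 by auto
  obtain k where rr: "r5 r b x q h k"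
    using r5_share[of r b x q h] F0 d5s R0 r5_faces[OF rq, unfolded F6_def] r5_adj(4)[OF rq] by auto
  have rm: "r5 x p b r q a" using r5_rot[OF r5_rot[OF r5_rot[OF r5_rot[OF r5_rev[OF r]]]]] .
  have rpm: "r5 p b x a e1 e2" using r5_rot[OF r5_rot[OF r5_rev[OF rp]]] .
  have ab: "8 \<le> d a" "8 \<le> d b" using slack_triple_split_main[OF r rp rq rr s] slack_triple_split_main[OF rm rpm rr rq s] by auto
  note R = r5_adj[OF r] r5_adj[OF rp] r5_adj[OF rq] r5_adj[OF rr]
  have nq: "q \<notin> N p" "r \<notin> N p" using slack_triple_split_nonadjacent[OF r rp rq] slack_triple_split_nonadjacent[OF rm rpm rr] .
  have out: "h \<notin> N x" "e1 \<notin> N x" "e2 \<notin> N x" using R nq r5D(2)[OF r] symN by auto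
  have ne: "e1 \<noteq> q" "e1 \<noteq> r" "e2 \<noteq> q" "e2 \<noteq> r" "h \<noteq> p" using R nq symN by auto
  have gv: "gv x v" if "7 \<le> d v" "v \<in> N p \<or> v \<in> N q \<or> v \<in> N r" for v
    using gv_adj55[of x p v] gv_adj55[of x q v] gv_adj55[of x r v] R that by auto
  have a: "gv x a" "extra x a = 2" using gv_adj5[of x a] extra_in[of a x] R ab by auto
  have b: "gv x b" "extra x b = 2" using gv_adj5[of x b] extra_in[of b x] R ab by auto
  have two: False if "gv x v" "2 \<le> extra x v" "v \<notin> N x" for v
    using slack_sum3[OF s a(1) b(1) that(1)] a b that(2,3) R by auto
  have h6: "d h \<le> 6"
  proof (rule ccontr)
    assume "\<not> d h \<le> 6"
    then show False using two[OF gv[of h]] extra_out(2)[OF out(1)] not_ovf_adj[of h q r] R out by auto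
  qed
  have le: "d v \<le> 7" if "v \<in> {e1, e2}" for v
  proof (rule ccontr)
    assume "\<not> d v \<le> 7"
    then show False using two[OF gv[of v]] extra_out(3)[of v x] that R out by auto
  qed
  show False
  proof (cases "e1 = h")
    case True
    then show False using explode[of b "[(x, [b]), (p, [x]), (q, [x]), (r, [x]), (h, [q, r]), (e2, [p, b, h])]"]
      R h6 le[of e2] ne by auto
  next
    case F1: False
    show False
    proof (cases "e2 = h")
      case True
      then show False using explode[of a "[(x, [a]), (p, [x]), (q, [x]), (r, [x]), (h, [q, r]), (e1, [p, a, h])]"]
        R h6 le[of e1] ne by auto
    next
      case F2: False
      have e1: "7 \<le> d e1"
      proof (rule ccontr)
        assume "\<not> 7 \<le> d e1"
        then show False using explode[of a "[(x, [a]), (p, [x]), (q, [x]), (r, [x]), (h, [q, r]), (e1, [p, a])]"]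
          R h6 F1 ne by auto
      qed
      have e2: "7 \<le> d e2"
      proof (rule ccontr)
        assume "\<not> 7 \<le> d e2"
        then show False using explode[of b "[(x, [b]), (p, [x]), (q, [x]), (r, [x]), (h, [q, r]), (e2, [p, b])]"]
          R h6 F2 ne by auto
      qed
      have "gv x e1" "gv x e2" using gv e1 e2 R by auto
      then show False using slack_sum4[OF s a(1) b(1), of e1 e2] a b extra_out(1)[OF out(2)] extra_out(1)[OF out(3)] R by auto
    qed
  qed
qed

lemma slack_triple_run_nonadjacent:
  assumes r: "r5 x p q r b c" and rq: "r5 q p x r h2 h1" and rp: "r5 p c x q h1 k1" and rr: "r5 r b x q h2 k2"
  shows "r \<notin> N p"
proof
  assume rp': "r \<in> N p"
  note R = r5_adj[OF r] r5_adj[OF rp] r5_adj[OF rq] r5_adj[OF rr]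
  note FF = r5_faces[OF rp, unfolded F6_def] r5_faces[OF rr, unfolded F6_def]
  have k1: "r = k1" using rp' r5D(2)[OF rp] R by auto
  have "p \<in> N r" using rp' symN by blast
  then have k2: "p = k2" using r5D(2)[OF rr] R by auto
  have "F p r h1" "F p r c" "F p r h2" "F p r b" using FF k1 k2 by auto
  then have "h2 = c" "b = h1" using F_third[of p r h1 c h2] F_third[of p r h1 c b] R by auto
  then show False using K5[of x p q r b] R rp' by auto
qed

lemma slack_triple_run_outside:
  assumes r: "r5 x p q r b c" and rp: "r5 p c x q h1 k1" and n: "r \<notin> N p"
  shows "k1 \<notin> N x"
proof
  assume "k1 \<in> N x"
  note R = r5_adj[OF r] r5_adj[OF rp]
  note FF = r5_faces[OF r, unfolded F6_def] r5_faces[OF rp, unfolded F6_def]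
  have "k1 = b" using \<open>k1 \<in> N x\<close> r5D(2)[OF r] R n by auto
  then show False using not_degree_3[of c x p b] FF R by auto
qed

text \<open>An apex \<open>h1\<close> on the rim is no outside payer. If only one of
  \<open>b\<close>, \<open>c\<close> is large, \<open>k1\<close> replaces it, being adjacent to
  \<open>b\<close> as well and so of degree at least 8. If both are large, no slack is left for
  payers and the closure of \<open>b\<close> explodes.\<close>

lemma slack_triple_run_apex:
  assumes r: "r5 x p q r b c" and rq: "r5 q p x r h2 h1" and rp: "r5 p c x q h1 k1" and rr: "r5 r b x q h2 k2"
    and s: "slack x 5" and k: "k1 \<notin> N x" "k2 \<notin> N x" and h: "h1 = b" "h2 \<notin> N x" and bc: "8 \<le> d b \<or> 8 \<le> d c"
  shows False
proof -
  note R = r5_adj[OF r] r5_adj[OF rp] r5_adj[OF rq] r5_adj[OF rr]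
  have nin: "v \<noteq> p \<and> v \<noteq> q \<and> v \<noteq> r \<and> v \<noteq> b \<and> v \<noteq> c" if "v \<notin> N x" for v using R that by auto
  have gv: "gv x v" if "7 \<le> d v" "v \<in> N p \<or> v \<in> N q \<or> v \<in> N r" for v
    using gv_adj55[of x p v] gv_adj55[of x q v] gv_adj55[of x r v] R that by auto
  have gx: "gv x v \<and> extra x v = 2" if "8 \<le> d v" "v \<in> N x" for v
    using gv_adj5[of x v] extra_in[of v x] that R by auto
  show False
  proof (cases "8 \<le> d b \<and> 8 \<le> d c")
    case True
    have two: False if "gv x v" "2 \<le> extra x v" "v \<notin> N x" for v
      using slack_sum3[OF s _ _ that(1), of b c] gx[of b] gx[of c] True that(2,3) R by auto
    have h6: "d h2 \<le> 6"
    proof (rule ccontr)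
      assume "\<not> d h2 \<le> 6"
      then show False using two[OF gv[of h2]] extra_out(2)[OF h(2)] not_ovf_adj[of h2 q r] R h(2) by auto
    qed
    have k7: "d k2 \<le> 7"
    proof (rule ccontr)
      assume "\<not> d k2 \<le> 7"
      then show False using two[OF gv[of k2]] extra_out(3)[OF k(2)] R k(2) by auto
    qed
    show False using explode[of b "[(x, [b]), (p, [x]), (q, [x]), (r, [x]), (h2, [q, r]), (k2, [r, b, h2])]"]
      R h6 k7 nin[OF h(2)] nin[OF k(2)] by auto
  next
    case False
    obtain w where w: "w \<in> {b, c}" "8 \<le> d w" using bc by blast
    have cw: "5 + length cs \<le> d v" if "v \<notin> {b, c, x, p, q, r}" "set cs \<subseteq> N v" "set cs \<subseteq> {b, c, x, p, q, r}" "distinct cs" "cs \<noteq> []" for v cs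
    proof (cases "w = b")
      case True
      then show ?thesis using outside[of b "[(x, [b]), (p, [x]), (q, [x]), (r, [x]), (c, [x, p, b])]" v cs] w False that R by auto
    next
      case F: False
      then show ?thesis using outside[of c "[(x, [c]), (p, [x]), (q, [x]), (r, [x]), (b, [x, r, c])]" v cs] w False that R by auto
    qed
    have gw: "gv x w" "extra x w = 2" "w \<in> N x" using gx[of w] w R by auto
    have k8: "8 \<le> d k1" using cw[of k1 "[p, c, b]"] R h nin[OF k(1)] by auto
    have h8: "8 \<le> d h2" using cw[of h2 "[q, r, b]"] R h nin[OF h(2)] by auto
    have g: "gv x k1" "gv x h2" using gv k8 h8 R by auto
    show False
    proof (cases "k1 = h2")
      case True
      have "9 \<le> d h2" using cw[of h2 "[p, q, r, b]"] R h True nin[OF h(2)] by auto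
      then show False using slack_sum2[OF s gw(1) g(2)] gw(2,3) extra_out(4)[OF h(2)] h(2) by auto
    next
      case F: False
      then show False using slack_sum3[OF s gw(1) g] gw(2,3) extra_out(3)[OF h(2)] extra_out(3)[OF k(1)] h8 k8 h(2) k(1) by auto
    qed
  qed
qed

text \<open>If neither \<open>b\<close> nor \<open>c\<close> has degree 8, the closure of
  \<open>k1\<close> explodes. If both do, the apexes \<open>h1\<close> and \<open>h2\<close> cannot
  pay and are absorbed. If just one does, its closure is the star of \<open>x\<close>, so both
  apexes reach degree 7 and overpay.\<close>

lemma slack_triple_run:
  assumes r: "r5 x p q r b c" and d5s: "d p = 5" "d q = 5" "d r = 5" and s: "slack x 5"
  shows False
proof -
  note R0 = r5_adj[OF r] note F0 = r5_faces[OF r, unfolded F6_def]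
  obtain h2 h1 where rq: "r5 q p x r h2 h1" using r5_mid[of q p x r] F0 d5s R0 by auto
  note Fq = r5_faces[OF rq, unfolded F6_def] r5_adj(4)[OF rq]
  obtain k1 where rp: "r5 p c x q h1 k1" using r5_share[of p c x q h1] F0 d5s R0 Fq by auto
  obtain k2 where rr: "r5 r b x q h2 k2" using r5_share[of r b x q h2] F0 d5s R0 Fq by auto
  have rm: "r5 x r q p c b" using r5_rot[OF r5_rot[OF r5_rev[OF r]]] .
  have rqm: "r5 q r x p h1 h2" using r5_rot[OF r5_rot[OF r5_rev[OF rq]]] .
  note R = r5_adj[OF r] r5_adj[OF rp] r5_adj[OF rq] r5_adj[OF rr]
  have n: "r \<notin> N p" using slack_triple_run_nonadjacent[OF r rq rp rr] .
  then have n': "p \<notin> N r" using symN by blast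
  have k: "k1 \<notin> N x" "k2 \<notin> N x" using slack_triple_run_outside[OF r rp n] slack_triple_run_outside[OF rm rr n'] by auto
  have nin: "v \<noteq> p \<and> v \<noteq> q \<and> v \<noteq> r \<and> v \<noteq> b \<and> v \<noteq> c" if "v \<notin> N x" for v using R that by auto
  have bc: "8 \<le> d b \<or> 8 \<le> d c"
  proof (rule ccontr)
    assume "\<not> ?thesis"
    then show False using explode[of k1 "[(p, [k1]), (x, [p]), (q, [x]), (r, [x]), (c, [x, p, k1]), (b, [x, r, c])]"]
      R nin[OF k(1)] by auto
  qed
  have hx: "h1 \<in> N x \<Longrightarrow> h1 = b" "h2 \<in> N x \<Longrightarrow> h2 = c" using R r5D(2)[OF r] by auto
  have kk: "\<not> (h1 = b \<and> h2 = c)" using K5[of x p q b c] R by auto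
  have h: "h1 \<notin> N x" "h2 \<notin> N x"
    using hx kk slack_triple_run_apex[OF r rq rp rr s k] slack_triple_run_apex[OF rm rqm rr rp s k(2) k(1)] bc by blast+
  have gv: "gv x v" if "7 \<le> d v" "v \<in> N p \<or> v \<in> N q \<or> v \<in> N r" for v
    using gv_adj55[of x p v] gv_adj55[of x q v] gv_adj55[of x r v] R that by auto
  have gx: "gv x v \<and> extra x v = 2" if "8 \<le> d v" "v \<in> N x" for v
    using gv_adj5[of x v] extra_in[of v x] that R by auto
  have ex: "2 \<le> extra x h1" "2 \<le> extra x h2"
    using extra_out(2)[OF h(1)] extra_out(2)[OF h(2)] not_ovf_adj[of h1 p q] not_ovf_adj[of h2 q r] R by auto
  show False
  proof (cases "8 \<le> d b \<and> 8 \<le> d c")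
    case True
    have two: False if "gv x v" "2 \<le> extra x v" "v \<notin> N x" for v
      using slack_sum3[OF s _ _ that(1), of b c] gx[of b] gx[of c] True that(2,3) R by auto
    have h6: "d h1 \<le> 6"
    proof (rule ccontr)
      assume "\<not> d h1 \<le> 6"
      then show False using two[OF gv[of h1]] ex h R by auto
    qed
    have h6': "d h2 \<le> 6"
    proof (rule ccontr)
      assume "\<not> d h2 \<le> 6"
      then show False using two[OF gv[of h2]] ex h R by auto
    qed
    show False using explode[of b "[(x, [b]), (p, [x]), (q, [x]), (r, [x]), (h1, [p, q]), (h2, [q, r])]"]
      R h6 h6' nin[OF h(1)] nin[OF h(2)] by auto
  next
    case False
    obtain w where w: "w \<in> {b, c}" "8 \<le> d w" using bc by blast
    have cw: "5 + length cs \<le> d v" if "v \<notin> {b, c, x, p, q, r}" "set cs \<subseteq> N v" "set cs \<subseteq> {b, c, x, p, q, r}" "distinct cs" "cs \<noteq> []" for v cs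
    proof (cases "w = b")
      case True
      then show ?thesis using outside[of b "[(x, [b]), (p, [x]), (q, [x]), (r, [x]), (c, [x, p, b])]" v cs] w False that R by auto
    next
      case F: False
      then show ?thesis using outside[of c "[(x, [c]), (p, [x]), (q, [x]), (r, [x]), (b, [x, r, c])]" v cs] w False that R by auto
    qed
    have gw: "gv x w" "extra x w = 2" "w \<in> N x" using gx[of w] w R by auto
    have h7: "7 \<le> d h1" using cw[of h1 "[p, q]"] R nin[OF h(1)] by auto
    have h7': "7 \<le> d h2" using cw[of h2 "[q, r]"] R nin[OF h(2)] by auto
    have g: "gv x h1" "gv x h2" using gv h7 h7' R by auto
    show False using slack_sum3[OF s gw(1) g] gw ex h R by auto
  qed
qed

lemma slack_four_apex_outside:
  assumes r: "r5 x p q r s b" and rq: "r5 q p x r h2 h1" and rp: "r5 p b x q h1 k1"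
    and rr: "r5 r s x q h2 h3" and rs: "r5 s b x r h3 k2"
  shows "h1 \<notin> N x"
proof
  assume "h1 \<in> N x"
  note R = r5_adj[OF r] r5_adj[OF rp] r5_adj[OF rq] r5_adj[OF rr] r5_adj[OF rs]
  note FF = r5_faces[OF r, unfolded F6_def] r5_faces[OF rr, unfolded F6_def]
  have hs: "h1 = s" using \<open>h1 \<in> N x\<close> r5D(2)[OF r] R by auto
  then have "p \<in> N s" "q \<in> N s" using R by auto
  then have "p = h3 \<or> p = k2" "q = h3 \<or> q = k2" using r5D(2)[OF rs] R by auto
  moreover have "h3 \<noteq> q" using not_degree_3[of r q x s] FF R by auto
  ultimately have "h3 = p" using R by auto
  then show False using K5[of x p q r s] R hs by auto
qed

lemma slack_four_outside:
  assumes r: "r5 x p q r s b" and rp: "r5 p b x q h1 k1" and rr: "r5 r s x q b h3" and rs: "r5 s b x r h3 k2"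
    and h3: "h3 \<notin> N x"
  shows "k1 \<notin> N x"
proof
  assume k: "k1 \<in> N x"
  note R = r5_adj[OF r] r5_adj[OF rp] r5_adj[OF rr] r5_adj[OF rs]
  note FF = r5_faces[OF r, unfolded F6_def] r5_faces[OF rs, unfolded F6_def]
  have "k1 = r \<or> k1 = s" using k r5D(2)[OF r] R by auto
  then show False
  proof
    assume "k1 = r"
    then have "p \<in> N r" using R by auto
    then have "p = h3" using r5D(2)[OF rr] R by auto
    then show False using h3 R by auto
  next
    assume "k1 = s"
    then have "p \<in> N s" using R by auto
    moreover have "p \<noteq> h3" using h3 R by auto
    ultimately have "p = k2" using r5D(2)[OF rs] R by auto
    then show False using not_degree_3[of b x p s] FF R by auto
  qed
qed

text \<open>The closure of \<open>h1\<close> is filled without \<open>b\<close>, whose three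
  contacts give it degree at least 8; the closure of \<open>b\<close> in turn is the star of
  \<open>x\<close>. In general \<open>b\<close> and three apexes bring 8 against a slack of 7.
  Coinciding apexes have four contacts, hence degree at least 9 and payment 4.\<close>

lemma slack_four:
  assumes r: "r5 x p q r s b" and d5s: "d p = 5" "d q = 5" "d r = 5" "d s = 5" and sl: "slack x 7"
  shows False
proof -
  note R0 = r5_adj[OF r] note F0 = r5_faces[OF r, unfolded F6_def]
  obtain h2 h1 where rq: "r5 q p x r h2 h1" using r5_mid[of q p x r] F0 d5s R0 by auto
  note Fq = r5_faces[OF rq, unfolded F6_def] r5_adj(4)[OF rq]
  obtain k1 where rp: "r5 p b x q h1 k1" using r5_share[of p b x q h1] F0 d5s R0 Fq by auto
  obtain h3 where rr: "r5 r s x q h2 h3" using r5_share[of r s x q h2] F0 d5s R0 Fq by auto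
  note Fr = r5_faces[OF rr, unfolded F6_def] r5_adj(4)[OF rr]
  obtain k2 where rs: "r5 s b x r h3 k2" using r5_share[of s b x r h3] F0 d5s R0 Fr by auto
  have rm: "r5 x s r q p b" using r5_rot[OF r5_rev[OF r]] .
  have h: "h1 \<notin> N x" "h3 \<notin> N x" using slack_four_apex_outside[OF r rq rp rr rs] slack_four_apex_outside[OF rm rr rs rq rp] by auto
  note R = r5_adj[OF r] r5_adj[OF rp] r5_adj[OF rq] r5_adj[OF rr] r5_adj[OF rs]
  have nin: "v \<noteq> p \<and> v \<noteq> q \<and> v \<noteq> r \<and> v \<noteq> s \<and> v \<noteq> b" if "v \<notin> N x" for v using R that by auto
  have gv: "gv x v" if "7 \<le> d v" "v \<in> N p \<or> v \<in> N q \<or> v \<in> N r \<or> v \<in> N s" for v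
    using gv_adj55[of x p v] gv_adj55[of x q v] gv_adj55[of x r v] gv_adj55[of x s v] R that by auto
  have cw: "5 + length cs \<le> d v" if "v \<notin> {b, x, p, q, r, s}" "set cs \<subseteq> N v" "set cs \<subseteq> {b, x, p, q, r, s}" "distinct cs" "cs \<noteq> []" for v cs
    using outside[of b "[(x, [b]), (p, [x]), (q, [x]), (r, [x]), (s, [x])]" v cs] that R by auto
  have b8: "8 \<le> d b" using outside[of h1 "[(p, [h1]), (x, [p]), (q, [x]), (r, [x]), (s, [x])]" b "[x, p, s]"] R nin[OF h(1)] by auto
  have b: "gv x b" "extra x b = 2" using gv_adj5[of x b] extra_in[of b x] R b8 by auto
  have h17: "7 \<le> d h1" using cw[of h1 "[p, q]"] R nin[OF h(1)] by auto
  have h37: "7 \<le> d h3" using cw[of h3 "[r, s]"] R nin[OF h(2)] by auto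
  have g: "gv x h1" "gv x h3" using gv h17 h37 R by auto
  have ex: "2 \<le> extra x h1" "2 \<le> extra x h3"
    using extra_out(2)[OF h(1)] extra_out(2)[OF h(2)] not_ovf_adj[of h1 p q] not_ovf_adj[of h3 r s] R by auto
  show False
  proof (cases "h2 = b")
    case False
    then have h2: "h2 \<notin> N x" using R r5D(2)[OF r] by auto
    have h27: "7 \<le> d h2" using cw[of h2 "[q, r]"] R nin[OF h2] by auto
    have g2: "gv x h2" using gv h27 R by auto
    have ex2: "2 \<le> extra x h2" using extra_out(2)[OF h2] not_ovf_adj[of h2 q r] R by auto
    show False
    proof (cases "h1 = h3")
      case True
      then have "9 \<le> d h1" using cw[of h1 "[p, q, r, s]"] R nin[OF h(1)] by auto
      then show False using slack_sum3[OF sl b(1) g(1) g2] b(2) ex2 extra_out(4)[OF h(1)] nin[OF h(1)] nin[OF h2] R by auto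
    next
      case F: False
      then show False using slack_sum4[OF sl b(1) g(1) g2 g(2)] b(2) ex2 ex nin[OF h(1)] nin[OF h2] nin[OF h(2)] R by auto
    qed
  next
    case True
    \<comment> \<open>The middle apex falls on the rim; the last neighbours \<open>k1\<close> and
      \<open>k2\<close> of the outer 5-vertices make up for it.\<close>
    have rr': "r5 r s x q b h3" and rq': "r5 q p x r b h1" using rr rq True by auto
    have k: "k1 \<notin> N x" "k2 \<notin> N x" using slack_four_outside[OF r rp rr' rs h(2)] slack_four_outside[OF rm rs rq' rp h(1)] by auto
    have k17: "7 \<le> d k1" using cw[of k1 "[p, b]"] R nin[OF k(1)] by auto
    have k27: "7 \<le> d k2" using cw[of k2 "[s, b]"] R nin[OF k(2)] by auto
    have gk: "gv x k1" "gv x k2" using gv k17 k27 R by auto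
    have exk: "1 \<le> extra x k1" "1 \<le> extra x k2" using extra_out(1) k by auto
    have exkk: "2 \<le> extra x k1" if "k1 = k2"
      using extra_out(2)[OF k(1)] not_ovf_two'[of k1 p s x] that R by auto
    note nn = nin[OF h(1)] nin[OF h(2)] nin[OF k(1)] nin[OF k(2)]
    show False
    proof (cases "h1 = h3")
      case hh: True
      then have "9 \<le> d h1" using cw[of h1 "[p, q, r, s]"] R nin[OF h(1)] by auto
      then have e4: "4 \<le> extra x h1" using extra_out(4)[OF h(1)] by auto
      show False
      proof (cases "k1 = k2")
        case True
        then show False using slack_sum3[OF sl b(1) g(1) gk(1)] b(2) e4 exkk nn R by auto
      next
        case False
        then show False using slack_sum4[OF sl b(1) g(1) gk] b(2) e4 exk nn hh R by auto
      qed
    next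
      case hh: False
      consider "k1 = h3" | "k2 = h1" | "k1 \<noteq> h3" "k2 \<noteq> h1" "k1 = k2" | "k1 \<noteq> h3" "k2 \<noteq> h1" "k1 \<noteq> k2" by blast
      then show False
      proof cases
        case 1
        then have "9 \<le> d h3" using cw[of h3 "[p, r, s, b]"] R nn by auto
        then show False using slack_sum3[OF sl b(1) g] b(2) ex extra_out(4)[OF h(2)] hh nn R by auto
      next
        case 2
        then have "9 \<le> d h1" using cw[of h1 "[p, q, s, b]"] R nn by auto
        then show False using slack_sum3[OF sl b(1) g] b(2) ex extra_out(4)[OF h(1)] hh nn R by auto
      next
        case 3
        then show False using slack_sum4[OF sl b(1) g gk(1)] b(2) ex exkk hh nn R by auto
      next
        case 4
        then show False using slack_sum5[OF sl b(1) g gk] b(2) ex exk hh nn R by auto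
      qed
    qed
  qed
qed

lemma five_not_all_five:
  assumes r: "r5 x p q r s t" and d5s: "d p = 5" "d q = 5" "d r = 5" "d s = 5" "d t = 5"
  shows False
proof -
  note R = r5_adj[OF r]
  obtain w where w: "w \<in> N p" "w \<notin> insert x (N x)" using nbr_outside[of x p] R d5s by auto
  have "w \<noteq> p" "w \<noteq> q" "w \<noteq> r" "w \<noteq> s" "w \<noteq> t" "w \<noteq> x" using w(2) R by auto
  moreover have "p \<in> N w" "w \<in> V" using w symN NV by blast+
  ultimately show False using explode[of w "[(p, [w]), (x, [p]), (q, [x]), (r, [x]), (s, [x]), (t, [x])]"] R d5s w(1) by auto
qed

text \<open>The shares of the 6-neighbours arrive separately. A shortfall is refuted for each cyclic
  pattern of 5-neighbours; up to symmetry there are one, two, two, one and one patterns for one to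
  five of them.\<close>

lemma five_income:
  assumes dx: "d x = 5"
  shows "2 * (card (Bg x) + card (P5 x)) \<le> ghat x"
proof (rule ccontr)
  assume "\<not> ?thesis"
  then have g: "ghat x < 2 * card (Bg x) + 2 * card (P5 x)" by simp
  have ne: "card (P5 x) \<noteq> 0" using g ghat_Bg(1)[OF dx] by linarith
  have s: "slack x k" if "2 * card (P5 x) = Suc k" for k
    using ghat_Bg(2)[OF dx, of k] g that by simp
  obtain y where y: "y \<in> N x" using dx unfolding d_def by fastforce
  obtain a b c p q where r: "r5 x a b c p q" using r5_ex[of x y "nx x y"] dx face[OF y] y unfolding F_def by blast
  note r1 = r5_rot[OF r] note r2 = r5_rot[OF r1] note r3 = r5_rot[OF r2] note r4 = r5_rot[OF r3]
  note v0 = r5_rev[OF r] note v1 = r5_rev[OF r1] note v2 = r5_rev[OF r2] note v3 = r5_rev[OF r3] note v4 = r5_rev[OF r4]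
  have D: "distinct [a, b, c, p, q]" "N x = {a, b, c, p, q}" using r5D[OF r] by auto
  have "card (P5 x) = (\<Sum>v\<in>N x. if d v = 5 then 1 else 0)"
    unfolding P5_def using finN by (simp add: sum.If_cases Int_def)
  also have "\<dots> = (if d a = 5 then 1 else 0) + (if d b = 5 then 1 else 0) + (if d c = 5 then 1 else 0)
     + (if d p = 5 then 1 else 0) + (if d q = 5 then 1 else 0)"
    using D by simp
  finally have cnt: "card (P5 x) = \<dots>" .
  consider "card (P5 x) = 1" | "card (P5 x) = 2" | "card (P5 x) = 3" | "card (P5 x) = 4" | "card (P5 x) = 5"
    using cnt ne by (auto split: if_splits)
  then show False
  proof cases
    case 1
    have s1: "slack x 1" using s[of 1] 1 by simp
    show False using 1 cnt slack_single[OF r _ _ _ _ _ s1] slack_single[OF r1 _ _ _ _ _ s1] slack_single[OF r2 _ _ _ _ _ s1] slack_single[OF r3 _ _ _ _ _ s1] slack_single[OF r4 _ _ _ _ _ s1]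
      by - (cases "d a = 5"; cases "d b = 5"; cases "d c = 5"; cases "d p = 5"; cases "d q = 5"; simp)
  next
    case 2
    have s3: "slack x 3" using s[of 3] 2 by simp
    show False using 2 cnt slack_pair_adjacent[OF r _ _ s3] slack_pair_adjacent[OF r1 _ _ s3] slack_pair_adjacent[OF r2 _ _ s3] slack_pair_adjacent[OF r3 _ _ s3] slack_pair_adjacent[OF r4 _ _ s3]
      slack_pair_apart[OF r _ _ s3] slack_pair_apart[OF r1 _ _ s3] slack_pair_apart[OF r2 _ _ s3] slack_pair_apart[OF r3 _ _ s3] slack_pair_apart[OF r4 _ _ s3]
      by - (cases "d a = 5"; cases "d b = 5"; cases "d c = 5"; cases "d p = 5"; cases "d q = 5"; simp)
  next
    case 3
    have s5: "slack x 5" using s[of 5] 3 by simp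
    show False using 3 cnt slack_triple_run[OF r _ _ _ s5] slack_triple_run[OF r1 _ _ _ s5] slack_triple_run[OF r2 _ _ _ s5] slack_triple_run[OF r3 _ _ _ s5] slack_triple_run[OF r4 _ _ _ s5]
      slack_triple_split[OF r _ _ _ s5] slack_triple_split[OF r1 _ _ _ s5] slack_triple_split[OF r2 _ _ _ s5] slack_triple_split[OF r3 _ _ _ s5] slack_triple_split[OF r4 _ _ _ s5]
      by - (cases "d a = 5"; cases "d b = 5"; cases "d c = 5"; cases "d p = 5"; cases "d q = 5"; simp)
  next
    case 4
    have s7: "slack x 7" using s[of 7] 4 by simp
    show False using 4 cnt slack_four[OF r _ _ _ _ s7] slack_four[OF r1 _ _ _ _ s7] slack_four[OF r2 _ _ _ _ s7] slack_four[OF r3 _ _ _ _ s7] slack_four[OF r4 _ _ _ _ s7]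
      by - (cases "d a = 5"; cases "d b = 5"; cases "d c = 5"; cases "d p = 5"; cases "d q = 5"; simp)
  next
    case 5
    show False using 5 cnt five_not_all_five[OF r] by - (cases "d a = 5"; cases "d b = 5"; cases "d c = 5"; cases "d p = 5"; cases "d q = 5"; simp)
  qed
qed

section \<open>Income of the vertices of degree 6\<close>

lemma ghat1: "gv c a \<Longrightarrow> pay a c \<le> ghat c" using ghat_list[of "[a]" c] by simp

lemma ghat2: "gv c a \<Longrightarrow> gv c b \<Longrightarrow> a \<noteq> b \<Longrightarrow> pay a c + pay b c \<le> ghat c"
  using ghat_list[of "[a, b]" c] by auto

lemma ghat3:
  assumes "gv x a" "gv x b" "gv x c" "distinct [a, b, c]" shows "pay a x + pay b x + pay c x \<le> ghat x"
proof -
  have "sum_list (map (\<lambda>v. pay v x) [a, b, c]) \<le> ghat x" by (rule ghat_list) (use assms in auto)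
  then show ?thesis by simp
qed

lemma gv_chain: "chain [v] steps \<Longrightarrow> v \<in> V \<Longrightarrow> 7 \<le> d v \<Longrightarrow> y \<in> set (map fst steps) \<Longrightarrow> gv y v"
  using cl_chain[of v steps] unfolding gv_def big_def by auto

text \<open>\<open>v\<close> gives two half units unless it overflows, and then it has degree 7. In
  that case the closure of an outer neighbour of the 5-vertex \<open>p\<close> takes in the whole
  star of \<open>x\<close>, even \<open>v\<close> by three contacts.\<close>

lemma six_single_one_big_near:
  assumes r: "r5 x v a b c e" and le: "d a \<le> 6" "d b \<le> 6" "d c \<le> 6" "d e \<le> 6" and v: "7 \<le> d v"
    and p: "p \<in> {a, b}" "d p = 5" and y: "y \<in> {a, b, c, e}"
  shows "2 \<le> ghat y"
proof -
  note R = r5_adj[OF r]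
  have gy: "gv y v" using gv_chain[of v "[(x, [v]), (a, [v, x]), (b, [a, x]), (c, [b, x]), (e, [v, x])]" y] R le v y by auto
  show ?thesis
  proof (cases "ovf v")
    case False
    then show ?thesis using ghat1[OF gy] pay_lower(3)[of v y] by linarith
  next
    case True
    then have v7: "d v = 7" by (rule ovf_7)
    have "p \<in> N x" using p R by auto
    then obtain w where w: "w \<in> N p" "w \<notin> insert x (N x)" using nbr_outside[of x p] p R by auto
    have ne: "w \<noteq> x \<and> w \<noteq> v \<and> w \<noteq> a \<and> w \<noteq> b \<and> w \<noteq> c \<and> w \<noteq> e" using w(2) R by auto
    have wp: "p \<in> N w" "w \<in> V" using w symN NV by blast+
    obtain S where S: "chain [w] S" "distinct (w # map fst S)" "length S = 6" "{a, b, c, e} \<subseteq> set (map fst S)"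
    proof (cases "p = a")
      case True
      show ?thesis by (rule that[of "[(a, [w]), (x, [a]), (b, [a, x]), (c, [b, x]), (e, [c, x]), (v, [x, a, e])]"])
          (use R le v7 True ne w wp p in auto)
    next
      case False
      then have "p = b" using p by blast
      then show ?thesis by (intro that[of "[(b, [w]), (x, [b]), (a, [b, x]), (c, [b, x]), (e, [c, x]), (v, [x, a, e])]"])
          (use R le v7 ne w wp p in auto)
    qed
    show ?thesis using explode[OF wp(2) S(1-3)] by blast
  qed
qed

lemma six_single_one_big:
  assumes r: "r5 x v a b c e" and le: "d a \<le> 6" "d b \<le> 6" "d c \<le> 6" "d e \<le> 6" and v: "7 \<le> d v"
    and nh: "\<not> hub x" and y: "y \<in> {a, b, c, e}"
  shows "2 \<le> ghat y"
proof -
  note R = r5_adj[OF r]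
  have "Bg x = {v}" unfolding Bg_def using r5D(2)[OF r] le v by auto
  then have "P5 x \<noteq> {}" using nh R unfolding hub_def hub1_def by auto
  then obtain p where p: "p \<in> N x" "d p = 5" unfolding P5_def by blast
  then have "p \<in> {a, b} \<or> p \<in> {c, e}" using r5D(2)[OF r] v by auto
  then show ?thesis
  proof
    assume "p \<in> {a, b}"
    then show ?thesis using six_single_one_big_near[OF r le v _ p(2) y] by blast
  next
    assume h: "p \<in> {c, e}"
    have r': "r5 x v e c b a" using r5_rot[OF r5_rot[OF r5_rot[OF r5_rot[OF r5_rev[OF r]]]]] .
    show ?thesis using six_single_one_big_near[OF r' le(4,3,2,1) v _ p(2), of y] h y by blast
  qed
qed

text \<open>Either two vertices of degree at least 7 in the link of \<open>x\<close> reach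
  \<open>y\<close> and give at least a half unit each, or there is only one and
  \<open>six_single_one_big\<close> applies, or there is none, which only a hub allows.\<close>

lemma six_single:
  assumes y: "d y = 6" and x: "x \<in> N y" "d x = 5" "\<not> hub x"
  shows "2 \<le> ghat y"
proof -
  have yx: "y \<in> N x" using x symN by blast
  obtain a b c e where r: "r5 x y a b c e" using r5_ex[of x y "nx x y"] x face[OF yx] yx unfolding F_def by blast
  note R = r5_adj[OF r]
  have ga: "gv y a" if "7 \<le> d a" using gv_chain[of a "[(x, [a]), (y, [a, x])]" y] R that y by auto
  have ge: "gv y e" if "7 \<le> d e" using gv_chain[of e "[(x, [e]), (y, [e, x])]" y] R that y by auto
  have gb: "gv y b" if "7 \<le> d b" "d a \<le> 6 \<or> (d c \<le> 6 \<and> d e \<le> 6)"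
    using that(2)
  proof
    assume "d a \<le> 6"
    then show ?thesis using gv_chain[of b "[(x, [b]), (a, [b, x]), (y, [a, x])]" y] R that y by auto
  next
    assume "d c \<le> 6 \<and> d e \<le> 6"
    then show ?thesis using gv_chain[of b "[(x, [b]), (c, [b, x]), (e, [c, x]), (y, [e, x])]" y] R that y by auto
  qed
  have gc: "gv y c" if "7 \<le> d c" "d e \<le> 6 \<or> (d b \<le> 6 \<and> d a \<le> 6)"
    using that(2)
  proof
    assume "d e \<le> 6"
    then show ?thesis using gv_chain[of c "[(x, [c]), (e, [c, x]), (y, [e, x])]" y] R that y by auto
  next
    assume "d b \<le> 6 \<and> d a \<le> 6"
    then show ?thesis using gv_chain[of c "[(x, [c]), (b, [c, x]), (a, [b, x]), (y, [a, x])]" y] R that y by auto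
  qed
  have two: ?thesis if "gv y u" "gv y w" "u \<noteq> w" for u w
    using ghat2[OF that] pay_lower(1)[of u y] pay_lower(1)[of w y] by linarith
  note r1 = r5_rot[OF r] note r2 = r5_rot[OF r1] note r3 = r5_rot[OF r2] note r4 = r5_rot[OF r3]
  have y6: "d y \<le> 6" using y by simp
  have ne: "a \<noteq> e" "a \<noteq> c" "a \<noteq> b" "b \<noteq> e" "c \<noteq> e" "b \<noteq> c" using R by auto
  have L: "d v \<le> 6" if "\<not> 7 \<le> d v" for v using that by simp
  show ?thesis
  proof (cases "7 \<le> d a")
    case a: True
    show ?thesis
    proof (cases "7 \<le> d e")
      case True then show ?thesis using two ga ge a ne by blast
    next
      case e: False
      show ?thesis
      proof (cases "7 \<le> d c")
        case True then show ?thesis using two ga gc a L[OF e] ne by blast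
      next
        case c: False
        show ?thesis
        proof (cases "7 \<le> d b")
          case True then show ?thesis using two ga gb a L[OF e] L[OF c] ne by blast
        next
          case b: False
          then show ?thesis using six_single_one_big[OF r1 L[OF b] L[OF c] L[OF e] y6 a x(3)] by blast
        qed
      qed
    qed
  next
    case a: False
    show ?thesis
    proof (cases "7 \<le> d e")
      case e: True
      show ?thesis
      proof (cases "7 \<le> d b")
        case True then show ?thesis using two ge gb e L[OF a] ne by blast
      next
        case b: False
        show ?thesis
        proof (cases "7 \<le> d c")
          case True then show ?thesis using two ge gc e L[OF a] L[OF b] ne by blast
        next
          case c: False
          then show ?thesis using six_single_one_big[OF r4 y6 L[OF a] L[OF b] L[OF c] e x(3)] by blast
        qed
      qed
    next
      case e: False
      show ?thesis
      proof (cases "7 \<le> d b")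
        case b: True
        show ?thesis
        proof (cases "7 \<le> d c")
          case True then show ?thesis using two gb gc b L[OF a] L[OF e] ne by blast
        next
          case c: False
          then show ?thesis using six_single_one_big[OF r2 L[OF c] L[OF e] y6 L[OF a] b x(3)] by blast
        qed
      next
        case b: False
        show ?thesis
        proof (cases "7 \<le> d c")
          case c: True
          show ?thesis using six_single_one_big[OF r3 L[OF e] y6 L[OF a] L[OF b] c x(3)] by blast
        next
          case c: False
          have "Bg x = {}" unfolding Bg_def using r5D(2)[OF r] a b c e y by auto
          then have "hub0 x \<or> P5 x \<noteq> {}" using x(2) unfolding hub0_def by blast
          then show ?thesis using x(3) Bg_nonempty[OF x(2)] \<open>Bg x = {}\<close> unfolding hub_def by blast
        qed
      qed
    qed
  qed
qed

text \<open>A common 5-neighbour \<open>x\<close> carries the closure of \<open>v\<close> to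
  \<open>y\<close>, and from there to all 5-neighbours of \<open>y\<close> and to the light vertices
  next to them.\<close>

lemma six_cl:
  assumes y: "d y = 6" and v: "v \<in> N y" and x: "x \<in> N y" "x \<in> N v" "d x = 5"
  shows "x \<in> cl v" "y \<in> cl v" "P5 y \<subseteq> cl v"
    "l \<in> N y \<Longrightarrow> d l \<le> 6 \<Longrightarrow> x' \<in> P5 y \<Longrightarrow> x' \<in> N l \<Longrightarrow> l \<in> cl v"
    "7 \<le> d v \<Longrightarrow> gv y v \<and> 2 \<le> pay v y" "8 \<le> d v \<Longrightarrow> 4 \<le> pay v y"
proof -
  have vV: "v \<in> V" using v NV by blast
  show xc: "x \<in> cl v" using absorb1[OF vV, of v x] x cl_self symN by auto
  have "v \<noteq> x" using x irr by blast
  then show yc: "y \<in> cl v" using absorb2[OF vV v x(1)] xc cl_self y by auto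
  show P: "P5 y \<subseteq> cl v" using absorb1[OF vV, of y] yc symN unfolding P5_def by auto
  show "l \<in> cl v" if l: "l \<in> N y" "d l \<le> 6" "x' \<in> P5 y" "x' \<in> N l"
  proof -
    have "x' \<in> N y" using l(3) unfolding P5_def by blast
    then have "x' \<noteq> y" using irr by blast
    then show ?thesis using absorb2[OF vV l(4), of y] l P yc symN by auto
  qed
  show "7 \<le> d v \<Longrightarrow> gv y v \<and> 2 \<le> pay v y" using yc vV pay_lower(2)[OF v] unfolding gv_def big_def by simp
  show "8 \<le> d v \<Longrightarrow> 4 \<le> pay v y" using pay_lower(5)[OF v] .
qed

lemma six_seven:
  assumes y: "d y = 6" and v: "v \<in> V" "insert y (N y) \<subseteq> cl v"
  shows False
proof -
  have "card (insert y (N y)) = 7" using y irr[of y] finN[of y] by (simp add: d_def)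
  then show False using card_mono[OF fin_cl[OF v(1)] v(2)] cl_card[OF v(1)] by simp
qed

text \<open>The star of \<open>y\<close> has seven vertices, so \<open>w\<close> is left out of the
  closure. Its contacts are \<open>y\<close> and the apexes of the two faces at their common
  edge.\<close>

lemma six_eight:
  assumes y: "d y = 6" and w: "w \<in> N y" and v: "v \<in> V" "insert y (N y) - {w} \<subseteq> cl v"
  shows "8 \<le> d w"
proof -
  have n: "w \<notin> cl v" using six_seven[OF y v(1)] v(2) by blast
  have yw: "y \<in> N w" using w symN by blast
  have f: "nx y w \<in> N y" "nx y w \<in> N w" "nx w y \<in> N w" "nx w y \<in> N y" using face[OF w] face[OF yw] by auto
  have ne: "nx y w \<noteq> nx w y" using apex_two(2)[OF w] .
  have "nx y w \<noteq> w" "nx w y \<noteq> w" "nx y w \<noteq> y" "nx w y \<noteq> y" "y \<noteq> w" using f irr w by metis+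
  then have "5 + card {y, nx y w, nx w y} \<le> d w"
    using contacts_cl[OF v(1) NV(1)[OF w] n, of "{y, nx y w, nx w y}"] f yw v(2) by auto
  then show ?thesis using ne \<open>nx y w \<noteq> y\<close> \<open>nx w y \<noteq> y\<close> by simp
qed

text \<open>The closure of \<open>a\<close> takes in everything but \<open>e\<close>. This
  \<open>e\<close> then has three contacts with it, hence degree at least 8 and payment 4.\<close>

lemma six_pair_opposite_main:
  assumes r: "r6 y p a b q c e" and f: "d p = 5" "d q = 5" and le: "d a \<le> 6" "d b \<le> 6" "d c \<le> 6"
  shows "4 \<le> ghat y"
proof -
  note R = r6_adj[OF r]
  show ?thesis
  proof (cases "d e \<le> 6")
    case True
    then show ?thesis using explode[of a "[(p, [a]), (y, [a, p]), (q, [y]), (b, [q, y]), (c, [q, y]), (e, [p, y])]"] R f le by auto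
  next
    case False
    have e8: "8 \<le> d e" using outside[of a "[(p, [a]), (y, [a, p]), (q, [y]), (b, [q, y]), (c, [q, y])]" e "[p, y, c]"] R f le by auto
    then have "gv y e" "4 \<le> pay e y" using six_cl(5,6)[of y e p] R f by auto
    then show ?thesis using ghat1[of y e] by linarith
  qed
qed

lemma six_pair_opposite:
  assumes r: "r6 y p a b q c e" and f: "d p = 5" "d q = 5"
  shows "4 \<le> ghat y"
proof -
  note R = r6_adj[OF r]
  have r3: "r6 y q c e p a b" using r6_rot[OF r6_rot[OF r6_rot[OF r]]] .
  have v0: "r6 y p e c q b a" using r6_rot[OF r6_rot[OF r6_rot[OF r6_rot[OF r6_rot[OF r6_rev[OF r]]]]]] .
  have v3: "r6 y q b a p e c" using r6_rot[OF r6_rot[OF r6_rot[OF r6_rot[OF r6_rot[OF r6_rev[OF r3]]]]]] .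
  have g: "gv y v \<and> 2 \<le> pay v y" if "7 \<le> d v" "v \<in> {a, b, c, e}" for v
    using six_cl(5)[of y v p] six_cl(5)[of y v q] R f that by auto
  have two: ?thesis if "7 \<le> d v" "7 \<le> d w" "v \<in> {a, b, c, e}" "w \<in> {a, b, c, e}" "v \<noteq> w" for v w
    using g[OF that(1,3)] g[OF that(2,4)] ghat2[of y v w] that(5) by linarith
  have ne: "a \<noteq> e" "a \<noteq> c" "a \<noteq> b" "b \<noteq> e" "c \<noteq> e" "b \<noteq> c" using R by auto
  show ?thesis
  proof (cases "(7 \<le> d a \<and> 7 \<le> d b) \<or> (7 \<le> d a \<and> 7 \<le> d c) \<or> (7 \<le> d a \<and> 7 \<le> d e) \<or> (7 \<le> d b \<and> 7 \<le> d c)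
      \<or> (7 \<le> d b \<and> 7 \<le> d e) \<or> (7 \<le> d c \<and> 7 \<le> d e)")
    case True
    then show ?thesis using two ne by blast
  next
    case False
    then consider "d a \<le> 6" "d b \<le> 6" "d c \<le> 6" | "d c \<le> 6" "d e \<le> 6" "d a \<le> 6" | "d e \<le> 6" "d c \<le> 6" "d b \<le> 6"
      | "d b \<le> 6" "d a \<le> 6" "d e \<le> 6" by linarith
    then show ?thesis
      using six_pair_opposite_main[OF r f] six_pair_opposite_main[OF r3 f(2,1)] six_pair_opposite_main[OF v0 f] six_pair_opposite_main[OF v3 f(2,1)]
      by cases blast+
  qed
qed

text \<open>\<open>s\<close> and \<open>t\<close> are the outer neighbours of \<open>q\<close>. The
  chains fill the closure of each of them without the other, so both have degree at least 7 and pay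
  at least a half unit; \<open>e\<close> of degree 7 supplies the other two. A light
  \<open>e\<close> makes a closure explode.\<close>

lemma six_pair_gap_main:
  assumes r: "r6 y p a q b c e" and f: "d p = 5" "d q = 5" and le: "d a \<le> 6" "d b \<le> 6" "d e \<le> 7"
  shows "4 \<le> ghat y"
proof -
  note F0 = r6_faces[OF r, unfolded F6_def] r6_adj(4)[OF r]
  obtain s t where rq: "r5 q a y b s t" using r5_mid[of q a y b] F0 f by auto
  obtain s' t' where rp: "r5 p a y e s' t'" using r5_mid[of p a y e] F0 f by auto
  note R = r6_adj[OF r] r5_adj[OF rq] r5_adj[OF rp]
  note FF = F0 r5_faces[OF rq, unfolded F6_def] r5_faces[OF rp, unfolded F6_def]
  have tp: "t \<noteq> p" using not_degree_3[of a y p q] FF by auto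
  have sp: "s \<noteq> p"
  proof
    assume sp: "s = p"
    have "q \<in> N p" "b \<in> N p" using R sp by auto
    then have "q = s' \<or> q = t'" "b = s' \<or> b = t'" using r5D(2)[OF rp] R by auto
    moreover have "t' \<noteq> q" using not_degree_3[of a y p q] FF by auto
    ultimately have "t' = b" "s' = q" using R by auto
    then show False using K5[of p q y a b] R by auto
  qed
  let ?S = "[(q, [s]), (b, [q, s]), (y, [q, b]), (p, [y]), (a, [q, y])]"
  let ?T = "[(q, [t]), (a, [q, t]), (y, [q, a]), (p, [y]), (b, [q, y])]"
  show ?thesis
  proof (cases "d e \<le> 6")
    case True
    have False
    proof (cases "s = e")
      case se: True
      then show False using explode[of t "[(q, [t]), (a, [q, t]), (y, [q, a]), (p, [y]), (b, [q, y]), (e, [p, y])]"] R f le True tp by auto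
    next
      case False
      then show False using explode[of s "[(q, [s]), (b, [q, s]), (y, [q, b]), (p, [y]), (a, [q, y]), (e, [p, y])]"] R f le True sp by auto
    qed
    then show ?thesis ..
  next
    case False
    have oS: "5 + length cs \<le> d w" if "w \<notin> {s, q, b, y, p, a}" "set cs \<subseteq> N w" "set cs \<subseteq> {s, q, b, y, p, a}" "distinct cs" "cs \<noteq> []" for w cs
      using outside[of s ?S w cs] that R f le sp by auto
    have oT: "5 + length cs \<le> d w" if "w \<notin> {t, q, b, y, p, a}" "set cs \<subseteq> N w" "set cs \<subseteq> {t, q, b, y, p, a}" "distinct cs" "cs \<noteq> []" for w cs
      using outside[of t ?T w cs] that R f le tp by auto
    have t7: "7 \<le> d t" using oS[of t "[q, a]"] R tp by auto
    have s7: "7 \<le> d s" using oT[of s "[q, b]"] R sp by auto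
    have es: "e \<noteq> s" using oT[of e "[p, y, q, b]"] R le sp tp by auto
    have et: "e \<noteq> t" using oS[of e "[p, y, q, a]"] R le sp tp by auto
    have g: "gv y s" "gv y t" using gv_chain[of s ?S y] gv_chain[of t ?T y] R f le s7 t7 sp tp by auto
    have ge: "gv y e" "2 \<le> pay e y" using six_cl(5)[of y e p] R f False by auto
    have "pay e y + pay s y + pay t y \<le> ghat y" using ghat3[OF ge(1) g] es et R by auto
    then show ?thesis using ge pay_lower(1)[of s y] pay_lower(1)[of t y] by linarith
  qed
qed

text \<open>With \<open>b\<close> and \<open>e\<close> light, the closure of an outer neighbour of
  \<open>p\<close> collects too much; the remaining coincidence ends in a \<open>K5\<close>.\<close>

lemma six_pair_gap_middle:
  assumes r: "r6 y p a q b c e" and f: "d p = 5" "d q = 5" and le: "d a \<le> 7" "d b \<le> 6" "d e \<le> 6"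
  shows False
proof -
  note F0 = r6_faces[OF r, unfolded F6_def] r6_adj(4)[OF r]
  obtain s t where rp: "r5 p a y e s t" using r5_mid[of p a y e] F0 f by auto
  note R = r6_adj[OF r] r5_adj[OF rp]
  note FF = F0 r5_faces[OF rp, unfolded F6_def]
  have tq: "t \<noteq> q" using not_degree_3[of a y p q] FF by auto
  have "s = b \<or> s = q"
  proof (rule ccontr)
    assume "\<not> ?thesis"
    then show False using explode[of s "[(p, [s]), (e, [p, s]), (y, [p, e]), (q, [y]), (b, [q, y]), (a, [p, q, y])]"] R f le by auto
  qed
  then show False
  proof
    assume "s = b"
    then show False using explode[of t "[(p, [t]), (b, [p, t]), (e, [p, b]), (y, [p, e]), (q, [y]), (a, [p, q, y])]"] R f le tq by auto
  next
    assume sq: "s = q"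
    show False
    proof (cases "t = b")
      case True
      then show False using K5[of p q y a b] R sq by auto
    next
      case False
      then show False using explode[of t "[(p, [t]), (q, [t]), (e, [p, q]), (y, [p, e]), (b, [q, y]), (a, [p, q, y])]"] R f le tq sq by auto
    qed
  qed
qed

lemma six_pair_gap:
  assumes r: "r6 y p a q b c e" and f: "d p = 5" "d q = 5"
  shows "4 \<le> ghat y"
proof -
  note R = r6_adj[OF r]
  have v: "r6 y q a p e c b" using r6_rot[OF r6_rot[OF r6_rot[OF r6_rev[OF r]]]] .
  have g: "gv y v \<and> 2 \<le> pay v y" if "7 \<le> d v" "v \<in> {a, b, e}" for v
    using six_cl(5)[of y v p] six_cl(5)[of y v q] R f that by auto
  have g8: ?thesis if "8 \<le> d v" "v \<in> {a, b, e}" for v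
    using six_cl(6)[of y v p] six_cl(6)[of y v q] g[of v] ghat1[of y v] R f that by auto
  have two: ?thesis if "7 \<le> d v" "7 \<le> d w" "v \<in> {a, b, e}" "w \<in> {a, b, e}" "v \<noteq> w" for v w
    using g[OF that(1,3)] g[OF that(2,4)] ghat2[of y v w] that(5) by linarith
  have ne: "a \<noteq> b" "a \<noteq> e" "b \<noteq> e" using R by auto
  show ?thesis
  proof (cases "8 \<le> d a \<or> 8 \<le> d b \<or> 8 \<le> d e \<or> (7 \<le> d a \<and> 7 \<le> d b) \<or> (7 \<le> d a \<and> 7 \<le> d e) \<or> (7 \<le> d b \<and> 7 \<le> d e)")
    case True
    then show ?thesis using g8 two ne by blast
  next
    case False
    then consider "d a \<le> 6" "d b \<le> 6" "d e \<le> 7" | "d a \<le> 6" "d e \<le> 6" "d b \<le> 7" | "d a \<le> 7" "d b \<le> 6" "d e \<le> 6" by linarith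
    then show ?thesis using six_pair_gap_main[OF r f] six_pair_gap_main[OF v f(2,1)] six_pair_gap_middle[OF r f] by cases blast+
  qed
qed

text \<open>The closures of the apex \<open>r\<close> and of the outer neighbour \<open>s\<close> of
  \<open>p\<close> are both filled, and each of the two vertices has three contacts with the closure
  of the other. So both have degree at least 8.\<close>

lemma six_pair_adjacent_light:
  assumes r: "r6 y p q a b c e" and rp: "r5 p e y q r s" and rq: "r5 q a y p r u"
    and le: "d a \<le> 6" "d e \<le> 6" and sa: "s \<noteq> a"
  shows "4 \<le> ghat y"
proof -
  note R = r6_adj[OF r] r5_adj[OF rp] r5_adj[OF rq]
  let ?R = "[(p, [r]), (q, [r]), (y, [p, q]), (a, [q, y]), (e, [p, y])]"
  let ?S = "[(p, [s]), (q, [p]), (y, [p, q]), (a, [q, y]), (e, [p, y])]"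
  have s8: "8 \<le> d s" using outside[of r ?R s "[p, e, r]"] R le sa by auto
  have r8: "8 \<le> d r" using outside[of s ?S r "[p, q, s]"] R le sa by auto
  have "gv y s" "gv y r" using gv_chain[of s ?S y] gv_chain[of r ?R y] R le r8 s8 by auto
  then have "pay s y + pay r y \<le> ghat y" using ghat2[of y s r] R by auto
  then show ?thesis using pay_lower(4)[OF s8, of y] pay_lower(4)[OF r8, of y] by linarith
qed

text \<open>\<open>e\<close> gives two. The rest comes from the apex \<open>r\<close>, which never
  overflows, or, if \<open>r\<close> is light, from an outer neighbour of \<open>q\<close> or
  \<open>p\<close> with three contacts to the closure of \<open>e\<close>.\<close>

lemma six_pair_adjacent_one_big:
  assumes r: "r6 y p q a b c e" and rp: "r5 p e y q r s" and rq: "r5 q a y p r u"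
    and le: "d a \<le> 6" "7 \<le> d e"
  shows "4 \<le> ghat y"
proof -
  note R = r6_adj[OF r] r5_adj[OF rp] r5_adj[OF rq]
  have ge: "gv y e" "2 \<le> pay e y" using six_cl(5)[of y e p] R le by auto
  have fin: ?thesis if "gv y v" "2 \<le> pay v y" "v \<noteq> e" for v
    using ghat2[OF that(1) ge(1) that(3)] that(2) ge(2) by linarith
  show ?thesis
  proof (cases "7 \<le> d r")
    case True
    have "gv y r" using gv_chain[of r "[(p, [r]), (q, [r]), (y, [p, q])]" y] R True by auto
    moreover have "\<not> ovf r" using not_ovf_adj[of r p q] R by auto
    ultimately show ?thesis using fin[of r] pay_lower(3)[of r y] R by auto
  next
    case False
    let ?E = "[(p, [e]), (q, [p]), (y, [p, q]), (a, [q, y]), (r, [p, q])]"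
    show ?thesis
    proof (cases "u = e")
      case ue: False
      have u8: "8 \<le> d u" using outside[of e ?E u "[q, a, r]"] R le False ue by auto
      have "gv y u" using gv_chain[of u "[(q, [u]), (p, [q]), (y, [p, q])]" y] R u8 by auto
      then show ?thesis using fin[of u] pay_lower(4)[OF u8, of y] ue by blast
    next
      case ue: True
      show ?thesis
      proof (cases "s = a")
        case True
        then show ?thesis using K5[of p q y a e] R ue by auto
      next
        case sa: False
        have s8: "8 \<le> d s" using outside[of e ?E s "[p, e, r]"] R le False sa by auto
        have "gv y s" using gv_chain[of s "[(p, [s]), (q, [p]), (y, [p, q])]" y] R s8 by auto
        then show ?thesis using fin[of s] pay_lower(4)[OF s8, of y] R by auto
      qed
    qed
  qed
qed

lemma six_pair_adjacent:
  assumes r: "r6 y p q a b c e" and f: "d p = 5" "d q = 5"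
  shows "4 \<le> ghat y"
proof -
  note F0 = r6_faces[OF r, unfolded F6_def] r6_adj(4)[OF r]
  obtain r' s where rp: "r5 p e y q r' s" using r5_mid[of p e y q] F0 f by auto
  obtain u where rq: "r5 q a y p r' u"
    using r5_share[of q a y p r'] F0 f r5_faces[OF rp, unfolded F6_def] r5_adj(4)[OF rp] by auto
  have v: "r6 y q p e c b a" using r6_rot[OF r6_rot[OF r6_rot[OF r6_rot[OF r6_rev[OF r]]]]] .
  note R = r6_adj[OF r] r5_adj[OF rp] r5_adj[OF rq]
  consider "d a \<le> 6" "d e \<le> 6" | "d a \<le> 6" "7 \<le> d e" | "7 \<le> d a" "d e \<le> 6" | "7 \<le> d a" "7 \<le> d e" by linarith
  then show ?thesis
  proof cases
    case 1
    show ?thesis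
    proof (cases "s = a \<and> u = e")
      case True
      then show ?thesis using K5[of p q y a e] R by auto
    next
      case False
      then show ?thesis using six_pair_adjacent_light[OF r rp rq 1] six_pair_adjacent_light[OF v rq rp 1(2,1)] by blast
    qed
  next
    case 2
    then show ?thesis using six_pair_adjacent_one_big[OF r rp rq] by blast
  next
    case 3
    then show ?thesis using six_pair_adjacent_one_big[OF v rq rp] by blast
  next
    case 4
    have "gv y a \<and> 2 \<le> pay a y" "gv y e \<and> 2 \<le> pay e y" "a \<noteq> e"
      using six_cl(5)[of y a q] six_cl(5)[of y e p] 4 R by auto
    then show ?thesis using ghat2[of y a e] by linarith
  qed
qed

text \<open>A light vertex among \<open>a\<close>, \<open>b\<close>, \<open>c\<close> is absorbed by
  the closure of either of the other two, which forces the third to degree 8; one light vertex thus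
  already yields two payments of 4. Without any, all three pay at least 2.\<close>

lemma six_triple_spread:
  assumes y: "d y = 6" and N: "N y = {p, q, r, a, b, c}" "distinct [p, q, r, a, b, c]" and f: "d p = 5" "d q = 5" "d r = 5"
    and adj: "\<And>v. v \<in> {a, b, c} \<Longrightarrow> \<exists>x\<in>{p, q, r}. x \<in> N v"
  shows "6 \<le> ghat y"
proof -
  have P: "{p, q, r} \<subseteq> P5 y" unfolding P5_def using N f by auto
  have vN: "v \<in> N y" if "v \<in> {a, b, c}" for v using that N by auto
  have g: "gv y v \<and> 2 \<le> pay v y" if v: "v \<in> {a, b, c}" "7 \<le> d v" for v
  proof -
    obtain x where x: "x \<in> {p, q, r}" "x \<in> N v" using adj v by blast
    then show ?thesis using six_cl(5)[OF y vN[OF v(1)], of x] v N f by auto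
  qed
  have light: "8 \<le> d w" if lvw: "{a, b, c} = {l, v, w}" "distinct [l, v, w]" "d l \<le> 6" for l v w
  proof -
    have m: "l \<in> {a, b, c}" "v \<in> {a, b, c}" "w \<in> {a, b, c}" using lvw(1) by auto
    obtain x where x: "x \<in> {p, q, r}" "x \<in> N v" using adj m by blast
    then have x': "x \<in> N y" "d x = 5" using N f by auto
    obtain x2 where x2: "x2 \<in> {p, q, r}" "x2 \<in> N l" using adj m by blast
    note S = six_cl[OF y vN[OF m(2)] x'(1) x(2) x'(2)]
    have "l \<in> cl v" using S(4)[OF vN[OF m(1)] lvw(3) _ x2(2)] x2 P by blast
    moreover have "insert y (N y) = {y, p, q, r, l, v, w}" using N(1) lvw(1) by auto
    ultimately have "insert y (N y) - {w} \<subseteq> cl v" using S(2,3) P cl_self by auto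
    then show ?thesis using six_eight[OF y vN[OF m(3)]] NV vN[OF m(2)] by blast
  qed
  have two: ?thesis if "8 \<le> d v" "8 \<le> d w" "v \<in> {a, b, c}" "w \<in> {a, b, c}" "v \<noteq> w" for v w
    using g[of v] g[of w] ghat2[of y v w] that pay_lower(5)[OF vN] by fastforce
  have D: "a \<noteq> b" "a \<noteq> c" "b \<noteq> c" using N(2) by auto
  consider "d a \<le> 6" | "d b \<le> 6" | "d c \<le> 6" | "7 \<le> d a" "7 \<le> d b" "7 \<le> d c" by linarith
  then show ?thesis
  proof cases
    case 1
    show ?thesis using two[of b c] light[of a b c] light[of a c b] 1 D by auto
  next
    case 2
    show ?thesis using two[of a c] light[of b a c] light[of b c a] 2 D by auto
  next
    case 3
    show ?thesis using two[of a b] light[of c a b] light[of c b a] 3 D by auto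
  next
    case 4
    have "gv y a \<and> 2 \<le> pay a y" "gv y b \<and> 2 \<le> pay b y" "gv y c \<and> 2 \<le> pay c y" using g 4 by auto
    then show ?thesis using ghat3[of y a b c] D by auto
  qed
qed

lemma six_triple_alternating:
  assumes r: "r6 y p a q b r c" and f: "d p = 5" "d q = 5" "d r = 5"
  shows "6 \<le> ghat y"
  by (rule six_triple_spread[of y p q r a b c]) (use r6_adj[OF r] r6D(2)[OF r] f in auto)

lemma six_triple_split:
  assumes r: "r6 y p q a r b c" and f: "d p = 5" "d q = 5" "d r = 5"
  shows "6 \<le> ghat y"
  by (rule six_triple_spread[of y p q r a b c]) (use r6_adj[OF r] r6D(2)[OF r] f in auto)

text \<open>With \<open>a\<close> light the closure of \<open>c\<close> is filled, so the apexes
  \<open>t1\<close> and \<open>t2\<close> pay two each unless they fall on \<open>a\<close> or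
  \<open>c\<close>. A light \<open>c\<close> is impossible, degree 7 makes both apexes payers, and
  from degree 8 on \<open>c\<close> pays 4, so that one apex suffices.\<close>

lemma six_triple_run_light:
  assumes r: "r6 y p q r a b c" and rq: "r5 q p y r t2 t1" and rp: "r5 p c y q t1 s" and rr: "r5 r a y q t2 u"
    and a6: "d a \<le> 6"
  shows "6 \<le> ghat y"
proof -
  note R = r6_adj[OF r] r5_adj[OF rp] r5_adj[OF rq] r5_adj[OF rr]
  have no: "\<not> ovf t1" "\<not> ovf t2" using not_ovf_adj[of t1 p q] not_ovf_adj[of t2 q r] R by auto
  let ?C = "[(p, [c]), (q, [p]), (r, [q]), (y, [p, q]), (a, [r, y])]"
  have oC: "7 \<le> d t1 \<and> gv y t1 \<and> 2 \<le> pay t1 y" if "t1 \<noteq> a"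
    using outside[of c ?C t1 "[p, q]"] gv_chain[of t1 "[(p, [t1]), (q, [p]), (y, [p, q])]" y] pay_lower(3)[OF no(1)] R a6 that by auto
  have oC2: "7 \<le> d t2 \<and> gv y t2 \<and> 2 \<le> pay t2 y" if "t2 \<noteq> c"
    using outside[of c ?C t2 "[q, r]"] gv_chain[of t2 "[(q, [t2]), (p, [q]), (y, [p, q])]" y] pay_lower(3)[OF no(2)] R a6 that by auto
  have kac: "\<not> (t1 = a \<and> t2 = c)" using K5[of p q y a c] R by auto
  have gc: "gv y c \<and> 2 \<le> pay c y" if "7 \<le> d c" using six_cl(5)[of y c p] R that by auto
  consider "d c \<le> 6" | "d c = 7" | "8 \<le> d c" by linarith
  then show ?thesis
  proof cases
    case 1
    have "t1 = a"
    proof (rule ccontr)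
      assume "t1 \<noteq> a"
      then show False using explode[of t1 "[(p, [t1]), (q, [p]), (r, [q]), (y, [p, q]), (a, [r, y]), (c, [p, y])]"] R a6 1 by auto
    qed
    moreover have "s = r"
    proof (rule ccontr)
      assume "s \<noteq> r"
      then show False using explode[of s "[(p, [s]), (q, [p]), (r, [q]), (y, [p, q]), (a, [r, y]), (c, [p, y])]"] R a6 1 \<open>t1 = a\<close> by auto
    qed
    ultimately show ?thesis using K5[of p q r y a] R by auto
  next
    case 2
    have sx: "s = r \<or> s = a"
    proof (rule ccontr)
      assume "\<not> ?thesis"
      then show False using outside[of s "[(p, [s]), (q, [p]), (r, [q]), (y, [p, q]), (a, [r, y])]" c "[p, y, s]"] R a6 2 by auto
    qed
    have t1a: "t1 \<noteq> a"
    proof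
      assume "t1 = a"
      then have "s = r" using sx R by auto
      then show False using K5[of p q r y a] R \<open>t1 = a\<close> by auto
    qed
    have t2c: "t2 \<noteq> c"
    proof
      assume "t2 = c"
      then show False using outside[of t1 "[(p, [t1]), (q, [p]), (r, [q]), (y, [p, q]), (a, [r, y])]" c "[p, y, q, r]"] R a6 2 t1a by auto
    qed
    have "pay c y + pay t1 y + pay t2 y \<le> ghat y" using ghat3[of y c t1 t2] gc 2 oC[OF t1a] oC2[OF t2c] t2c R by auto
    then show ?thesis using oC[OF t1a] oC2[OF t2c] gc 2 by linarith
  next
    case 3
    have c4: "gv y c" "4 \<le> pay c y" using gc 3 six_cl(6)[of y c p] R by auto
    show ?thesis
    proof (cases "t1 = a")
      case True
      then have "t2 \<noteq> c" using kac by blast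
      then show ?thesis using ghat2[of y c t2] oC2 c4 by fastforce
    next
      case False
      moreover have "c \<noteq> t1" using R by auto
      ultimately show ?thesis using ghat2[of y c t1] oC c4 by fastforce
    qed
  qed
qed

text \<open>If \<open>a\<close> and \<open>c\<close> both have degree at least 7, they give four,
  and two more come from a degree of 8 or from an apex. Otherwise a \<open>K5\<close>, a closure of
  seven vertices or a forced degree of 9 is the contradiction.\<close>

lemma six_triple_run:
  assumes r: "r6 y p q r a b c" and f: "d p = 5" "d q = 5" "d r = 5"
  shows "6 \<le> ghat y"
proof -
  note F0 = r6_faces[OF r, unfolded F6_def] r6_adj(4)[OF r]
  obtain t2 t1 where rq: "r5 q p y r t2 t1" using r5_mid[of q p y r] F0 f by auto
  note Fq = r5_faces[OF rq, unfolded F6_def] r5_adj(4)[OF rq]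
  obtain s where rp: "r5 p c y q t1 s" using r5_share[of p c y q t1] F0 f Fq by auto
  obtain u where rr: "r5 r a y q t2 u" using r5_share[of r a y q t2] F0 f Fq by auto
  have v: "r6 y r q p c b a" using r6_rot[OF r6_rot[OF r6_rot[OF r6_rev[OF r]]]] .
  have vq: "r5 q r y p t1 t2" using r5_rot[OF r5_rot[OF r5_rev[OF rq]]] .
  note R = r6_adj[OF r] r5_adj[OF rp] r5_adj[OF rq] r5_adj[OF rr]
  consider "d a \<le> 6" | "d c \<le> 6" | "7 \<le> d a" "7 \<le> d c" by linarith
  then show ?thesis
  proof cases
    case 1
    then show ?thesis by (rule six_triple_run_light[OF r rq rp rr])
  next
    case 2
    then show ?thesis by (rule six_triple_run_light[OF v vq rr rp])
  next
    case 3
    have ga: "gv y a" "2 \<le> pay a y" "8 \<le> d a \<Longrightarrow> 4 \<le> pay a y" using six_cl(5,6)[of y a r] R 3 by auto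
    have gc: "gv y c" "2 \<le> pay c y" "8 \<le> d c \<Longrightarrow> 4 \<le> pay c y" using six_cl(5,6)[of y c p] R 3 by auto
    have ac: "a \<noteq> c" using R by auto
    have s2: "pay a y + pay c y \<le> ghat y" using ghat2[OF ga(1) gc(1) ac] .
    show ?thesis
    proof (cases "8 \<le> d a \<or> 8 \<le> d c")
      case True
      then show ?thesis using s2 ga gc by linarith
    next
      case False
      then have a7: "d a = 7" "d c = 7" using 3 by auto
      have no: "\<not> ovf t1" "\<not> ovf t2" using not_ovf_adj[of t1 p q] not_ovf_adj[of t2 q r] R by auto
      have third: ?thesis if "gv y v" "2 \<le> pay v y" "v \<noteq> a" "v \<noteq> c" for v
        using ghat3[OF ga(1) gc(1) that(1)] ga(2) gc(2) that ac by auto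
      show ?thesis
      proof (cases "(7 \<le> d t1 \<and> t1 \<noteq> a) \<or> (7 \<le> d t2 \<and> t2 \<noteq> c)")
        case True
        then show ?thesis
        proof
          assume h: "7 \<le> d t1 \<and> t1 \<noteq> a"
          then have "gv y t1" using gv_chain[of t1 "[(p, [t1]), (q, [p]), (y, [p, q])]" y] R by auto
          then show ?thesis using third[of t1] pay_lower(3)[OF no(1)] h R by auto
        next
          assume h: "7 \<le> d t2 \<and> t2 \<noteq> c"
          then have "gv y t2" using gv_chain[of t2 "[(q, [t2]), (p, [q]), (y, [p, q])]" y] R by auto
          then show ?thesis using third[of t2] pay_lower(3)[OF no(2)] h R by auto
        qed
      next
        case F: False
        then consider "t1 = a" "t2 = c" | "d t1 \<le> 6" "t2 = c" | "t1 = a" "d t2 \<le> 6" | "d t1 \<le> 6" "d t2 \<le> 6" by linarith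
        then show ?thesis
        proof cases
          case 1
          then show ?thesis using K5[of p q y a c] R by auto
        next
          case 2
          then have "a \<noteq> t1" using a7 by auto
          with 2 show ?thesis using outside[of a "[(r, [a]), (q, [r]), (p, [q]), (y, [p, q]), (t1, [p, q])]" c "[p, y, q, r]"] a7 R by auto
        next
          case 3
          then have "c \<noteq> t2" using a7 by auto
          with 3 show ?thesis using outside[of c "[(p, [c]), (q, [p]), (r, [q]), (y, [p, q]), (t2, [q, r])]" a "[r, y, p, q]"] a7 R by auto
        next
          case 4
          then have "a \<noteq> t1" "a \<noteq> t2" using a7 by auto
          with 4 show ?thesis using explode[of a "[(r, [a]), (q, [r]), (p, [q]), (y, [p, q]), (t1, [p, q]), (t2, [q, r])]"] a7 R by auto
        qed
      qed
    qed
  qed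
qed

text \<open>The apexes at the edge from \<open>y\<close> to \<open>v\<close> are distinct and differ
  from \<open>v\<close>, so at least one of them is not \<open>w\<close>.\<close>

lemma six_four_common:
  assumes v: "v \<in> N y" and o: "N y - {v, w} \<subseteq> P5 y" shows "\<exists>x\<in>P5 y. x \<in> N y \<and> x \<in> N v \<and> d x = 5"
proof -
  have yv: "y \<in> N v" using v symN by blast
  have f: "nx y v \<in> N y" "nx y v \<in> N v" "nx v y \<in> N v" "nx v y \<in> N y" using face[OF v] face[OF yv] by auto
  have ne: "nx y v \<noteq> nx v y" "nx y v \<noteq> v" "nx v y \<noteq> v" using apex_two(2)[OF v] f irr by metis+
  then have "nx y v \<in> P5 y \<or> nx v y \<in> P5 y" using f o by blast
  then show ?thesis using f unfolding P5_def by blast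
qed

text \<open>The closure of each of the two remaining neighbours contains the star of
  \<open>y\<close> except for the other one, which forces both to degree 8 and payment 4.\<close>

lemma six_four:
  assumes y: "d y = 6" and c: "card (P5 y) = 4"
  shows "8 \<le> ghat y"
proof -
  have sub: "P5 y \<subseteq> N y" unfolding P5_def by blast
  have "card (N y - P5 y) = 2" using card_Diff_subset[OF finite_subset[OF sub finN] sub] c y unfolding d_def by simp
  then obtain v w where vw: "N y - P5 y = {v, w}" "v \<noteq> w" by (meson card_2_iff)
  have m: "v \<in> N y" "w \<in> N y" using vw by blast+
  have o: "N y - {v, w} \<subseteq> P5 y" "N y - {w, v} \<subseteq> P5 y" using vw by blast+
  obtain x1 where x1: "x1 \<in> N y" "x1 \<in> N v" "d x1 = 5" using six_four_common[OF m(1) o(1)] by blast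
  obtain x2 where x2: "x2 \<in> N y" "x2 \<in> N w" "d x2 = 5" using six_four_common[OF m(2) o(2)] by blast
  note S = six_cl[OF y m(1) x1] note T = six_cl[OF y m(2) x2]
  have "insert y (N y) - {w} \<subseteq> cl v" using S(2,3) o cl_self by blast
  then have w8: "8 \<le> d w" using six_eight[OF y m(2)] NV m(1) by blast
  have "insert y (N y) - {v} \<subseteq> cl w" using T(2,3) o cl_self by blast
  then have v8: "8 \<le> d v" using six_eight[OF y m(1)] NV m(2) by blast
  have "gv y v" "gv y w" using S(5) T(5) v8 w8 by auto
  then show ?thesis using ghat2[of y v w] vw(2) S(6)[OF v8] T(6)[OF w8] by linarith
qed

lemma six_not_five:
  assumes y: "d y = 6" and c: "5 \<le> card (P5 y)"
  shows False
proof -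
  have sub: "P5 y \<subseteq> N y" unfolding P5_def by blast
  have "card (N y - P5 y) \<le> 1" using card_Diff_subset[OF finite_subset[OF sub finN] sub] c y unfolding d_def by simp
  then have "\<exists>v\<in>N y. N y - {v} \<subseteq> P5 y"
  proof (cases "N y - P5 y = {}")
    case True
    moreover have "N y \<noteq> {}" using y unfolding d_def by auto
    ultimately show ?thesis by blast
  next
    case False
    then obtain v where v: "v \<in> N y - P5 y" by blast
    have "N y - P5 y \<subseteq> {v}"
    proof
      fix w assume w: "w \<in> N y - P5 y"
      show "w \<in> {v}"
      proof (rule ccontr)
        assume "w \<notin> {v}"
        then have "card {v, w} \<le> card (N y - P5 y)" using v w finN[of y] by (intro card_mono) auto
        then show False using \<open>w \<notin> {v}\<close> \<open>card (N y - P5 y) \<le> 1\<close> by simp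
      qed
    qed
    then show ?thesis using v by blast
  qed
  then obtain v where v: "v \<in> N y" "N y - {v} \<subseteq> P5 y" by blast
  then have "N y - {v, v} \<subseteq> P5 y" by simp
  then obtain x where x: "x \<in> N y" "x \<in> N v" "d x = 5" using six_four_common[OF v(1)] by blast
  have "insert y (N y) \<subseteq> cl v" using six_cl(2,3)[OF y v(1) x] v cl_self by blast
  then show False using six_seven[OF y] NV v by blast
qed

text \<open>Two half units are owed to each 5-neighbour. Patterns with two or three such neighbours
  are covered up to rotation and reflection.\<close>

lemma six_income:
  assumes y: "d y = 6" and nh: "\<And>x. x \<in> P5 y \<Longrightarrow> \<not> hub x"
  shows "2 * card (P5 y) \<le> ghat y"
proof -
  obtain w where w: "w \<in> N y" using y unfolding d_def by fastforce
  obtain a b c p q t where r: "r6 y a b c p q t" using r6_ex[of y w "nx y w"] y face[OF w] w unfolding F_def by blast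
  note r1 = r6_rot[OF r] note r2 = r6_rot[OF r1] note r3 = r6_rot[OF r2] note r4 = r6_rot[OF r3] note r5 = r6_rot[OF r4]
  note v0 = r6_rev[OF r] note v1 = r6_rev[OF r1] note v2 = r6_rev[OF r2] note v3 = r6_rev[OF r3] note v4 = r6_rev[OF r4] note v5 = r6_rev[OF r5]
  have D: "distinct [a, b, c, p, q, t]" "N y = {a, b, c, p, q, t}" using r6D[OF r] by auto
  have "card (P5 y) = (\<Sum>v\<in>N y. if d v = 5 then 1 else 0)"
    unfolding P5_def using finN by (simp add: sum.If_cases Int_def)
  also have "\<dots> = (if d a = 5 then 1 else 0) + (if d b = 5 then 1 else 0) + (if d c = 5 then 1 else 0)
     + (if d p = 5 then 1 else 0) + (if d q = 5 then 1 else 0) + (if d t = 5 then 1 else 0)"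
    using D by simp
  finally have cnt: "card (P5 y) = \<dots>" .
  consider "card (P5 y) = 0" | "card (P5 y) = 1" | "card (P5 y) = 2" | "card (P5 y) = 3" | "card (P5 y) = 4" | "5 \<le> card (P5 y)"
    by linarith
  then show ?thesis
  proof cases
    case 2
    then obtain x where "P5 y = {x}" by (metis card_1_singletonE)
    then have "x \<in> N y" "d x = 5" "\<not> hub x" using nh unfolding P5_def by auto
    then show ?thesis using six_single[OF y] 2 by simp
  next
    case 3
    have "4 \<le> ghat y"
      using 3 cnt six_pair_adjacent[OF r] six_pair_adjacent[OF r1] six_pair_adjacent[OF r2] six_pair_adjacent[OF r3] six_pair_adjacent[OF r4] six_pair_adjacent[OF r5]
        six_pair_gap[OF r] six_pair_gap[OF r1] six_pair_gap[OF r2] six_pair_gap[OF r3] six_pair_gap[OF r4] six_pair_gap[OF r5]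
        six_pair_opposite[OF r] six_pair_opposite[OF r1] six_pair_opposite[OF r2]
      by - (cases "d a = 5"; cases "d b = 5"; cases "d c = 5"; cases "d p = 5"; cases "d q = 5"; cases "d t = 5"; simp)
    then show ?thesis using 3 by simp
  next
    case 4
    have "6 \<le> ghat y"
      using 4 cnt six_triple_alternating[OF r] six_triple_alternating[OF r1] six_triple_run[OF r] six_triple_run[OF r1] six_triple_run[OF r2] six_triple_run[OF r3] six_triple_run[OF r4] six_triple_run[OF r5]
        six_triple_split[OF r] six_triple_split[OF r1] six_triple_split[OF r2] six_triple_split[OF r3] six_triple_split[OF r4] six_triple_split[OF r5]
        six_triple_split[OF v0] six_triple_split[OF v1] six_triple_split[OF v2] six_triple_split[OF v3] six_triple_split[OF v4] six_triple_split[OF v5]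
      by - (cases "d a = 5"; cases "d b = 5"; cases "d c = 5"; cases "d p = 5"; cases "d q = 5"; cases "d t = 5"; simp)
    then show ?thesis using 4 by simp
  next
    case 5
    then show ?thesis using six_four[OF y] by simp
  next
    case 6
    then show ?thesis using six_not_five[OF y] by blast
  qed simp
qed

section \<open>Matching claims with corners, and the final count\<close>

lemma corner_transfer:
  assumes "CP x n"
  shows "nx x n \<in> cor (nx (nx x n) n)" "nx (nx (nx x n) n) (nx x n) = n" "nx n (nx x n) = x" "nx (nx x n) n \<in> V"
proof -
  have n: "n \<in> N x" using assms unfolding CP_def by blast
  define m where "m = nx x n"
  have f: "m \<in> N n" "nx n m = x" using face[OF n] unfolding m_def by auto
  have nm: "n \<in> N m" using f symN by blast
  define u where "u = nx m n"
  have g: "u \<in> N m" "nx u m = n" using face[OF nm] unfolding u_def by auto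
  have mu: "m \<in> N u" using g symN by blast
  have "CP (nx (nx u m) m) (nx u m)" using g f assms by simp
  then show "nx x n \<in> cor (nx (nx x n) n)" using mu unfolding cor_def u_def m_def by simp
  show "nx (nx (nx x n) n) (nx x n) = n" using g(2) unfolding u_def m_def .
  show "nx n (nx x n) = x" using f unfolding m_def by simp
  show "nx (nx x n) n \<in> V" using g NV unfolding u_def m_def by blast
qed

lemma CP_hub: "CP x n \<Longrightarrow> d x = 5 \<and> n \<in> N x"
  unfolding CP_def hub0_def hub1_def by blast

lemma corner_big: "m \<in> cor u \<Longrightarrow> big u"
proof -
  assume m: "m \<in> cor u"
  obtain x a b c where x: "r5 x (nx u m) m a b c" "F u m (nx u m)" "5 + card (N u \<inter> N x) \<le> d u" using corE[OF m] by blast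
  have "{m, nx u m} \<subseteq> N u \<inter> N x" using r5_adj[OF x(1)] F_adj[OF x(2)] by auto
  then have "card {m, nx u m} \<le> card (N u \<inter> N x)" using finN by (intro card_mono) auto
  moreover have "card {m, nx u m} = 2" using F_dist[OF x(2)] by simp
  ultimately have "7 \<le> d u" using x(3) by linarith
  moreover have "u \<in> V" using F_V[OF x(2)] by blast
  ultimately show "big u" unfolding big_def by simp
qed

text \<open>Sending the claim of a hub to its corner is injective, as \<open>nx\<close> leads from
  the corner back to the rim pair and to the hub.\<close>

lemma corner_count: "(\<Sum>x\<in>{x\<in>V. d x = 5}. card {n. CP x n}) \<le> (\<Sum>u\<in>{v. big v}. z u)"
proof -
  let ?P = "SIGMA x:{x\<in>V. d x = 5}. {n. CP x n}" and ?C = "SIGMA u:{v. big v}. cor u"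
  have finB: "finite {v. big v}" by (rule finite_subset[OF _ finV]) (auto simp: big_def)
  have finc: "finite (cor u)" for u unfolding cor_def using finN by simp
  have finp: "finite {n. CP x n}" for x by (rule finite_subset[OF _ finN[of x]]) (use CP_hub in auto)
  let ?f = "\<lambda>(x, n). (nx (nx x n) n, nx x n)"
  have "inj_on ?f ?P"
    by (rule inj_on_inverseI[where g = "\<lambda>(u, m). (nx (nx u m) m, nx u m)"])
      (auto simp: corner_transfer(2,3))
  moreover have "?f ` ?P \<subseteq> ?C"
  proof
    fix t assume "t \<in> ?f ` ?P"
    then obtain x n where "CP x n" "t = (nx (nx x n) n, nx x n)" by auto
    then show "t \<in> ?C" using corner_transfer(1)[of x n] corner_big by simp
  qed
  moreover have "finite ?C" using finB finc by (intro finite_SigmaI)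
  ultimately have "card ?P \<le> card ?C" by (rule card_inj_on_le)
  moreover have "card ?P = (\<Sum>x\<in>{x\<in>V. d x = 5}. card {n. CP x n})" using finV finp by (intro card_SigmaI) auto
  moreover have "card ?C = (\<Sum>u\<in>{v. big v}. z u)" unfolding z_def using finB finc by (intro card_SigmaI) auto
  ultimately show ?thesis by simp
qed

text \<open>The half units which the 6-vertex \<open>y\<close> passes on to its neighbour \<open>x\<close> of degree 5.\<close>

definition wt :: "'a \<Rightarrow> 'a \<Rightarrow> nat" where
  "wt y x = (if \<not> hub x \<or> (hub1 x \<and> (\<exists>v\<in>Bg x. v \<in> N y)) then 2 else 0)"

text \<open>Next to a hub, \<open>y\<close> has no other 5-neighbour, and it hands something on only
  if it is also adjacent to the large neighbour of the hub, which then pays it.\<close>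

lemma six_pays:
  assumes y: "d y = 6"
  shows "(\<Sum>x\<in>P5 y. wt y x) \<le> ghat y"
proof (cases "\<exists>x\<in>P5 y. hub x")
  case False
  then have "(\<Sum>x\<in>P5 y. wt y x) = 2 * card (P5 y)" by (simp add: wt_def)
  then show ?thesis using six_income[OF y] False by auto
next
  case True
  then obtain x where x: "x \<in> N y" "d x = 5" "hub x" unfolding P5_def by blast
  have "P5 y = {x}" 
  proof -
    have "y \<in> N x" using x(1) by (rule sym)
    then have "t = x" if "t \<in> P5 y" for t using hub_five[OF x(3) _ y, of t] that unfolding P5_def by simp
    then show ?thesis using x(1,2) unfolding P5_def by blast
  qed
  then have s: "(\<Sum>x\<in>P5 y. wt y x) = wt y x" by simp
  show ?thesis
  proof (cases "\<exists>v\<in>Bg x. v \<in> N y")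
    case True
    then obtain v where v: "v \<in> N x" "7 \<le> d v" "v \<in> N y" unfolding Bg_def by blast
    then have "gv y v" "2 \<le> pay v y" using six_cl(5)[OF y v(3) x(1) sym[OF v(1)] x(2)] by auto
    moreover have "wt y x \<le> 2" unfolding wt_def by simp
    ultimately show ?thesis using ghat1[of y v] s by linarith
  next
    case False
    then show ?thesis using s x(3) by (simp add: wt_def)
  qed
qed

lemma hub1_ring:
  assumes h: "hub1 x"
  shows "\<exists>v n w m. Bg x = {v} \<and> nx x v = n \<and> nx x w = v \<and> nx x m = w \<and> {v, n, w, m} \<subseteq> N x \<and> distinct [v, n, w] \<and> m \<noteq> n \<and> m \<noteq> v \<and> nx x n \<noteq> v"
proof -
  have dx: "d x = 5" using h unfolding hub1_def by blast
  obtain v where v: "Bg x = {v}" using h unfolding hub1_def by (meson card_1_singletonE)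
  have vN: "v \<in> N x" using v unfolding Bg_def by blast
  have onto: "\<exists>w\<in>N x. nx x w = t" if "t \<in> N x" for t
    using nx_bij[of x] that unfolding bij_betw_def by (metis imageE)
  obtain w where w: "w \<in> N x" "nx x w = v" using onto[OF vN] by blast
  obtain m where m: "m \<in> N x" "nx x m = w" using onto[OF w(1)] by blast
  define n where "n = nx x v"
  have nN: "n \<in> N x" using face[OF vN] unfolding n_def by blast
  have small: False if X: "X \<subseteq> N x" "v \<in> X" "\<And>t. t \<in> X \<Longrightarrow> nx x t \<in> X" "card X \<le> 3" for X
    using link_closed[OF X(1-3)] X(4) dx unfolding d_def by simp
  have c1: "card {v} \<le> 3" "card {v, n} \<le> 3" "card {v, w} \<le> 3" "card {v, n, w} \<le> 3" by (simp_all add: card_insert_if)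
  have a: "n \<noteq> v" using small[of "{v}"] vN c1 n_def by auto
  have b: "w \<noteq> v" using small[of "{v}"] vN c1 w by auto
  have nv: "nx x n \<noteq> v" using small[of "{v, n}"] vN nN c1 n_def by auto
  have c: "w \<noteq> n" using nv w by auto
  have e: "m \<noteq> v" using m c n_def by auto
  have f: "m \<noteq> n"
  proof
    assume "m = n"
    then show False using small[of "{v, n, w}"] vN nN w m c1 n_def by auto
  qed
  show ?thesis
    by (rule exI[of _ v], rule exI[of _ n], rule exI[of _ w], rule exI[of _ m]) (use v n_def[symmetric] w m vN nN a b c e f nv in simp)
qed

text \<open>Ten half units are the whole deficit. A hub with a rim of degree 6 collects them from
  five corners. A hub with a large neighbour \<open>v\<close> gets two from \<open>v\<close>, two
  through each of the two rim vertices next to \<open>v\<close>, and two from each of two corners.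
  Any other 5-vertex gets two on account of each neighbour.\<close>

lemma five_total:
  assumes dx: "d x = 5"
  shows "10 \<le> ghat x + (\<Sum>y\<in>T6 x. wt y x) + 2 * card {n. CP x n}"
proof -
  have c5: "card (P5 x) + card (T6 x) + card (Bg x) = 5" using P5_T6_Bg(2)[of x] dx unfolding d_def by simp
  have finp: "finite {n. CP x n}" by (rule finite_subset[OF _ finN[of x]]) (use CP_hub in auto)
  consider "\<not> hub x" | "hub0 x" | "hub1 x" unfolding hub_def by blast
  then show ?thesis
  proof cases
    case 1
    then have "(\<Sum>y\<in>T6 x. wt y x) = 2 * card (T6 x)" by (simp add: wt_def)
    moreover have "2 * (card (Bg x) + card (P5 x)) + 2 * card (T6 x) = 10" using c5 by simp
    ultimately show ?thesis using five_income[OF dx] by simp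
  next
    case 2
    then have "{n. CP x n} = N x" unfolding CP_def by blast
    then show ?thesis using dx unfolding d_def by simp
  next
    case 3
    obtain v n w m where r: "Bg x = {v}" "nx x v = n" "nx x w = v" "nx x m = w" "{v, n, w, m} \<subseteq> N x" "distinct [v, n, w]"
      "m \<noteq> n" "m \<noteq> v" "nx x n \<noteq> v" using hub1_ring[OF 3] by blast
    have "w \<noteq> v" using r(6) by auto
    have "n \<in> N x \<and> n \<noteq> v \<and> nx x n \<noteq> v \<and> (nx x v = n \<or> nx x (nx x n) = v)" using r(2,5,6,9) by auto
    then have "CP x n" unfolding CP_def using 3 r(1) by blast
    moreover have "m \<in> N x \<and> m \<noteq> v \<and> nx x m \<noteq> v \<and> (nx x v = m \<or> nx x (nx x m) = v)"
      using r(3,4,5,8) \<open>w \<noteq> v\<close> by simp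
    then have "CP x m" unfolding CP_def using 3 r(1) by blast
    ultimately have "{n, m} \<subseteq> {n. CP x n}" by blast
    then have "card {n, m} \<le> card {n. CP x n}" using finp by (rule card_mono[rotated])
    then have c: "2 \<le> card {n. CP x n}" using r(7) by simp
    have g: "2 \<le> ghat x" using ghat_Bg(1)[OF dx] r(1) by simp
    have P: "P5 x = {}" using 3 unfolding hub1_def by blast
    have T: "{n, w} \<subseteq> T6 x" using P5_T6_Bg(1)[of x] P r(1,5,6) by auto
    have "v \<in> N n" "v \<in> N w" using face[of v x] face[of w x] r(2,3,5) symN[of v n] by auto
    then have "wt n x = 2" "wt w x = 2" using 3 r(1) unfolding wt_def by simp_all
    then have "(\<Sum>y\<in>{n, w}. wt y x) = 4" using r(6) by simp
    moreover have "finite (T6 x)" unfolding T6_def using finN by simp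
    then have "(\<Sum>y\<in>{n, w}. wt y x) \<le> (\<Sum>y\<in>T6 x. wt y x)" using T by (intro sum_mono2) auto
    ultimately show ?thesis using c g by linarith
  qed
qed

text \<open>Counting payments from both sides shows that the deficits of the 5-vertices are covered
  by the surplus over degree 6 elsewhere, so the degree sum is at least \<open>6 * card V\<close>,
  against \<open>euler\<close>.\<close>

theorem no_triangulation: False
proof -
  define L5 where "L5 = {x\<in>V. d x = 5}"
  define L6 where "L6 = {x\<in>V. d x = 6}"
  define B where "B = {v. big v}"
  have BV: "B \<subseteq> V" unfolding B_def big_def by auto
  have fin: "finite L5" "finite L6" "finite B" unfolding L5_def L6_def using finV finite_subset[OF BV] by auto
  have swap: "(\<Sum>y\<in>L6. \<Sum>x\<in>P5 y. wt y x) = (\<Sum>x\<in>L5. \<Sum>y\<in>T6 x. wt y x)"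
  proof -
    have "(\<Sum>y\<in>L6. sum (wt y) {x. x \<in> L5 \<and> x \<in> N y}) = (\<Sum>x\<in>L5. \<Sum>y | y \<in> L6 \<and> x \<in> N y. wt y x)"
      by (rule sum.swap_restrict[OF fin(2,1)])
    moreover have "{x. x \<in> L5 \<and> x \<in> N y} = P5 y" for y unfolding L5_def P5_def using NV by auto
    moreover have "{y. y \<in> L6 \<and> x \<in> N y} = T6 x" for x unfolding L6_def T6_def using NV symN by auto
    ultimately show ?thesis by simp
  qed
  have dual: "(\<Sum>v\<in>B. \<Sum>c\<in>C56 v. pay v c) = (\<Sum>c\<in>L5 \<union> L6. ghat c)"
  proof -
    have "(\<Sum>v\<in>B. sum (pay v) {c. c \<in> L5 \<union> L6 \<and> gv c v}) = (\<Sum>c\<in>L5 \<union> L6. \<Sum>v | v \<in> B \<and> gv c v. pay v c)"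
      by (rule sum.swap_restrict) (use fin in auto)
    moreover have "{v. v \<in> B \<and> gv c v} = {v. gv c v}" for c unfolding B_def gv_def by auto
    moreover have "{c. c \<in> L5 \<union> L6 \<and> gv c v} = C56 v" if "v \<in> B" for v
    proof -
      have v: "big v" "v \<in> V" "7 \<le> d v" using that unfolding B_def big_def by auto
      have "d c = 5 \<or> d c = 6" if "c \<in> V" "d c \<le> 6" for c using d5[OF that(1)] that(2) by linarith
      then show ?thesis unfolding L5_def L6_def gv_def C56_def using v cl_sub[OF v(2)] by auto
    qed
    ultimately show ?thesis unfolding ghat_def by simp
  qed
  have "10 * card L5 = (\<Sum>x\<in>L5. 10)" by simp
  also have "\<dots> \<le> (\<Sum>x\<in>L5. ghat x + (\<Sum>y\<in>T6 x. wt y x) + 2 * card {n. CP x n})"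
    by (rule sum_mono) (use five_total in \<open>auto simp: L5_def\<close>)
  also have "\<dots> = (\<Sum>x\<in>L5. ghat x) + (\<Sum>y\<in>L6. \<Sum>x\<in>P5 y. wt y x) + 2 * (\<Sum>x\<in>L5. card {n. CP x n})"
    by (simp add: sum.distrib swap sum_distrib_left)
  also have "\<dots> \<le> (\<Sum>x\<in>L5. ghat x) + (\<Sum>y\<in>L6. ghat y) + 2 * (\<Sum>u\<in>B. z u)"
  proof -
    have "(\<Sum>y\<in>L6. \<Sum>x\<in>P5 y. wt y x) \<le> (\<Sum>y\<in>L6. ghat y)"
      by (rule sum_mono) (use six_pays in \<open>auto simp: L6_def\<close>)
    then show ?thesis using corner_count unfolding L5_def B_def by linarith
  qed
  also have "(\<Sum>x\<in>L5. ghat x) + (\<Sum>y\<in>L6. ghat y) = (\<Sum>c\<in>L5 \<union> L6. ghat c)"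
    by (rule sum.union_disjoint[symmetric]) (use fin in \<open>auto simp: L5_def L6_def\<close>)
  also have "\<dots> + 2 * (\<Sum>u\<in>B. z u) = (\<Sum>v\<in>B. (\<Sum>c\<in>C56 v. pay v c) + 2 * z v)"
    by (simp add: sum.distrib sum_distrib_left dual)
  also have "\<dots> \<le> (\<Sum>v\<in>B. 10 * (d v - 6))"
    by (rule sum_mono) (use load in \<open>auto simp: B_def\<close>)
  also have "\<dots> = 10 * (\<Sum>v\<in>B. d v - 6)" by (simp add: sum_distrib_left)
  finally have le: "card L5 \<le> (\<Sum>v\<in>B. d v - 6)" by simp
  have V: "V = L5 \<union> L6 \<union> B"
  proof -
    have "d v = 5 \<or> d v = 6 \<or> 7 \<le> d v" if "v \<in> V" for v using d5[OF that] by linarith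
    then show ?thesis using BV unfolding L5_def L6_def B_def big_def by auto
  qed
  have dis: "L5 \<inter> L6 = {}" "(L5 \<union> L6) \<inter> B = {}" unfolding L5_def L6_def B_def big_def by auto
  have cV: "card V = card L5 + card L6 + card B"
    unfolding V using fin dis by (simp add: card_Un_disjoint)
  have "(\<Sum>v\<in>V. d v) = (\<Sum>v\<in>L5. d v) + (\<Sum>v\<in>L6. d v) + (\<Sum>v\<in>B. d v)"
    unfolding V using fin dis by (simp add: sum.union_disjoint)
  moreover have "(\<Sum>v\<in>L5. d v) = 5 * card L5" "(\<Sum>v\<in>L6. d v) = 6 * card L6" by (simp_all add: L5_def L6_def)
  moreover have "(\<Sum>v\<in>B. d v) = (\<Sum>v\<in>B. (d v - 6) + 6)" by (rule sum.cong) (auto simp: B_def big_def)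
  then have "(\<Sum>v\<in>B. d v) = (\<Sum>v\<in>B. d v - 6) + 6 * card B" by (simp add: sum.distrib)
  moreover have "(\<Sum>v\<in>V. d v) + 12 \<le> 6 * card V" using euler unfolding d_def by simp
  ultimately show False using le cV by linarith
qed

end

section \<open>Collecting vertices of planar graphs\<close>

text \<open>Each grid point is labelled by the vertex whose branch set contains it, or by itself if
  there is none. The quotient by this labelling is a connected map, and contracting the points left
  over gives a map on \<open>verts G\<close>, possibly with more edges than
  \<open>G\<close>.\<close>

lemma planar_conn_drawing:
  assumes G: "graph G" and dr: "plane_drawing G p \<gamma>" and ne: "verts G \<noteq> {}"
  shows "\<exists>E. planar_conn (verts G) E \<and> arcs_ends G \<subseteq> E"
proof -
  obtain N W where WW: "\<forall>v\<in>verts G. W v \<noteq> {} \<and> W v \<subseteq> grid_sq N \<and>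
        (\<forall>x\<in>W v. \<forall>y\<in>W v. (x, y) \<in> (grid_edges N \<inter> W v \<times> W v)\<^sup>*)"
    and disj: "\<forall>u\<in>verts G. \<forall>v\<in>verts G. u \<noteq> v \<longrightarrow> W u \<inter> W v = {}"
    and adj: "\<forall>(u, v)\<in>arcs_ends G. \<exists>x\<in>W u. \<exists>y\<in>W v. (x, y) \<in> grid_edges N"
    using drawing_grid_minor[OF G dr] by (elim exE conjE)
  have W: "W v \<noteq> {}" "W v \<subseteq> grid_sq N" "x \<in> W v \<Longrightarrow> y \<in> W v \<Longrightarrow> (x, y) \<in> (grid_edges N \<inter> W v \<times> W v)\<^sup>*"
    if v: "v \<in> verts G" for v x y
    using bspec[OF WW v] by simp_all
  have dis: "W u \<inter> W v = {}" if "u \<in> verts G" "v \<in> verts G" "u \<noteq> v" for u v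
    using disj that by simp
  define h where "h q = (if \<exists>v\<in>verts G. q \<in> W v then Inl (SOME v. v \<in> verts G \<and> q \<in> W v) else Inr q)" for q
  have hW: "h q = Inl v" if v: "v \<in> verts G" "q \<in> W v" for q v
  proof -
    have "(SOME v. v \<in> verts G \<and> q \<in> W v) \<in> verts G \<and> q \<in> W (SOME v. v \<in> verts G \<and> q \<in> W v)"
      by (rule someI[of "\<lambda>v. v \<in> verts G \<and> q \<in> W v" v]) (use v in blast)
    then have "(SOME v. v \<in> verts G \<and> q \<in> W v) = v" using dis[of "SOME v. v \<in> verts G \<and> q \<in> W v" v] v by blast
    then show ?thesis using v unfolding h_def by auto
  qed
  have hI: "q \<in> W v \<and> v \<in> verts G" if q: "h q = Inl v" for q v
  proof (cases "\<exists>v\<in>verts G. q \<in> W v")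
    case True
    then obtain u where "u \<in> verts G" "q \<in> W u" by blast
    then show ?thesis using hW[of u q] q by simp
  qed (use q in \<open>simp add: h_def\<close>)
  have hr: "h q = Inr r \<Longrightarrow> q = r" for q r unfolding h_def by (simp split: if_splits)
  have fib: "(x, y) \<in> (grid_edges N \<inter> {(p, q). h p = h q})\<^sup>*" if xy: "h x = h y" for x y
  proof (cases "h x")
    case (Inl v)
    then have v: "x \<in> W v" "y \<in> W v" "v \<in> verts G" using hI[of x v] hI[of y v] xy by auto
    have "grid_edges N \<inter> W v \<times> W v \<subseteq> grid_edges N \<inter> {(p, q). h p = h q}" using hW[OF v(3)] by auto
    then show ?thesis using W(3)[OF v(3,1,2)] by (meson rtrancl_mono subsetD)
  next
    case (Inr r)
    then have "x = y" using hr xy by metis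
    then show ?thesis by simp
  qed
  obtain D :: "dart set" and s a lab where P: "pmap 4 D s a lab (grid_sq N) (grid_edges N)"
    using grid_pmap[of N] by blast
  let ?E = "map_prod h h ` grid_edges N - Id"
  obtain s1 a1 l1 where P1: "pmap 4 D s1 a1 l1 (h ` grid_sq N) ?E"
    using pmap_quotient[OF P, of h] fib by auto
  have c1: "conn (h ` grid_sq N) ?E"
    unfolding conn_def
  proof (intro ballI)
    fix b c assume "b \<in> h ` grid_sq N" "c \<in> h ` grid_sq N"
    then obtain x y where xy: "x \<in> grid_sq N" "y \<in> grid_sq N" "b = h x" "c = h y" by (elim imageE)
    then have "(x, y) \<in> (grid_edges N)\<^sup>*" using grid_conn[of N] unfolding conn_def by simp
    then show "(b, c) \<in> ?E\<^sup>*" unfolding xy by (rule rtrancl_map_quotient)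
  qed
  have sub: "Inl ` verts G \<subseteq> h ` grid_sq N"
  proof
    fix t :: "'a + int \<times> int" assume "t \<in> Inl ` verts G"
    then obtain v where v: "v \<in> verts G" "t = Inl v" by blast
    obtain q where q: "q \<in> W v" using W(1)[OF v(1)] by blast
    then have "h q = t" "q \<in> grid_sq N" using hW[OF v(1)] v W(2)[OF v(1)] by auto
    then show "t \<in> h ` grid_sq N" by blast
  qed
  obtain s2 a2 l2 E2 where P2: "pmap 4 D s2 a2 l2 (Inl ` verts G) E2" "conn (Inl ` verts G) E2"
      "?E \<inter> (Inl ` verts G) \<times> (Inl ` verts G) \<subseteq> E2"
    using pmap_contract_to[OF P1 c1 sub] ne by (simp only: image_is_empty simp_thms) blast
  let ?V = "Inl ` verts G :: ('a + int \<times> int) set"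
  have "inj_on projl ?V" by (auto simp: inj_on_def)
  moreover have V: "projl ` ?V = verts G" by (simp add: image_image)
  ultimately have "pmap 4 D s2 a2 (projl \<circ> l2) (verts G) (map_prod projl projl ` E2)"
    using pmap_relabel[OF P2(1), of projl] by simp
  moreover have "conn (verts G) (map_prod projl projl ` E2)"
    unfolding conn_def
  proof (intro ballI)
    fix u v assume uv: "u \<in> verts G" "v \<in> verts G"
    then have "(Inl u, Inl v) \<in> E2\<^sup>*" using P2(2) unfolding conn_def by blast
    from rtrancl_map_quotient[OF this, of projl]
    have "(u, v) \<in> (map_prod projl projl ` E2 - Id)\<^sup>*" by simp
    then show "(u, v) \<in> (map_prod projl projl ` E2)\<^sup>*" by (meson Diff_subset rtrancl_mono subsetD)
  qed
  ultimately have "planar_conn (verts G) (map_prod projl projl ` E2)" unfolding planar_conn_def by blast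
  moreover have "arcs_ends G \<subseteq> map_prod projl projl ` E2"
  proof
    fix e assume e: "e \<in> arcs_ends G"
    obtain u v where uv: "e = (u, v)" by fastforce
    interpret graph G by fact
    have ends: "u \<in> verts G" "v \<in> verts G" "u \<noteq> v" using e uv adj_not_same by auto
    obtain x y where xy: "x \<in> W u" "y \<in> W v" "(x, y) \<in> grid_edges N" using bspec[OF adj e] uv by auto
    have "(Inl u, Inl v) \<in> map_prod h h ` grid_edges N"
      using xy hW[OF ends(1) xy(1)] hW[OF ends(2) xy(2)] by (metis map_prod_imageI)
    then have "(Inl u, Inl v) \<in> ?E \<inter> (Inl ` verts G) \<times> (Inl ` verts G)" using ends by simp
    then have "(Inl u, Inl v) \<in> E2" by (rule subsetD[OF P2(3)])
    from imageI[OF this, of "map_prod projl projl"] show "e \<in> map_prod projl projl ` E2" using uv by simp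
  qed
  ultimately show ?thesis by blast
qed

definition collectable :: "'v set \<Rightarrow> ('v \<times> 'v) set \<Rightarrow> bool" where
  "collectable V E \<longleftrightarrow> (\<exists>v\<in>V. \<exists>us. length us = 6 \<and> distinct us \<and> set us \<subseteq> V - {v} \<and>
     (\<forall>i<6. card {w \<in> V - insert v (set (take i us)). (us ! i, w) \<in> E} \<le> 4))"

lemma collectable_mono:
  assumes "collectable V E'" "E \<subseteq> E'" "finite V" shows "collectable V E"
proof -
  obtain v us where v: "v \<in> V" and us: "length us = 6" "distinct us" "set us \<subseteq> V - {v}"
    "\<And>i. i < 6 \<Longrightarrow> card {w \<in> V - insert v (set (take i us)). (us ! i, w) \<in> E'} \<le> 4"
    using assms(1) unfolding collectable_def by blast
  have "card {w \<in> V - insert v (set (take i us)). (us ! i, w) \<in> E} \<le> 4" if "i < 6" for i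
  proof -
    have "card {w \<in> V - insert v (set (take i us)). (us ! i, w) \<in> E}
       \<le> card {w \<in> V - insert v (set (take i us)). (us ! i, w) \<in> E'}"
      using assms(2,3) by (intro card_mono) auto
    then show ?thesis using us(4)[OF that] by linarith
  qed
  then show ?thesis unfolding collectable_def using v us(1-3) by blast
qed

text \<open>Collecting is needed only while at most six vertices, \<open>v\<close> included, are
  gone; so it can get stuck only at a set of at most six vertices.\<close>

lemma collectable_greedy:
  assumes v: "v \<in> V" and E: "E \<subseteq> V \<times> V"
    and grow: "\<And>S. v \<in> S \<Longrightarrow> S \<subseteq> V \<Longrightarrow> card S \<le> 6 \<Longrightarrow> \<exists>u\<in>V - S. card ({w. (u, w) \<in> E} - S) \<le> 4"
  shows "collectable V E"
proof -
  have "\<exists>us. length us = k \<and> distinct us \<and> set us \<subseteq> V - {v} \<and>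
     (\<forall>i<k. card {w \<in> V - insert v (set (take i us)). (us ! i, w) \<in> E} \<le> 4)" if "k \<le> 6" for k
    using that
  proof (induction k)
    case (Suc k)
    then obtain us where us: "length us = k" "distinct us" "set us \<subseteq> V - {v}"
      "\<And>i. i < k \<Longrightarrow> card {w \<in> V - insert v (set (take i us)). (us ! i, w) \<in> E} \<le> 4" by auto
    let ?S = "insert v (set us)"
    have "card ?S \<le> 6" using distinct_card[OF us(2)] us(1,3) Suc.prems by (simp add: card_insert_if)
    then obtain u where u: "u \<in> V - ?S" "card ({w. (u, w) \<in> E} - ?S) \<le> 4"
      using grow[of ?S] v us(3) by auto
    have eq: "{w \<in> V - ?S. (u, w) \<in> E} = {w. (u, w) \<in> E} - ?S" using E by auto
    have "card {w \<in> V - insert v (set (take i (us @ [u]))). ((us @ [u]) ! i, w) \<in> E} \<le> 4" if "i < Suc k" for i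
      using that us(1) us(4)[of i] u(2) eq by (cases "i = k") (auto simp: nth_append)
    then show ?case using us u by (intro exI[of _ "us @ [u]"]) auto
  qed simp
  from this[of 6] show ?thesis unfolding collectable_def using v by auto
qed

text \<open>Collect \<open>u\<close> first and then follow the sequence for the smaller graph
  without its last vertex, since six in all are enough. Additional edges of \<open>E'\<close> only
  raise degrees there.\<close>

lemma collectable_low_degree:
  assumes u: "u \<in> V" "card {w. (u, w) \<in> E} \<le> 4" and fin: "finite V" and EV: "E \<subseteq> V \<times> V"
    and c: "collectable (V - {u}) E'" and sub: "\<And>a b. (a, b) \<in> E \<Longrightarrow> a \<noteq> u \<Longrightarrow> b \<noteq> u \<Longrightarrow> (a, b) \<in> E'"
  shows "collectable V E"
proof -
  obtain v us where v: "v \<in> V - {u}" and us: "length us = 6" "distinct us" "set us \<subseteq> V - {u} - {v}"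
    "\<And>i. i < 6 \<Longrightarrow> card {w \<in> V - {u} - insert v (set (take i us)). (us ! i, w) \<in> E'} \<le> 4"
    using c unfolding collectable_def by blast
  let ?us = "u # butlast us"
  have sub2: "set (butlast us) \<subseteq> set us" by (meson in_set_butlastD subsetI)
  have "card {w \<in> V - insert v (set (take i ?us)). (?us ! i, w) \<in> E} \<le> 4" if i: "i < 6" for i
  proof (cases i)
    case 0
    have "{w \<in> V - insert v (set (take i ?us)). (?us ! i, w) \<in> E} \<subseteq> {w. (u, w) \<in> E}" using 0 by auto
    moreover have "finite {w. (u, w) \<in> E}" by (rule finite_subset[OF _ fin]) (use EV in auto)
    ultimately have "card {w \<in> V - insert v (set (take i ?us)). (?us ! i, w) \<in> E} \<le> card {w. (u, w) \<in> E}"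
      by (rule card_mono[rotated])
    then show ?thesis using u(2) by linarith
  next
    case (Suc j)
    have j: "j < 5" "take j (butlast us) = take j us" "butlast us ! j = us ! j"
      using i Suc us(1) by (auto simp: take_butlast nth_butlast)
    have uj: "us ! j \<noteq> u" using us(1,3) j(1) nth_mem[of j us] by force
    have "{w \<in> V - insert v (set (take i ?us)). (?us ! i, w) \<in> E}
      \<subseteq> {w \<in> V - {u} - insert v (set (take j us)). (us ! j, w) \<in> E'}"
      using Suc j sub uj by auto
    then have "card {w \<in> V - insert v (set (take i ?us)). (?us ! i, w) \<in> E}
      \<le> card {w \<in> V - {u} - insert v (set (take j us)). (us ! j, w) \<in> E'}"
      using fin by (intro card_mono) auto
    then show ?thesis using us(4)[of j] j(1) by linarith
  qed
  moreover have "length ?us = 6" "distinct ?us" "set ?us \<subseteq> V - {v}"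
    using us u v sub2 distinct_butlast by auto
  ultimately show ?thesis unfolding collectable_def using v by blast
qed

text \<open>Contracting \<open>u\<close> instead of deleting it keeps the graph connected.\<close>

lemma planar_conn_contract:
  assumes T: "planar_conn V E" and e: "(u, w) \<in> E"
  shows "\<exists>E'. planar_conn (V - {u}) E' \<and> (\<forall>a b. (a, b) \<in> E \<longrightarrow> a \<noteq> u \<longrightarrow> b \<noteq> u \<longrightarrow> (a, b) \<in> E')"
proof -
  obtain D :: "dart set" and s a lab where P: "pmap 4 D s a lab V E" and c: "conn V E"
    using T unfolding planar_conn_def by blast
  define f where "f = (\<lambda>t. if t = u then w else t)"
  obtain s' a' where P': "pmap 4 D s' a' (f \<circ> lab) (V - {u}) (map_prod f f ` E - Id)"
    using pmap_contract[OF P e] unfolding f_def by blast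
  have "conn (V - {u}) (map_prod f f ` E - Id)" unfolding conn_def
  proof (intro ballI)
    fix x y assume xy: "x \<in> V - {u}" "y \<in> V - {u}"
    then have "(x, y) \<in> E\<^sup>*" using c unfolding conn_def by blast
    from rtrancl_map_quotient[OF this, of f] show "(x, y) \<in> (map_prod f f ` E - Id)\<^sup>*"
      using xy by (simp add: f_def)
  qed
  then have "planar_conn (V - {u}) (map_prod f f ` E - Id)" using P' unfolding planar_conn_def by blast
  moreover have "(a, b) \<in> map_prod f f ` E - Id" if ab: "(a, b) \<in> E" "a \<noteq> u" "b \<noteq> u" for a b
  proof -
    have "map_prod f f (a, b) \<in> map_prod f f ` E" using ab(1) by (rule imageI)
    moreover have "a \<noteq> b" using pmap_graph(4)[OF P] ab(1) by blast
    ultimately show ?thesis using ab by (simp add: f_def)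
  qed
  ultimately show ?thesis by blast
qed

lemma planar_conn_maximal:
  assumes "planar_conn V E"
  shows "\<exists>T. planar_conn V T \<and> E \<subseteq> T \<and> (\<forall>T'. planar_conn V T' \<longrightarrow> T \<subseteq> T' \<longrightarrow> T' = T)"
proof -
  have sub: "finite V \<and> T \<subseteq> V \<times> V" if "planar_conn V T" for T
    using that pmap_graph(1,2) unfolding planar_conn_def by blast
  have "finite (V \<times> V)" using sub[OF assms] by simp
  moreover have "{T. planar_conn V T} \<subseteq> Pow (V \<times> V)" using sub by blast
  ultimately have "finite {T. planar_conn V T}" by (meson finite_Pow_iff finite_subset)
  then obtain T where T: "T \<in> {T. planar_conn V T}" "E \<subseteq> T" "\<forall>T'\<in>{T. planar_conn V T}. T \<subseteq> T' \<longrightarrow> T = T'"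
    using finite_has_maximal2[of "{T. planar_conn V T}" E] assms by auto
  have "T' = T" if "planar_conn V T'" "T \<subseteq> T'" for T' using T(3) that by blast
  then show ?thesis using T(1,2) by auto
qed

text \<open>More edges only make collecting harder, so an edge-maximal \<open>T\<close> is again a
  counterexample. Failure of the greedy process in \<open>T\<close> provides exactly the closed sets
  that the locale requires.\<close>

lemma min_degree_5_collectable:
  assumes T: "planar_conn V E" and V: "V \<noteq> {}" and deg: "\<And>v. v \<in> V \<Longrightarrow> 5 \<le> card {w. (v, w) \<in> E}"
  shows "collectable V E"
proof (rule ccontr)
  assume nc: "\<not> collectable V E"
  obtain T where T: "planar_conn V T" "E \<subseteq> T" "\<And>T'. planar_conn V T' \<Longrightarrow> T \<subseteq> T' \<Longrightarrow> T' = T"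
    using planar_conn_maximal[OF T] by blast
  obtain D :: "dart set" and s a lab where P: "pmap 4 D s a lab V T" and c: "conn V T"
    using T(1) unfolding planar_conn_def by blast
  note G = pmap_graph[OF P]
  have finT: "finite {w. (v, w) \<in> T}" for v using G(1) by (rule finite_subset[rotated]) (use G(2) in auto)
  have ncT: "\<not> collectable V T" using nc collectable_mono[OF _ T(2) G(1)] by blast
  have degT: "5 \<le> card {w. (v, w) \<in> T}" if "v \<in> V" for v
  proof -
    have "card {w. (v, w) \<in> E} \<le> card {w. (v, w) \<in> T}" using finT T(2) by (intro card_mono) auto
    then show ?thesis using deg[OF that] by linarith
  qed
  have two: "\<exists>u w. (v, u) \<in> T \<and> (v, w) \<in> T \<and> u \<noteq> w" if vV: "v \<in> V" for v
  proof (rule ccontr)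
    assume n: "\<not> ?thesis"
    obtain u where u: "(v, u) \<in> T" using degT[OF vV] by fastforce
    then have "{w. (v, w) \<in> T} \<subseteq> {u}" using n by blast
    then have "card {w. (v, w) \<in> T} \<le> card {u}" by (intro card_mono) auto
    then show False using degT[OF vV] by simp
  qed
  obtain nx where nx: "\<And>u v w. (v, u) \<in> T \<Longrightarrow> w = nx v u \<Longrightarrow> (v, w) \<in> T \<and> (u, w) \<in> T \<and> nx w v = u \<and> nx u w = v"
    "\<And>v p q. (v, p) \<in> T \<Longrightarrow> (v, q) \<in> T \<Longrightarrow> \<exists>k. (nx v ^^ k) p = q" "card T + 12 \<le> 6 * card V"
    using rotation_exists[OF T(1,3) two V] by blast
  have "triangulation V (\<lambda>v. {w. (v, w) \<in> T}) nx"
  proof (unfold_locales, goal_cases)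
    case 1 show ?case by (rule G(1))
  next
    case (2 u v) then show ?case using G(2) by auto
  next
    case (3 u v) then show ?case using G(3) by auto
  next
    case (4 v) then show ?case using G(4) by auto
  next
    case (5 u v) then show ?case using nx(1)[of v u "nx v u"] by auto
  next
    case (6 p v q) then show ?case using nx(2)[of v p q] by auto
  next
    case 7
    have "T = (SIGMA v:V. {w. (v, w) \<in> T})" using G(2) by auto
    then have "card T = (\<Sum>v\<in>V. card {w. (v, w) \<in> T})" using card_SigmaI[OF G(1), of "\<lambda>v. {w. (v, w) \<in> T}"] finT by simp
    then show ?case using nx(3) by simp
  next
    case (8 K)
    have "K \<times> K - Id \<subseteq> T" using 8(3) by auto
    then show ?case using no_K5[OF P c 8(1,2)] by blast
  next
    case (9 v) then show ?case by (rule degT)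
  next
    case (10 v)
    show ?case
    proof (rule ccontr)
      assume n: "\<not> ?case"
      have "collectable V T"
      proof (rule collectable_greedy[OF 10 G(2)])
        fix S assume "v \<in> S" "S \<subseteq> V" "card S \<le> 6"
        then have "\<not> (\<forall>u\<in>V - S. 5 \<le> card ({w. (u, w) \<in> T} - S))" using n by blast
        then show "\<exists>u\<in>V - S. card ({w. (u, w) \<in> T} - S) \<le> 4" by force
      qed
      then show False using ncT by blast
    qed
  qed
  then show False by (rule triangulation.no_triangulation)
qed

text \<open>If collecting stops at \<open>S\<close>, each of the remaining \<open>7 - card S\<close>
  vertices has at least 5 neighbours among the others. So only \<open>v\<close> is gone and the
  other six are mutually adjacent, which contains a \<open>K5\<close>.\<close>

lemma seven_collectable:
  assumes T: "planar_conn V E" and V: "card V = 7"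
  shows "collectable V E"
proof -
  obtain D :: "dart set" and s a lab where P: "pmap 4 D s a lab V E" and c: "conn V E"
    using T unfolding planar_conn_def by blast
  note G = pmap_graph[OF P]
  obtain v where v: "v \<in> V" using V by fastforce
  show ?thesis
  proof (rule collectable_greedy[OF v G(2)], rule ccontr)
    fix S assume S: "v \<in> S" "S \<subseteq> V" "card S \<le> 6" "\<not> (\<exists>u\<in>V - S. card ({w. (u, w) \<in> E} - S) \<le> 4)"
    have finS: "finite S" using S(2) G(1) finite_subset by blast
    have cVS: "card (V - S) = 7 - card S" using card_Diff_subset[OF finS S(2)] V by simp
    have full: "{w. (u, w) \<in> E} - S = V - S - {u} \<and> card S = 1" if u: "u \<in> V - S" for u
    proof -
      have sub: "{w. (u, w) \<in> E} - S \<subseteq> V - S - {u}" using G(2,4) by auto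
      have c5: "5 \<le> card ({w. (u, w) \<in> E} - S)" using S(4) u by force
      have "card (V - S - {u}) = 6 - card S" using cVS u G(1) by simp
      moreover have "card ({w. (u, w) \<in> E} - S) \<le> card (V - S - {u})" using sub G(1) by (intro card_mono) auto
      moreover have "card S \<noteq> 0" using S(1) finS by auto
      ultimately have "card S = 1" "card (V - S - {u}) \<le> card ({w. (u, w) \<in> E} - S)" using c5 by linarith+
      then show ?thesis using card_seteq[OF _ sub] G(1) by auto
    qed
    have "V - S \<noteq> {}"
    proof
      assume "V - S = {}"
      then have "card (V - S) = 0" by (simp only: card.empty)
      then show False using cVS S(3) by linarith
    qed
    then obtain u where "u \<in> V - S" by blast
    then have "card (V - S) = 6" using full cVS by simp
    then obtain K where K: "K \<subseteq> V - S" "card K = 5"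
      using obtain_subset_with_card_n[of 5 "V - S"] by auto
    have "K \<times> K - Id \<subseteq> E"
    proof
      fix t assume "t \<in> K \<times> K - Id"
      then obtain x y where xy: "t = (x, y)" "x \<in> K" "y \<in> K" "x \<noteq> y" by auto
      then have "y \<in> {w. (x, w) \<in> E} - S" using full[of x] K(1) by auto
      then show "t \<in> E" using xy by simp
    qed
    then show False using no_K5[OF P c _ K(2)] K(1) by blast
  qed
qed

text \<open>The induction removes a vertex of degree at most 4 and has to stop at seven vertices,
  since a smaller graph has too few vertices to collect six after a deletion.\<close>

lemma planar_conn_collectable:
  assumes "planar_conn V E" "7 \<le> card V"
  shows "collectable V E"
  using assms
proof (induction "card V" arbitrary: V E rule: less_induct)
  case less
  obtain D :: "dart set" and s a lab where P: "pmap 4 D s a lab V E" and c: "conn V E"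
    using less.prems(1) unfolding planar_conn_def by blast
  note G = pmap_graph[OF P]
  have Vne: "V \<noteq> {}" using less.prems(2) by auto
  show ?case
  proof (cases "\<forall>v\<in>V. 5 \<le> card {w. (v, w) \<in> E}")
    case True
    then show ?thesis using min_degree_5_collectable[OF less.prems(1) Vne] by blast
  next
    case False
    then obtain u where u: "u \<in> V" "card {w. (u, w) \<in> E} \<le> 4" by force
    show ?thesis
    proof (cases "card V = 7")
      case True
      then show ?thesis using seven_collectable[OF less.prems(1)] by blast
    next
      case F: False
      have "card (V - {u}) = card V - 1" using u G(1) by simp
      then have cu: "7 \<le> card (V - {u})" "card (V - {u}) < card V" using less.prems(2) F by linarith+
      have "V - {u} \<noteq> {}"
      proof
        assume "V - {u} = {}"
        then have "card (V - {u}) = 0" by (simp only: card.empty)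
        then show False using cu(1) by linarith
      qed
      then obtain t where t: "t \<in> V" "t \<noteq> u" by blast
      then have "(u, t) \<in> E\<^sup>*" using c u(1) unfolding conn_def by blast
      then obtain w where w: "(u, w) \<in> E" using t(2) by (metis converse_rtranclE)
      obtain E' where E': "planar_conn (V - {u}) E'" "\<And>a b. (a, b) \<in> E \<Longrightarrow> a \<noteq> u \<Longrightarrow> b \<noteq> u \<Longrightarrow> (a, b) \<in> E'"
        using planar_conn_contract[OF less.prems(1) w] by blast
      have "collectable (V - {u}) E'" using less.hyps[OF cu(2) E'(1) cu(1)] .
      then show ?thesis using collectable_low_degree[OF u G(1,2) _ E'(2)] by blast
    qed
  qed
qed

theorem theorem2:
  fixes G :: "('a, 'b) pre_digraph"
  assumes "graph G" and "planar G" and "card (verts G) \<ge> 7"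
  shows "\<exists>v \<in> verts G. \<exists>u :: nat \<Rightarrow> 'a.
           inj_on u {1..6} \<and> u ` {1..6} \<subseteq> verts (del_verts G {v}) \<and>
           (\<forall>i \<in> {1..6}. out_degree (del_verts G ({v} \<union> u ` {1..<i})) (u i) \<le> 4)"
proof -
  interpret graph G by fact
  obtain p \<gamma> where dr: "plane_drawing G p \<gamma>" using assms(2) unfolding planar_def by blast
  have "verts G \<noteq> {}" using assms(3) by auto
  then obtain E where E: "planar_conn (verts G) E" "arcs_ends G \<subseteq> E"
    using planar_conn_drawing[OF assms(1) dr] by blast
  have "collectable (verts G) (arcs_ends G)"
    using collectable_mono[OF planar_conn_collectable[OF E(1) assms(3)] E(2)] by simp
  then obtain v us where v: "v \<in> verts G" and us: "length us = 6" "distinct us" "set us \<subseteq> verts G - {v}"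
    "\<And>i. i < 6 \<Longrightarrow> card {w \<in> verts G - insert v (set (take i us)). (us ! i, w) \<in> arcs_ends G} \<le> 4"
    unfolding collectable_def by blast
  \<comment> \<open>The theorem numbers the collected vertices from 1, the list from 0.\<close>
  define u where "u i = us ! (i - 1)" for i
  have inj: "inj_on u {1..6}"
    unfolding inj_on_def u_def using us(1,2) by (auto simp: nth_eq_iff_index_eq)
  have img: "u ` {1..<i} = set (take (i - 1) us)" if "i \<in> {1..6}" for i
  proof -
    have "u ` {1..<i} = (\<lambda>j. us ! j) ` {..<i - 1}"
    proof -
      have "{1..<i} = Suc ` {..<i - 1}" using that by (cases i) (auto simp: image_Suc_lessThan)
      then show ?thesis by (simp add: image_image u_def)
    qed
    also have "\<dots> = set (take (i - 1) us)"
      using that us(1) by (subst nth_image[symmetric]) (auto simp: lessThan_atLeast0)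
    finally show ?thesis .
  qed
  have mem: "u i \<in> set us" if "i \<in> {1..6}" for i using that us(1) unfolding u_def by auto
  have out: "u i \<notin> {v} \<union> u ` {1..<i}" if i: "i \<in> {1..6}" for i
  proof -
    have "u i \<notin> u ` {1..<i}"
    proof
      assume "u i \<in> u ` {1..<i}"
      then obtain j where j: "j \<in> {1..<i}" "u i = u j" by blast
      then have "i = j" using inj_onD[OF inj j(2)] i by auto
      then show False using j(1) by simp
    qed
    then show ?thesis using mem[OF i] us(3) by blast
  qed
  have "out_degree (del_verts G ({v} \<union> u ` {1..<i})) (u i) \<le> 4" if i: "i \<in> {1..6}" for i
  proof -
    have "i - 1 < 6" using i by auto
    note le = us(4)[OF this]
    have "out_degree (del_verts G ({v} \<union> u ` {1..<i})) (u i)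
      = card {w \<in> verts G - ({v} \<union> u ` {1..<i}). (u i, w) \<in> arcs_ends G}"
      by (rule out_degree_del_verts[OF out[OF i]])
    also have "\<dots> \<le> 4" unfolding img[OF i] using le by (simp add: u_def)
    finally show ?thesis .
  qed
  moreover have "u ` {1..6} \<subseteq> verts (del_verts G {v})"
  proof -
    have "u ` {1..6} \<subseteq> set us" using mem by blast
    then show ?thesis using us(3) by (auto simp: del_verts_def)
  qed
  ultimately show ?thesis using v inj by blast
qed

end
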